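(* Let $N\ge3$. For any $u\in\mathcal J$, $$\|u\|_{\mathcal J}^2=\lim_{\varepsilon\to0}\Big(I_{B^c_{\varepsilon,m}}[u]-\Lambda_\varepsilon(u)+\sum_{m=1}^\infty\big(\Lambda_{\varepsilon^+,m}(u)-\Lambda_{\varepsilon^-,m}(u)\big)\Big),$$ where $$\Lambda_{\varepsilon^+,m}(u)=\int_{\partial B_{z_m+\varepsilon}(0)}J_0^{-1}J_0'\,u^2\,ds,\qquad \Lambda_{\varepsilon^-,m}(u)=\int_{\partial B_{z_m-\varepsilon}(0)}J_0^{-1}J_0'\,u^2\,ds .$$ The quantities $\Lambda_{\varepsilon^+,m}(u)$ and $-\Lambda_{\varepsilon^-,m}(u)$ are always positive.
   Context: $J_0$ is the Bessel function of the first kind of order $0$ with $J_0(0)=1$, evaluated at $|x|$; $0<z_1<z_2<\dots$ are its positive zeroes. $B_r(0)$ is the ball of radius $r$ centered at $0$ in $\mathbb{R}^N$. $\widetilde{\mathcal J}$ is the closure of $C_0^\infty(\mathbb{R}^N)$ with respect to the norm $$\|v\|^2_{\widetilde{\mathcal J}}=\int_{\mathbb{R}^N}|x|^{-(N-2)}J_0^2(|x|)|\nabla v|^2dx+\int_{\mathbb{R}^N}|x|^{-(N-2)}J_0^2(|x|)v^2dx .$$ $\mathcal J$ is its isometric image under $v\mapsto u=|x|^{-\frac{N-2}{2}}J_0(|x|)v$, i.e. the completion of $\{|x|^{-\frac{N-2}{2}}J_0(|x|)v: v\in C_0^\infty(\mathbb{R}^N)\}$ under $$\|u\|_{\mathcal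 J}^2=\int_{\mathbb{R}^N}|x|^{-(N-2)}J_0^2\big|\nabla(|x|^{\frac{N-2}{2}}J_0^{-1}u)\big|^2dx+\int_{\mathbb{R}^N}|x|^{-(N-2)}J_0^2\big||x|^{\frac{N-2}{2}}J_0^{-1}u\big|^2dx ,$$ where the last integral is just $\int_{\mathbb{R}^N}u^2\,dx$. For $\varepsilon>0$, $B_{\varepsilon,m}=B_\varepsilon(0)\cup\bigcup_{m\ge1}\big(B_{z_m+\varepsilon}(0)\setminus B_{z_m-\varepsilon}(0)\big)$, and $B^c_{\varepsilon,m}$ is its complement in $\mathbb{R}^N$. For a set $D\subset\mathbb{R}^N$, $I_D[u]=\int_D|\nabla u|^2dx-\big(\frac{N-2}{2}\big)^2\int_D\frac{u^2}{|x|^2}dx$ (with limits taken in the sense of principal value if both integrals diverge). Finally, $\Lambda_\varepsilon(u)=\frac{N-2}{2}\,\varepsilon^{-1}\int_{\partial B_\varepsilon(0)}u^2\,dS$ is the Hardy singularity energy at the origin. *)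

theory Defs
  imports "HOL-Analysis.Analysis"
begin

definition partial_deriv :: "'n \<Rightarrow> (real^'n::finite \<Rightarrow> real) \<Rightarrow> real^'n \<Rightarrow> real" where
  "partial_deriv i f x = frechet_derivative f (at x) (axis i 1)"

text \<open>Meant for open \<open>S\<close>, where \<^term>\<open>at x within S\<close> and \<^term>\<open>at x\<close> agree at the points of \<open>S\<close>.\<close>

fun Ck_on :: "nat \<Rightarrow> (real^'n::finite) set \<Rightarrow> (real^'n \<Rightarrow> real) \<Rightarrow> bool" where
  "Ck_on 0 S f \<longleftrightarrow> continuous_on S f"
| "Ck_on (Suc k) S f \<longleftrightarrow> f differentiable_on S \<and> (\<forall>i. Ck_on k S (partial_deriv i f))"

definition smooth_on :: "(real^'n::finite) set \<Rightarrow> (real^'n \<Rightarrow> real) \<Rightarrow> bool" where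
  "smooth_on S f \<longleftrightarrow> (\<forall>k. Ck_on k S f)"

definition test_functions :: "(real^'n::finite) set \<Rightarrow> (real^'n \<Rightarrow> real) set" where
  "test_functions S =
     {\<psi>. smooth_on UNIV \<psi> \<and> compact (closure {x. \<psi> x \<noteq> 0}) \<and> closure {x. \<psi> x \<noteq> 0} \<subseteq> S}"

text \<open>
  The weak gradient is unique up to null sets on \<open>S\<close>; the values of \<open>g\<close> outside \<open>S\<close>
  are irrelevant, but \<open>g\<close> is required to be Borel everywhere so that it can be integrated
  over the whole space when the complement of \<open>S\<close> is a null set.
\<close>

definition has_weak_gradient_on ::
    "(real^'n::finite \<Rightarrow> real) \<Rightarrow> (real^'n \<Rightarrow> real^'n) \<Rightarrow> (real^'n) set \<Rightarrow> bool" where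
  "has_weak_gradient_on v g S \<longleftrightarrow>
     g \<in> borel_measurable borel \<and>
     (\<forall>K. compact K \<and> K \<subseteq> S \<longrightarrow> set_integrable lborel K v \<and> set_integrable lborel K g) \<and>
     (\<forall>\<psi>\<in>test_functions S. \<forall>i.
        (LINT x:S|lborel. v x * partial_deriv i \<psi> x) = - (LINT x:S|lborel. (g x $ i) * \<psi> x))"

definition weakly_differentiable_on :: "(real^'n::finite) set \<Rightarrow> (real^'n \<Rightarrow> real) \<Rightarrow> bool" where
  "weakly_differentiable_on S v \<longleftrightarrow> (\<exists>g. has_weak_gradient_on v g S)"

definition weak_gradient ::
    "(real^'n::finite) set \<Rightarrow> (real^'n \<Rightarrow> real) \<Rightarrow> real^'n \<Rightarrow> real^'n" where
  "weak_gradient S v = (SOME g. has_weak_gradient_on v g S)"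

definition H1_on :: "(real^'n::finite) set \<Rightarrow> (real^'n \<Rightarrow> real) set" where
  "H1_on S = {v. weakly_differentiable_on S v \<and>
                 set_integrable lborel S (\<lambda>x. (v x)\<^sup>2) \<and>
                 set_integrable lborel S (\<lambda>x. (norm (weak_gradient S v x))\<^sup>2)}"

definition H1_norm2 :: "(real^'n::finite) set \<Rightarrow> (real^'n \<Rightarrow> real) \<Rightarrow> real" where
  "H1_norm2 S v = (LINT x:S|lborel. (v x)\<^sup>2) + (LINT x:S|lborel. (norm (weak_gradient S v x))\<^sup>2)"

text \<open>
  Surface measure on the sphere of radius \<open>r > 0\<close> in \<open>N\<close>-space, by way of cone volumes:
  the area of \<open>A\<close> is \<open>N / r\<close> times the volume of the cone \<open>{t x | x \<in> A, 0 < t < 1}\<close>.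
\<close>

definition sphere_measure :: "real \<Rightarrow> (real^'n::finite) measure" where
  "sphere_measure r =
     scale_measure (ennreal (real CARD('n) / r))
       (distr (restrict_space lborel (ball 0 r - {0})) (restrict_space borel (sphere 0 r))
          (\<lambda>x. (r / norm x) *\<^sub>R x))"

text \<open>
  The Sobolev trace: \<open>h\<close> is the \<open>L\<^sup>2\<close>-limit on the sphere of the restrictions of smooth
  functions that converge to \<open>u\<close> in \<open>H\<^sup>1\<close> of some open spherical shell containing the sphere.
  It is unique up to null sets of the surface measure.
\<close>

definition has_sphere_trace :: "real \<Rightarrow> (real^'n::finite \<Rightarrow> real) \<Rightarrow> (real^'n \<Rightarrow> real) \<Rightarrow> bool" where
  "has_sphere_trace r u h \<longleftrightarrow>
     h \<in> borel_measurable (sphere_measure r) \<and>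
     integrable (sphere_measure r) (\<lambda>x. (h x)\<^sup>2) \<and>
     (\<exists>a b. 0 \<le> a \<and> a < r \<and> r < b \<and>
        (let A = {x. a < norm x \<and> norm x < b} in
           u \<in> H1_on A \<and>
           (\<exists>w :: nat \<Rightarrow> real^'n \<Rightarrow> real.
              (\<forall>k. smooth_on A (w k) \<and> w k \<in> H1_on A) \<and>
              (\<lambda>k. H1_norm2 A (\<lambda>x. w k x - u x)) \<longlonglongrightarrow> 0 \<and>
              (\<lambda>k. LINT x|sphere_measure r. (w k x - h x)\<^sup>2) \<longlonglongrightarrow> 0)))"

definition sphere_trace :: "real \<Rightarrow> (real^'n::finite \<Rightarrow> real) \<Rightarrow> real^'n \<Rightarrow> real" where
  "sphere_trace r u = (SOME h. has_sphere_trace r u h)"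

definition bessel_J0 :: "real \<Rightarrow> real" where
  "bessel_J0 x = (\<Sum>k. (-1) ^ k / (fact k)\<^sup>2 * (x / 2) ^ (2 * k))"

text \<open>
  \<open>bessel_J0_zero m\<close> is the \<open>m\<close>-th positive zero for \<open>m \<ge> 1\<close>. The positive zeros are isolated
  and unbounded, so each infimum is attained; index \<open>0\<close> is only the start of the recursion
  (\<open>0\<close> itself is not a zero).
\<close>

fun bessel_J0_zero :: "nat \<Rightarrow> real" where
  "bessel_J0_zero 0 = 0"
| "bessel_J0_zero (Suc m) = Inf {x. bessel_J0_zero m < x \<and> bessel_J0 x = 0}"

definition ground_state :: "real^'n::finite \<Rightarrow> real" where
  "ground_state x = norm x powr (- ((real CARD('n) - 2) / 2)) * bessel_J0 (norm x)"

definition bessel_weight :: "real^'n::finite \<Rightarrow> real" where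
  "bessel_weight x = norm x powr (- (real CARD('n) - 2)) * (bessel_J0 (norm x))\<^sup>2"

text \<open>
  The weight is positive off the origin and the nodal spheres, a closed null set. Elements of
  the completions are \<open>H\<^sup>1\<^sub>l\<^sub>o\<^sub>c\<close> only on this open set: limits of test functions in the
  weighted norm may jump across the nodal spheres. All gradients are therefore taken there.
\<close>

definition regular_set :: "(real^'n::finite) set" where
  "regular_set = {x. x \<noteq> 0 \<and> bessel_J0 (norm x) \<noteq> 0}"

definition Jtilde_norm2 :: "(real^'n::finite \<Rightarrow> real) \<Rightarrow> real" where
  "Jtilde_norm2 v =
     (LINT x|lborel. bessel_weight x * (norm (weak_gradient regular_set v x))\<^sup>2) +
     (LINT x|lborel. bessel_weight x * (v x)\<^sup>2)"

definition finite_Jtilde_norm :: "(real^'n::finite \<Rightarrow> real) set" where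
  "finite_Jtilde_norm = {v \<in> borel_measurable borel.
     weakly_differentiable_on regular_set v \<and>
     integrable lborel (\<lambda>x. bessel_weight x * (norm (weak_gradient regular_set v x))\<^sup>2) \<and>
     integrable lborel (\<lambda>x. bessel_weight x * (v x)\<^sup>2)}"

text \<open>
  The completion of the test functions, realised as a space of functions: a Cauchy sequence
  \<open>w k\<close> converges in weighted \<open>L\<^sup>2\<close> together with its gradients, and the limit of the gradients
  is the weak gradient of the limit on \<^const>\<open>regular_set\<close>.
\<close>

definition Jtilde :: "(real^'n::finite \<Rightarrow> real) set" where
  "Jtilde = {v \<in> finite_Jtilde_norm.
     \<exists>w :: nat \<Rightarrow> real^'n \<Rightarrow> real. (\<forall>k. w k \<in> test_functions UNIV) \<and>
       (\<lambda>k. Jtilde_norm2 (\<lambda>x. w k x - v x)) \<longlonglongrightarrow> 0}"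

definition J_space :: "(real^'n::finite \<Rightarrow> real) set" where
  "J_space = {u \<in> borel_measurable borel.
     \<exists>v\<in>Jtilde. AE x in lborel. u x = ground_state x * v x}"

definition J_norm2 :: "(real^'n::finite \<Rightarrow> real) \<Rightarrow> real" where
  "J_norm2 u =
     (let v = (\<lambda>x. norm x powr ((real CARD('n) - 2) / 2) * inverse (bessel_J0 (norm x)) * u x) in
       (LINT x|lborel. norm x powr (- (real CARD('n) - 2)) * (bessel_J0 (norm x))\<^sup>2 *
                        (norm (weak_gradient regular_set v x))\<^sup>2) +
       (LINT x|lborel. norm x powr (- (real CARD('n) - 2)) * (bessel_J0 (norm x))\<^sup>2 *
                        \<bar>v x\<bar>\<^sup>2))"

definition B_eps :: "real \<Rightarrow> (real^'n::finite) set" where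
  "B_eps \<epsilon> = ball 0 \<epsilon> \<union>
     (\<Union>m\<in>{1..}. ball 0 (bessel_J0_zero m + \<epsilon>) - ball 0 (bessel_J0_zero m - \<epsilon>))"

text \<open>
  For sets on which both integrals converge; no principal value is needed on the complement
  of \<^term>\<open>B_eps \<epsilon>\<close>.
\<close>

definition hardy_functional :: "(real^'n::finite) set \<Rightarrow> (real^'n \<Rightarrow> real) \<Rightarrow> real" where
  "hardy_functional D u =
     (LINT x:D|lborel. (norm (weak_gradient regular_set u x))\<^sup>2) -
     ((real CARD('n) - 2) / 2)\<^sup>2 * (LINT x:D|lborel. (u x)\<^sup>2 / (norm x)\<^sup>2)"

definition hardy_integrals_converge :: "(real^'n::finite) set \<Rightarrow> (real^'n \<Rightarrow> real) \<Rightarrow> bool" where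
  "hardy_integrals_converge D u \<longleftrightarrow>
     weakly_differentiable_on regular_set u \<and>
     set_integrable lborel D (\<lambda>x. (norm (weak_gradient regular_set u x))\<^sup>2) \<and>
     set_integrable lborel D (\<lambda>x. (u x)\<^sup>2 / (norm x)\<^sup>2)"

definition hardy_energy :: "real \<Rightarrow> (real^'n::finite \<Rightarrow> real) \<Rightarrow> real" where
  "hardy_energy \<epsilon> u =
     (real CARD('n) - 2) / 2 * inverse \<epsilon> * (LINT x|sphere_measure \<epsilon>. (sphere_trace \<epsilon> u x)\<^sup>2)"

definition bessel_boundary_term :: "real \<Rightarrow> (real^'n::finite \<Rightarrow> real) \<Rightarrow> real" where
  "bessel_boundary_term r u =
     (LINT x|sphere_measure r. inverse (bessel_J0 (norm x)) * deriv bessel_J0 (norm x) *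
                                (sphere_trace r u x)\<^sup>2)"

definition Lambda_plus :: "real \<Rightarrow> nat \<Rightarrow> (real^'n::finite \<Rightarrow> real) \<Rightarrow> real" where
  "Lambda_plus \<epsilon> m u = bessel_boundary_term (bessel_J0_zero m + \<epsilon>) u"

definition Lambda_minus :: "real \<Rightarrow> nat \<Rightarrow> (real^'n::finite \<Rightarrow> real) \<Rightarrow> real" where
  "Lambda_minus \<epsilon> m u = bessel_boundary_term (bessel_J0_zero m - \<epsilon>) u"

end

theory Submission
  imports Defs
begin

text \<open>
Write \<open>s = (N - 2) / 2\<close> and let \<open>\<phi> = |x| powr (- s) * J\<^sub>0(|x|)\<close> be the ground state. Bessel's equation
says \<open>- \<Delta> \<phi> - s\<^sup>2 \<phi> / |x|\<^sup>2 = \<phi>\<close> off the origin. For \<open>u = \<phi> v\<close> this turns the Hardy density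
into a divergence,
  \<open>|\<nabla> u|\<^sup>2 - s\<^sup>2 u\<^sup>2 / |x|\<^sup>2 = \<phi>\<^sup>2 (|\<nabla> v|\<^sup>2 + v\<^sup>2) + div (v\<^sup>2 \<phi> \<nabla> \<phi>)\<close>,
so on a spherical shell \<open>a \<le> |x| \<le> b\<close> free of zeros of \<open>\<phi>\<close> the functional \<open>I\<close> is the weighted energy of
\<open>v\<close> plus the difference of the fluxes \<open>(J\<^sub>0'/J\<^sub>0 - s/r) S(r)\<close> at \<open>b\<close> and \<open>a\<close>, where \<open>S(r)\<close> is the integral of
the squared trace of \<open>u\<close> over the sphere of radius \<open>r\<close>.

Summing over the shells that make up the complement of the excised set, the fluxes telescope against
\<open>\<Lambda>\<^sub>\<epsilon>\<close> and the \<open>\<Lambda>\<^sub>\<plusminus>\<close>, and what remains is the energy of \<open>v\<close> outside the excised set, minus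
\<open>J\<^sub>0'/J\<^sub>0(\<epsilon>) S(\<epsilon>)\<close>, plus \<open>s\<close> times the sum over \<open>m\<close> of \<open>S(z\<^sub>m + \<epsilon>)/(z\<^sub>m + \<epsilon>) - S(z\<^sub>m - \<epsilon>)/(z\<^sub>m - \<epsilon>)\<close>. The
energy converges to the full norm by dominated convergence, and the other terms are \<open>O(\<epsilon>)\<close>. For these
the same radial integration is used with a quadratic cutoff: it bounds \<open>\<plusminus> J\<^sub>0'/J\<^sub>0 S\<close> at
\<open>z\<^sub>m \<plusminus> \<epsilon>\<close> by the energy in a fixed neighbourhood of the nodal sphere (\<open>boundary_estimate_right\<close>,
\<open>boundary_estimate_left\<close>), and \<open>S\<close> gains a factor \<open>\<epsilon>\<close> because \<open>J\<^sub>0/J\<^sub>0'\<close> is comparable to the distance to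
the zero, with constants independent of \<open>m\<close> (\<open>J0_quotient_near_zero\<close>). The neighbourhoods are disjoint,
so the bounds sum up to the total energy; this also gives summability, and the sign of \<open>J\<^sub>0/J\<^sub>0'\<close>
gives positivity.

All identities are proved for the products of \<open>\<phi>\<close> with test functions, by the fundamental theorem of calculus
along rays (\<open>radial_FTC\<close>), and pass to the limit (\<open>radial_identity\<close>). The products are smooth away from the origin
and converge to \<open>u\<close> in \<open>H\<^sup>1\<close> of every regular shell; so they also produce the traces of \<open>u\<close>, and since
any two approximations have the same trace (\<open>sphere_trace_limit\<close>), it does not matter which
trace is chosen. Weak gradients on the regular set are compared with classical ones by their uniqueness
almost everywhere (\<open>weak_gradient_unique\<close>).
\<close>

section \<open>The Bessel function of order zero\<close>

definition J0' :: "real \<Rightarrow> real" where "J0' = deriv bessel_J0"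

text \<open>
\<open>J\<^sub>0(x)\<close> is a power series in \<open>x\<^sup>2\<close>, and these are its coefficients. In the variable \<open>t = x\<^sup>2\<close> the function
\<open>J\<^sub>0(|x|)\<close> becomes the composition of an entire function with the polynomial \<open>|x|\<^sup>2\<close>, hence smooth.
\<close>

definition bessel_coeff :: "nat \<Rightarrow> real" where
  "bessel_coeff k = (-1) ^ k / ((fact k)\<^sup>2 * 4 ^ k)"

lemma summable_bessel_coeff: "summable (\<lambda>k. bessel_coeff k * t ^ k)"
proof -
  have "summable (\<lambda>k. norm (inverse (fact k) * (\<bar>t\<bar>/4) ^ k))"
    using summable_norm_exp[of "\<bar>t\<bar>/4"] by (simp only: real_scaleR_def)
  moreover have "norm (bessel_coeff k * t ^ k) \<le> norm (inverse (fact k) * (\<bar>t\<bar>/4) ^ k)" for k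
  proof -
    have "(fact k :: real) \<ge> 1" by simp
    hence "(fact k :: real) * 1 \<le> fact k * fact k" by (intro mult_left_mono) auto
    hence "inverse ((fact k :: real)\<^sup>2) \<le> inverse (fact k)"
      by (intro le_imp_inverse_le) (auto simp: power2_eq_square)
    hence "inverse ((fact k :: real)\<^sup>2) * (\<bar>t\<bar> ^ k / 4 ^ k) \<le> inverse (fact k) * (\<bar>t\<bar> ^ k / 4 ^ k)"
      by (intro mult_right_mono) auto
    thus ?thesis
      by (simp add: bessel_coeff_def abs_mult power_abs power_divide divide_simps mult_ac)
  qed
  ultimately show ?thesis
    by (rule summable_comparison_test'[where N=0])
qed

text \<open>
The \<open>n\<close>-th derivative of \<open>t \<mapsto> J\<^sub>0(sqrt t)\<close>. Having the derivatives as one indexed family is what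
\<open>Ck_on_compose\<close> asks for.
\<close>

definition bessel_entire :: "nat \<Rightarrow> real \<Rightarrow> real" where
  "bessel_entire n t = (\<Sum>k. (diffs ^^ n) bessel_coeff k * t ^ k)"

lemma summable_diffs_funpow:
  assumes "\<And>t. summable (\<lambda>k. c k * (t::real) ^ k)"
  shows "summable (\<lambda>k. (diffs ^^ n) c k * t ^ k)"
proof (induction n arbitrary: t)
  case 0 then show ?case using assms by simp
next
  case (Suc n)
  have "summable (\<lambda>k. diffs ((diffs ^^ n) c) k * t ^ k)"
    using termdiff_converges_all Suc by blast
  then show ?case by simp
qed

lemma bessel_entire_deriv: "(bessel_entire n has_real_derivative bessel_entire (Suc n) t) (at t)"
  unfolding bessel_entire_def [abs_def]
  using termdiffs_strong_converges_everywhere[OF summable_diffs_funpow[OF summable_bessel_coeff]]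
  by simp

lemma bessel_J0_entire: "bessel_J0 x = bessel_entire 0 (x\<^sup>2)"
proof -
  have "(-1) ^ k / (fact k)\<^sup>2 * (x / 2) ^ (2 * k) = bessel_coeff k * (x\<^sup>2) ^ k" for k
    by (simp add: bessel_coeff_def power_mult power_divide)
  thus ?thesis unfolding bessel_J0_def bessel_entire_def by (simp only: funpow_0)
qed

text \<open>
Bessel's equation in the variable \<open>t = x\<^sup>2\<close>; comparing coefficients, it is the recursion
\<open>(k + 1)\<^sup>2 c\<^bsub>k+1\<^esub> = - c\<^bsub>k\<^esub> / 4\<close>.
\<close>

lemma bessel_entire_ode: "t * bessel_entire 2 t + bessel_entire 1 t + bessel_entire 0 t / 4 = 0"
proof -
  note S = summable_diffs_funpow[OF summable_bessel_coeff]
  let ?c = bessel_coeff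
  let ?f = "\<lambda>k. (if k = 0 then 0 else (diffs ^^ 2) ?c (k-1)) * t ^ k"
  have eq: "t * ((diffs ^^ 2) ?c k * t ^ k) = ?f (Suc k)" for k by simp
  have s2: "(\<lambda>k. t * ((diffs ^^ 2) ?c k * t ^ k)) sums (t * bessel_entire 2 t)"
    unfolding bessel_entire_def by (intro sums_mult summable_sums S)
  have "?f sums (t * bessel_entire 2 t + ?f 0)"
    using s2 unfolding eq by (rule sums_Suc)
  hence f: "?f sums (t * bessel_entire 2 t)" by simp
  have s1: "(\<lambda>k. (diffs ^^ 1) ?c k * t ^ k) sums bessel_entire 1 t"
    unfolding bessel_entire_def by (intro summable_sums S)
  have s0: "(\<lambda>k. (diffs ^^ 0) ?c k * t ^ k) sums bessel_entire 0 t"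
    unfolding bessel_entire_def by (intro summable_sums S)
  have tot: "(\<lambda>k. ?f k + (diffs ^^ 1) ?c k * t ^ k + (diffs ^^ 0) ?c k * t ^ k / 4) sums
        (t * bessel_entire 2 t + bessel_entire 1 t + bessel_entire 0 t / 4)"
    by (intro sums_add f s1 sums_divide s0)
  have rec: "(real k + 1)\<^sup>2 * ?c (Suc k) = - ?c k / 4" for k
  proof -
    have "(fact (Suc k) :: real) = (real k + 1) * fact k" by simp
    thus ?thesis
      by (simp add: bessel_coeff_def power_mult_distrib divide_simps del: fact_Suc)
  qed
  have "?f k + (diffs ^^ 1) ?c k * t ^ k + (diffs ^^ 0) ?c k * t ^ k / 4 = 0" for k
  proof (cases k)
    case 0 
    have "diffs ?c 0 + ?c 0 / 4 = 0" using rec[of 0] by (simp add: diffs_def)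
    thus ?thesis using 0 by simp
  next
    case (Suc j)
    have "real k * (real k + 1) * ?c (Suc k) + (real k + 1) * ?c (Suc k) + ?c k / 4 = 0"
      using rec[of k] by (simp add: algebra_simps power2_eq_square)
    hence "((real k * (real k + 1) * ?c (Suc k)) + (real k + 1) * ?c (Suc k) + ?c k / 4) * t ^ k = 0"
      by simp
    thus ?thesis using Suc
      by (simp add: diffs_def numeral_2_eq_2 algebra_simps)
  qed
  hence "(\<lambda>k::nat. 0) sums (t * bessel_entire 2 t + bessel_entire 1 t + bessel_entire 0 t / 4)"
    using tot by (simp only:)
  thus ?thesis using sums_unique2 sums_zero by blast
qed

lemma J0_has_deriv: "(bessel_J0 has_real_derivative (2 * x * bessel_entire 1 (x\<^sup>2))) (at x)"
proof -
  have d0: "(bessel_entire 0 has_real_derivative bessel_entire 1 t) (at t)" for t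
    using bessel_entire_deriv[of 0 t] by simp
  have "((\<lambda>x. bessel_entire 0 (x\<^sup>2)) has_real_derivative (bessel_entire 1 (x\<^sup>2) * (2 * x))) (at x)"
    by (rule DERIV_chain2[where f="bessel_entire 0" and g="\<lambda>x. x\<^sup>2", OF d0])
       (auto intro!: derivative_eq_intros)
  thus ?thesis by (simp add: bessel_J0_entire[abs_def] mult_ac)
qed

lemma J0'_eq: "J0' x = 2 * x * bessel_entire 1 (x\<^sup>2)"
  unfolding J0'_def using J0_has_deriv by (rule DERIV_imp_deriv)

lemma J0_deriv [derivative_intros]:
  "(f has_real_derivative f') (at x within A) \<Longrightarrow>
   ((\<lambda>x. bessel_J0 (f x)) has_real_derivative J0' (f x) * f') (at x within A)"
  by (rule DERIV_chain2[where f=bessel_J0 and g=f, OF J0_has_deriv[folded J0'_eq]])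

definition J0'' :: "real \<Rightarrow> real" where
  "J0'' x = 2 * bessel_entire 1 (x\<^sup>2) + 4 * x\<^sup>2 * bessel_entire 2 (x\<^sup>2)"

lemma J0'_has_deriv: "(J0' has_real_derivative J0'' x) (at x)"
proof -
  have "((\<lambda>x. bessel_entire 1 (x\<^sup>2)) has_real_derivative (bessel_entire 2 (x\<^sup>2) * (2 * x))) (at x)"
    by (rule DERIV_chain2[OF bessel_entire_deriv[of 1, unfolded Suc_1]]) (auto intro!: derivative_eq_intros)
  hence "((\<lambda>x. 2 * x * bessel_entire 1 (x\<^sup>2)) has_real_derivative J0'' x) (at x)"
    unfolding J0''_def by (auto intro!: derivative_eq_intros simp: power2_eq_square)
  thus ?thesis unfolding J0'_eq[abs_def] .
qed

lemma J0'_deriv [derivative_intros]: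
  "(f has_real_derivative f') (at x within A) \<Longrightarrow>
   ((\<lambda>x. J0' (f x)) has_real_derivative J0'' (f x) * f') (at x within A)"
  by (rule DERIV_chain2[where f=J0' and g=f, OF J0'_has_deriv])

lemma J0_ode: "x * J0'' x + J0' x + x * bessel_J0 x = 0"
proof -
  have "x * J0'' x + J0' x + x * bessel_J0 x =
     4 * x * (x\<^sup>2 * bessel_entire 2 (x\<^sup>2) + bessel_entire 1 (x\<^sup>2) + bessel_entire 0 (x\<^sup>2) / 4)"
    unfolding J0''_def J0'_eq bessel_J0_entire by (simp add: algebra_simps)
  thus ?thesis using bessel_entire_ode by simp
qed

lemma J0''_eq: "x \<noteq> 0 \<Longrightarrow> J0'' x = - J0' x / x - bessel_J0 x"
  using J0_ode[of x] by (simp add: field_simps)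

lemma J0_0 [simp]: "bessel_J0 0 = 1" "J0' 0 = 0"
  by (simp_all add: bessel_J0_entire bessel_entire_def J0'_eq bessel_coeff_def[of 0])

lemma continuous_on_J0 [continuous_intros]:
  "continuous_on A f \<Longrightarrow> continuous_on A (\<lambda>x. bessel_J0 (f x))"
  by (rule continuous_on_compose2[of UNIV bessel_J0 A f])
     (auto intro: DERIV_continuous_on has_field_derivative_at_within[OF J0_has_deriv])

lemma continuous_on_J0' [continuous_intros]:
  "continuous_on A f \<Longrightarrow> continuous_on A (\<lambda>x. J0' (f x))"
  by (rule continuous_on_compose2[of UNIV J0' A f])
     (auto intro: DERIV_continuous_on has_field_derivative_at_within[OF J0'_has_deriv])

lemma J0_measurable [measurable]: "bessel_J0 \<in> borel_measurable borel" "J0' \<in> borel_measurable borel"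
  by (intro borel_measurable_continuous_onI continuous_intros)+

section \<open>Energy, phase and the zeros of the Bessel function\<close>

text \<open>
The energy of the damped oscillator \<open>J'' + J'/r + J = 0\<close>. Damping makes it decrease, but not faster than
\<open>1/r\<^sup>2\<close>. These two bounds replace both uniqueness for the equation and the asymptotics of \<open>J\<^sub>0\<close>.
\<close>

definition bessel_energy :: "real \<Rightarrow> real" where
  "bessel_energy r = (bessel_J0 r)\<^sup>2 + (J0' r)\<^sup>2"

lemma bessel_energy_deriv:
  assumes "r \<noteq> 0"
  shows "(bessel_energy has_real_derivative - 2 * (J0' r)\<^sup>2 / r) (at r)"
proof -
  have "(bessel_energy has_real_derivative 2 * bessel_J0 r * J0' r + 2 * J0' r * J0'' r) (at r)"
    unfolding bessel_energy_def[abs_def] by (auto intro!: derivative_eq_intros)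
  moreover have "2 * bessel_J0 r * J0' r + 2 * J0' r * J0'' r = - 2 * (J0' r)\<^sup>2 / r"
    using assms by (simp add: J0''_eq field_simps power2_eq_square)
  ultimately show ?thesis by simp
qed

lemma bessel_energy_antimono:
  assumes "0 \<le> a" "a \<le> b" shows "bessel_energy b \<le> bessel_energy a"
proof -
  have c: "continuous_on {a..b} bessel_energy"
    unfolding bessel_energy_def[abs_def] by (intro continuous_intros)
  show ?thesis
  proof (rule DERIV_nonpos_imp_decreasing_open[OF assms(2)])
    fix x assume "a < x" "x < b"
    with assms show "\<exists>y. (bessel_energy has_real_derivative y) (at x) \<and> y \<le> 0"
      by (intro exI[of _ "- 2 * (J0' x)\<^sup>2 / x"] conjI bessel_energy_deriv) auto
  qed (use c in auto)
qed

lemma bessel_energy_mono: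
  assumes "0 \<le> a" "a \<le> b" shows "a\<^sup>2 * bessel_energy a \<le> b\<^sup>2 * bessel_energy b"
proof -
  have c: "continuous_on {a..b} (\<lambda>r. r\<^sup>2 * bessel_energy r)"
    unfolding bessel_energy_def[abs_def] by (intro continuous_intros)
  show ?thesis
  proof (rule DERIV_nonneg_imp_increasing_open[OF assms(2)])
    fix x assume x: "a < x" "x < b"
    have "((\<lambda>r. r\<^sup>2 * bessel_energy r) has_real_derivative
       (2 * x * bessel_energy x + (- 2 * (J0' x)\<^sup>2 / x) * x\<^sup>2)) (at x)"
      using x assms by (auto intro!: derivative_eq_intros DERIV_mult bessel_energy_deriv)
    moreover have "2 * x * bessel_energy x + (- 2 * (J0' x)\<^sup>2 / x) * x\<^sup>2 = 2 * x * (bessel_J0 x)\<^sup>2"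
      using x assms by (simp add: bessel_energy_def field_simps power2_eq_square)
    moreover have "0 \<le> 2 * x * (bessel_J0 x)\<^sup>2" using x assms by simp
    ultimately show "\<exists>y. ((\<lambda>r. r\<^sup>2 * bessel_energy r) has_real_derivative y) (at x) \<and> y \<ge> 0"
      by metis
  qed (use c in auto)
qed

lemma abs_le_sqrt_energy: "\<bar>bessel_J0 r\<bar> \<le> sqrt (bessel_energy r)" "\<bar>J0' r\<bar> \<le> sqrt (bessel_energy r)"
  by (auto simp: bessel_energy_def intro!: real_le_rsqrt)

lemma abs_J0_le_1: assumes "0 \<le> r" shows "\<bar>bessel_J0 r\<bar> \<le> 1"
proof -
  have "bessel_energy r \<le> 1"
    using bessel_energy_antimono[of 0 r] assms by (simp add: bessel_energy_def)
  hence "sqrt (bessel_energy r) \<le> 1" by simp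
  thus ?thesis using abs_le_sqrt_energy(1)[of r] by linarith
qed

text \<open>
Integrate \<open>(r J')' = - r J\<close> and use \<open>|J| \<le> 1\<close>.
\<close>

lemma abs_J0'_le: assumes "0 \<le> r" shows "\<bar>J0' r\<bar> \<le> r / 2"
proof (cases "r = 0")
  case False
  have d: "((\<lambda>r. r * J0' r) has_real_derivative - (x * bessel_J0 x)) (at x)" for x
    using J0_ode[of x] by (auto intro!: derivative_eq_intros simp: mult.commute)
  have "0 * J0' 0 + 0\<^sup>2/2 \<le> r * J0' r + r\<^sup>2/2"
  proof (rule DERIV_nonneg_imp_nondecreasing[OF assms])
    fix x assume x: "0 \<le> x" "x \<le> r"
    have "((\<lambda>r. r * J0' r + r\<^sup>2/2) has_real_derivative - (x * bessel_J0 x) + x) (at x)"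
      by (rule DERIV_add[OF d]) (auto intro!: derivative_eq_intros)
    moreover have "x * bessel_J0 x \<le> x * 1" using abs_J0_le_1[of x] x by (intro mult_left_mono) auto
    ultimately show "\<exists>y. ((\<lambda>r. r * J0' r + r\<^sup>2/2) has_real_derivative y) (at x) \<and> 0 \<le> y"
      by (intro exI conjI) auto
  qed
  hence 1: "- (r * (r/2)) \<le> r * J0' r" by (simp add: power2_eq_square)
  have "r * J0' r - r\<^sup>2/2 \<le> 0 * J0' 0 - 0\<^sup>2/2"
  proof (rule DERIV_nonpos_imp_nonincreasing[OF assms])
    fix x assume x: "0 \<le> x" "x \<le> r"
    have "((\<lambda>r. r * J0' r - r\<^sup>2/2) has_real_derivative - (x * bessel_J0 x) - x) (at x)"
      by (rule DERIV_diff[OF d]) (auto intro!: derivative_eq_intros)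
    moreover have "x * (- 1) \<le> x * bessel_J0 x" using abs_J0_le_1[of x] x by (intro mult_left_mono) auto
    ultimately show "\<exists>y. ((\<lambda>r. r * J0' r - r\<^sup>2/2) has_real_derivative y) (at x) \<and> y \<le> 0"
      by (intro exI conjI) auto
  qed
  hence 2: "r * J0' r \<le> r * (r/2)" by (simp add: power2_eq_square)
  have "r > 0" using False assms by simp
  hence "- (r/2) \<le> J0' r" "J0' r \<le> r/2" using 1 2 
    by (metis mult_le_cancel_left_pos mult_minus_right, metis mult_le_cancel_left_pos)
  thus ?thesis by auto
qed auto

lemma J0_ge: assumes "0 \<le> r" shows "bessel_J0 r \<ge> 1 - r\<^sup>2 / 4"
proof -
  have "bessel_J0 0 + 0\<^sup>2/4 \<le> bessel_J0 r + r\<^sup>2/4"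
  proof (rule DERIV_nonneg_imp_nondecreasing[OF assms])
    fix x assume x: "0 \<le> x" "x \<le> r"
    have "((\<lambda>r. bessel_J0 r + r\<^sup>2/4) has_real_derivative J0' x + x/2) (at x)"
      by (auto intro!: derivative_eq_intros)
    moreover have "- (x/2) \<le> J0' x" using abs_J0'_le[of x] x by auto
    ultimately show "\<exists>y. ((\<lambda>r. bessel_J0 r + r\<^sup>2/4) has_real_derivative y) (at x) \<and> 0 \<le> y"
      by (intro exI conjI) auto
  qed
  thus ?thesis by simp
qed

lemma J0_pos_lt_2: assumes "0 \<le> r" "r < 2" shows "bessel_J0 r > 0"
proof -
  have "r\<^sup>2 < 2\<^sup>2" using assms by (intro power_strict_mono) auto
  thus ?thesis using J0_ge[OF assms(1)] by simp
qed

text \<open>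
The angle of the phase-plane curve \<open>(J, J')\<close>. Since \<open>p = J'/J\<close> satisfies the Riccati equation
\<open>p' = - 1 - p/r - p\<^sup>2\<close>, the angle \<open>arctan p\<close> falls at rate at least \<open>1/2\<close> once \<open>r \<ge> 1\<close>. As it is confined to
\<open>(- \<pi>/2, \<pi>/2)\<close> between zeros, this yields a zero in every interval longer than \<open>2 \<pi>\<close>, and it keeps \<open>p\<close> bounded
away from the zeros (\<open>log_deriv_J0_bounded\<close>).
\<close>

lemma arctan_log_deriv_J0:
  assumes "r \<ge> 1" "bessel_J0 r \<noteq> 0"
  shows "\<exists>d. ((\<lambda>r. arctan (J0' r / bessel_J0 r)) has_real_derivative d) (at r) \<and> d \<le> - 1/2"
proof -
  let ?p = "J0' r / bessel_J0 r"
  have p: "((\<lambda>r. J0' r / bessel_J0 r) has_real_derivative (- 1 - ?p / r - ?p\<^sup>2)) (at r)"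
    using assms by (auto intro!: derivative_eq_intros simp: J0''_eq field_simps power2_eq_square)
  have a: "((\<lambda>r. arctan (J0' r / bessel_J0 r)) has_real_derivative (inverse (1 + ?p\<^sup>2) * (- 1 - ?p / r - ?p\<^sup>2))) (at r)"
    by (rule DERIV_chain2[OF DERIV_arctan p])
  have "- ?p / r \<le> \<bar>?p\<bar> / 1"
    using assms by (smt (verit, best) abs_divide abs_ge_self abs_minus_cancel frac_le abs_ge_zero minus_divide_left)
  moreover have "\<bar>?p\<bar> \<le> (1 + ?p\<^sup>2) / 2" 
    using sum_squares_bound[of 1 "\<bar>?p\<bar>"] by (simp add: mult.commute power_divide)
  ultimately have "- (?p / r) \<le> (1 + ?p\<^sup>2) / 2" by (simp only: minus_divide_left div_by_1)
  hence "- 1 - ?p / r - ?p\<^sup>2 \<le> (-1/2) * (1 + ?p\<^sup>2)" by argo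
  hence "inverse (1 + ?p\<^sup>2) * (- 1 - ?p / r - ?p\<^sup>2) \<le> inverse (1 + ?p\<^sup>2) * ((-1/2) * (1 + ?p\<^sup>2))"
    by (intro mult_left_mono) auto
  also have "\<dots> = -1/2" 
  proof -
    have "1 + ?p\<^sup>2 > 0" by (smt (verit) zero_le_power2)
    thus ?thesis by simp
  qed
  finally show ?thesis using a by blast
qed

lemma arctan_log_deriv_decrease:
  assumes "1 \<le> a" "a \<le> b" "\<And>r. a \<le> r \<Longrightarrow> r \<le> b \<Longrightarrow> bessel_J0 r \<noteq> 0"
  shows "arctan (J0' b / bessel_J0 b) \<le> arctan (J0' a / bessel_J0 a) - (b - a) / 2"
proof -
  have "arctan (J0' b / bessel_J0 b) + b/2 \<le> arctan (J0' a / bessel_J0 a) + a/2"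
  proof (rule DERIV_nonpos_imp_nonincreasing[OF assms(2)])
    fix x assume x: "a \<le> x" "x \<le> b"
    obtain d where d: "((\<lambda>r. arctan (J0' r / bessel_J0 r)) has_real_derivative d) (at x)" "d \<le> - 1/2"
      using arctan_log_deriv_J0[of x] x assms by auto
    have "((\<lambda>r. arctan (J0' r / bessel_J0 r) + r/2) has_real_derivative d + 1/2) (at x)"
      by (intro DERIV_add d) (auto intro!: derivative_eq_intros)
    with d show "\<exists>y. ((\<lambda>r. arctan (J0' r / bessel_J0 r) + r/2) has_real_derivative y) (at x) \<and> y \<le> 0"
      by (intro exI conjI) auto
  qed
  thus ?thesis by (simp add: field_simps)
qed

lemma J0_zero_exists: assumes "1 \<le> a" shows "\<exists>r\<in>{a..a+7}. bessel_J0 r = 0"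
proof (rule ccontr)
  assume "\<not> ?thesis"
  hence "arctan (J0' (a+7) / bessel_J0 (a+7)) \<le> arctan (J0' a / bessel_J0 a) - (a + 7 - a) / 2"
    using assms by (intro arctan_log_deriv_decrease) auto
  moreover have "- (pi/2) < arctan (J0' (a+7) / bessel_J0 (a+7))" "arctan (J0' a / bessel_J0 a) < pi/2"
    by (rule arctan_lbound, rule arctan_ubound)
  moreover have "pi < 3.5" using pi_approx by simp
  ultimately show False by simp
qed

text \<open>
At a double zero the energy vanishes. As \<open>r\<^sup>2\<close> times the energy increases, it would vanish on all of
\<open>(0, z]\<close>, although \<open>J\<^sub>0\<close> is positive on \<open>[0, 2)\<close>.
\<close>

lemma J0_zero_nondegenerate:
  assumes "0 < z" "bessel_J0 z = 0" shows "J0' z \<noteq> 0"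
proof
  assume "J0' z = 0"
  hence "bessel_energy z = 0" using assms by (simp add: bessel_energy_def)
  moreover have "(min z 1)\<^sup>2 * bessel_energy (min z 1) \<le> z\<^sup>2 * bessel_energy z"
    using assms by (intro bessel_energy_mono) auto
  ultimately have "(min z 1)\<^sup>2 * bessel_energy (min z 1) \<le> 0" by simp
  moreover have "min z 1 > 0" using assms by simp
  ultimately have "bessel_energy (min z 1) \<le> 0" by (simp add: mult_le_0_iff)
  moreover have "bessel_J0 (min z 1) > 0" using assms by (intro J0_pos_lt_2) auto
  hence "bessel_energy (min z 1) > 0" unfolding bessel_energy_def
    by (intro add_pos_nonneg) auto
  ultimately show False by simp
qed

text \<open>
Bounds that do not depend on the zero: on \<open>[z - 1/8, z + 1/8]\<close> the square root of the energy is at most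
\<open>2 |J'(z)|\<close>, hence \<open>|J''| \<le> 4 |J'(z)|\<close> by the equation, and \<open>J'\<close> changes by at most half of \<open>J'(z)\<close>.
\<close>

lemma J0'_near_zero:
  assumes z: "2 \<le> z" "bessel_J0 z = 0" and t: "\<bar>r - z\<bar> \<le> 1/8"
  shows "1/2 \<le> J0' r / J0' z" "J0' r / J0' z \<le> 3/2"
proof -
  define e where "e = \<bar>J0' z\<bar>"
  have e: "e > 0" using J0_zero_nondegenerate[of z] z by (auto simp: e_def)
  have Ez: "bessel_energy z = e\<^sup>2" using z by (simp add: bessel_energy_def e_def)
  have E: "bessel_energy x \<le> (2 * e)\<^sup>2" if x: "\<bar>x - z\<bar> \<le> 1/8" for x
  proof (cases "x \<ge> z")
    case True
    have "bessel_energy x \<le> e\<^sup>2" using bessel_energy_antimono[of z x] True z Ez by auto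
    also have "\<dots> \<le> (2*e)\<^sup>2" using e by (intro power_mono) auto
    finally show ?thesis .
  next
    case False
    have "x\<^sup>2 * bessel_energy x \<le> z\<^sup>2 * bessel_energy z" using False x z by (intro bessel_energy_mono) auto
    also have "\<dots> \<le> (2 * x)\<^sup>2 * e\<^sup>2" unfolding Ez
    proof (intro mult_right_mono power_mono)
      show "z \<le> 2 * x" using x z(1) by linarith
    qed (use z in auto)
    finally have "x\<^sup>2 * bessel_energy x \<le> x\<^sup>2 * (2*e)\<^sup>2" by (simp add: power_mult_distrib)
    moreover have "x\<^sup>2 > 0" using x z by auto
    ultimately show ?thesis by (simp add: mult_le_cancel_left_pos)
  qed
  have sqE: "sqrt (bessel_energy x) \<le> 2 * e" if "\<bar>x - z\<bar> \<le> 1/8" for x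
    using E[OF that] e by (simp add: real_le_lsqrt)
  have d2: "\<bar>J0'' x\<bar> \<le> 4 * e" if x: "\<bar>x - z\<bar> \<le> 1/8" for x
  proof -
    have x1: "x \<ge> 1" using x z(1) by linarith
    have "J0'' x = - (J0' x / x) - bessel_J0 x"
      using J0''_eq[of x] x1 by simp
    moreover have "\<bar>J0' x / x\<bar> \<le> \<bar>J0' x\<bar>" using x1 by (simp add: abs_divide divide_le_eq mult_le_cancel_left1)
    ultimately show ?thesis using abs_le_sqrt_energy[of x] sqE[OF x] by linarith
  qed
  have "\<bar>J0' r - J0' z\<bar> \<le> 4 * e * \<bar>r - z\<bar>"
  proof -
    have "norm (J0' r - J0' z) \<le> 4 * e * norm (r - z)"
    proof (rule field_differentiable_bound[where S="cball z (1/8)" and f'=J0''])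
      fix x assume "x \<in> cball z (1/8)"
      thus "norm (J0'' x) \<le> 4 * e" using d2[of x] by (auto simp: dist_real_def abs_minus_commute)
    qed (use t in \<open>auto intro: has_field_derivative_at_within[OF J0'_has_deriv] simp: dist_real_def abs_minus_commute\<close>)
    thus ?thesis by simp
  qed
  also have "\<dots> \<le> 4 * e * (1/8)" using t e by (intro mult_left_mono) auto
  finally have *: "\<bar>J0' r - J0' z\<bar> \<le> e / 2" by simp
  have "J0' z \<noteq> 0" using e by (auto simp: e_def)
  have "\<bar>J0' r / J0' z - 1\<bar> = \<bar>J0' r - J0' z\<bar> / e"
    using \<open>J0' z \<noteq> 0\<close> by (simp add: e_def flip: abs_divide) (simp add: diff_divide_distrib)
  also have "\<dots> \<le> 1/2" using * e by (simp add: divide_le_eq)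
  finally show "1/2 \<le> J0' r / J0' z" "J0' r / J0' z \<le> 3/2" by linarith+
qed

text \<open>
\<open>J/J'\<close> has the sign of \<open>r - z\<close> and is at most three times as large, uniformly in the zero \<open>z\<close>. In
particular distinct zeros are more than \<open>1/8\<close> apart, which allows all nodal spheres to be treated at once.
\<close>

lemma J0_quotient_near_zero:
  assumes z: "2 \<le> z" "bessel_J0 z = 0" and t: "0 < \<bar>r - z\<bar>" "\<bar>r - z\<bar> \<le> 1/8"
  shows "0 < (bessel_J0 r / J0' r) / (r - z)" "(bessel_J0 r / J0' r) / (r - z) \<le> 3"
    "bessel_J0 r \<noteq> 0" "J0' r \<noteq> 0"
proof -
  have nz: "J0' z \<noteq> 0" using J0_zero_nondegenerate[of z] z by auto
  have "\<exists>x. \<bar>x - z\<bar> \<le> 1/8 \<and> bessel_J0 r = (r - z) * J0' x"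
  proof (cases "r > z")
    case True
    obtain x where "z < x" "x < r" "bessel_J0 r - bessel_J0 z = (r - z) * J0' x"
      using MVT2[OF True, of bessel_J0 J0'] J0_deriv[OF DERIV_ident] by auto
    thus ?thesis using z t by (intro exI[of _ x]) auto
  next
    case False
    hence lt: "r < z" using t by auto
    obtain x where "r < x" "x < z" "bessel_J0 z - bessel_J0 r = (z - r) * J0' x"
      using MVT2[OF lt, of bessel_J0 J0'] J0_deriv[OF DERIV_ident] by auto
    thus ?thesis using z t by (intro exI[of _ x]) (auto simp: algebra_simps)
  qed
  then obtain x where x: "\<bar>x - z\<bar> \<le> 1/8" "bessel_J0 r = (r - z) * J0' x" by blast
  note bx = J0'_near_zero[OF z x(1)]
  note br = J0'_near_zero[OF z t(2)]
  show n: "J0' r \<noteq> 0" using br nz by auto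
  show "bessel_J0 r \<noteq> 0" using x bx nz t by auto
  have eq: "(bessel_J0 r / J0' r) / (r - z) = (J0' x / J0' z) / (J0' r / J0' z)"
    using n nz t by (simp add: x(2))
  show "0 < (bessel_J0 r / J0' r) / (r - z)" unfolding eq using bx br by (intro divide_pos_pos[of "_ / _"]) linarith+
  have "(J0' x / J0' z) / (J0' r / J0' z) \<le> (3/2) / (1/2)" using bx br by (intro frac_le[of "3/2" "_ / _" "1/2"]) linarith+
  thus "(bessel_J0 r / J0' r) / (r - z) \<le> 3" unfolding eq by simp
qed

text \<open>
The gap to the previous zero turns the defining infimum into one over a closed set, so it is attained.
\<close>

lemma bessel_J0_zero_Suc:
  assumes "0 \<le> bessel_J0_zero m" "m > 0 \<Longrightarrow> 2 \<le> bessel_J0_zero m \<and> bessel_J0 (bessel_J0_zero m) = 0"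
  shows "bessel_J0 (bessel_J0_zero (Suc m)) = 0" "bessel_J0_zero m + 1/8 \<le> bessel_J0_zero (Suc m)"
    "2 \<le> bessel_J0_zero (Suc m)"
    "\<And>x. bessel_J0_zero m < x \<Longrightarrow> x < bessel_J0_zero (Suc m) \<Longrightarrow> bessel_J0 x \<noteq> 0"
proof -
  let ?z = "bessel_J0_zero m"
  let ?S = "{x. ?z < x \<and> bessel_J0 x = 0}"
  let ?T = "{x. max 2 (?z + 1/8) \<le> x \<and> bessel_J0 x = 0}"
  have ST: "?S = ?T"
  proof (intro Collect_cong iffI conjI; (elim conjE)?)
    fix x assume x: "?z < x" "bessel_J0 x = 0"
    have "2 \<le> x" using J0_pos_lt_2[of x] x assms(1) by fastforce
    moreover have "?z + 1/8 \<le> x"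
    proof (rule ccontr)
      assume "\<not> ?z + 1/8 \<le> x"
      moreover from this have "m > 0" using \<open>2 \<le> x\<close> by (cases m) auto
      ultimately have "bessel_J0 x \<noteq> 0"
        using J0_quotient_near_zero(3)[of ?z x] assms(2) x by auto
      thus False using x by simp
    qed
    ultimately show "max 2 (?z + 1/8) \<le> x" by simp
  qed auto
  have bd: "bdd_below ?T" by (intro bdd_belowI[of _ 2]) auto
  have ne: "?T \<noteq> {}"
  proof -
    obtain r where "r \<ge> max 2 (?z + 1/8)" "bessel_J0 r = 0"
      using J0_zero_exists[of "max 2 (?z + 1/8)"] by force
    thus ?thesis by blast
  qed
  have "closed ?T"
    by (intro closed_Collect_conj closed_Collect_le closed_Collect_eq continuous_intros)
  hence mem: "Inf ?T \<in> ?T" by (rule closed_contains_Inf[OF ne bd])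
  have eq: "bessel_J0_zero (Suc m) = Inf ?T" using ST by simp
  show "bessel_J0 (bessel_J0_zero (Suc m)) = 0" "bessel_J0_zero m + 1/8 \<le> bessel_J0_zero (Suc m)"
    "2 \<le> bessel_J0_zero (Suc m)" using mem unfolding eq by auto
  fix x assume x: "?z < x" "x < bessel_J0_zero (Suc m)"
  show "bessel_J0 x \<noteq> 0"
  proof
    assume "bessel_J0 x = 0"
    hence "x \<in> ?T" using x ST by auto
    hence "Inf ?T \<le> x" using bd by (rule cInf_lower)
    thus False using x eq by simp
  qed
qed

lemma bessel_J0_zero_props:
  "0 \<le> bessel_J0_zero m \<and> (m > 0 \<longrightarrow> 2 \<le> bessel_J0_zero m \<and> bessel_J0 (bessel_J0_zero m) = 0)"
proof (induction m)
  case (Suc m) thus ?case using bessel_J0_zero_Suc[of m] by auto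
qed auto

declare bessel_J0_zero.simps(2) [simp del]

lemma bessel_J0_zero_is_zero: "1 \<le> m \<Longrightarrow> bessel_J0 (bessel_J0_zero m) = 0"
  and bessel_J0_zero_ge_2: "1 \<le> m \<Longrightarrow> 2 \<le> bessel_J0_zero m"
  and bessel_J0_zero_gap: "bessel_J0_zero m + 1/8 \<le> bessel_J0_zero (Suc m)"
  and J0_nonzero_between: "bessel_J0_zero m < x \<Longrightarrow> x < bessel_J0_zero (Suc m) \<Longrightarrow> bessel_J0 x \<noteq> 0"
  using bessel_J0_zero_props[of m] bessel_J0_zero_Suc[of m] by auto

lemma bessel_J0_zero_mono: "m \<le> n \<Longrightarrow> bessel_J0_zero m \<le> bessel_J0_zero n"
proof (rule lift_Suc_mono_le)
  fix n show "bessel_J0_zero n \<le> bessel_J0_zero (Suc n)" using bessel_J0_zero_gap[of n] by linarith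
qed

lemma bessel_J0_zero_ge: "real m / 8 \<le> bessel_J0_zero m"
proof (induction m)
  case (Suc m) thus ?case using bessel_J0_zero_gap[of m] by (simp add: field_simps)
qed auto

lemma ex_zero_interval:
  assumes "0 \<le> r" shows "\<exists>m. bessel_J0_zero m \<le> r \<and> r < bessel_J0_zero (Suc m)"
proof -
  obtain n where "real n / 8 > r" using reals_Archimedean2[of "8 * r"] by (auto simp: field_simps)
  hence n: "r < bessel_J0_zero n" using bessel_J0_zero_ge[of n] by linarith
  define k where "k = (LEAST k. r < bessel_J0_zero k)"
  have k: "r < bessel_J0_zero k" unfolding k_def using n by (rule LeastI)
  then obtain m where m: "k = Suc m" using assms by (cases k) auto
  have "m < (LEAST k. r < bessel_J0_zero k)" using m k_def by simp
  hence "\<not> r < bessel_J0_zero m" by (rule not_less_Least)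
  thus ?thesis using k m by (intro exI[of _ m]) auto
qed

lemma J0_zero_is_listed:
  assumes "0 < r" "bessel_J0 r = 0" shows "\<exists>m\<ge>1. r = bessel_J0_zero m"
proof -
  obtain m where m: "bessel_J0_zero m \<le> r" "r < bessel_J0_zero (Suc m)" using ex_zero_interval[of r] assms by auto
  have "bessel_J0_zero m = r" using J0_nonzero_between[of m r] m assms by force
  moreover have "m \<ge> 1" using calculation assms by (cases m) auto
  ultimately show ?thesis by auto
qed

text \<open>
If there is no zero within distance \<open>e\<close>, the phase angle needs to stay \<open>e/2\<close> away from \<open>\<plusminus> \<pi>/2\<close>.
\<close>

lemma log_deriv_J0_bounded:
  assumes e: "0 < e" "e \<le> 1/2"
  shows "\<exists>C. \<forall>r\<ge>0. (\<forall>x. \<bar>x - r\<bar> \<le> e \<longrightarrow> 0 < x \<longrightarrow> bessel_J0 x \<noteq> 0) \<longrightarrow> \<bar>J0' r / bessel_J0 r\<bar> \<le> C"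
proof -
  define T where "T = tan (pi/2 - e/2)"
  have bound: "\<bar>J0' r / bessel_J0 r\<bar> \<le> max T 2" if r: "r \<ge> 0" and nz: "\<And>x. \<bar>x - r\<bar> \<le> e \<Longrightarrow> 0 < x \<Longrightarrow> bessel_J0 x \<noteq> 0" for r
  proof (cases "r \<le> 3/2")
    case True
    have "r * r \<le> 3/2 * (3/2)" using True r by (intro mult_mono) auto
    hence "bessel_J0 r \<ge> 7/16" using J0_ge[OF r] by (simp add: power2_eq_square)
    moreover have "\<bar>J0' r\<bar> \<le> 3/4" using abs_J0'_le[OF r] True by simp
    ultimately have "\<bar>J0' r\<bar> / \<bar>bessel_J0 r\<bar> \<le> (3/4) / (7/16)" by (intro frac_le) auto
    also have "\<dots> \<le> max T 2" by (simp add: le_max_iff_disj)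
    finally show ?thesis by (simp only: abs_divide)
  next
    case False
    let ?p = "\<lambda>r. J0' r / bessel_J0 r"
    have "arctan (?p r) \<le> arctan (?p (r-e)) - (r - (r-e)) / 2"
      using False e nz by (intro arctan_log_deriv_decrease) auto
    moreover have "arctan (?p (r-e)) < pi/2" by (rule arctan_ubound)
    ultimately have 1: "arctan (?p r) < pi/2 - e/2" by simp
    have "arctan (?p (r+e)) \<le> arctan (?p r) - (r + e - r) / 2"
      using False e nz by (intro arctan_log_deriv_decrease) auto
    moreover have "- (pi/2) < arctan (?p (r+e))" by (rule arctan_lbound)
    ultimately have 2: "arctan (?p r) > - (pi/2 - e/2)" by simp
    have pi: "pi > 3" by (rule pi_gt3)
    have "tan (arctan (?p r)) < T" unfolding T_def using 1 e arctan_lbound pi by (intro tan_monotone) auto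
    hence "?p r < T" by (simp add: tan_arctan)
    moreover have "tan (- (pi/2 - e/2)) < tan (arctan (?p r))" using 2 e arctan_ubound pi by (intro tan_monotone) auto
    hence "- T < ?p r" by (simp add: T_def tan_arctan del: minus_diff_eq)
    ultimately show ?thesis by linarith
  qed
  show ?thesis by (intro exI[of _ "max T 2"]) (use bound in blast)
qed

lemma log_deriv_J0_near_0:
  assumes "0 \<le> r" "r \<le> 1" shows "\<bar>J0' r / bessel_J0 r\<bar> \<le> r"
proof -
  have "r\<^sup>2 \<le> 1\<^sup>2" using assms by (intro power_mono) auto
  hence "bessel_J0 r \<ge> 3/4" using J0_ge[of r] assms by simp
  moreover have "\<bar>J0' r\<bar> \<le> r / 2" using abs_J0'_le assms by simp
  ultimately have "\<bar>J0' r\<bar> / \<bar>bessel_J0 r\<bar> \<le> (r/2) / (3/4)" using assms by (intro frac_le) auto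
  also have "\<dots> \<le> r" using assms by simp
  finally show ?thesis by (simp add: abs_divide)
qed

section \<open>Functions with continuous partial derivatives\<close>

lemmas frechet_derivative_worksI = frechet_derivative_works[THEN iffD1]

lemma partial_deriv_eqI:
  "(f has_derivative f') (at x) \<Longrightarrow> partial_deriv i f x = f' (axis i 1)"
  unfolding partial_deriv_def by (simp add: frechet_derivative_at[symmetric])

lemma has_derivative_cong_open:
  assumes "open S" "x \<in> S" "\<And>y. y \<in> S \<Longrightarrow> f y = g y"
  shows "(f has_derivative D) (at x) \<longleftrightarrow> (g has_derivative D) (at x)"
  using has_derivative_transform_within_open[of f D x UNIV S g] 
        has_derivative_transform_within_open[of g D x UNIV S f] assms by auto

lemma partial_deriv_cong_open:
  assumes "open S" "x \<in> S" "\<And>y. y \<in> S \<Longrightarrow> f y = g y"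
  shows "partial_deriv i f x = partial_deriv i g x"
  unfolding partial_deriv_def frechet_derivative_def
  by (simp add: has_derivative_cong_open[OF assms])

lemma differentiable_on_open:
  "open S \<Longrightarrow> f differentiable_on S \<longleftrightarrow> (\<forall>x\<in>S. f differentiable (at x))"
  unfolding differentiable_on_def using at_within_open[of _ S] by metis

lemma Ck_on_cong:
  assumes "open S" "\<And>x. x \<in> S \<Longrightarrow> f x = g x" "Ck_on k S f"
  shows "Ck_on k S g"
  using assms(2,3)
proof (induction k arbitrary: f g)
  case 0 then show ?case using continuous_on_cong[of S S f g] by simp
next
  case (Suc k)
  have "g differentiable (at x)" if "x \<in> S" for x
  proof -
    have "f differentiable (at x)" using Suc.prems that assms(1) by (simp add: differentiable_on_open)
    then obtain D where "(f has_derivative D) (at x)" unfolding differentiable_def by blast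
    hence "(g has_derivative D) (at x)" 
      by (rule has_derivative_transform_within_open[where f=f and g=g, OF _ assms(1) that]) (rule Suc.prems(1))
    thus ?thesis unfolding differentiable_def by blast
  qed
  moreover have "Ck_on k S (partial_deriv i g)" for i
  proof (rule Suc.IH)
    show "partial_deriv i f x = partial_deriv i g x" if "x \<in> S" for x
      by (rule partial_deriv_cong_open[where f=f and g=g, OF assms(1) that]) (rule Suc.prems(1))
  qed (use Suc.prems in simp)
  ultimately show ?case using assms(1) by (simp add: differentiable_on_open)
qed

lemma Ck_on_subset: "Ck_on k S f \<Longrightarrow> T \<subseteq> S \<Longrightarrow> Ck_on k T f"
  by (induction k arbitrary: f) (auto intro: continuous_on_subset differentiable_on_subset)

lemma Ck_on_Un: "open S \<Longrightarrow> open T \<Longrightarrow> Ck_on k S f \<Longrightarrow> Ck_on k T f \<Longrightarrow> Ck_on k (S \<union> T) f"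
  by (induction k arbitrary: f) (auto intro: continuous_on_open_Un simp: differentiable_on_open open_Un)

lemma Ck_on_Suc_imp: "Ck_on (Suc k) S f \<Longrightarrow> Ck_on k S f"
proof (induction k arbitrary: f)
  case 0 then show ?case by (auto intro: differentiable_imp_continuous_on)
next
  case (Suc k) 
  then have "Ck_on k S (partial_deriv i f)" for i by auto
  then show ?case using Suc.prems by auto
qed

lemma Ck_on_const: "Ck_on k (S :: (real^'n::finite) set) (\<lambda>x. c)"
proof (induction k arbitrary: c)
  case (Suc k)
  have "partial_deriv i (\<lambda>x::real^'n. c) = (\<lambda>x. 0)" for i
    by (rule ext, rule partial_deriv_eqI[THEN trans]) (auto intro: derivative_eq_intros)
  then show ?case using Suc by (auto intro: differentiable_on_const)
qed auto

lemma partial_deriv_add: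
  "f differentiable (at x) \<Longrightarrow> g differentiable (at x) \<Longrightarrow>
   partial_deriv i (\<lambda>x. f x + g x) x = partial_deriv i f x + partial_deriv i g x"
  using partial_deriv_eqI[OF has_derivative_add[OF frechet_derivative_worksI frechet_derivative_worksI], of f x g i]
  by (simp add: partial_deriv_def)

lemma partial_deriv_mult:
  fixes f g :: "real^'n::finite \<Rightarrow> real"
  assumes "f differentiable (at x)" "g differentiable (at x)"
  shows "partial_deriv i (\<lambda>x. f x * g x) x = partial_deriv i f x * g x + f x * partial_deriv i g x"
proof -
  note D = assms[THEN frechet_derivative_worksI]
  show ?thesis
    by (subst partial_deriv_eqI[OF has_derivative_mult[OF D]]) (simp add: partial_deriv_def algebra_simps)
qed

lemma Ck_on_add:
  assumes "open S" shows "Ck_on k S f \<Longrightarrow> Ck_on k S g \<Longrightarrow> Ck_on k S (\<lambda>x. f x + g x)"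
proof (induction k arbitrary: f g)
  case 0 then show ?case by (auto intro: continuous_intros)
next
  case (Suc k)
  have "Ck_on k S (partial_deriv i (\<lambda>x. f x + g x))" for i
    by (rule Ck_on_cong[OF assms _ Suc.IH[of "partial_deriv i f" "partial_deriv i g"]])
       (use Suc.prems assms in \<open>auto simp: differentiable_on_open partial_deriv_add\<close>)
  then show ?case using Suc.prems by (auto intro: differentiable_on_add)
qed

lemma Ck_on_mult:
  assumes "open S" shows "Ck_on k S f \<Longrightarrow> Ck_on k S g \<Longrightarrow> Ck_on k S (\<lambda>x. f x * g x)"
proof (induction k arbitrary: f g)
  case 0 then show ?case by (auto intro: continuous_intros)
next
  case (Suc k)
  have k: "Ck_on k S f" "Ck_on k S g" using Suc.prems by (blast intro: Ck_on_Suc_imp)+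
  have "Ck_on k S (partial_deriv i (\<lambda>x. f x * g x))" for i
    by (rule Ck_on_cong[OF assms _ Ck_on_add[OF assms Suc.IH[of "partial_deriv i f" g] Suc.IH[of f "partial_deriv i g"]]])
       (use Suc.prems k assms in \<open>auto simp: differentiable_on_open partial_deriv_mult\<close>)
  then show ?case using Suc.prems by (auto intro: differentiable_on_mult)
qed

lemma Ck_on_diff:
  assumes "open S" "Ck_on k S f" "Ck_on k S g" shows "Ck_on k S (\<lambda>x. f x - g x)"
  using Ck_on_add[OF assms(1,2) Ck_on_mult[OF assms(1) Ck_on_const[of k S "-1"] assms(3)]] by simp

lemma has_derivative_chain_real:
  fixes q :: "real^'n::finite \<Rightarrow> real"
  assumes "(F has_real_derivative d) (at (q x))" "q differentiable (at x)"
  shows "((\<lambda>x. F (q x)) has_derivative (\<lambda>h. d * frechet_derivative q (at x) h)) (at x)"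
proof -
  have "(F has_derivative (\<lambda>h. d * h)) (at (q x))"
    using assms(1) unfolding has_field_derivative_def by simp
  from has_derivative_compose[OF frechet_derivative_worksI[OF assms(2)] this]
  show ?thesis by simp
qed

text \<open>
The derivative of \<open>F n \<circ> q\<close> involves \<open>F (Suc n)\<close>, so the chain rule is proved for the whole sequence of
derivatives at once.
\<close>

lemma Ck_on_compose:
  fixes q :: "real^'n::finite \<Rightarrow> real"
  assumes "open S" "\<And>k. Ck_on k S q" 
    "\<And>n x. x \<in> S \<Longrightarrow> (F n has_real_derivative F (Suc n) (q x)) (at (q x))"
  shows "Ck_on k S (\<lambda>x. F n (q x))"
proof (induction k arbitrary: n)
  have dq: "q differentiable (at x)" if "x \<in> S" for x
    using assms(2)[of 1] that assms(1) by (simp add: differentiable_on_open)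
  note D = has_derivative_chain_real[OF assms(3) dq]
  {
    case 0
    show ?case using D
      by (auto intro!: continuous_at_imp_continuous_on has_derivative_continuous)
  next
    case (Suc k)
    have "Ck_on k S (partial_deriv i (\<lambda>x. F n (q x)))" for i
    proof (rule Ck_on_cong[OF assms(1) _ Ck_on_mult[OF assms(1) Suc[of "Suc n"], of "partial_deriv i q"]])
      show "Ck_on k S (partial_deriv i q)" using assms(2)[of "Suc k"] by simp
      show "F (Suc n) (q x) * partial_deriv i q x = partial_deriv i (\<lambda>x. F n (q x)) x" if "x \<in> S" for x
        unfolding partial_deriv_eqI[OF D[OF that that]] by (simp add: partial_deriv_def)
    qed
    moreover have "(\<lambda>x. F n (q x)) differentiable_on S"
      using D assms(1) by (auto simp: differentiable_on_open differentiable_def)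
    ultimately show ?case by simp
  }
qed

lemma has_derivative_coord: "((\<lambda>x::real^'n::finite. x $ i) has_derivative (\<lambda>h. h $ i)) (at x)"
  by (rule bounded_linear_imp_has_derivative) (rule bounded_linear_vec_nth)

lemma Ck_on_coord: "Ck_on k (S :: (real^'n::finite) set) (\<lambda>x. x $ i)"
proof (cases k)
  case (Suc k')
  have "partial_deriv j (\<lambda>x::real^'n. x $ i) = (\<lambda>x. axis j 1 $ i)" for j
    by (rule ext) (rule partial_deriv_eqI[OF has_derivative_coord])
  moreover have "(\<lambda>x::real^'n. x $ i) differentiable_on S"
    by (intro differentiable_at_imp_differentiable_on differentiableI[OF has_derivative_coord])
  ultimately show ?thesis using Suc by (simp add: Ck_on_const)
qed (auto intro: continuous_intros)

lemma Ck_on_sum: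
  assumes "open S" "finite I" "\<And>i. i \<in> I \<Longrightarrow> Ck_on k S (f i)"
  shows "Ck_on k S (\<lambda>x. \<Sum>i\<in>I. f i x)"
  using assms(2,3) by (induction I rule: finite_induct) (auto simp: Ck_on_const intro: Ck_on_add[OF assms(1)])

lemma Ck_on_prod:
  assumes "open S" "finite I" "\<And>i. i \<in> I \<Longrightarrow> Ck_on k S (f i)"
  shows "Ck_on k S (\<lambda>x. \<Prod>i\<in>I. f i x)"
  using assms(2,3) by (induction I rule: finite_induct) (auto simp: Ck_on_const intro: Ck_on_mult[OF assms(1)])

lemma norm_sq_vec: "(norm (x::real^'n::finite))\<^sup>2 = (\<Sum>i\<in>UNIV. x $ i * x $ i)"
  by (simp add: power2_norm_eq_inner inner_vec_def)

lemma Ck_on_norm_sq: "Ck_on k UNIV (\<lambda>x::real^'n::finite. (norm x)\<^sup>2)"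
  unfolding norm_sq_vec by (intro Ck_on_sum Ck_on_mult Ck_on_coord) auto

text \<open>
The \<open>n\<close>-th derivative of \<open>t \<mapsto> t powr a\<close>.
\<close>

definition powr_derivs :: "real \<Rightarrow> nat \<Rightarrow> real \<Rightarrow> real" where
  "powr_derivs a n t = (\<Prod>j<n. a - real j) * t powr (a - real n)"

lemma powr_derivs_deriv:
  "t > 0 \<Longrightarrow> (powr_derivs a n has_real_derivative powr_derivs a (Suc n) t) (at t)"
  unfolding powr_derivs_def
  by (auto intro!: derivative_eq_intros simp: algebra_simps)

lemma norm_powr_sq: "norm x powr a = ((norm x)\<^sup>2) powr (a/2)"
  by (cases "x = 0") (auto simp: powr_powr simp flip: powr_numeral)

text \<open>
Both factors are smooth functions of \<open>|x|\<^sup>2\<close>.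
\<close>

lemma ground_state_Ck: "Ck_on k (- {0}) (ground_state :: real^'n::finite \<Rightarrow> real)"
proof -
  let ?a = "- ((real CARD('n) - 2) / 2) / 2"
  have U: "open (- {0::real^'n})" by auto
  have "Ck_on k (- {0}) (\<lambda>x::real^'n. powr_derivs ?a 0 ((norm x)\<^sup>2))"
    by (rule Ck_on_compose[OF U Ck_on_subset[OF Ck_on_norm_sq]]) (auto intro!: powr_derivs_deriv)
  moreover have "Ck_on k (- {0}) (\<lambda>x::real^'n. bessel_entire 0 ((norm x)\<^sup>2))"
    by (rule Ck_on_compose[OF U Ck_on_subset[OF Ck_on_norm_sq]]) (auto intro!: bessel_entire_deriv)
  ultimately have "Ck_on k (- {0}) (\<lambda>x::real^'n. powr_derivs ?a 0 ((norm x)\<^sup>2) * bessel_entire 0 ((norm x)\<^sup>2))"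
    by (rule Ck_on_mult[OF U])
  thus ?thesis
    by (rule Ck_on_cong[OF U, rotated])
       (simp add: ground_state_def[abs_def] powr_derivs_def bessel_J0_entire norm_powr_sq[of _ "- ((real CARD('n) - 2) / 2)"])
qed

definition grad :: "(real^'n::finite \<Rightarrow> real) \<Rightarrow> real^'n \<Rightarrow> real^'n" where
  "grad f x = (\<chi> i. partial_deriv i f x)"

lemma frechet_derivative_grad:
  assumes "f differentiable (at x)" shows "frechet_derivative f (at x) h = grad f x \<bullet> h"
proof -
  have lin: "linear (frechet_derivative f (at x))"
    by (rule linear_frechet_derivative[OF assms])
  have "frechet_derivative f (at x) h = frechet_derivative f (at x) (\<Sum>i\<in>UNIV. h $ i *\<^sub>R axis i 1)"
    by (simp add: basis_expansion scalar_mult_eq_scaleR[symmetric])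
  also have "\<dots> = (\<Sum>i\<in>UNIV. h $ i *\<^sub>R frechet_derivative f (at x) (axis i 1))"
    by (simp add: linear_sum[OF lin] linear_scale[OF lin])
  also have "\<dots> = grad f x \<bullet> h"
    by (simp add: grad_def inner_vec_def partial_deriv_def mult.commute)
  finally show ?thesis .
qed

lemma has_derivative_grad:
  assumes "f differentiable (at x)" shows "(f has_derivative (\<lambda>h. grad f x \<bullet> h)) (at x)"
proof -
  have "frechet_derivative f (at x) = (\<lambda>h. grad f x \<bullet> h)"
    by (rule ext) (rule frechet_derivative_grad[OF assms])
  thus ?thesis using frechet_derivative_worksI[OF assms] by simp
qed

lemma grad_eqI: "(f has_derivative (\<lambda>h. v \<bullet> h)) (at x) \<Longrightarrow> grad f x = v"
  by (simp add: grad_def vec_eq_iff partial_deriv_eqI inner_axis)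

lemma grad_mult:
  fixes f g :: "real^'n::finite \<Rightarrow> real"
  assumes "f differentiable (at x)" "g differentiable (at x)"
  shows "grad (\<lambda>x. f x * g x) x = g x *\<^sub>R grad f x + f x *\<^sub>R grad g x"
  by (simp add: grad_def vec_eq_iff partial_deriv_mult[OF assms] mult.commute)

lemma Ck1_D:
  assumes "open S" "Ck_on 1 S f"
  shows "\<And>x. x \<in> S \<Longrightarrow> f differentiable (at x)" "continuous_on S (grad f)" "continuous_on S f"
proof -
  show "\<And>x. x \<in> S \<Longrightarrow> f differentiable (at x)" using assms by (simp add: differentiable_on_open)
  show "continuous_on S (grad f)" unfolding grad_def [abs_def]
    using assms by (intro continuous_on_vec_lambda) auto
  show "continuous_on S f" using assms by (auto intro: differentiable_imp_continuous_on)
qed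

lemma smooth_onD: "smooth_on S f \<Longrightarrow> Ck_on k S f" by (simp add: smooth_on_def)

lemma smooth_on_mult: "open S \<Longrightarrow> smooth_on S f \<Longrightarrow> smooth_on S g \<Longrightarrow> smooth_on S (\<lambda>x. f x * g x)"
  by (simp add: smooth_on_def Ck_on_mult)

lemma smooth_on_diff: "open S \<Longrightarrow> smooth_on S f \<Longrightarrow> smooth_on S g \<Longrightarrow> smooth_on S (\<lambda>x. f x - g x)"
  by (simp add: smooth_on_def Ck_on_diff)

lemma smooth_on_subset: "smooth_on S f \<Longrightarrow> T \<subseteq> S \<Longrightarrow> smooth_on T f"
  by (auto simp: smooth_on_def intro: Ck_on_subset)

lemma ground_state_smooth: "smooth_on (- {0}) (ground_state :: real^'n::finite \<Rightarrow> real)"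
  by (simp add: smooth_on_def ground_state_Ck)

lemma grad_radial:
  fixes x :: "real^'n::finite"
  assumes "x \<noteq> 0" "(F has_real_derivative d) (at (norm x))"
  shows "((\<lambda>x. F (norm x)) has_derivative (\<lambda>h. ((d / norm x) *\<^sub>R x) \<bullet> h)) (at x)"
proof -
  have n: "(norm has_derivative (\<lambda>h. inner h (sgn x))) (at x)"
    using has_derivative_norm[of x] assms(1) by simp
  have "(F has_derivative (\<lambda>h. d * h)) (at (norm x))"
    using assms(2) unfolding has_field_derivative_def by simp
  from has_derivative_compose[OF n this]
  have "((\<lambda>x. F (norm x)) has_derivative (\<lambda>h. d * inner h (sgn x))) (at x)" .
  moreover have "(\<lambda>h. d * inner h (sgn x)) = (\<lambda>h. ((d / norm x) *\<^sub>R x) \<bullet> h)"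
    by (auto simp: fun_eq_iff sgn_div_norm inner_commute divide_inverse)
  ultimately show ?thesis by simp
qed

text \<open>
The derivative of the ground state along rays, as a function of the radius. The first argument only
carries the dimension.
\<close>

definition ground_state_deriv :: "'n::finite itself \<Rightarrow> real \<Rightarrow> real" where
  "ground_state_deriv _ r = r powr (- ((real CARD('n) - 2) / 2)) * (J0' r - (real CARD('n) - 2) / 2 * bessel_J0 r / r)"

lemma ground_state_grad:
  fixes x :: "real^'n::finite"
  assumes "x \<noteq> 0"
  shows "grad ground_state x = (ground_state_deriv TYPE('n) (norm x) / norm x) *\<^sub>R x"
proof (rule grad_eqI)
  let ?s = "(real CARD('n) - 2) / 2"
  have r: "norm x > 0" using assms by simp
  have p: "norm x powr (- ?s - 1) = norm x powr (- ?s) / norm x"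
    using r by (simp add: powr_diff)
  have "((\<lambda>r. r powr (- ?s)) has_real_derivative ((- ?s) * norm x powr (- ?s - 1) * 1)) (at (norm x))"
    using r by (auto intro!: derivative_eq_intros)
  hence "((\<lambda>r. r powr (- ?s) * bessel_J0 r) has_real_derivative 
     ((- ?s) * norm x powr (- ?s - 1) * 1 * bessel_J0 (norm x) + J0' (norm x) * 1 * norm x powr (- ?s))) (at (norm x))"
    by (rule DERIV_mult[OF _ DERIV_ident[THEN J0_deriv]])
  also have "((- ?s) * norm x powr (- ?s - 1) * 1 * bessel_J0 (norm x) + J0' (norm x) * 1 * norm x powr (- ?s)) 
     = ground_state_deriv TYPE('n) (norm x)"
    unfolding ground_state_deriv_def p by (simp add: algebra_simps)
  finally show "(ground_state has_derivative (\<lambda>h. ((ground_state_deriv TYPE('n) (norm x) / norm x) *\<^sub>R x) \<bullet> h)) (at x)"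
    unfolding ground_state_def[abs_def] by (rule grad_radial[OF assms])
qed

section \<open>Smooth bumps and the fundamental lemma of the calculus of variations\<close>

text \<open>
The \<open>n\<close>-th derivative of \<open>exp (- 1/t)\<close> is \<open>P\<^sub>n(1/t) exp (- 1/t)\<close>; differentiating once more replaces \<open>P(y)\<close> by
\<open>y\<^sup>2 (P(y) - P'(y))\<close>.
\<close>

fun expinv_poly :: "nat \<Rightarrow> real poly" where
  "expinv_poly 0 = 1"
| "expinv_poly (Suc n) = [:0, 0, 1:] * (expinv_poly n - pderiv (expinv_poly n))"

definition expinv :: "nat \<Rightarrow> real \<Rightarrow> real" where
  "expinv n t = (if t > 0 then poly (expinv_poly n) (1/t) * exp (- (1/t)) else 0)"

lemma poly_exp_neg_tendsto_0: "((\<lambda>y. poly P y * exp (- y)) \<longlongrightarrow> (0::real)) at_top"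
proof -
  have "((\<lambda>y. \<Sum>i\<le>degree P. coeff P i * (y ^ i / exp y)) \<longlongrightarrow> (\<Sum>i\<le>degree P. coeff P i * 0)) at_top"
    by (intro tendsto_sum tendsto_mult tendsto_const tendsto_power_div_exp_0)
  thus ?thesis by (simp add: poly_altdef sum_distrib_right exp_minus divide_inverse mult.assoc)
qed

lemma expinv_deriv: "(expinv n has_real_derivative expinv (Suc n) t) (at t)"
proof (cases "t = 0")
  case True
  have "((\<lambda>h. (expinv n h - expinv n 0) / (h - 0)) \<longlongrightarrow> 0) (at_right 0)"
  proof (rule Lim_transform_eventually)
    show "((\<lambda>h. poly (pCons 0 (expinv_poly n)) (inverse h) * exp (- inverse h)) \<longlongrightarrow> (0::real)) (at_right 0)"
      by (rule filterlim_compose[OF poly_exp_neg_tendsto_0 filterlim_inverse_at_top_right])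
    show "\<forall>\<^sub>F h in at_right 0. poly (pCons 0 (expinv_poly n)) (inverse h) * exp (- inverse h) = (expinv n h - expinv n 0) / (h - 0)"
      using eventually_at_right_less[of "0::real"]
      by eventually_elim (simp add: expinv_def divide_inverse mult_ac)
  qed
  moreover have "((\<lambda>h. (expinv n h - expinv n 0) / (h - 0)) \<longlongrightarrow> 0) (at_left 0)"
  proof (rule Lim_transform_eventually[OF tendsto_const])
    show "\<forall>\<^sub>F h in at_left 0. 0 = (expinv n h - expinv n 0) / (h - 0)"
      unfolding eventually_at_filter by (rule always_eventually) (simp add: expinv_def)
  qed
  ultimately have "((\<lambda>h. (expinv n h - expinv n 0) / (h - 0)) \<longlongrightarrow> 0) (at 0)"
    by (intro filterlim_split_at)
  thus ?thesis using True by (simp add: has_field_derivative_iff expinv_def)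
next
  case False
  show ?thesis
  proof (cases "t > 0")
    case True
    have "((\<lambda>t. poly (expinv_poly n) (1/t) * exp (- (1/t))) has_real_derivative
       (poly (pderiv (expinv_poly n)) (1/t) * (- (1/t\<^sup>2)) * exp (- (1/t)) + exp (-(1/t)) * (1/t\<^sup>2) * poly (expinv_poly n) (1/t))) (at t)"
      using True by (auto intro!: derivative_eq_intros DERIV_chain2[OF poly_DERIV] simp: power2_eq_square)
    moreover have "poly (pderiv (expinv_poly n)) (1/t) * (- (1/t\<^sup>2)) * exp (- (1/t)) + exp (-(1/t)) * (1/t\<^sup>2) * poly (expinv_poly n) (1/t)
       = expinv (Suc n) t"
      using True by (simp add: expinv_def algebra_simps power2_eq_square)
    ultimately have "((\<lambda>t. poly (expinv_poly n) (1/t) * exp (- (1/t))) has_real_derivative expinv (Suc n) t) (at t)" by simp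
    thus ?thesis
      by (rule has_field_derivative_transform_within_open[where S="{0<..}"]) (use True in \<open>auto simp: expinv_def\<close>)
  next
    case F2: False
    have "((\<lambda>t::real. 0::real) has_real_derivative 0) (at t)" by simp
    hence "(expinv n has_real_derivative 0) (at t)"
      by (rule has_field_derivative_transform_within_open[where S="{..<0}"]) (use False F2 in \<open>auto simp: expinv_def\<close>)
    thus ?thesis using F2 by (simp add: expinv_def)
  qed
qed

lemma expinv_0_bounds: "0 \<le> expinv 0 t" "expinv 0 t \<le> 1" "expinv 0 t = 0 \<longleftrightarrow> t \<le> 0"
  by (auto simp: expinv_def)

lemma expinv_0_scaled_tendsto:
  assumes "t > 0" shows "(\<lambda>n. expinv 0 (real (Suc n) * t)) \<longlonglongrightarrow> 1"
proof -
  have "(\<lambda>n. exp (- (1/t * inverse (real (Suc n))))) \<longlonglongrightarrow> exp (- (1/t * 0))"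
    by (intro tendsto_intros LIMSEQ_inverse_real_of_nat)
  thus ?thesis using assms by (simp add: expinv_def divide_inverse mult_ac del: of_nat_Suc)
qed

text \<open>
As \<open>n\<close> grows these functions increase to the indicator of the open box with corners \<open>a\<close> and \<open>b\<close>.
\<close>

definition box_bump :: "real^'n::finite \<Rightarrow> real^'n \<Rightarrow> nat \<Rightarrow> real^'n \<Rightarrow> real" where
  "box_bump a b n x = (\<Prod>i\<in>UNIV. expinv 0 (real (Suc n) * (x $ i - a $ i)) * expinv 0 (real (Suc n) * (b $ i - x $ i)))"

lemma box_bump_smooth: "smooth_on UNIV (box_bump a b n)"
  unfolding smooth_on_def box_bump_def[abs_def]
proof (intro allI Ck_on_prod Ck_on_mult)
  fix k i
  note q = Ck_on_mult[OF open_UNIV Ck_on_const Ck_on_diff[OF open_UNIV Ck_on_coord Ck_on_const]]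
    Ck_on_mult[OF open_UNIV Ck_on_const Ck_on_diff[OF open_UNIV Ck_on_const Ck_on_coord]]
  show "Ck_on k UNIV (\<lambda>x. expinv 0 (real (Suc n) * (x $ i - a $ i)))"
    "Ck_on k UNIV (\<lambda>x. expinv 0 (real (Suc n) * (b $ i - x $ i)))"
    by (rule Ck_on_compose[where F=expinv and n=0], simp, rule q, rule expinv_deriv)+
qed auto

lemma box_bump_bounds: "0 \<le> box_bump a b n x" "box_bump a b n x \<le> 1"
  unfolding box_bump_def by (auto intro!: prod_nonneg prod_le_1 mult_le_one expinv_0_bounds mult_nonneg_nonneg)

lemma box_bump_nonzero: "box_bump a b n x \<noteq> 0 \<longleftrightarrow> x \<in> box a b"
  by (auto simp: box_bump_def expinv_0_bounds mem_box_cart not_le zero_less_mult_iff mult_le_0_iff)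

lemma box_bump_tendsto: "x \<in> box a b \<Longrightarrow> (\<lambda>n. box_bump a b n x) \<longlonglongrightarrow> 1"
proof -
  assume x: "x \<in> box a b"
  have "(\<lambda>n. box_bump a b n x) \<longlonglongrightarrow> (\<Prod>i::'a\<in>UNIV. 1 * 1)"
    unfolding box_bump_def using x
    by (intro tendsto_prod tendsto_mult expinv_0_scaled_tendsto) (auto simp: mem_box_cart)
  thus ?thesis by simp
qed

lemma box_bump_test:
  assumes "cbox a b \<subseteq> S" shows "box_bump a b n \<in> test_functions S"
proof -
  have "{x. box_bump a b n x \<noteq> 0} \<subseteq> cbox a b" using box_subset_cbox by (auto simp: box_bump_nonzero)
  hence c: "closure {x. box_bump a b n x \<noteq> 0} \<subseteq> cbox a b" by (rule closure_minimal) (rule closed_cbox)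
  hence "compact (closure {x. box_bump a b n x \<noteq> 0})"
    using compact_Int_closed[OF compact_cbox closed_closure, of a b "{x. box_bump a b n x \<noteq> 0}"] by (simp add: Int_absorb1)
  thus ?thesis using c assms box_bump_smooth by (auto simp: test_functions_def)
qed

text \<open>
Boxes are an intersection-stable generator of the Borel sets. So the positive and the negative part
of \<open>h\<close> are densities of the same finite measure, and therefore agree almost everywhere.
\<close>

lemma vanishing_box_integrals_AE_0:
  fixes h :: "'a::euclidean_space \<Rightarrow> real"
  assumes h: "set_integrable lborel (box a b) h"
    and z: "\<And>c d. box c d \<subseteq> box a b \<Longrightarrow> (LINT x:box c d|lborel. h x) = 0"
  shows "AE x in lborel. x \<in> box a b \<longrightarrow> h x = 0"
proof -
  let ?f = "\<lambda>x. indicator (box a b) x * h x"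
  have int: "integrable lborel ?f" using h by (simp add: set_integrable_def)
  have [measurable]: "?f \<in> borel_measurable lborel" using int by auto
  define P where "P = density lborel (\<lambda>x. ennreal (?f x))"
  define Q where "Q = density lborel (\<lambda>x. ennreal (- ?f x))"
  have em: "emeasure P (box c d) = emeasure Q (box c d)" for c d
  proof -
    have "box c d \<inter> box a b = box (\<Sum>i\<in>Basis. max (c \<bullet> i) (a \<bullet> i) *\<^sub>R i) (\<Sum>i\<in>Basis. min (d \<bullet> i) (b \<bullet> i) *\<^sub>R i)"
      by (rule box_Int_box)
    then obtain c' d' where cd: "box c d \<inter> box a b = box c' d'" by blast
    let ?g = "\<lambda>x. indicator (box c d) x * ?f x"
    have g: "?g x = indicator (box c' d') x * h x" for x
      using cd by (auto simp: indicator_def)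
    have gi: "integrable lborel ?g"
      using integrable_mult_indicator[OF _ int, of "box c d"] by simp
    have "(\<integral>x. ?g x \<partial>lborel) = 0"
    proof -
      have "box c' d' \<subseteq> box a b" using cd by blast
      from z[OF this] show ?thesis by (simp add: g set_lebesgue_integral_def)
    qed
    hence "enn2real (\<integral>\<^sup>+x. ennreal (?g x) \<partial>lborel) = enn2real (\<integral>\<^sup>+x. ennreal (- ?g x) \<partial>lborel)"
      using real_lebesgue_integral_def[OF gi] by simp
    moreover have "(\<integral>\<^sup>+x. ennreal (?g x) \<partial>lborel) < \<infinity>" "(\<integral>\<^sup>+x. ennreal (- ?g x) \<partial>lborel) < \<infinity>"
      using gi real_integrable_def[of lborel ?g] by (auto simp: less_top)
    ultimately have "(\<integral>\<^sup>+x. ennreal (?g x) \<partial>lborel) = (\<integral>\<^sup>+x. ennreal (- ?g x) \<partial>lborel)"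
      by (metis ennreal_enn2real infinity_ennreal_def)
    moreover have "ennreal (?f x) * indicator (box c d) x = ennreal (?g x)" "ennreal (- ?f x) * indicator (box c d) x = ennreal (- ?g x)" for x
      by (auto simp: indicator_def)
    ultimately show ?thesis
      unfolding P_def Q_def by (simp add: emeasure_density)
  qed
  have fin: "emeasure P A \<noteq> \<infinity>" if "A \<in> sets borel" for A
  proof -
    have "emeasure P A \<le> (\<integral>\<^sup>+x. ennreal (?f x) \<partial>lborel)"
      unfolding P_def using that by (auto simp: emeasure_density intro!: nn_integral_mono split: split_indicator)
    also have "\<dots> < \<infinity>" using int real_integrable_def[of lborel ?f] by (auto simp: less_top)
    finally show ?thesis by auto
  qed
  have "P = Q"
  proof (rule measure_eqI_generator_eq)
    let ?E = "range (\<lambda>(a, b). box a b::'a set)"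
    show "Int_stable ?E"
      by (auto simp: Int_stable_def box_Int_box)
    show "?E \<subseteq> Pow UNIV" "sets P = sigma_sets UNIV ?E" "sets Q = sigma_sets UNIV ?E"
      unfolding P_def Q_def by (simp_all add: borel_eq_box)
    let ?A = "\<lambda>n::nat. box (- (real n *\<^sub>R One)) (real n *\<^sub>R One) :: 'a set"
    show "range ?A \<subseteq> ?E" "(\<Union>i. ?A i) = UNIV"
      unfolding UN_box_eq_UNIV by auto
    show "emeasure P (?A i) \<noteq> \<infinity>" for i by (rule fin) simp
    show "emeasure P X = emeasure Q X" if "X \<in> ?E" for X using that em by auto
  qed
  hence "AE x in lborel. ennreal (?f x) = ennreal (- ?f x)"
    unfolding P_def Q_def by (subst (asm) sigma_finite_measure.density_unique_iff[OF sigma_finite_lborel]) auto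
  thus ?thesis
  proof eventually_elim
    case (elim x)
    show ?case
    proof
      assume "x \<in> box a b"
      hence "ennreal (h x) = ennreal (- h x)" using elim by simp
      thus "h x = 0" by (cases "h x \<ge> 0") (auto simp: ennreal_neg ennreal_eq_0_iff intro: antisym)
    qed
  qed
qed

text \<open>
Box bumps are test functions that converge boundedly to indicators of boxes, which reduces the claim to
\<open>vanishing_box_integrals_AE_0\<close>; countably many closed boxes exhaust the open set.
\<close>

lemma fundamental_lemma_calc_var:
  fixes h :: "real^'n::finite \<Rightarrow> real"
  assumes S: "open S" and h: "\<And>K. compact K \<Longrightarrow> K \<subseteq> S \<Longrightarrow> set_integrable lborel K h"
    and z: "\<And>\<psi>. \<psi> \<in> test_functions S \<Longrightarrow> (LINT x:S|lborel. h x * \<psi> x) = 0"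
  shows "AE x in lborel. x \<in> S \<longrightarrow> h x = 0"
proof -
  have box0: "(LINT x:box c d|lborel. h x) = 0" if cd: "cbox c d \<subseteq> S" for c d
  proof -
    have hi: "integrable lborel (\<lambda>x. indicator (cbox c d) x * h x)"
      using h[OF compact_cbox cd] by (simp add: set_integrable_def)
    have eq: "indicator S x *\<^sub>R (h x * box_bump c d n x) = (indicator (cbox c d) x * h x) * box_bump c d n x" for x n
      using cd box_bump_nonzero[of c d n x] box_subset_cbox[of c d] by (auto simp: indicator_def)
    have meas: "box_bump c d n \<in> borel_measurable borel" for n
      using Ck1_D(3)[OF open_UNIV smooth_onD[OF box_bump_smooth]] by (rule borel_measurable_continuous_onI)
    have "(\<lambda>n. \<integral>x. (indicator (cbox c d) x * h x) * box_bump c d n x \<partial>lborel) \<longlonglongrightarrow> (\<integral>x. indicator (box c d) x * h x \<partial>lborel)"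
    proof (rule integral_dominated_convergence[where w="\<lambda>x. norm (indicator (cbox c d) x * h x)"])
      show "(\<lambda>x. indicator (box c d) x * h x) \<in> borel_measurable lborel"
      proof -
        have eq: "(\<lambda>x. indicator (box c d) x * h x) = (\<lambda>x. indicator (box c d) x * (indicator (cbox c d) x * h x))"
          by (rule ext) (use box_subset_cbox[of c d] in \<open>auto simp: indicator_def\<close>)
        show ?thesis unfolding eq
          by (rule borel_measurable_times[OF _ borel_measurable_integrable[OF hi]]) auto
      qed
      show "(\<lambda>x. (indicator (cbox c d) x * h x) * box_bump c d n x) \<in> borel_measurable lborel" for n
        by (rule borel_measurable_times[OF borel_measurable_integrable[OF hi]]) (use meas[of n] in simp)
      show "integrable lborel (\<lambda>x. norm (indicator (cbox c d) x * h x))" using hi by (rule integrable_norm)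
      show "AE x in lborel. (\<lambda>n. (indicator (cbox c d) x * h x) * box_bump c d n x) \<longlonglongrightarrow> indicator (box c d) x * h x"
      proof (rule AE_I2)
        fix x 
        show "(\<lambda>n. (indicator (cbox c d) x * h x) * box_bump c d n x) \<longlonglongrightarrow> indicator (box c d) x * h x"
        proof (cases "x \<in> box c d")
          case True
          have "(\<lambda>n. (indicator (cbox c d) x * h x) * box_bump c d n x) \<longlonglongrightarrow> (indicator (cbox c d) x * h x) * 1"
            by (intro tendsto_mult tendsto_const box_bump_tendsto True)
          thus ?thesis using True box_subset_cbox[of c d] by (auto simp: indicator_def)
        next
          case False
          hence "box_bump c d n x = 0" for n using box_bump_nonzero by blast
          thus ?thesis using False by simp
        qed
      qed
      show "AE x in lborel. norm ((indicator (cbox c d) x * h x) * box_bump c d n x) \<le> norm (indicator (cbox c d) x * h x)" for n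
      proof (rule AE_I2)
        fix x
        show "norm ((indicator (cbox c d) x * h x) * box_bump c d n x) \<le> norm (indicator (cbox c d) x * h x)"
          unfolding norm_mult[of _ "box_bump c d n x"] using box_bump_bounds[of c d n x]
          by (intro mult_left_le) auto
      qed
    qed
    moreover have "(\<integral>x. (indicator (cbox c d) x * h x) * box_bump c d n x \<partial>lborel) = 0" for n
      using z[OF box_bump_test[OF cd], of n] unfolding set_lebesgue_integral_def eq .
    ultimately have "(\<lambda>n::nat. 0::real) \<longlonglongrightarrow> (\<integral>x. indicator (box c d) x * h x \<partial>lborel)" by (simp only:)
    from LIMSEQ_unique[OF this tendsto_const] show ?thesis
      by (simp add: set_lebesgue_integral_def)
  qed
  have AEbox: "AE x in lborel. x \<in> box a b \<longrightarrow> h x = 0" if ab: "cbox a b \<subseteq> S" for a b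
  proof (rule vanishing_box_integrals_AE_0)
    show "set_integrable lborel (box a b) h"
      by (rule set_integrable_subset[OF h[OF compact_cbox ab]]) (auto simp: box_subset_cbox)
    fix c d :: "real^'n" assume "box c d \<subseteq> box a b"
    hence "closure (box c d) \<subseteq> cbox a b"
      using box_subset_cbox[of a b] by (intro closure_minimal closed_cbox) blast
    hence "box c d = {} \<or> cbox c d \<subseteq> cbox a b"
      using closure_box[of c d] by (cases "box c d = {}") simp_all
    thus "(LINT x:box c d|lborel. h x) = 0"
    proof
      assume "cbox c d \<subseteq> cbox a b" thus ?thesis using box0 ab by blast
    qed (simp add: set_lebesgue_integral_def)
  qed
  obtain D where D: "countable D" "D \<subseteq> Pow S" "\<Union>D = S" "\<And>X. X \<in> D \<Longrightarrow> \<exists>a b. X = cbox a b"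
    using open_countable_Union_open_cbox[OF S] by metis
  have "AE x in lborel. \<forall>X\<in>D. x \<in> X \<longrightarrow> h x = 0"
  proof (subst AE_ball_countable[OF D(1)], rule ballI)
    fix X assume X: "X \<in> D"
    then obtain a b where ab: "X = cbox a b" using D by blast
    have "AE x in lborel. x \<notin> cbox a b - box a b"
    proof (rule AE_not_in)
      show "cbox a b - box a b \<in> null_sets lborel"
        using emeasure_lborel_cbox_eq[of a b] emeasure_lborel_box_eq[of a b]
        by (intro null_setsI) (auto simp: emeasure_Diff box_subset_cbox)
    qed
    moreover have "AE x in lborel. x \<in> box a b \<longrightarrow> h x = 0"
      by (rule AEbox) (use X D(3) ab in blast)
    ultimately show "AE x in lborel. x \<in> X \<longrightarrow> h x = 0"
      by eventually_elim (use ab in blast)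
  qed
  thus ?thesis by eventually_elim (use D(3) in blast)
qed

section \<open>Integration by parts and weak gradients\<close>

lemma bounded_imageE:
  assumes "bounded (f ` K)" obtains B where "\<And>x. x \<in> K \<Longrightarrow> norm (f x) \<le> B"
  using assms unfolding bounded_iff by blast

text \<open>
Lebesgue measure is translation invariant, so every difference quotient of \<open>f\<close> has integral zero. The
quotients are bounded by the Lipschitz constant, are supported in a common ball, and converge to the
partial derivative.
\<close>

lemma integral_partial_deriv_eq_0:
  fixes f :: "real^'n::finite \<Rightarrow> real"
  assumes f: "Ck_on 1 UNIV f" and R: "\<And>x. R < norm x \<Longrightarrow> f x = 0"
  shows "integrable lborel (partial_deriv i f)" "(\<integral>x. partial_deriv i f x \<partial>lborel) = 0"
proof -
  let ?e = "axis i 1 :: real^'n"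
  note D = has_derivative_grad[OF Ck1_D(1)[OF open_UNIV f UNIV_I]]
  have contg: "continuous_on UNIV (grad f)" by (rule Ck1_D(2)[OF open_UNIV f])
  have contf: "continuous_on UNIV f" by (rule Ck1_D(3)[OF open_UNIV f])
  have contp: "continuous_on UNIV (partial_deriv i f)" using f by simp
  have grad0: "grad f x = 0" if "R < norm x" for x
  proof (rule grad_eqI)
    have "open {x::real^'n. R < norm x}" by (intro open_Collect_less continuous_intros)
    hence "(f has_derivative (\<lambda>h. 0)) (at x)"
      by (rule has_derivative_transform_within_open[where f="\<lambda>x. 0" and g=f, OF has_derivative_const])
         (use that R in auto)
    thus "(f has_derivative (\<lambda>h. 0 \<bullet> h)) (at x)" by (simp only: inner_zero_left)
  qed
  obtain M where M: "\<And>x. norm (grad f x) \<le> M"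
  proof -
    have "bounded (grad f ` cball 0 R)"
      by (intro compact_imp_bounded compact_continuous_image continuous_on_subset[OF contg]) auto
    then obtain B where B: "\<And>x. x \<in> cball 0 R \<Longrightarrow> norm (grad f x) \<le> B" by (rule bounded_imageE) blast
    have "norm (grad f x) \<le> max B 0" for x using B[of x] grad0[of x] by (cases "norm x \<le> R") (auto simp: le_max_iff_disj)
    thus thesis by (rule that)
  qed
  have M0: "M \<ge> 0" by (rule order_trans[OF norm_ge_zero M[of 0]])
  have lip: "\<bar>f y - f x\<bar> \<le> M * norm (y - x)" for x y
  proof -
    have "norm (f y - f x) \<le> M * norm (y - x)"
    proof (rule differentiable_bound[where S=UNIV and f'="\<lambda>x h. grad f x \<bullet> h"])
      fix x show "onorm (\<lambda>h. grad f x \<bullet> h) \<le> M"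
      proof (rule onorm_le)
        fix h
        have "norm (grad f x \<bullet> h) \<le> norm (grad f x) * norm h" using Cauchy_Schwarz_ineq2[of "grad f x" h] by simp
        also have "\<dots> \<le> M * norm h" by (rule mult_right_mono[OF M norm_ge_zero])
        finally show "norm (grad f x \<bullet> h) \<le> M * norm h" .
      qed
    qed (use D in auto)
    thus ?thesis by simp
  qed
  define q where "q n x = real (Suc n) * (f (inverse (real (Suc n)) *\<^sub>R ?e + x) - f x)" for n x
  have lim: "(\<lambda>n. q n x) \<longlonglongrightarrow> partial_deriv i f x" for x
  proof -
    have "((\<lambda>t. f (x + t *\<^sub>R ?e)) has_derivative (\<lambda>t. grad f x \<bullet> (t *\<^sub>R ?e))) (at 0)"
    proof (rule has_derivative_compose[where f="\<lambda>t. x + t *\<^sub>R ?e" and g=f])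
      show "((\<lambda>t. x + t *\<^sub>R ?e) has_derivative (\<lambda>t. t *\<^sub>R ?e)) (at 0)"
        by (auto intro!: derivative_eq_intros)
    qed (use D[of x] in simp)
    hence "((\<lambda>t. f (x + t *\<^sub>R ?e)) has_real_derivative partial_deriv i f x) (at 0)"
      by (simp add: has_field_derivative_def grad_def inner_axis mult.commute[of _ "partial_deriv i f x"])
    hence "(\<lambda>t. (f (x + t *\<^sub>R ?e) - f x) / t) \<midarrow>0\<rightarrow> partial_deriv i f x"
      by (simp add: has_field_derivative_iff)
    from filterlim_compose[OF this, of "\<lambda>n. inverse (real (Suc n))" sequentially]
    have "(\<lambda>n. (f (x + inverse (real (Suc n)) *\<^sub>R ?e) - f x) / inverse (real (Suc n))) \<longlonglongrightarrow> partial_deriv i f x"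
      using LIMSEQ_inverse_real_of_nat by (simp add: filterlim_at del: of_nat_Suc)
    thus ?thesis unfolding q_def by (simp add: divide_inverse mult.commute add.commute del: of_nat_Suc)
  qed
  have bnd: "norm (q n x) \<le> M * indicator (cball 0 (R+1)) x" for n x
  proof (cases "norm x \<le> R + 1")
    case True
    have "\<bar>q n x\<bar> \<le> real (Suc n) * (M * norm (inverse (real (Suc n)) *\<^sub>R ?e))"
      unfolding q_def abs_mult using lip[of "inverse (real (Suc n)) *\<^sub>R ?e + x" x]
      by (intro mult_mono) auto
    also have "\<dots> = M" by (simp add: norm_axis_1 del: of_nat_Suc)
    finally show ?thesis using True by simp
  next
    case False
    have "norm x \<le> norm (inverse (real (Suc n)) *\<^sub>R ?e + x) + norm (inverse (real (Suc n)) *\<^sub>R ?e)"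
      using norm_triangle_ineq4[of "inverse (real (Suc n)) *\<^sub>R ?e + x" "inverse (real (Suc n)) *\<^sub>R ?e"] by simp
    moreover have "norm (inverse (real (Suc n)) *\<^sub>R ?e) \<le> 1" by (simp add: norm_axis_1 inverse_le_1_iff del: of_nat_Suc)
    ultimately have "R < norm (inverse (real (Suc n)) *\<^sub>R ?e + x)" using False by linarith
    hence "q n x = 0" using R False by (simp add: q_def)
    thus ?thesis using M0 by simp
  qed
  have wi: "integrable lborel (\<lambda>x::real^'n. M * indicator (cball 0 (R+1)) x)"
    using emeasure_bounded_finite[of "cball 0 (R+1)"] by (auto intro!: integrable_real_indicator)
  have mf: "f \<in> borel_measurable borel" by (rule borel_measurable_continuous_onI[OF contf])
  have mq: "q n \<in> borel_measurable lborel" for n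
    unfolding q_def using mf by measurable
  have mp: "partial_deriv i f \<in> borel_measurable lborel"
    using borel_measurable_continuous_onI[OF contp] by simp
  show "integrable lborel (partial_deriv i f)"
    by (rule integrable_dominated_convergence[where s=q, OF mp mq wi]) (use lim bnd in \<open>simp_all del: real_norm_def\<close>)
  have "(\<lambda>n. \<integral>x. q n x \<partial>lborel) \<longlonglongrightarrow> (\<integral>x. partial_deriv i f x \<partial>lborel)"
    by (rule integral_dominated_convergence[OF mp mq wi]) (use lim bnd in \<open>simp_all del: real_norm_def\<close>)
  moreover have "(\<integral>x. q n x \<partial>lborel) = 0" for n
  proof -
    let ?t = "inverse (real (Suc n)) *\<^sub>R ?e"
    have fi: "integrable lborel f"
    proof -
      have "bounded (f ` cball 0 R)"
        by (intro compact_imp_bounded compact_continuous_image continuous_on_subset[OF contf]) auto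
      then obtain B where B: "\<And>x. x \<in> cball 0 R \<Longrightarrow> norm (f x) \<le> B" by (rule bounded_imageE) blast
      show ?thesis
      proof (rule Bochner_Integration.integrable_bound[where f="\<lambda>x. B * indicator (cball 0 R) x"])
      have "norm (f x) \<le> norm (B * indicator (cball 0 R) x)" for x
        using B[of x] R[of x] by (cases "norm x \<le> R") auto
      thus "AE x in lborel. norm (f x) \<le> norm (B * indicator (cball 0 R) x)" by simp
      show "integrable lborel (\<lambda>x::real^'n. B * indicator (cball 0 R) x)"
        using emeasure_bounded_finite[of "cball 0 R"] by (auto intro!: integrable_real_indicator)
      qed (use mf in simp)
    qed
    have eq: "lborel = distr lborel borel ((+) ?t)" by (simp add: lborel_distr_plus)
    have "integrable (distr lborel borel ((+) ?t)) f" using fi eq by simp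
    hence fi2: "integrable lborel (\<lambda>x. f (?t + x))" using mf by (simp add: integrable_distr_eq)
    have "(\<integral>x. f x \<partial>(distr lborel borel ((+) ?t))) = (\<integral>x. f (?t + x) \<partial>lborel)"
      by (rule integral_distr) (use mf in auto)
    hence "(\<integral>x. f (?t + x) \<partial>lborel) = (\<integral>x. f x \<partial>lborel)" using eq by simp
    thus ?thesis unfolding q_def using fi fi2 by simp
  qed
  ultimately have "(\<lambda>n::nat. 0::real) \<longlonglongrightarrow> (\<integral>x. partial_deriv i f x \<partial>lborel)" by (simp only:)
  from LIMSEQ_unique[OF this tendsto_const] show "(\<integral>x. partial_deriv i f x \<partial>lborel) = 0" .
qed

text \<open>
The closed support, as a set outside of which \<open>\<psi>\<close> and its derivatives vanish.
\<close>

lemma test_function_support: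
  assumes "\<psi> \<in> test_functions S"
  obtains K where "compact K" "K \<subseteq> S" "\<And>x. x \<notin> K \<Longrightarrow> \<psi> x = 0" "\<And>x i. x \<notin> K \<Longrightarrow> partial_deriv i \<psi> x = 0"
proof -
  define K where "K = closure {x. \<psi> x \<noteq> 0}"
  have K: "compact K" "K \<subseteq> S" using assms by (auto simp: test_functions_def K_def)
  have cl: "closed K" unfolding K_def by (rule closed_closure)
  have 0: "\<psi> x = 0" if "x \<notin> K" for x 
    using that closure_subset[of "{x. \<psi> x \<noteq> 0}"] unfolding K_def by blast
  have "partial_deriv i \<psi> x = 0" if x: "x \<notin> K" for x i
  proof -
    have "partial_deriv i \<psi> x = partial_deriv i (\<lambda>x. 0) x"
      by (rule partial_deriv_cong_open[of "- K"]) (use x 0 cl in auto)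
    also have "\<dots> = 0" by (rule partial_deriv_eqI[OF has_derivative_const])
    finally show ?thesis .
  qed
  with K 0 show thesis by (rule that)
qed

lemma test_function_smooth: "\<psi> \<in> test_functions S \<Longrightarrow> smooth_on UNIV \<psi>"
  by (simp add: test_functions_def)

lemma test_function_continuous:
  assumes "\<psi> \<in> test_functions S"
  shows "continuous_on A \<psi>" "continuous_on A (grad \<psi>)" "continuous_on A (partial_deriv i \<psi>)"
proof -
  note C = smooth_onD[OF test_function_smooth[OF assms], of 1]
  have "continuous_on UNIV (partial_deriv i \<psi>)" using C by simp
  thus "continuous_on A \<psi>" "continuous_on A (grad \<psi>)" "continuous_on A (partial_deriv i \<psi>)"
    using continuous_on_subset[OF Ck1_D(3)[OF open_UNIV C] subset_UNIV]
        continuous_on_subset[OF Ck1_D(2)[OF open_UNIV C] subset_UNIV] 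
        continuous_on_subset[OF _ subset_UNIV] by blast+
qed

lemma test_functions_mono: "T \<subseteq> S \<Longrightarrow> test_functions T \<subseteq> test_functions S"
  by (auto simp: test_functions_def)

lemma Ck_on_extend_zero:
  assumes "open S" "closed C" "C \<subseteq> S" "Ck_on k S f" "\<And>x. x \<in> S \<Longrightarrow> x \<notin> C \<Longrightarrow> f x = 0"
  shows "Ck_on k UNIV (\<lambda>x. if x \<in> S then f x else 0)"
proof -
  have "Ck_on k S (\<lambda>x. if x \<in> S then f x else 0)" by (rule Ck_on_cong[OF assms(1) _ assms(4)]) simp
  moreover have "Ck_on k (- C) (\<lambda>x. if x \<in> S then f x else 0)"
    by (rule Ck_on_cong[OF _ _ Ck_on_const[of k "- C" 0]]) (use assms in auto)
  ultimately have "Ck_on k (S \<union> - C) (\<lambda>x. if x \<in> S then f x else 0)"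
    by (rule Ck_on_Un[OF assms(1) open_Compl[OF assms(2)]])
  moreover have "S \<union> - C = UNIV" using assms(3) by auto
  ultimately show ?thesis by simp
qed

lemma test_function_mult:
  assumes S: "open S" and \<phi>: "smooth_on S \<phi>" and \<psi>: "\<psi> \<in> test_functions S"
  shows "(\<lambda>x. if x \<in> S then \<phi> x * \<psi> x else 0) \<in> test_functions S"
proof -
  obtain K where K: "compact K" "K \<subseteq> S" "\<And>x. x \<notin> K \<Longrightarrow> \<psi> x = 0" "\<And>x i. x \<notin> K \<Longrightarrow> partial_deriv i \<psi> x = 0"
    by (rule test_function_support[OF \<psi>]) blast
  let ?f = "\<lambda>x. if x \<in> S then \<phi> x * \<psi> x else 0"
  have "smooth_on UNIV ?f"
    unfolding smooth_on_def
  proof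
    fix k show "Ck_on k UNIV ?f"
      by (rule Ck_on_extend_zero[OF S compact_imp_closed[OF K(1)] K(2) 
          smooth_onD[OF smooth_on_mult[OF S \<phi> smooth_on_subset[OF test_function_smooth[OF \<psi>]]]]])
        (use K in auto)
  qed
  moreover have "closure {x. ?f x \<noteq> 0} \<subseteq> K"
    by (rule closure_minimal[OF _ compact_imp_closed[OF K(1)]]) (use K in auto)
  moreover from this have "compact (closure {x. ?f x \<noteq> 0})"
    using compact_Int_closed[OF K(1) closed_closure, of "{x. ?f x \<noteq> 0}"] by (simp add: Int_absorb1)
  ultimately show ?thesis using K(2) by (auto simp: test_functions_def)
qed

lemma set_integrable_mult_continuous:
  fixes g :: "'a::euclidean_space \<Rightarrow> 'b::euclidean_space"
  assumes "compact K" "set_integrable lborel K g" "continuous_on K \<phi>"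
  shows "set_integrable lborel K (\<lambda>x. \<phi> x *\<^sub>R g x)"
proof -
  have "bounded (\<phi> ` K)" by (intro compact_imp_bounded compact_continuous_image assms)
  then obtain B where B: "\<And>x. x \<in> K \<Longrightarrow> norm (\<phi> x) \<le> B" by (rule bounded_imageE) blast
  have gi: "integrable lborel (\<lambda>x. indicator K x *\<^sub>R g x)" using assms(2) by (simp add: set_integrable_def)
  have m: "(\<lambda>x. indicator K x *\<^sub>R \<phi> x) \<in> borel_measurable borel"
    by (rule borel_measurable_continuous_on_indicator) (use assms compact_imp_closed[OF assms(1)] in auto)
  have eq: "(\<lambda>x. indicator K x *\<^sub>R \<phi> x *\<^sub>R g x) = (\<lambda>x. (indicator K x *\<^sub>R \<phi> x) *\<^sub>R (indicator K x *\<^sub>R g x))"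
    by (auto simp: indicator_def fun_eq_iff)
  show ?thesis unfolding set_integrable_def eq
  proof (rule Bochner_Integration.integrable_bound)
    show "integrable lborel (\<lambda>x. B *\<^sub>R (indicator K x *\<^sub>R g x))" using gi by (rule integrable_scaleR_right)
    show "(\<lambda>x. (indicator K x *\<^sub>R \<phi> x) *\<^sub>R indicator K x *\<^sub>R g x) \<in> borel_measurable lborel"
      by (rule borel_measurable_scaleR[OF _ borel_measurable_integrable[OF gi]]) (use m in simp)
    show "AE x in lborel. norm ((indicator K x *\<^sub>R \<phi> x) *\<^sub>R indicator K x *\<^sub>R g x) \<le> norm (B *\<^sub>R indicator K x *\<^sub>R g x)"
    proof (rule AE_I2)
      fix x show "norm ((indicator K x *\<^sub>R \<phi> x) *\<^sub>R indicator K x *\<^sub>R g x) \<le> norm (B *\<^sub>R indicator K x *\<^sub>R g x)"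
        using B[of x] by (cases "x \<in> K") (auto intro!: mult_right_mono)
    qed
  qed
qed

lemma set_integrable_mult_continuous_real:
  fixes g :: "'a::euclidean_space \<Rightarrow> real"
  assumes "compact K" "set_integrable lborel K g" "continuous_on K \<phi>"
  shows "set_integrable lborel K (\<lambda>x. g x * \<phi> x)"
  using set_integrable_mult_continuous[OF assms] by (simp add: mult.commute)

lemma set_integrable_continuous_compact:
  fixes g :: "'a::euclidean_space \<Rightarrow> 'b::euclidean_space"
  assumes "compact K" "continuous_on K g" shows "set_integrable lborel K g"
  using borel_integrable_compact[OF assms] by (simp add: set_integrable_def)

lemma set_integral_support:
  fixes F :: "'a::euclidean_space \<Rightarrow> real"
  assumes "K \<subseteq> S" "\<And>x. x \<notin> K \<Longrightarrow> F x = 0"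
  shows "(LINT x:S|lborel. F x) = (LINT x:K|lborel. F x)" "(LINT x:S|lborel. F x) = (\<integral>x. F x \<partial>lborel)"
proof -
  have "indicator S x *\<^sub>R F x = indicator K x *\<^sub>R F x" "indicator S x *\<^sub>R F x = F x" for x
    using assms by (auto simp: indicator_def)
  thus "(LINT x:S|lborel. F x) = (LINT x:K|lborel. F x)" "(LINT x:S|lborel. F x) = (\<integral>x. F x \<partial>lborel)"
    unfolding set_lebesgue_integral_def by (simp_all only:)
qed

lemma set_integrable_vec_nth:
  fixes g :: "_ \<Rightarrow> real^'n::finite"
  assumes "set_integrable M K g" shows "set_integrable M K (\<lambda>x. g x $ i)"
  using integrable_inner_left[OF assms[unfolded set_integrable_def], of "axis i 1"]
  by (simp add: set_integrable_def inner_axis)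

lemma vec_AE_eqI:
  fixes g h :: "_ \<Rightarrow> real^'n::finite"
  assumes "\<And>i. AE x in M. P x \<longrightarrow> g x $ i = h x $ i"
  shows "AE x in M. P x \<longrightarrow> g x = h x"
proof -
  have "AE x in M. \<forall>i\<in>UNIV. P x \<longrightarrow> g x $ i = h x $ i" using assms by (intro AE_finite_allI) auto
  thus ?thesis by eventually_elim (auto simp: vec_eq_iff)
qed

lemma has_weak_gradientD:
  assumes "has_weak_gradient_on v g S"
  shows "g \<in> borel_measurable borel" "\<And>K. compact K \<Longrightarrow> K \<subseteq> S \<Longrightarrow> set_integrable lborel K v"
    "\<And>K. compact K \<Longrightarrow> K \<subseteq> S \<Longrightarrow> set_integrable lborel K g"
    "\<And>\<psi> i. \<psi> \<in> test_functions S \<Longrightarrow> 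
       (LINT x:S|lborel. v x * partial_deriv i \<psi> x) = - (LINT x:S|lborel. (g x $ i) * \<psi> x)"
  using assms unfolding has_weak_gradient_on_def by auto

text \<open>
Apply the fundamental lemma to the difference of the components.
\<close>

lemma weak_gradient_unique:
  fixes g :: "real^'n::finite \<Rightarrow> real^'n"
  assumes S: "open S" and g: "has_weak_gradient_on v g S" and h: "has_weak_gradient_on v h S"
  shows "AE x in lborel. x \<in> S \<longrightarrow> g x = h x"
proof (rule vec_AE_eqI)
  fix i
  have "AE x in lborel. x \<in> S \<longrightarrow> g x $ i - h x $ i = 0"
  proof (rule fundamental_lemma_calc_var[OF S])
    show "set_integrable lborel K (\<lambda>x. g x $ i - h x $ i)" if "compact K" "K \<subseteq> S" for K
      by (intro set_integral_diff set_integrable_vec_nth has_weak_gradientD(3)[OF g] has_weak_gradientD(3)[OF h] that)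
    fix \<psi> assume \<psi>: "\<psi> \<in> test_functions S"
    obtain K where K: "compact K" "K \<subseteq> S" "\<And>x. x \<notin> K \<Longrightarrow> \<psi> x = 0"
      by (rule test_function_support[OF \<psi>]) blast
    have i: "set_integrable lborel K (\<lambda>x. g x $ i * \<psi> x)" "set_integrable lborel K (\<lambda>x. h x $ i * \<psi> x)"
      by (intro set_integrable_mult_continuous_real K set_integrable_vec_nth has_weak_gradientD(3)[OF g] has_weak_gradientD(3)[OF h]
          test_function_continuous[OF \<psi>])+
    have "(LINT x:S|lborel. (g x $ i - h x $ i) * \<psi> x) = (LINT x:K|lborel. g x $ i * \<psi> x - h x $ i * \<psi> x)"
      using K by (subst set_integral_support(1)[of K]) (auto simp: algebra_simps)
    also have "\<dots> = (LINT x:K|lborel. g x $ i * \<psi> x) - (LINT x:K|lborel. h x $ i * \<psi> x)"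
      using i by (rule set_integral_diff)
    also have "\<dots> = (LINT x:S|lborel. g x $ i * \<psi> x) - (LINT x:S|lborel. h x $ i * \<psi> x)"
      using K by (subst (3 4) set_integral_support(1)[of K]) auto
    also have "\<dots> = 0"
      using has_weak_gradientD(4)[OF g \<psi>, of i] has_weak_gradientD(4)[OF h \<psi>, of i] by simp
    finally show "(LINT x:S|lborel. (g x $ i - h x $ i) * \<psi> x) = 0" .
  qed
  thus "AE x in lborel. x \<in> S \<longrightarrow> g x $ i = h x $ i" by simp
qed

lemma has_weak_gradient_restrict:
  assumes g: "has_weak_gradient_on v g S" and T: "T \<subseteq> S"
  shows "has_weak_gradient_on v g T"
  unfolding has_weak_gradient_on_def
proof (intro conjI allI impI ballI; (elim conjE)?)
  fix \<psi> i assume \<psi>: "\<psi> \<in> test_functions T"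
  obtain K where K: "compact K" "K \<subseteq> T" "\<And>x. x \<notin> K \<Longrightarrow> \<psi> x = 0" "\<And>x i. x \<notin> K \<Longrightarrow> partial_deriv i \<psi> x = 0"
    by (rule test_function_support[OF \<psi>]) blast
  have KS: "K \<subseteq> S" using K T by blast
  have "(LINT x:T|lborel. v x * partial_deriv i \<psi> x) = (LINT x:S|lborel. v x * partial_deriv i \<psi> x)"
    using K KS by (subst (1 2) set_integral_support(2)[of K]) auto
  also have "\<dots> = - (LINT x:S|lborel. (g x $ i) * \<psi> x)"
    using has_weak_gradientD(4)[OF g] \<psi> test_functions_mono[OF T] by blast
  also have "(LINT x:S|lborel. (g x $ i) * \<psi> x) = (LINT x:T|lborel. (g x $ i) * \<psi> x)"
    using K KS by (subst (1 2) set_integral_support(2)[of K]) auto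
  finally show "(LINT x:T|lborel. v x * partial_deriv i \<psi> x) = - (LINT x:T|lborel. (g x $ i) * \<psi> x)" .
qed (use has_weak_gradientD[OF g] T in blast)+

lemma has_weak_gradient_diff:
  assumes g: "has_weak_gradient_on v g S" and h: "has_weak_gradient_on w h S"
  shows "has_weak_gradient_on (\<lambda>x. v x - w x) (\<lambda>x. g x - h x) S"
  unfolding has_weak_gradient_on_def
proof (intro conjI allI impI ballI; (elim conjE)?)
  show "(\<lambda>x. g x - h x) \<in> borel_measurable borel"
    by (intro borel_measurable_diff has_weak_gradientD(1)[OF g] has_weak_gradientD(1)[OF h])
  fix \<psi> i assume \<psi>: "\<psi> \<in> test_functions S"
  obtain K where K: "compact K" "K \<subseteq> S" "\<And>x. x \<notin> K \<Longrightarrow> \<psi> x = 0" "\<And>x i. x \<notin> K \<Longrightarrow> partial_deriv i \<psi> x = 0"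
    by (rule test_function_support[OF \<psi>]) blast
  have i: "set_integrable lborel K (\<lambda>x. g x $ i * \<psi> x)" "set_integrable lborel K (\<lambda>x. h x $ i * \<psi> x)"
    by (intro set_integrable_mult_continuous_real K set_integrable_vec_nth has_weak_gradientD(3)[OF g] has_weak_gradientD(3)[OF h]
        test_function_continuous[OF \<psi>])+
  have j: "set_integrable lborel K (\<lambda>x. v x * partial_deriv i \<psi> x)" "set_integrable lborel K (\<lambda>x. w x * partial_deriv i \<psi> x)"
    by (intro set_integrable_mult_continuous_real K has_weak_gradientD(2)[OF g] has_weak_gradientD(2)[OF h]
        test_function_continuous[OF \<psi>])+
  have e: "(LINT x:S|lborel. g x $ i * \<psi> x) = (LINT x:K|lborel. g x $ i * \<psi> x)"
       "(LINT x:S|lborel. h x $ i * \<psi> x) = (LINT x:K|lborel. h x $ i * \<psi> x)"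
       "(LINT x:S|lborel. v x * partial_deriv i \<psi> x) = (LINT x:K|lborel. v x * partial_deriv i \<psi> x)"
       "(LINT x:S|lborel. w x * partial_deriv i \<psi> x) = (LINT x:K|lborel. w x * partial_deriv i \<psi> x)"
       "(LINT x:S|lborel. (v x - w x) * partial_deriv i \<psi> x) = (LINT x:K|lborel. v x * partial_deriv i \<psi> x - w x * partial_deriv i \<psi> x)"
       "(LINT x:S|lborel. ((g x - h x) $ i) * \<psi> x) = (LINT x:K|lborel. g x $ i * \<psi> x - h x $ i * \<psi> x)"
    using K by (subst set_integral_support(1)[of K]; force simp: algebra_simps)+
  show "(LINT x:S|lborel. (v x - w x) * partial_deriv i \<psi> x) = - (LINT x:S|lborel. ((g x - h x) $ i) * \<psi> x)"
    unfolding e(5,6) set_integral_diff(2)[OF i] set_integral_diff(2)[OF j]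
    using has_weak_gradientD(4)[OF g \<psi>, of i] has_weak_gradientD(4)[OF h \<psi>, of i] e by simp
qed (intro set_integral_diff has_weak_gradientD(2)[OF g] has_weak_gradientD(2)[OF h] has_weak_gradientD(3)[OF g] has_weak_gradientD(3)[OF h]; assumption)+

lemma has_weak_gradient_cong_AE:
  assumes S: "open S" and g: "has_weak_gradient_on v g S" and w: "w \<in> borel_measurable borel"
    and ae: "AE x in lborel. x \<in> S \<longrightarrow> v x = w x"
  shows "has_weak_gradient_on w g S"
proof -
  have wK: "set_integrable lborel K w" if K: "compact K" "K \<subseteq> S" for K
    unfolding set_integrable_def
  proof (rule integrable_cong_AE_imp)
    show "integrable lborel (\<lambda>x. indicator K x *\<^sub>R v x)"
      using has_weak_gradientD(2)[OF g K] by (simp add: set_integrable_def)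
    show "(\<lambda>x. indicator K x *\<^sub>R w x) \<in> borel_measurable lborel"
      using w compact_imp_closed[OF K(1)] by (intro borel_measurable_scaleR borel_measurable_indicator) auto
    show "AE x in lborel. indicator K x *\<^sub>R v x = indicator K x *\<^sub>R w x"
      using ae by eventually_elim (use K in \<open>auto simp: indicator_def\<close>)
  qed
  show ?thesis
    unfolding has_weak_gradient_on_def
  proof (intro conjI allI impI ballI; (elim conjE)?)
  fix \<psi> i assume \<psi>: "\<psi> \<in> test_functions S"
  obtain K where K: "compact K" "K \<subseteq> S" "\<And>x. x \<notin> K \<Longrightarrow> \<psi> x = 0" "\<And>x i. x \<notin> K \<Longrightarrow> partial_deriv i \<psi> x = 0"
    by (rule test_function_support[OF \<psi>]) blast
  have m: "(\<lambda>x. indicator K x *\<^sub>R (u x * partial_deriv i \<psi> x)) \<in> borel_measurable lborel" if "set_integrable lborel K u" for u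
    using set_integrable_mult_continuous_real[OF K(1) that test_function_continuous(3)[OF \<psi>], of i]
    by (auto simp: set_integrable_def)
  have "(LINT x:S|lborel. w x * partial_deriv i \<psi> x) = (LINT x:K|lborel. w x * partial_deriv i \<psi> x)"
    using K by (intro set_integral_support) auto
  also have "\<dots> = (LINT x:K|lborel. v x * partial_deriv i \<psi> x)"
    unfolding set_lebesgue_integral_def
  proof (rule integral_cong_AE)
    show "AE x in lborel. indicator K x *\<^sub>R (w x * partial_deriv i \<psi> x) = indicator K x *\<^sub>R (v x * partial_deriv i \<psi> x)"
      using ae by eventually_elim (use K in \<open>auto simp: indicator_def\<close>)
  qed (intro m wK has_weak_gradientD(2)[OF g] K)+
  also have "\<dots> = (LINT x:S|lborel. v x * partial_deriv i \<psi> x)"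
    using K by (intro set_integral_support[symmetric]) auto
  also have "\<dots> = - (LINT x:S|lborel. (g x $ i) * \<psi> x)" by (rule has_weak_gradientD(4)[OF g \<psi>])
  finally show "(LINT x:S|lborel. w x * partial_deriv i \<psi> x) = - (LINT x:S|lborel. (g x $ i) * \<psi> x)" .
  qed (use wK has_weak_gradientD[OF g] in blast)+
qed

text \<open>
For a test function \<open>\<psi>\<close> on \<open>S\<close> the product \<open>w \<psi>\<close>, extended by zero, is continuously differentiable on the
whole space; so the integral of its partial derivatives vanishes. The indicator only makes the gradient a Borel
function on the whole space.
\<close>

lemma classical_gradient_weak:
  fixes w :: "real^'n::finite \<Rightarrow> real"
  assumes S: "open S" and w: "Ck_on 1 S w"
  shows "has_weak_gradient_on w (\<lambda>x. indicator S x *\<^sub>R grad w x) S"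
  unfolding has_weak_gradient_on_def
proof (intro conjI allI impI ballI; (elim conjE)?)
  show "(\<lambda>x. indicator S x *\<^sub>R grad w x) \<in> borel_measurable borel"
    by (rule borel_measurable_continuous_on_indicator) (use S Ck1_D[OF S w] in auto)
next
  fix K assume K: "compact K" "K \<subseteq> S"
  show "set_integrable lborel K w"
    by (intro set_integrable_continuous_compact K continuous_on_subset[OF Ck1_D(3)[OF S w] K(2)])
  have "set_integrable lborel K (grad w)"
    by (intro set_integrable_continuous_compact K continuous_on_subset[OF Ck1_D(2)[OF S w] K(2)])
  moreover have "indicator K x *\<^sub>R indicator S x *\<^sub>R grad w x = indicator K x *\<^sub>R grad w x" for x
    using K by (auto simp: indicator_def)
  ultimately show "set_integrable lborel K (\<lambda>x. indicator S x *\<^sub>R grad w x)"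
    unfolding set_integrable_def by (simp only:)
next
  fix \<psi> i assume \<psi>: "\<psi> \<in> test_functions S"
  obtain K where K: "compact K" "K \<subseteq> S" "\<And>x. x \<notin> K \<Longrightarrow> \<psi> x = 0" "\<And>x i. x \<notin> K \<Longrightarrow> partial_deriv i \<psi> x = 0"
    by (rule test_function_support[OF \<psi>]) blast
  let ?f = "\<lambda>x. if x \<in> S then w x * \<psi> x else 0"
  have psS: "Ck_on 1 S \<psi>" using smooth_onD[OF test_function_smooth[OF \<psi>], of 1] Ck_on_subset by blast
  have f: "Ck_on 1 UNIV ?f"
    by (rule Ck_on_extend_zero[OF S compact_imp_closed[OF K(1)] K(2) Ck_on_mult[OF S w psS]]) (use K in auto)
  obtain R where R: "\<And>x. x \<in> K \<Longrightarrow> norm x \<le> R" using compact_imp_bounded[OF K(1)] by (auto simp: bounded_iff)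
  have f0: "?f x = 0" if "R < norm x" for x using R[of x] K(3)[of x] that by force
  have pd: "partial_deriv i ?f x = w x * partial_deriv i \<psi> x + indicator S x * partial_deriv i w x * \<psi> x" if x: "x \<in> S" for x
  proof -
    have "partial_deriv i ?f x = partial_deriv i (\<lambda>x. w x * \<psi> x) x"
      by (rule partial_deriv_cong_open[OF S x]) simp
    also have "\<dots> = partial_deriv i w x * \<psi> x + w x * partial_deriv i \<psi> x"
      by (intro partial_deriv_mult Ck1_D(1)[OF S w x] Ck1_D(1)[OF S psS x])
    finally show ?thesis using x by simp
  qed
  have pd0: "partial_deriv i ?f x = 0" if "x \<notin> K" for x
  proof -
    have "partial_deriv i ?f x = partial_deriv i (\<lambda>x. 0) x"
      by (rule partial_deriv_cong_open[of "- K"]) (use that K compact_imp_closed[OF K(1)] in auto)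
    thus ?thesis using partial_deriv_eqI[OF has_derivative_const, of i "0::real" x] by simp
  qed
  have i1: "set_integrable lborel K (\<lambda>x. w x * partial_deriv i \<psi> x)"
    by (intro set_integrable_continuous_compact K continuous_intros continuous_on_subset[OF Ck1_D(3)[OF S w] K(2)] test_function_continuous[OF \<psi>])
  have "continuous_on S (partial_deriv i w)" using w by simp
  hence i2: "set_integrable lborel K (\<lambda>x. partial_deriv i w x * \<psi> x)"
    using K(2) by (intro set_integrable_continuous_compact K continuous_intros test_function_continuous[OF \<psi>]) (auto intro: continuous_on_subset)
  have "0 = (\<integral>x. partial_deriv i ?f x \<partial>lborel)"
    using integral_partial_deriv_eq_0(2)[OF f f0, where i=i] by simp
  also have "\<dots> = (LINT x:K|lborel. partial_deriv i ?f x)"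
    using set_integral_support[of K K "partial_deriv i ?f"] pd0 by simp
  also have "\<dots> = (LINT x:K|lborel. w x * partial_deriv i \<psi> x + partial_deriv i w x * \<psi> x)"
    by (rule set_lebesgue_integral_cong) (use K pd compact_imp_closed[OF K(1)] in auto)
  also have "\<dots> = (LINT x:K|lborel. w x * partial_deriv i \<psi> x) + (LINT x:K|lborel. partial_deriv i w x * \<psi> x)"
    by (rule set_integral_add(2)[OF i1 i2])
  also have "(LINT x:K|lborel. w x * partial_deriv i \<psi> x) = (LINT x:S|lborel. w x * partial_deriv i \<psi> x)"
    using K by (intro set_integral_support[symmetric]) auto
  also have "(LINT x:K|lborel. partial_deriv i w x * \<psi> x) = (LINT x:S|lborel. partial_deriv i w x * \<psi> x)"
    using K by (intro set_integral_support[symmetric]) auto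
  also have "\<dots> = (LINT x:S|lborel. ((indicator S x *\<^sub>R grad w x) $ i) * \<psi> x)"
    unfolding set_lebesgue_integral_def by (rule Bochner_Integration.integral_cong) (auto simp: grad_def indicator_def)
  finally show "(LINT x:S|lborel. w x * partial_deriv i \<psi> x) = - (LINT x:S|lborel. ((indicator S x *\<^sub>R grad w x) $ i) * \<psi> x)"
    by simp
qed

text \<open>
If \<open>\<psi>\<close> is a test function on \<open>S\<close>, so is \<open>\<phi> \<psi>\<close>, and testing \<open>v\<close> against \<open>\<phi> \<psi>\<close> gives the product rule.
\<close>

lemma has_weak_gradient_mult_smooth:
  fixes v \<phi> :: "real^'n::finite \<Rightarrow> real"
  assumes S: "open S" and \<phi>: "smooth_on S \<phi>" and g: "has_weak_gradient_on v g S" and v: "v \<in> borel_measurable borel"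
  shows "has_weak_gradient_on (\<lambda>x. \<phi> x * v x) (\<lambda>x. indicator S x *\<^sub>R (\<phi> x *\<^sub>R g x + v x *\<^sub>R grad \<phi> x)) S"
  unfolding has_weak_gradient_on_def
proof (intro conjI allI impI ballI; (elim conjE)?)
  have c\<phi>: "continuous_on S \<phi>" "continuous_on S (grad \<phi>)" and d\<phi>: "\<And>x. x \<in> S \<Longrightarrow> \<phi> differentiable (at x)"
    and cp: "\<And>i. continuous_on S (partial_deriv i \<phi>)"
    using Ck1_D[OF S smooth_onD[OF \<phi>]] smooth_onD[OF \<phi>, of 1] by auto
  have m1: "(\<lambda>x. indicator S x *\<^sub>R \<phi> x) \<in> borel_measurable borel" "(\<lambda>x. indicator S x *\<^sub>R grad \<phi> x) \<in> borel_measurable borel"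
    by (rule borel_measurable_continuous_on_indicator; use S c\<phi> in auto)+
  have eq: "(\<lambda>x. indicator S x *\<^sub>R (\<phi> x *\<^sub>R g x + v x *\<^sub>R grad \<phi> x)) = 
     (\<lambda>x. (indicator S x *\<^sub>R \<phi> x) *\<^sub>R g x + v x *\<^sub>R (indicator S x *\<^sub>R grad \<phi> x))"
    by (auto simp: fun_eq_iff algebra_simps)
  show "(\<lambda>x. indicator S x *\<^sub>R (\<phi> x *\<^sub>R g x + v x *\<^sub>R grad \<phi> x)) \<in> borel_measurable borel"
    unfolding eq using m1 v has_weak_gradientD(1)[OF g] by measurable
  {
    fix K assume K: "compact K" "K \<subseteq> S"
    show "set_integrable lborel K (\<lambda>x. \<phi> x * v x)"
      using set_integrable_mult_continuous[OF K(1) has_weak_gradientD(2)[OF g K], of \<phi>] c\<phi> K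
      by (auto intro: continuous_on_subset)
    have "set_integrable lborel K (\<lambda>x. \<phi> x *\<^sub>R g x)"
      using set_integrable_mult_continuous[OF K(1) has_weak_gradientD(3)[OF g K], of \<phi>] c\<phi> K
      by (auto intro: continuous_on_subset)
    moreover have "set_integrable lborel K (\<lambda>x. v x *\<^sub>R grad \<phi> x)"
    proof -
      have "integrable lborel (\<lambda>x. \<Sum>i\<in>UNIV. (indicator K x *\<^sub>R (v x * partial_deriv i \<phi> x)) *\<^sub>R axis i (1::real))"
        using set_integrable_mult_continuous_real[OF K(1) has_weak_gradientD(2)[OF g K] continuous_on_subset[OF cp K(2)]]
        by (intro Bochner_Integration.integrable_sum integrable_scaleR_left) (simp add: set_integrable_def)
      moreover have "(\<Sum>i\<in>UNIV. (indicator K x *\<^sub>R (v x * partial_deriv i \<phi> x)) *\<^sub>R axis i (1::real)) = indicator K x *\<^sub>R v x *\<^sub>R grad \<phi> x" for x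
        by (simp add: vec_eq_iff grad_def axis_def if_distrib cong: if_cong)
      ultimately show ?thesis by (simp add: set_integrable_def)
    qed
    ultimately have "set_integrable lborel K (\<lambda>x. \<phi> x *\<^sub>R g x + v x *\<^sub>R grad \<phi> x)" by (rule set_integral_add)
    moreover have "indicator K x *\<^sub>R indicator S x *\<^sub>R (\<phi> x *\<^sub>R g x + v x *\<^sub>R grad \<phi> x) = indicator K x *\<^sub>R (\<phi> x *\<^sub>R g x + v x *\<^sub>R grad \<phi> x)" for x
      using K by (auto simp: indicator_def)
    ultimately show "set_integrable lborel K (\<lambda>x. indicator S x *\<^sub>R (\<phi> x *\<^sub>R g x + v x *\<^sub>R grad \<phi> x))"
      unfolding set_integrable_def by (simp only:)
  }
  fix \<psi> i assume \<psi>: "\<psi> \<in> test_functions S"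
  obtain K where K: "compact K" "K \<subseteq> S" "\<And>x. x \<notin> K \<Longrightarrow> \<psi> x = 0" "\<And>x i. x \<notin> K \<Longrightarrow> partial_deriv i \<psi> x = 0"
    by (rule test_function_support[OF \<psi>]) blast
  let ?f = "\<lambda>x. if x \<in> S then \<phi> x * \<psi> x else 0"
  have ft: "?f \<in> test_functions S" by (rule test_function_mult[OF S \<phi> \<psi>])
  have psS: "Ck_on 1 S \<psi>" using smooth_onD[OF test_function_smooth[OF \<psi>], of 1] Ck_on_subset by blast
  have pd: "partial_deriv i ?f x = partial_deriv i \<phi> x * \<psi> x + \<phi> x * partial_deriv i \<psi> x" if x: "x \<in> S" for x
  proof -
    have "partial_deriv i ?f x = partial_deriv i (\<lambda>x. \<phi> x * \<psi> x) x"
      by (rule partial_deriv_cong_open[OF S x]) simp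
    also have "\<dots> = partial_deriv i \<phi> x * \<psi> x + \<phi> x * partial_deriv i \<psi> x"
      by (intro partial_deriv_mult d\<phi> x Ck1_D(1)[OF S psS x])
    finally show ?thesis .
  qed
  have vK: "set_integrable lborel K v" and gK: "set_integrable lborel K (\<lambda>x. g x $ i)"
    by (rule has_weak_gradientD(2)[OF g K(1,2)], rule set_integrable_vec_nth[OF has_weak_gradientD(3)[OF g K(1,2)]])
  have cK: "continuous_on K \<phi>" "continuous_on K (partial_deriv i \<phi>)"
    by (rule continuous_on_subset[OF c\<phi>(1) K(2)], rule continuous_on_subset[OF cp K(2)])
  have i1: "set_integrable lborel K (\<lambda>x. v x * (\<phi> x * partial_deriv i \<psi> x))"
   and i2: "set_integrable lborel K (\<lambda>x. v x * (partial_deriv i \<phi> x * \<psi> x))"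
   and i3: "set_integrable lborel K (\<lambda>x. g x $ i * (\<phi> x * \<psi> x))"
    by (intro set_integrable_mult_continuous_real K vK gK continuous_intros cK test_function_continuous[OF \<psi>])+
  have "(LINT x:S|lborel. v x * partial_deriv i ?f x) = (LINT x:K|lborel. v x * (\<phi> x * partial_deriv i \<psi> x)) + (LINT x:K|lborel. v x * (partial_deriv i \<phi> x * \<psi> x))"
  proof -
    have "indicator S x *\<^sub>R (v x * partial_deriv i ?f x) = indicator K x *\<^sub>R (v x * (\<phi> x * partial_deriv i \<psi> x) + v x * (partial_deriv i \<phi> x * \<psi> x))" for x
      using K pd[of x] by (auto simp: indicator_def algebra_simps)
    hence "(LINT x:S|lborel. v x * partial_deriv i ?f x) = (LINT x:K|lborel. v x * (\<phi> x * partial_deriv i \<psi> x) + v x * (partial_deriv i \<phi> x * \<psi> x))"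
      by (simp add: set_lebesgue_integral_def)
    thus ?thesis using set_integral_add(2)[OF i1 i2] by simp
  qed
  moreover have "(LINT x:S|lborel. v x * partial_deriv i ?f x) = - (LINT x:S|lborel. (g x $ i) * ?f x)"
    by (rule has_weak_gradientD(4)[OF g ft])
  moreover have "(LINT x:S|lborel. (g x $ i) * ?f x) = (LINT x:K|lborel. g x $ i * (\<phi> x * \<psi> x))"
    unfolding set_lebesgue_integral_def by (rule Bochner_Integration.integral_cong) (use K in \<open>auto simp: indicator_def\<close>)
  moreover have "(LINT x:S|lborel. \<phi> x * v x * partial_deriv i \<psi> x) = (LINT x:K|lborel. v x * (\<phi> x * partial_deriv i \<psi> x))"
    unfolding set_lebesgue_integral_def by (rule Bochner_Integration.integral_cong) (use K in \<open>auto simp: indicator_def\<close>)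
  moreover have "(LINT x:S|lborel. ((indicator S x *\<^sub>R (\<phi> x *\<^sub>R g x + v x *\<^sub>R grad \<phi> x)) $ i) * \<psi> x) = 
      (LINT x:K|lborel. g x $ i * (\<phi> x * \<psi> x) + v x * (partial_deriv i \<phi> x * \<psi> x))"
    unfolding set_lebesgue_integral_def by (rule Bochner_Integration.integral_cong) (use K in \<open>auto simp: indicator_def grad_def algebra_simps\<close>)
  moreover have "\<dots> = (LINT x:K|lborel. g x $ i * (\<phi> x * \<psi> x)) + (LINT x:K|lborel. v x * (partial_deriv i \<phi> x * \<psi> x))"
    by (rule set_integral_add(2)[OF i3 i2])
  ultimately show "(LINT x:S|lborel. \<phi> x * v x * partial_deriv i \<psi> x) = - (LINT x:S|lborel. ((indicator S x *\<^sub>R (\<phi> x *\<^sub>R g x + v x *\<^sub>R grad \<phi> x)) $ i) * \<psi> x)"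
    by simp
qed

lemma weak_gradient_works: "has_weak_gradient_on v g S \<Longrightarrow> has_weak_gradient_on v (weak_gradient S v) S"
  unfolding weak_gradient_def by (rule someI[of "\<lambda>g. has_weak_gradient_on v g S"])

lemma weak_gradient_AE:
  "open S \<Longrightarrow> has_weak_gradient_on v g S \<Longrightarrow> AE x in lborel. x \<in> S \<longrightarrow> weak_gradient S v x = g x"
  by (rule weak_gradient_unique[OF _ weak_gradient_works])

section \<open>Polar coordinates and surface measure\<close>

lemma sgn_measurable [measurable]: "(sgn :: real^'n::finite \<Rightarrow> _) \<in> borel_measurable borel"
  unfolding sgn_div_norm[abs_def] by measurable

lemma nn_integral_lborel_scale:
  fixes f :: "'a::euclidean_space \<Rightarrow> ennreal"
  assumes [measurable]: "f \<in> borel_measurable borel" and c: "c \<noteq> 0"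
  shows "(\<integral>\<^sup>+x. f x \<partial>lborel) = ennreal (\<bar>c\<bar> ^ DIM('a)) * (\<integral>\<^sup>+x. f (c *\<^sub>R x) \<partial>lborel)"
proof -
  have "(\<integral>\<^sup>+x. f x \<partial>lborel) = (\<integral>\<^sup>+x. f x \<partial>density (distr lborel borel (\<lambda>x. 0 + c *\<^sub>R x)) (\<lambda>_. ennreal (\<bar>c\<bar> ^ DIM('a))))"
    using lborel_affine[OF c, of "0::'a"] by (simp add: ennreal_power)
  also have "\<dots> = ennreal (\<bar>c\<bar> ^ DIM('a)) * (\<integral>\<^sup>+x. f (c *\<^sub>R x) \<partial>lborel)"
    by (subst nn_integral_density) (auto simp: nn_integral_distr nn_integral_cmult)
  finally show ?thesis .
qed

lemma scaleR_sgn: "(norm y * t) *\<^sub>R sgn y = t *\<^sub>R (y :: 'a::real_normed_vector)"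
  by (cases "y = 0") (auto simp: sgn_div_norm)

lemma nn_integral_inverse_power:
  assumes c: "c > 0" and N: "N > 0"
  shows "(\<integral>\<^sup>+t. ennreal (real N * inverse t ^ (N+1)) * indicator {c<..} t \<partial>lborel) = ennreal (inverse c ^ N)"
proof -
  have "AE t in lborel. t \<noteq> c" by (rule AE_lborel_singleton)
  hence "(\<integral>\<^sup>+t. ennreal (real N * inverse t ^ (N+1)) * indicator {c<..} t \<partial>lborel) = 
     (\<integral>\<^sup>+t. ennreal (real N * inverse t ^ (N+1)) * indicator {c..} t \<partial>lborel)"
    by (intro nn_integral_cong_AE) (auto elim!: eventually_mono simp: indicator_def)
  also have "\<dots> = ennreal (0 - (- (inverse c ^ N)))"
  proof (rule nn_integral_FTC_atLeast)
    fix x assume "c \<le> x"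
    hence x: "x > 0" using c by simp
    obtain k where k: "N = Suc k" using N by (cases N) auto
    show "((\<lambda>t. - (inverse t ^ N)) has_real_derivative real N * inverse x ^ (N+1)) (at x)"
    proof -
      have "((\<lambda>t. inverse t ^ Suc k) has_real_derivative (1 + of_nat k) * (- (inverse x ^ Suc (Suc 0)) * inverse x ^ k)) (at x)"
        by (rule DERIV_power_Suc[OF DERIV_inverse]) (use x in auto)
      from DERIV_minus[OF this] show ?thesis by (simp add: k algebra_simps)
    qed
    show "0 \<le> real N * inverse x ^ (N+1)" using x by simp
  next
    have "((\<lambda>t. - (inverse t ^ N)) \<longlongrightarrow> - (0 ^ N)) (at_top :: real filter)"
      by (intro tendsto_intros tendsto_inverse_0_at_top filterlim_ident)
    moreover have "- ((0::real) ^ N) = 0" using N by simp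
    ultimately show "((\<lambda>t. - (inverse t ^ N)) \<longlongrightarrow> 0) (at_top :: real filter)" by (simp only:)
  qed measurable
  finally show ?thesis by simp
qed

text \<open>
Directions are sampled by points \<open>y\<close> of the unit ball, each representing the ray through \<open>sgn y\<close>. Substitute
\<open>r = |y| t\<close> on every ray, exchange the integrals, and substitute \<open>x = t y\<close>. The remaining
integral over \<open>t > |x|\<close> of \<open>N t powr (- N - 1)\<close> equals \<open>|x| powr (- N)\<close> and cancels the Jacobian. This form matches
the description of the surface measure by cone volumes.
\<close>

lemma polar_nn_integral:
  fixes F :: "real^'n::finite \<Rightarrow> ennreal"
  assumes F [measurable]: "F \<in> borel_measurable borel"
  shows "(\<integral>\<^sup>+r. (\<integral>\<^sup>+y. ennreal (real CARD('n) * r ^ (CARD('n) - 1)) * indicator {0<..} r * indicator (ball 0 1) y * F (r *\<^sub>R sgn y) \<partial>lborel) \<partial>lborel)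
     = (\<integral>\<^sup>+x. F x \<partial>lborel)"
proof -
  let ?N = "CARD('n)"
  obtain k where k: "?N = Suc k" by (metis Suc_pred zero_less_card_finite)
  let ?G = "\<lambda>r (y::real^'n). ennreal (real ?N * r ^ (?N - 1)) * indicator {0<..} r * indicator (ball 0 1) y * F (r *\<^sub>R sgn y)"
  let ?K = "\<lambda>t (y::real^'n). ennreal (real ?N * t ^ (?N - 1) * norm y ^ ?N) * indicator {0<..} t * indicator (ball 0 1) y * F (t *\<^sub>R y)"
  let ?L = "\<lambda>t (x::real^'n). ennreal (real ?N * inverse t ^ (?N + 1)) * indicator {norm x<..} t * (ennreal (norm x ^ ?N) * F x)"
  have [measurable]: "ball (0::real^'n) 1 \<in> sets borel" by simp
  have [measurable]: "(\<lambda>x. F (fst x *\<^sub>R sgn (snd x))) \<in> borel_measurable (lborel \<Otimes>\<^sub>M lborel)"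
    by (rule measurable_compose[OF _ F]) measurable
  have [measurable]: "(\<lambda>x. F (snd x *\<^sub>R sgn (fst x))) \<in> borel_measurable (lborel \<Otimes>\<^sub>M lborel)"
    by (rule measurable_compose[OF _ F]) measurable
  have "(\<integral>\<^sup>+r. (\<integral>\<^sup>+y. ?G r y \<partial>lborel) \<partial>lborel) = (\<integral>\<^sup>+y. (\<integral>\<^sup>+r. ?G r y \<partial>lborel) \<partial>lborel)"
    by (rule lborel_pair.Fubini'[symmetric]) measurable
  also have "\<dots> = (\<integral>\<^sup>+y. (\<integral>\<^sup>+t. ?K t y \<partial>lborel) \<partial>lborel)"
  proof (rule nn_integral_cong_AE)
    have "AE y in lborel. y \<noteq> (0::real^'n)" by (rule AE_lborel_singleton)
    thus "AE y in lborel. (\<integral>\<^sup>+r. ?G r y \<partial>lborel) = (\<integral>\<^sup>+t. ?K t y \<partial>lborel)"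
    proof eventually_elim
      fix y :: "real^'n" assume y: "y \<noteq> 0"
      have [measurable]: "(\<lambda>t. F (t *\<^sub>R sgn y)) \<in> borel_measurable borel"
        by (rule measurable_compose[OF _ F]) measurable
      have [measurable]: "(\<lambda>t. F ((0 + norm y * t) *\<^sub>R sgn y)) \<in> borel_measurable borel"
        by (rule measurable_compose[OF _ F]) measurable
      have "(\<integral>\<^sup>+r. ?G r y \<partial>lborel) = ennreal \<bar>norm y\<bar> * (\<integral>\<^sup>+t. ?G (0 + norm y * t) y \<partial>lborel)"
        by (rule nn_integral_real_affine) (use y in \<open>measurable, auto\<close>)
      also have "\<dots> = (\<integral>\<^sup>+t. ennreal \<bar>norm y\<bar> * ?G (0 + norm y * t) y \<partial>lborel)"
        by (rule nn_integral_cmult[symmetric]) measurable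
      also have "\<dots> = (\<integral>\<^sup>+t. ?K t y \<partial>lborel)"
      proof (rule nn_integral_cong)
        fix t :: real
        show "ennreal \<bar>norm y\<bar> * ?G (0 + norm y * t) y = ?K t y"
        proof (cases "t > 0")
          case True
          have "ennreal \<bar>norm y\<bar> * ennreal (real ?N * (norm y * t) ^ (?N - 1)) = ennreal (real ?N * t ^ (?N - 1) * norm y ^ ?N)"
            using True by (simp add: k power_mult_distrib ennreal_mult[symmetric] mult_ac)
          thus ?thesis using True y by (simp add: scaleR_sgn mult.assoc[symmetric])
        next
          case False
          hence "\<not> norm y * t > 0" using y by (simp add: zero_less_mult_iff)
          thus ?thesis using False by simp
        qed
      qed
      finally show "(\<integral>\<^sup>+r. ?G r y \<partial>lborel) = (\<integral>\<^sup>+t. ?K t y \<partial>lborel)" .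
    qed
  qed
  also have "\<dots> = (\<integral>\<^sup>+t. (\<integral>\<^sup>+y. ?K t y \<partial>lborel) \<partial>lborel)"
    by (rule lborel_pair.Fubini') measurable
  also have "\<dots> = (\<integral>\<^sup>+t. (\<integral>\<^sup>+x. ?L t x \<partial>lborel) \<partial>lborel)"
  proof (rule nn_integral_cong)
    fix t :: real
    show "(\<integral>\<^sup>+y. ?K t y \<partial>lborel) = (\<integral>\<^sup>+x. ?L t x \<partial>lborel)"
    proof (cases "t > 0")
      case True
      have [measurable]: "(\<lambda>x. F (t *\<^sub>R x)) \<in> borel_measurable borel"
        by (rule measurable_compose[OF _ F]) measurable
      have [measurable]: "(\<lambda>x. F (t *\<^sub>R inverse t *\<^sub>R x)) \<in> borel_measurable borel"
        by (rule measurable_compose[OF _ F]) measurable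
      have "(\<integral>\<^sup>+y. ?K t y \<partial>lborel) = ennreal (\<bar>inverse t\<bar> ^ DIM(real^'n)) * (\<integral>\<^sup>+x. ?K t (inverse t *\<^sub>R x) \<partial>lborel)"
        by (rule nn_integral_lborel_scale) (use True in \<open>measurable, auto\<close>)
      also have "\<dots> = (\<integral>\<^sup>+x. ennreal (inverse t ^ ?N) * ?K t (inverse t *\<^sub>R x) \<partial>lborel)"
      proof -
        have e: "\<bar>inverse t\<bar> ^ DIM(real^'n) = inverse t ^ ?N" using True by simp
        show ?thesis unfolding e by (rule nn_integral_cmult[symmetric]) measurable
      qed
      also have "\<dots> = (\<integral>\<^sup>+x. ?L t x \<partial>lborel)"
      proof (rule nn_integral_cong)
        fix x :: "real^'n"
        have "inverse t ^ ?N * (real ?N * t ^ (?N - 1) * norm (inverse t *\<^sub>R x) ^ ?N) = real ?N * inverse t ^ (?N + 1) * norm x ^ ?N"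
          using True by (simp add: k power_mult_distrib power_inverse field_simps)
        hence "ennreal (inverse t ^ ?N) * ennreal (real ?N * t ^ (?N - 1) * norm (inverse t *\<^sub>R x) ^ ?N) = 
            ennreal (real ?N * inverse t ^ (?N + 1)) * ennreal (norm x ^ ?N)"
          using True by (simp add: ennreal_mult[symmetric])
        moreover have "indicator (ball 0 1) (inverse t *\<^sub>R x) = (indicator {norm x<..} t :: ennreal)"
          using True by (auto simp: indicator_def dist_norm divide_inverse[symmetric] mult.commute field_simps)
        ultimately show "ennreal (inverse t ^ ?N) * ?K t (inverse t *\<^sub>R x) = ?L t x"
          using True by (simp add: mult_ac)
      qed
      finally show ?thesis .
    next
      case False
      hence "?L t x = 0" "?K t x = 0" for x
        by (auto simp: indicator_def) (metis norm_ge_zero order_le_less_trans)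
      thus ?thesis by (simp only:)
    qed
  qed
  also have "\<dots> = (\<integral>\<^sup>+x. (\<integral>\<^sup>+t. ?L t x \<partial>lborel) \<partial>lborel)"
  proof (rule lborel_pair.Fubini'[symmetric])
    have [measurable]: "Measurable.pred (borel \<Otimes>\<^sub>M borel) (\<lambda>x::real \<times> (real^'n). fst x \<in> {norm (snd x)<..})"
      unfolding greaterThan_iff by measurable
    have [measurable]: "(\<lambda>x::real \<times> (real^'n). F (snd x)) \<in> borel_measurable (lborel \<Otimes>\<^sub>M lborel)"
      by (rule measurable_compose[OF _ F]) measurable
    show "case_prod ?L \<in> borel_measurable (lborel \<Otimes>\<^sub>M lborel)" by measurable
  qed
  also have "\<dots> = (\<integral>\<^sup>+x. F x \<partial>lborel)"
  proof (rule nn_integral_cong_AE)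
    have "AE y in lborel. y \<noteq> (0::real^'n)" by (rule AE_lborel_singleton)
    thus "AE x in lborel. (\<integral>\<^sup>+t. ?L t x \<partial>lborel) = F x"
    proof eventually_elim
      fix x :: "real^'n" assume x: "x \<noteq> 0"
      have "(\<integral>\<^sup>+t. ?L t x \<partial>lborel) = (\<integral>\<^sup>+t. ennreal (real ?N * inverse t ^ (?N + 1)) * indicator {norm x<..} t \<partial>lborel) * (ennreal (norm x ^ ?N) * F x)"
        by (rule nn_integral_multc) measurable
      also have "(\<integral>\<^sup>+t. ennreal (real ?N * inverse t ^ (?N + 1)) * indicator {norm x<..} t \<partial>lborel) = ennreal (inverse (norm x) ^ ?N)"
        by (rule nn_integral_inverse_power) (use x in auto)
      also have "ennreal (inverse (norm x) ^ ?N) * (ennreal (norm x ^ ?N) * F x) = F x"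
        using x by (simp add: mult.assoc[symmetric] ennreal_mult[symmetric] power_inverse)
      finally show "(\<integral>\<^sup>+t. ?L t x \<partial>lborel) = F x" .
    qed
  qed
  finally show ?thesis .
qed

definition polar_weight :: "real \<times> (real^'n::finite) \<Rightarrow> real" where
  "polar_weight z = real CARD('n) * fst z ^ (CARD('n) - 1) * indicator {0<..} (fst z) * indicator (ball 0 1) (snd z)"

lemma polar_weight_measurable [measurable]:
  "(polar_weight :: real \<times> (real^'n::finite) \<Rightarrow> real) \<in> borel_measurable (lborel \<Otimes>\<^sub>M lborel)"
proof -
  have [measurable]: "ball (0::real^'n) 1 \<in> sets borel" by simp
  show ?thesis unfolding polar_weight_def[abs_def] by measurable
qed

lemma polar_weight_nonneg: "0 \<le> polar_weight z"
  by (auto simp: polar_weight_def indicator_def)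

text \<open>
The same formula as an equality of measures, from which it extends to signed integrands.
\<close>

lemma lborel_polar:
  "lborel = distr (density (lborel \<Otimes>\<^sub>M lborel) polar_weight) borel (\<lambda>z. fst z *\<^sub>R sgn (snd z :: real^'n::finite))"
proof (rule measure_eqI)
  fix A :: "(real^'n) set" assume A: "A \<in> sets lborel"
  have [measurable]: "A \<in> sets borel" using A by simp
  let ?T = "\<lambda>z. fst z *\<^sub>R sgn (snd z :: real^'n)"
  have T [measurable]: "?T \<in> borel_measurable (lborel \<Otimes>\<^sub>M lborel)" by measurable
  have "emeasure (distr (density (lborel \<Otimes>\<^sub>M lborel) polar_weight) borel ?T) A 
     = (\<integral>\<^sup>+x. indicator A x \<partial>(distr (density (lborel \<Otimes>\<^sub>M lborel) polar_weight) borel ?T))"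
    by (subst nn_integral_indicator) auto
  also have "\<dots> = (\<integral>\<^sup>+z. indicator A (?T z) \<partial>(density (lborel \<Otimes>\<^sub>M lborel) polar_weight))"
    by (rule nn_integral_distr) measurable
  also have "\<dots> = (\<integral>\<^sup>+z. ennreal (polar_weight z) * indicator A (?T z) \<partial>(lborel \<Otimes>\<^sub>M lborel))"
    by (rule nn_integral_density) measurable
  also have "\<dots> = (\<integral>\<^sup>+r. \<integral>\<^sup>+y. ennreal (polar_weight (r, y)) * indicator A (?T (r, y)) \<partial>lborel \<partial>lborel)"
    by (rule lborel.nn_integral_fst[symmetric]) measurable
  also have "\<dots> = (\<integral>\<^sup>+r. (\<integral>\<^sup>+y. ennreal (real CARD('n) * r ^ (CARD('n) - 1)) * indicator {0<..} r * indicator (ball 0 1) y * indicator A (r *\<^sub>R sgn y) \<partial>lborel) \<partial>lborel)"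
    by (intro nn_integral_cong) (auto simp: polar_weight_def indicator_def)
  also have "\<dots> = (\<integral>\<^sup>+x. indicator A x \<partial>lborel)" by (rule polar_nn_integral) measurable
  finally show "emeasure lborel A = emeasure (distr (density (lborel \<Otimes>\<^sub>M lborel) polar_weight) borel ?T) A"
    using A by simp
qed simp

lemma polar_integral:
  fixes H :: "real^'n::finite \<Rightarrow> real"
  assumes H: "integrable lborel H"
  shows "(\<integral>x. H x \<partial>lborel) = (\<integral>y. (\<integral>r. polar_weight (r, y) * H (r *\<^sub>R sgn y) \<partial>lborel) \<partial>lborel)"
    "integrable lborel (\<lambda>y. \<integral>r. polar_weight (r, y) * H (r *\<^sub>R sgn y) \<partial>lborel)"
proof -
  let ?T = "\<lambda>z. fst z *\<^sub>R sgn (snd z :: real^'n)"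
  have [measurable]: "H \<in> borel_measurable borel" using H by auto
  have T [measurable]: "?T \<in> borel_measurable (lborel \<Otimes>\<^sub>M lborel)" by measurable
  have "integrable (distr (density (lborel \<Otimes>\<^sub>M lborel) polar_weight) borel ?T) H"
    using H lborel_polar by metis
  hence "integrable (density (lborel \<Otimes>\<^sub>M lborel) polar_weight) (\<lambda>z. H (?T z))"
    by (subst (asm) integrable_distr_eq) auto
  hence i: "integrable (lborel \<Otimes>\<^sub>M lborel) (\<lambda>z. polar_weight z *\<^sub>R H (?T z))"
    by (subst (asm) integrable_density) (auto simp: polar_weight_nonneg)
  have "(\<integral>x. H x \<partial>lborel) = (\<integral>x. H x \<partial>distr (density (lborel \<Otimes>\<^sub>M lborel) polar_weight) borel ?T)"
    using lborel_polar by metis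
  also have "\<dots> = (\<integral>z. H (?T z) \<partial>density (lborel \<Otimes>\<^sub>M lborel) polar_weight)"
    by (rule integral_distr) auto
  also have "\<dots> = (\<integral>z. polar_weight z *\<^sub>R H (?T z) \<partial>(lborel \<Otimes>\<^sub>M lborel))"
    by (rule integral_density) (auto simp: polar_weight_nonneg)
  finally have e: "(\<integral>x. H x \<partial>lborel) = (\<integral>z. polar_weight z *\<^sub>R H (?T z) \<partial>(lborel \<Otimes>\<^sub>M lborel))" .
  have i': "integrable (lborel \<Otimes>\<^sub>M lborel) (case_prod (\<lambda>r y. polar_weight (r, y) * H (r *\<^sub>R sgn y)))"
    using i by (simp add: case_prod_unfold)
  show "(\<integral>x. H x \<partial>lborel) = (\<integral>y. (\<integral>r. polar_weight (r, y) * H (r *\<^sub>R sgn y) \<partial>lborel) \<partial>lborel)"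
    unfolding e lborel_pair.integral_snd[OF i'] by (simp add: case_prod_unfold)
  show "integrable lborel (\<lambda>y. \<integral>r. polar_weight (r, y) * H (r *\<^sub>R sgn y) \<partial>lborel)"
    by (rule lborel_pair.integrable_snd[OF i'])
qed

lemma scale_measure_density: "scale_measure c M = density M (\<lambda>_. c)"
  by (rule measure_eqI) (auto simp: emeasure_density_const)

lemma space_sphere_measure [simp]: "space (sphere_measure r) = sphere 0 r"
  by (simp add: sphere_measure_def space_scale_measure space_restrict_space)

lemma sets_sphere_measure [measurable_cong]: "sets (sphere_measure r) = sets (restrict_space borel (sphere 0 r))"
  by (simp add: sphere_measure_def)

lemma continuous_on_sphere_measurable:
  fixes f :: "real^'n::finite \<Rightarrow> real"
  assumes "continuous_on (sphere 0 r) f" shows "f \<in> borel_measurable (sphere_measure r)"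
  using borel_measurable_continuous_on_restrict[OF assms] 
  by (simp cong: measurable_cong_sets add: sets_sphere_measure measurable_cong_sets[OF sets_sphere_measure refl])

context
  fixes r :: real
  assumes r: "r > 0"
begin

lemma sphere_proj_measurable:
  "(\<lambda>x::real^'n::finite. (r / norm x) *\<^sub>R x) \<in> measurable (restrict_space lborel (ball 0 r - {0})) (restrict_space borel (sphere 0 r))"
proof (rule measurable_restrict_space2)
  show "(\<lambda>x::real^'n. (r / norm x) *\<^sub>R x) \<in> space (restrict_space lborel (ball 0 r - {0})) \<rightarrow> sphere 0 r"
    using r by (auto simp: space_restrict_space)
  show "(\<lambda>x::real^'n. (r / norm x) *\<^sub>R x) \<in> borel_measurable (restrict_space lborel (ball 0 r - {0}))"
    by (intro measurable_restrict_space1) measurable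
qed

lemma sphere_integral:
  fixes h :: "real^'n::finite \<Rightarrow> real"
  assumes h: "h \<in> borel_measurable (sphere_measure r)"
  shows "(LINT x|sphere_measure r. h x) = real CARD('n) / r * (LINT y:ball 0 r|lborel. h (r *\<^sub>R sgn y))"
    "integrable (sphere_measure r) h \<longleftrightarrow> set_integrable lborel (ball 0 r) (\<lambda>y. h (r *\<^sub>R sgn y))"
proof -
  have h': "h \<in> borel_measurable (restrict_space borel (sphere 0 r))"
    using h by (simp add: measurable_cong_sets[OF sets_sphere_measure refl])
  let ?R = "restrict_space lborel (ball 0 r - {0::real^'n})"
  let ?P = "\<lambda>x::real^'n. (r / norm x) *\<^sub>R x"
  have c: "0 < real CARD('n) / r" using r by simp
  have P: "?P y = r *\<^sub>R sgn y" for y by (simp add: sgn_div_norm divide_inverse)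
  have Sg: "ball 0 r - {0::real^'n} \<inter> space lborel \<in> sets lborel" "(ball 0 r - {0::real^'n}) \<inter> space lborel \<in> sets lborel" by auto
  have mP: "(\<lambda>x. h (?P x)) \<in> borel_measurable ?R"
    using measurable_compose[OF sphere_proj_measurable h'] .
  have ae: "AE y in lborel. y \<noteq> (0::real^'n)" by (rule AE_lborel_singleton)
  have m1: "(\<lambda>y. indicator (ball 0 r - {0}) y *\<^sub>R h (r *\<^sub>R sgn y)) \<in> borel_measurable lborel"
    using mP unfolding P by (subst (asm) borel_measurable_restrict_space_iff) (auto simp: mult.commute)
  have "(\<lambda>y. indicator (ball 0 r) y *\<^sub>R h (r *\<^sub>R sgn y)) = (\<lambda>y. indicator (ball 0 r - {0}) y *\<^sub>R h (r *\<^sub>R sgn y) + indicator {0} y * h 0)"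
    using r by (auto simp: fun_eq_iff indicator_def)
  hence m2: "(\<lambda>y. indicator (ball 0 r) y *\<^sub>R h (r *\<^sub>R sgn y)) \<in> borel_measurable lborel"
    using m1 by simp
  have ae2: "AE y in lborel. indicator (ball 0 r - {0}) y *\<^sub>R h (r *\<^sub>R sgn y) = indicator (ball 0 r) y *\<^sub>R h (r *\<^sub>R sgn y)"
    using ae by eventually_elim (auto simp: indicator_def)
  have "(LINT x|sphere_measure r. h x) = (LINT x|distr ?R (restrict_space borel (sphere 0 r)) ?P. (real CARD('n) / r) *\<^sub>R h x)"
    unfolding sphere_measure_def scale_measure_density using h' c
    by (subst integral_density) auto
  also have "\<dots> = (LINT x|?R. (real CARD('n) / r) *\<^sub>R h (?P x))"
    by (rule integral_distr[OF sphere_proj_measurable]) (use h' in simp)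
  also have "\<dots> = (real CARD('n) / r) * (LINT x|?R. h (r *\<^sub>R sgn x))"
    by (simp add: P)
  also have "(LINT x|?R. h (r *\<^sub>R sgn x)) = (LINT y|lborel. indicator (ball 0 r - {0}) y *\<^sub>R h (r *\<^sub>R sgn y))"
    by (rule integral_restrict_space) auto
  also have "\<dots> = (LINT y:ball 0 r|lborel. h (r *\<^sub>R sgn y))"
    unfolding set_lebesgue_integral_def by (rule integral_cong_AE[OF m1 m2 ae2])
  finally show "(LINT x|sphere_measure r. h x) = real CARD('n) / r * (LINT y:ball 0 r|lborel. h (r *\<^sub>R sgn y))" .
  have "integrable (sphere_measure r) h \<longleftrightarrow> integrable (distr ?R (restrict_space borel (sphere 0 r)) ?P) (\<lambda>x. (real CARD('n) / r) *\<^sub>R h x)"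
    unfolding sphere_measure_def scale_measure_density using h' c
    by (subst integrable_density) auto
  also have "\<dots> \<longleftrightarrow> integrable (distr ?R (restrict_space borel (sphere 0 r)) ?P) h"
  proof
    define d where "d = real CARD('n) / r"
    assume "integrable (distr ?R (restrict_space borel (sphere 0 r)) ?P) (\<lambda>x. (real CARD('n) / r) *\<^sub>R h x)"
    hence "integrable (distr ?R (restrict_space borel (sphere 0 r)) ?P) (\<lambda>x. d *\<^sub>R h x)" by (simp only: d_def)
    from integrable_scaleR_right[of "inverse d", OF this]
    show "integrable (distr ?R (restrict_space borel (sphere 0 r)) ?P) h" using c by (simp add: d_def[symmetric])
  qed (rule integrable_scaleR_right)
  also have "\<dots> \<longleftrightarrow> integrable ?R (\<lambda>x. h (?P x))"
    by (rule integrable_distr_eq[OF sphere_proj_measurable]) (use h' in simp)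
  also have "\<dots> \<longleftrightarrow> integrable lborel (\<lambda>y. indicator (ball 0 r - {0}) y *\<^sub>R h (r *\<^sub>R sgn y))"
    unfolding P by (rule integrable_restrict_space) auto
  also have "\<dots> \<longleftrightarrow> set_integrable lborel (ball 0 r) (\<lambda>y. h (r *\<^sub>R sgn y))"
    unfolding set_integrable_def by (rule integrable_cong_AE[OF m1 m2 ae2])
  finally show "integrable (sphere_measure r) h \<longleftrightarrow> set_integrable lborel (ball 0 r) (\<lambda>y. h (r *\<^sub>R sgn y))" .
qed

text \<open>
Scaling the ball of radius \<open>r\<close> to the unit ball shows the factor \<open>r ^ (N - 1)\<close> of the surface measure.
\<close>

lemma sphere_integral_unit:
  fixes h :: "real^'n::finite \<Rightarrow> real"
  assumes h: "h \<in> borel_measurable (sphere_measure r)"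
  shows "(LINT x|sphere_measure r. h x) = r ^ (CARD('n) - 1) * (real CARD('n) * (LINT y:ball 0 1|lborel. h (r *\<^sub>R sgn y)))"
proof -
  let ?f = "\<lambda>y::real^'n. indicator (ball 0 r) y *\<^sub>R h (r *\<^sub>R sgn y)"
  have sgn_r: "sgn (r *\<^sub>R y) = sgn (y::real^'n)" for y using r by (simp add: sgn_scaleR)
  have "integral\<^sup>L lborel ?f = integral\<^sup>L (density (distr lborel borel (\<lambda>x. 0 + r *\<^sub>R x)) (\<lambda>_. ennreal (r ^ CARD('n)))) ?f"
    using lborel_affine[of r "0::real^'n"] r by (simp add: ennreal_power)
  also have "\<dots> = r ^ CARD('n) * (LINT y:ball 0 1|lborel. h (r *\<^sub>R sgn y))"
  proof (cases "?f \<in> borel_measurable borel")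
    case True
    have "integral\<^sup>L (density (distr lborel borel (\<lambda>x. 0 + r *\<^sub>R x)) (\<lambda>_. ennreal (r ^ CARD('n)))) ?f = 
        integral\<^sup>L (distr lborel borel (\<lambda>x. 0 + r *\<^sub>R x)) (\<lambda>x. r ^ CARD('n) *\<^sub>R ?f x)"
      by (rule integral_density) (use True r in auto)
    also have "\<dots> = integral\<^sup>L lborel (\<lambda>x. r ^ CARD('n) *\<^sub>R ?f (0 + r *\<^sub>R x))"
      by (rule integral_distr) (use True in auto)
    also have "\<dots> = r ^ CARD('n) * integral\<^sup>L lborel (\<lambda>x. ?f (r *\<^sub>R x))" by simp
    also have "(\<lambda>x. ?f (r *\<^sub>R x)) = (\<lambda>x. indicator (ball 0 1) x *\<^sub>R h (r *\<^sub>R sgn x))"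
      using r by (auto simp: fun_eq_iff indicator_def sgn_r)
    finally show ?thesis by (simp add: set_lebesgue_integral_def)
  next
    case False
    have "set_integrable lborel (ball 0 r) (\<lambda>y. h (r *\<^sub>R sgn y)) \<Longrightarrow> ?f \<in> borel_measurable borel"
      by (auto simp: set_integrable_def)
    moreover have "?f \<in> borel_measurable borel"
    proof -
      have h': "h \<in> borel_measurable (restrict_space borel (sphere 0 r))"
        using h by (simp add: measurable_cong_sets[OF sets_sphere_measure refl])
      have mP: "(\<lambda>x. h ((r / norm x) *\<^sub>R x)) \<in> borel_measurable (restrict_space lborel (ball 0 r - {0::real^'n}))"
        using measurable_compose[OF sphere_proj_measurable h'] .
      have P: "(r / norm y) *\<^sub>R y = r *\<^sub>R sgn y" for y :: "real^'n" by (simp add: sgn_div_norm divide_inverse)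
      have m1: "(\<lambda>y. indicator (ball 0 r - {0}) y *\<^sub>R h (r *\<^sub>R sgn y)) \<in> borel_measurable lborel"
        using mP unfolding P by (subst (asm) borel_measurable_restrict_space_iff) (auto simp: mult.commute)
      have "?f = (\<lambda>y. indicator (ball 0 r - {0}) y *\<^sub>R h (r *\<^sub>R sgn y) + indicator {0} y * h 0)"
        using r by (auto simp: fun_eq_iff indicator_def)
      thus ?thesis using m1 by simp
    qed
    ultimately show ?thesis using False by blast
  qed
  finally have "(LINT y:ball 0 r|lborel. h (r *\<^sub>R sgn y)) = r ^ CARD('n) * (LINT y:ball 0 1|lborel. h (r *\<^sub>R sgn y))"
    by (simp add: set_lebesgue_integral_def)
  moreover have "r ^ CARD('n) = r * r ^ (CARD('n) - 1)" by (metis power_minus_mult zero_less_card_finite mult.commute)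
  ultimately show ?thesis using r unfolding sphere_integral(1)[OF h] by simp
qed

lemma finite_sphere_measure: "finite_measure (sphere_measure r :: (real^'n::finite) measure)"
proof
  have "integrable (sphere_measure r) (\<lambda>x::real^'n. 1::real)"
    using sphere_integral(2)[of "\<lambda>x::real^'n. 1"] emeasure_bounded_finite[of "ball (0::real^'n) r"]
    by (auto simp: set_integrable_def)
  hence "integrable (sphere_measure r) (indicator (space (sphere_measure r)) :: real^'n \<Rightarrow> real)"
    by (rule Bochner_Integration.integrable_cong[OF refl, THEN iffD1, rotated]) auto
  thus "emeasure (sphere_measure r) (space (sphere_measure r :: (real^'n) measure)) \<noteq> \<infinity>"
    by (auto simp: integrable_indicator_iff)
qed

lemma integrable_sphere_continuous:
  fixes f :: "real^'n::finite \<Rightarrow> real"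
  assumes "continuous_on (sphere 0 r) f" shows "integrable (sphere_measure r) f"
proof -
  interpret finite_measure "sphere_measure r :: (real^'n) measure" by (rule finite_sphere_measure)
  have "bounded (f ` sphere 0 r)" by (intro compact_imp_bounded compact_continuous_image assms) auto
  then obtain B where B: "\<And>x. x \<in> sphere 0 r \<Longrightarrow> norm (f x) \<le> B" by (rule bounded_imageE) blast
  show ?thesis
    by (rule integrable_const_bound[of _ B]) (use B continuous_on_sphere_measurable[OF assms] in auto)
qed

end

definition cshell :: "real \<Rightarrow> real \<Rightarrow> (real^'n::finite) set" where
  "cshell a b = {x. a \<le> norm x \<and> norm x \<le> b}"

lemma compact_cshell: "compact (cshell a b :: (real^'n::finite) set)"
proof -
  have "cshell a b = cball 0 b \<inter> {x::real^'n. a \<le> norm x}" by (auto simp: cshell_def)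
  moreover have "closed {x::real^'n. a \<le> norm x}" by (intro closed_Collect_le continuous_intros)
  ultimately show ?thesis by (metis compact_Int_closed compact_cball)
qed

text \<open>
The divergence theorem for the field \<open>f(x) |x| powr (- N) x\<close>: in polar coordinates the weight cancels the
Jacobian, and the fundamental theorem of calculus applies on each ray.
\<close>

lemma radial_FTC:
  fixes f :: "real^'n::finite \<Rightarrow> real"
  assumes ab: "0 < a" "a < b" and T: "open T" "cshell a b \<subseteq> T" and f: "Ck_on 1 T f"
  shows "set_integrable lborel (cshell a b) (\<lambda>x. inverse (norm x ^ (CARD('n) - 1)) * (grad f x \<bullet> sgn x))"
    "(LINT x:cshell a b|lborel. inverse (norm x ^ (CARD('n) - 1)) * (grad f x \<bullet> sgn x)) =
       inverse (b ^ (CARD('n) - 1)) * (LINT x|sphere_measure b. f x) - inverse (a ^ (CARD('n) - 1)) * (LINT x|sphere_measure a. f x)"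
proof -
  let ?N = "CARD('n)"
  note df = Ck1_D(1)[OF T(1) f]
  have cg: "continuous_on (cshell a b) (grad f)" and cf: "continuous_on (cshell a b) f"
    using Ck1_D[OF T(1) f] T(2) continuous_on_subset by blast+
  have cs: "continuous_on (cshell a b) (\<lambda>x::real^'n. inverse (norm x ^ (?N - 1)) * (grad f x \<bullet> sgn x))"
    using ab by (intro continuous_intros cg continuous_on_sgn) (auto simp: cshell_def)
  show si: "set_integrable lborel (cshell a b) (\<lambda>x. inverse (norm x ^ (?N - 1)) * (grad f x \<bullet> sgn x))"
    by (rule set_integrable_continuous_compact[OF compact_cshell cs])
  let ?H = "\<lambda>x. indicator (cshell a b) x *\<^sub>R (inverse (norm x ^ (?N - 1)) * (grad f x \<bullet> sgn x))"
  have Hi: "integrable lborel ?H" using si by (simp add: set_integrable_def)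
  have sph: "continuous_on (sphere 0 s) f" if "a \<le> s" "s \<le> b" for s
    by (rule continuous_on_subset[OF cf]) (use that in \<open>auto simp: cshell_def\<close>)
  have inner: "(\<integral>r. polar_weight (r, y) * ?H (r *\<^sub>R sgn y) \<partial>lborel) = indicator (ball 0 1) y * (real ?N * (f (b *\<^sub>R sgn y) - f (a *\<^sub>R sgn y)))"
    if y: "y \<noteq> 0" for y :: "real^'n"
  proof -
    have ny: "norm (sgn y) = 1" using y by (simp add: norm_sgn)
    have mem: "r *\<^sub>R sgn y \<in> cshell a b \<longleftrightarrow> a \<le> r \<and> r \<le> b" if "r > 0" for r
      using that ny by (auto simp: cshell_def)
    have cont: "continuous_on {a..b} (\<lambda>r. grad f (r *\<^sub>R sgn y) \<bullet> sgn y)"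
      by (intro continuous_intros continuous_on_compose2[OF cg]) (use mem ab in auto)
    have D: "((\<lambda>r. f (r *\<^sub>R sgn y)) has_real_derivative (grad f (r *\<^sub>R sgn y) \<bullet> sgn y)) (at r)" if r: "a \<le> r" "r \<le> b" for r
    proof -
      have "f differentiable (at (r *\<^sub>R sgn y))" using mem[of r] r ab T(2) df by auto
      moreover have "((\<lambda>r. r *\<^sub>R sgn y) has_derivative (\<lambda>t. t *\<^sub>R sgn y)) (at r)"
        by (auto intro!: derivative_eq_intros)
      ultimately have "((\<lambda>r. f (r *\<^sub>R sgn y)) has_derivative (\<lambda>t. grad f (r *\<^sub>R sgn y) \<bullet> (t *\<^sub>R sgn y))) (at r)"
        using has_derivative_compose[where f="\<lambda>r. r *\<^sub>R sgn y" and g=f] has_derivative_grad by blast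
      thus ?thesis by (simp add: has_field_derivative_def mult.commute[of _ "grad f _ \<bullet> _"])
    qed
    have eq: "polar_weight (r, y) * ?H (r *\<^sub>R sgn y) = indicator (ball 0 1) y * (real ?N * (indicator {a..b} r * (grad f (r *\<^sub>R sgn y) \<bullet> sgn y)))" for r
    proof (cases "r > 0")
      case True
      have "sgn (sgn y) = sgn y" using ny by (simp add: sgn_div_norm[of "sgn y"])
      hence "sgn (r *\<^sub>R sgn y) = sgn y" "norm (r *\<^sub>R sgn y) = r" using True ny by (simp_all add: sgn_scaleR)
      thus ?thesis using True mem[OF True] by (simp add: polar_weight_def indicator_def)
    next
      case False
      thus ?thesis using ab by (simp add: polar_weight_def)
    qed
    have "(\<integral>r. indicator {a..b} r * (grad f (r *\<^sub>R sgn y) \<bullet> sgn y) \<partial>lborel) = f (b *\<^sub>R sgn y) - f (a *\<^sub>R sgn y)"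
      using integral_FTC_Icc_real[of a b "\<lambda>r. f (r *\<^sub>R sgn y)" "\<lambda>r. grad f (r *\<^sub>R sgn y) \<bullet> sgn y"] D ab
        cont continuous_on_eq_continuous_within
      using integral_FTC_atLeastAtMost[of a b "\<lambda>r. f (r *\<^sub>R sgn y)" "\<lambda>r. grad f (r *\<^sub>R sgn y) \<bullet> sgn y"]
      by (auto simp: has_real_derivative_iff_has_vector_derivative intro: has_vector_derivative_at_within)
    thus ?thesis unfolding eq by simp
  qed
  have unit: "set_integrable lborel (ball 0 1) (\<lambda>y. f (s *\<^sub>R sgn y))" if s: "a \<le> s" "s \<le> b" for s
  proof -
    have s0: "s > 0" using s ab by simp
    have "set_integrable lborel (ball 0 s) (\<lambda>y. f (s *\<^sub>R sgn y))"
      using sphere_integral(2)[OF s0 continuous_on_sphere_measurable[OF sph[OF s]]] integrable_sphere_continuous[OF s0 sph[OF s]] by simp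
    hence i: "integrable lborel (\<lambda>y. indicator (ball 0 s) y *\<^sub>R f (s *\<^sub>R sgn y))" by (simp add: set_integrable_def)
    hence m: "(\<lambda>y. indicator (ball 0 s) y *\<^sub>R f (s *\<^sub>R sgn y)) \<in> borel_measurable borel" by auto
    have "(\<lambda>x::real^'n. s *\<^sub>R x) \<in> borel_measurable borel" by measurable
    from measurable_compose[OF this m]
    have "(\<lambda>y. indicator (ball 0 s) (s *\<^sub>R y) *\<^sub>R f (s *\<^sub>R sgn (s *\<^sub>R y))) \<in> borel_measurable borel" .
    also have "(\<lambda>y. indicator (ball 0 s) (s *\<^sub>R y) *\<^sub>R f (s *\<^sub>R sgn (s *\<^sub>R y))) = (\<lambda>y. indicator (ball 0 1) y *\<^sub>R f (s *\<^sub>R sgn y))"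
      using s0 by (auto simp: fun_eq_iff indicator_def sgn_scaleR)
    finally have m1: "(\<lambda>y. indicator (ball 0 1) y *\<^sub>R f (s *\<^sub>R sgn y)) \<in> borel_measurable lborel" by simp
    have "bounded (f ` sphere 0 s)" by (intro compact_imp_bounded compact_continuous_image sph s) auto
    then obtain B where B: "\<And>x. x \<in> sphere 0 s \<Longrightarrow> norm (f x) \<le> B" by (rule bounded_imageE) blast
    have "AE y in lborel. y \<noteq> (0::real^'n)" by (rule AE_lborel_singleton)
    hence "AE y in lborel. norm (indicator (ball 0 1) y *\<^sub>R f (s *\<^sub>R sgn y)) \<le> norm (B * indicator (ball 0 1) (y::real^'n))"
    proof eventually_elim
      fix y :: "real^'n" assume "y \<noteq> 0"
      hence "s *\<^sub>R sgn y \<in> sphere 0 s" using s0 by (simp add: norm_sgn)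
      from B[OF this] show "norm (indicator (ball 0 1) y *\<^sub>R f (s *\<^sub>R sgn y)) \<le> norm (B * indicator (ball 0 1) y)"
        by (auto simp: indicator_def)
    qed
    note ae = this
    have "integrable lborel (\<lambda>y::real^'n. B * indicator (ball 0 1) y)"
      using emeasure_bounded_finite[of "ball (0::real^'n) 1"] by (auto intro!: integrable_real_indicator)
    from Bochner_Integration.integrable_bound[OF this m1 ae] show ?thesis unfolding set_integrable_def .
  qed
  have "(LINT x:cshell a b|lborel. inverse (norm x ^ (?N - 1)) * (grad f x \<bullet> sgn x)) = integral\<^sup>L lborel ?H"
    by (simp add: set_lebesgue_integral_def)
  also have "\<dots> = (\<integral>y. (\<integral>r. polar_weight (r, y) * ?H (r *\<^sub>R sgn y) \<partial>lborel) \<partial>lborel)"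
    by (rule polar_integral(1)[OF Hi])
  also have "\<dots> = (\<integral>y. real ?N * (indicator (ball 0 1) y *\<^sub>R f (b *\<^sub>R sgn y)) - real ?N * (indicator (ball 0 1) y *\<^sub>R f (a *\<^sub>R sgn y)) \<partial>lborel)"
  proof (rule integral_cong_AE)
    show "(\<lambda>y. \<integral>r. polar_weight (r, y) * ?H (r *\<^sub>R sgn y) \<partial>lborel) \<in> borel_measurable lborel"
      using polar_integral(2)[OF Hi] by (rule borel_measurable_integrable)
    show "(\<lambda>y. real ?N * (indicator (ball 0 1) y *\<^sub>R f (b *\<^sub>R sgn y)) - real ?N * (indicator (ball 0 1) y *\<^sub>R f (a *\<^sub>R sgn y))) \<in> borel_measurable lborel"
      using unit[of a] unit[of b] ab unfolding set_integrable_def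
      by (intro borel_measurable_diff borel_measurable_times borel_measurable_const borel_measurable_integrable) auto
    have "AE y in lborel. y \<noteq> (0::real^'n)" by (rule AE_lborel_singleton)
    thus "AE y in lborel. (\<integral>r. polar_weight (r, y) * ?H (r *\<^sub>R sgn y) \<partial>lborel) = 
       real ?N * (indicator (ball 0 1) y *\<^sub>R f (b *\<^sub>R sgn y)) - real ?N * (indicator (ball 0 1) y *\<^sub>R f (a *\<^sub>R sgn y))"
    proof eventually_elim
      fix y :: "real^'n" assume y: "y \<noteq> 0"
      show "(\<integral>r. polar_weight (r, y) * ?H (r *\<^sub>R sgn y) \<partial>lborel) = 
       real ?N * (indicator (ball 0 1) y *\<^sub>R f (b *\<^sub>R sgn y)) - real ?N * (indicator (ball 0 1) y *\<^sub>R f (a *\<^sub>R sgn y))"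
        unfolding inner[OF y] by (simp add: algebra_simps)
    qed
  qed
  also have "\<dots> = real ?N * (LINT y:ball 0 1|lborel. f (b *\<^sub>R sgn y)) - real ?N * (LINT y:ball 0 1|lborel. f (a *\<^sub>R sgn y))"
  proof -
    have "integrable lborel (\<lambda>y. indicator (ball 0 1) y *\<^sub>R f (b *\<^sub>R sgn y))" "integrable lborel (\<lambda>y. indicator (ball 0 1) y *\<^sub>R f (a *\<^sub>R sgn y))"
      using unit[of a] unit[of b] ab by (simp_all only: set_integrable_def)
    hence "integrable lborel (\<lambda>y. real ?N * (indicator (ball 0 1) y *\<^sub>R f (b *\<^sub>R sgn y)))" "integrable lborel (\<lambda>y. real ?N * (indicator (ball 0 1) y *\<^sub>R f (a *\<^sub>R sgn y)))"
      by (simp_all only: integrable_mult_right)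
    from Bochner_Integration.integral_diff[OF this]
    show ?thesis unfolding set_lebesgue_integral_def by (simp only: integral_mult_right_zero)
  qed
  also have "real ?N * (LINT y:ball 0 1|lborel. f (b *\<^sub>R sgn y)) = inverse (b ^ (?N - 1)) * (LINT x|sphere_measure b. f x)"
    using sphere_integral_unit[OF _ continuous_on_sphere_measurable[OF sph[of b]]] ab by simp
  also have "real ?N * (LINT y:ball 0 1|lborel. f (a *\<^sub>R sgn y)) = inverse (a ^ (?N - 1)) * (LINT x|sphere_measure a. f x)"
    using sphere_integral_unit[OF _ continuous_on_sphere_measurable[OF sph[of a]]] ab by simp
  finally show "(LINT x:cshell a b|lborel. inverse (norm x ^ (?N - 1)) * (grad f x \<bullet> sgn x)) =
       inverse (b ^ (?N - 1)) * (LINT x|sphere_measure b. f x) - inverse (a ^ (?N - 1)) * (LINT x|sphere_measure a. f x)" .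
qed

section \<open>Limits of square integrable functions\<close>

lemma square_integrable_mult:
  fixes f h :: "_ \<Rightarrow> real"
  assumes [measurable]: "f \<in> borel_measurable M" "h \<in> borel_measurable M"
    and "integrable M (\<lambda>x. (f x)\<^sup>2)" "integrable M (\<lambda>x. (h x)\<^sup>2)"
  shows "integrable M (\<lambda>x. f x * h x)"
proof (rule Bochner_Integration.integrable_bound)
  show "integrable M (\<lambda>x. (f x)\<^sup>2 + (h x)\<^sup>2)" using assms(3,4) by (rule Bochner_Integration.integrable_add)
  show "(\<lambda>x. f x * h x) \<in> borel_measurable M" by measurable
  show "AE x in M. norm (f x * h x) \<le> norm ((f x)\<^sup>2 + (h x)\<^sup>2)"
  proof (rule AE_I2)
    fix x
    have "2 * \<bar>f x\<bar> * \<bar>h x\<bar> \<le> \<bar>f x\<bar>\<^sup>2 + \<bar>h x\<bar>\<^sup>2" by (rule sum_squares_bound)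
    moreover have "0 \<le> \<bar>f x\<bar> * \<bar>h x\<bar>" by simp
    moreover have "norm (f x * h x) = \<bar>f x\<bar> * \<bar>h x\<bar>" by (simp add: abs_mult)
    moreover have "norm ((f x)\<^sup>2 + (h x)\<^sup>2) = \<bar>f x\<bar>\<^sup>2 + \<bar>h x\<bar>\<^sup>2" by simp
    ultimately show "norm (f x * h x) \<le> norm ((f x)\<^sup>2 + (h x)\<^sup>2)" by linarith
  qed
qed

lemma square_integrable_diff:
  fixes f h :: "_ \<Rightarrow> real"
  assumes m: "f \<in> borel_measurable M" "h \<in> borel_measurable M"
    and i: "integrable M (\<lambda>x. (f x)\<^sup>2)" "integrable M (\<lambda>x. (h x)\<^sup>2)"
  shows "integrable M (\<lambda>x. (f x - h x)\<^sup>2)"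
    "(\<integral>x. (f x - h x)\<^sup>2 \<partial>M) \<le> 2 * (\<integral>x. (f x)\<^sup>2 \<partial>M) + 2 * (\<integral>x. (h x)\<^sup>2 \<partial>M)"
proof -
  have "integrable M (\<lambda>x. (f x)\<^sup>2 + (h x)\<^sup>2 - 2 * (f x * h x))"
    by (intro Bochner_Integration.integrable_diff Bochner_Integration.integrable_add i integrable_mult_right square_integrable_mult m)
  thus 1: "integrable M (\<lambda>x. (f x - h x)\<^sup>2)" by (simp add: power2_diff mult.assoc)
  have "(\<integral>x. (f x - h x)\<^sup>2 \<partial>M) \<le> (\<integral>x. 2 * (f x)\<^sup>2 + 2 * (h x)\<^sup>2 \<partial>M)"
  proof (rule integral_mono[OF 1])
    show "integrable M (\<lambda>x. 2 * (f x)\<^sup>2 + 2 * (h x)\<^sup>2)" using i by simp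
    fix x show "(f x - h x)\<^sup>2 \<le> 2 * (f x)\<^sup>2 + 2 * (h x)\<^sup>2"
      using zero_le_power2[of "f x + h x"] by (simp add: power2_eq_square algebra_simps)
  qed
  also have "\<dots> = 2 * (\<integral>x. (f x)\<^sup>2 \<partial>M) + 2 * (\<integral>x. (h x)\<^sup>2 \<partial>M)" using i by simp
  finally show "(\<integral>x. (f x - h x)\<^sup>2 \<partial>M) \<le> 2 * (\<integral>x. (f x)\<^sup>2 \<partial>M) + 2 * (\<integral>x. (h x)\<^sup>2 \<partial>M)" .
qed

lemma tendsto_0_sandwich:
  fixes a b :: "nat \<Rightarrow> real"
  assumes "\<And>n. 0 \<le> a n" "\<And>n. a n \<le> b n" "b \<longlonglongrightarrow> 0" shows "a \<longlonglongrightarrow> 0"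
  using tendsto_sandwich[of "\<lambda>_. 0" a sequentially b 0] assms by auto

lemma scaled_less_half: "0 \<le> I \<Longrightarrow> 0 < e \<Longrightarrow> e / (2 * (I + 1)) * I < e / (2::real)"
  by (simp add: field_simps)

text \<open>
By Young's inequality the difference of the products is at most \<open>\<delta>\<close> times the fixed quantity \<open>f\<^sup>2 + h\<^sup>2\<close>,
plus a multiple of the squared errors, for every \<open>\<delta> > 0\<close>.
\<close>

lemma L2_limit_product:
  fixes f h :: "_ \<Rightarrow> real"
  assumes mf [measurable]: "\<And>n::nat. fn n \<in> borel_measurable M" "\<And>n::nat. hn n \<in> borel_measurable M"
      "f \<in> borel_measurable M" "h \<in> borel_measurable M"
    and i: "\<And>n. integrable M (\<lambda>x. (fn n x)\<^sup>2)" "\<And>n. integrable M (\<lambda>x. (hn n x)\<^sup>2)"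
      "integrable M (\<lambda>x. (f x)\<^sup>2)" "integrable M (\<lambda>x. (h x)\<^sup>2)"
    and lf: "(\<lambda>n. \<integral>x. (fn n x - f x)\<^sup>2 \<partial>M) \<longlonglongrightarrow> 0" and lh: "(\<lambda>n. \<integral>x. (hn n x - h x)\<^sup>2 \<partial>M) \<longlonglongrightarrow> 0"
  shows "(\<lambda>n. \<integral>x. fn n x * hn n x \<partial>M) \<longlonglongrightarrow> (\<integral>x. f x * h x \<partial>M)"
proof -
  let ?I = "\<integral>x. (f x)\<^sup>2 + (h x)\<^sup>2 \<partial>M"
  let ?d = "\<lambda>n. (\<integral>x. (fn n x - f x)\<^sup>2 \<partial>M) + (\<integral>x. (hn n x - h x)\<^sup>2 \<partial>M)"
  have I0: "0 \<le> ?I" by simp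
  have d: "?d \<longlonglongrightarrow> 0" using tendsto_add[OF lf lh] by simp
  have df: "integrable M (\<lambda>x. (fn n x - f x)\<^sup>2)" and dh: "integrable M (\<lambda>x. (hn n x - h x)\<^sup>2)" for n
    by (intro square_integrable_diff mf i)+
  have key: "\<bar>(\<integral>x. fn n x * hn n x \<partial>M) - (\<integral>x. f x * h x \<partial>M)\<bar> \<le> \<delta> * ?I + (1 + 1/\<delta>) * ?d n" if \<delta>: "\<delta> > 0" for \<delta> n
  proof -
    have "(\<integral>x. fn n x * hn n x \<partial>M) - (\<integral>x. f x * h x \<partial>M) = (\<integral>x. fn n x * hn n x - f x * h x \<partial>M)"
      by (rule Bochner_Integration.integral_diff[symmetric]; intro square_integrable_mult mf i)
    also have "\<bar>\<dots>\<bar> \<le> (\<integral>x. \<bar>fn n x * hn n x - f x * h x\<bar> \<partial>M)" by (rule integral_abs_bound)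
    also have "\<dots> \<le> (\<integral>x. \<delta> * ((f x)\<^sup>2 + (h x)\<^sup>2) + (1 + 1/\<delta>) * ((fn n x - f x)\<^sup>2 + (hn n x - h x)\<^sup>2) \<partial>M)"
    proof (rule integral_mono)
      show "integrable M (\<lambda>x. \<bar>fn n x * hn n x - f x * h x\<bar>)"
        by (intro integrable_abs Bochner_Integration.integrable_diff square_integrable_mult mf i)
      show "integrable M (\<lambda>x. \<delta> * ((f x)\<^sup>2 + (h x)\<^sup>2) + (1 + 1/\<delta>) * ((fn n x - f x)\<^sup>2 + (hn n x - h x)\<^sup>2))"
        by (intro Bochner_Integration.integrable_add integrable_mult_right i df dh)
      fix x
      define A B where "A = fn n x - f x" and "B = hn n x - h x"
      have e: "fn n x * hn n x - f x * h x = A * B + f x * B + A * h x" by (simp add: A_def B_def algebra_simps)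
      have y: "\<bar>a * b\<bar> \<le> \<delta> * a\<^sup>2 + 1/\<delta> * b\<^sup>2" for a b
      proof -
        have "2 * (\<delta> * \<bar>a\<bar>) * \<bar>b\<bar> \<le> (\<delta> * \<bar>a\<bar>)\<^sup>2 + \<bar>b\<bar>\<^sup>2" by (rule sum_squares_bound)
        hence "\<delta> * (2 * \<bar>a * b\<bar>) \<le> \<delta> * (\<delta> * a\<^sup>2 + 1/\<delta> * b\<^sup>2)" using \<delta> 
          by (simp add: power2_eq_square algebra_simps abs_mult)
        hence "2 * \<bar>a * b\<bar> \<le> \<delta> * a\<^sup>2 + 1/\<delta> * b\<^sup>2" using \<delta> by (simp only: mult_le_cancel_left_pos)
        thus ?thesis by linarith
      qed
      have "\<bar>A * B\<bar> \<le> A\<^sup>2 + B\<^sup>2"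
      proof -
        have "2 * (\<bar>A\<bar> * \<bar>B\<bar>) \<le> A\<^sup>2 + B\<^sup>2" using sum_squares_bound[of "\<bar>A\<bar>" "\<bar>B\<bar>"] by (simp add: mult.assoc)
        moreover have "0 \<le> \<bar>A\<bar> * \<bar>B\<bar>" by simp
        ultimately show ?thesis unfolding abs_mult by linarith
      qed
      moreover have "\<bar>f x * B\<bar> \<le> \<delta> * (f x)\<^sup>2 + 1/\<delta> * B\<^sup>2" by (rule y)
      moreover have "\<bar>A * h x\<bar> \<le> \<delta> * (h x)\<^sup>2 + 1/\<delta> * A\<^sup>2" using y[of "h x" A] by (simp only: mult.commute)
      ultimately have "\<bar>A * B + f x * B + A * h x\<bar> \<le> \<delta> * ((f x)\<^sup>2 + (h x)\<^sup>2) + (1 + 1/\<delta>) * (A\<^sup>2 + B\<^sup>2)"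
        unfolding distrib_left distrib_right by linarith
      thus "\<bar>fn n x * hn n x - f x * h x\<bar> \<le> \<delta> * ((f x)\<^sup>2 + (h x)\<^sup>2) + (1 + 1/\<delta>) * ((fn n x - f x)\<^sup>2 + (hn n x - h x)\<^sup>2)"
        unfolding e by (simp only: A_def B_def)
    qed
    also have "\<dots> = \<delta> * ?I + (1 + 1/\<delta>) * ?d n"
      using i df dh by simp
    finally show ?thesis .
  qed
  show ?thesis
  proof (rule LIMSEQ_I)
    fix e :: real assume e: "e > 0"
    define \<delta> where "\<delta> = e / (2 * (?I + 1))"
    have \<delta>: "\<delta> > 0" using e I0 by (simp add: \<delta>_def add_nonneg_pos)
    have dI: "\<delta> * ?I < e / 2" unfolding \<delta>_def by (rule scaled_less_half[OF I0 e])
    have "(\<lambda>n. (1 + 1/\<delta>) * ?d n) \<longlonglongrightarrow> (1 + 1/\<delta>) * 0" by (intro tendsto_mult tendsto_const d)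
    hence "\<forall>\<^sub>F n in sequentially. (1 + 1/\<delta>) * ?d n < e / 2" using e by (intro order_tendstoD(2)[of _ "0"]) auto
    then obtain n0 where n0: "\<And>n. n \<ge> n0 \<Longrightarrow> (1 + 1/\<delta>) * ?d n < e / 2" by (auto simp: eventually_sequentially)
    show "\<exists>no. \<forall>n\<ge>no. norm ((\<integral>x. fn n x * hn n x \<partial>M) - (\<integral>x. f x * h x \<partial>M)) < e"
    proof (intro exI allI impI)
      fix n assume "n \<ge> n0"
      from n0[OF this] key[OF \<delta>, of n] dI show "norm ((\<integral>x. fn n x * hn n x \<partial>M) - (\<integral>x. f x * h x \<partial>M)) < e"
        unfolding real_norm_def by linarith
    qed
  qed
qed

text \<open>
On a finite measure space an \<open>L\<^sup>2\<close>-Cauchy sequence is \<open>L\<^sup>1\<close>-Cauchy and so has a subsequence that converges almost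
everywhere. Fatou's lemma shows that its limit is the limit in \<open>L\<^sup>2\<close>.
\<close>

lemma L2_complete:
  fixes f :: "nat \<Rightarrow> 'a \<Rightarrow> real"
  assumes fin: "finite_measure M"
    and mf [measurable]: "\<And>n. f n \<in> borel_measurable M" and i: "\<And>n. integrable M (\<lambda>x. (f n x)\<^sup>2)"
    and C: "\<And>e. e > 0 \<Longrightarrow> \<exists>N. \<forall>m\<ge>N. \<forall>n\<ge>N. (\<integral>x. (f m x - f n x)\<^sup>2 \<partial>M) < e"
  shows "\<exists>h. h \<in> borel_measurable M \<and> integrable M (\<lambda>x. (h x)\<^sup>2) \<and> (\<lambda>n. \<integral>x. (f n x - h x)\<^sup>2 \<partial>M) \<longlonglongrightarrow> 0"
proof -
  interpret finite_measure M by (rule fin)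
  have d: "integrable M (\<lambda>x. (f m x - f n x)\<^sup>2)" for m n by (intro square_integrable_diff mf i)
  have int1: "integrable M (f n)" for n
    using square_integrable_mult[OF mf _ i, of "\<lambda>_. 1"] by simp
  define \<mu> where "\<mu> = measure M (space M)"
  have \<mu>: "\<mu> \<ge> 0" by (simp add: \<mu>_def)
  have L1: "\<exists>N. \<forall>m\<ge>N. \<forall>n\<ge>N. (\<integral>x. norm (f m x - f n x) \<partial>M) < e" if e: "e > 0" for e
  proof -
    \<comment> \<open>splits \<open>e\<close> between the measure of the space and the squared distance\<close>
    define \<delta> where "\<delta> = e / (2 * (\<mu> + 1))"
    have \<delta>: "\<delta> > 0" using e \<mu> by (simp add: \<delta>_def)
    have d\<mu>: "\<delta> * \<mu> < e / 2" using e \<mu> by (simp add: \<delta>_def field_simps)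
    obtain N where N: "\<forall>m\<ge>N. \<forall>n\<ge>N. (\<integral>x. (f m x - f n x)\<^sup>2 \<partial>M) < \<delta> * (e/2)" using C[of "\<delta> * (e/2)"] \<delta> e by auto
    have "(\<integral>x. norm (f m x - f n x) \<partial>M) < e" if mn: "m \<ge> N" "n \<ge> N" for m n
    proof -
      have "(\<integral>x. norm (f m x - f n x) \<partial>M) \<le> (\<integral>x. \<delta> + 1/\<delta> * (f m x - f n x)\<^sup>2 \<partial>M)"
      proof (rule integral_mono)
        show "integrable M (\<lambda>x. norm (f m x - f n x))" using int1 by simp
        show "integrable M (\<lambda>x. \<delta> + 1/\<delta> * (f m x - f n x)\<^sup>2)" 
          by (intro Bochner_Integration.integrable_add integrable_mult_right d) simp
        fix x
        have "2 * \<delta> * \<bar>f m x - f n x\<bar> \<le> \<delta>\<^sup>2 + \<bar>f m x - f n x\<bar>\<^sup>2" by (rule sum_squares_bound)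
        hence "\<delta> * (2 * \<bar>f m x - f n x\<bar>) \<le> \<delta> * (\<delta> + 1/\<delta> * (f m x - f n x)\<^sup>2)" using \<delta> 
          by (simp add: power2_eq_square[of \<delta>] distrib_left)
        hence "2 * \<bar>f m x - f n x\<bar> \<le> \<delta> + 1/\<delta> * (f m x - f n x)\<^sup>2" using \<delta> by (simp only: mult_le_cancel_left_pos)
        thus "norm (f m x - f n x) \<le> \<delta> + 1/\<delta> * (f m x - f n x)\<^sup>2" unfolding real_norm_def
          by (rule order_trans[rotated]) simp
      qed
      also have "\<dots> = \<delta> * \<mu> + 1/\<delta> * (\<integral>x. (f m x - f n x)\<^sup>2 \<partial>M)"
        using d[of m n] by (simp add: \<mu>_def)
      also have "\<dots> < e / 2 + 1/\<delta> * (\<delta> * (e/2))"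
        using N mn \<delta> by (intro add_strict_mono d\<mu> mult_strict_left_mono) auto
      also have "\<dots> = e" using \<delta> by simp
      finally show ?thesis .
    qed
    thus ?thesis by blast
  qed
  obtain r where r: "strict_mono r" "AE x in M. Cauchy (\<lambda>i. f (r i) x)"
    using cauchy_L1_AE_cauchy_subseq[OF int1 L1] by blast
  define h where "h x = lim (\<lambda>i. f (r i) x)" for x
  have mh [measurable]: "h \<in> borel_measurable M"
    unfolding h_def[abs_def] by (rule borel_measurable_lim_metric) measurable
  have lim: "AE x in M. (\<lambda>i. f (r i) x) \<longlonglongrightarrow> h x"
    using r(2) by eventually_elim (auto simp: h_def Cauchy_convergent_iff convergent_LIMSEQ_iff)
  have bound: "\<exists>N. \<forall>n\<ge>N. (\<integral>\<^sup>+x. ennreal ((f n x - h x)\<^sup>2) \<partial>M) \<le> ennreal e" if e: "e > 0" for e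
  proof -
    obtain N where N: "\<forall>m\<ge>N. \<forall>n\<ge>N. (\<integral>x. (f m x - f n x)\<^sup>2 \<partial>M) < e" using C[OF e] by auto
    have "(\<integral>\<^sup>+x. ennreal ((f n x - h x)\<^sup>2) \<partial>M) \<le> ennreal e" if n: "n \<ge> N" for n
    proof -
      have "(\<integral>\<^sup>+x. ennreal ((f n x - h x)\<^sup>2) \<partial>M) = (\<integral>\<^sup>+x. liminf (\<lambda>i. ennreal ((f n x - f (r i) x)\<^sup>2)) \<partial>M)"
      proof (rule nn_integral_cong_AE)
        show "AE x in M. ennreal ((f n x - h x)\<^sup>2) = liminf (\<lambda>i. ennreal ((f n x - f (r i) x)\<^sup>2))"
          using lim
        proof eventually_elim
          fix x assume "(\<lambda>i. f (r i) x) \<longlonglongrightarrow> h x"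
          hence "(\<lambda>i. ennreal ((f n x - f (r i) x)\<^sup>2)) \<longlonglongrightarrow> ennreal ((f n x - h x)\<^sup>2)"
            by (intro tendsto_ennrealI tendsto_intros)
          from lim_imp_Liminf[OF _ this] show "ennreal ((f n x - h x)\<^sup>2) = liminf (\<lambda>i. ennreal ((f n x - f (r i) x)\<^sup>2))"
            by simp
        qed
      qed
      also have "\<dots> \<le> liminf (\<lambda>i. \<integral>\<^sup>+x. ennreal ((f n x - f (r i) x)\<^sup>2) \<partial>M)"
        by (rule nn_integral_liminf) measurable
      also have "\<dots> \<le> ennreal e"
      proof (rule Liminf_le)
        show "\<forall>\<^sub>F i in sequentially. (\<integral>\<^sup>+x. ennreal ((f n x - f (r i) x)\<^sup>2) \<partial>M) \<le> ennreal e"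
          unfolding eventually_sequentially
        proof (intro exI allI impI)
          fix i assume "i \<ge> N"
          hence "r i \<ge> N" using seq_suble[OF r(1), of i] by linarith
          hence "(\<integral>x. (f n x - f (r i) x)\<^sup>2 \<partial>M) < e" using N n by blast
          thus "(\<integral>\<^sup>+x. ennreal ((f n x - f (r i) x)\<^sup>2) \<partial>M) \<le> ennreal e"
            using nn_integral_eq_integral[OF d[of n "r i"]] by (auto intro: ennreal_leI)
        qed
      qed simp
      finally show ?thesis .
    qed
    thus ?thesis by blast
  qed
  have hi: "integrable M (\<lambda>x. (f n x - h x)\<^sup>2)" if "(\<integral>\<^sup>+x. ennreal ((f n x - h x)\<^sup>2) \<partial>M) \<le> ennreal e" for n e
    by (rule integrableI_bounded) (use that in \<open>auto intro: le_less_trans\<close>)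
  \<comment> \<open>a single index suffices to see that the limit is square integrable\<close>
  obtain n1 where n1: "(\<integral>\<^sup>+x. ennreal ((f n1 x - h x)\<^sup>2) \<partial>M) \<le> ennreal 1" using bound[of 1] by auto
  have "integrable M (\<lambda>x. (f n1 x - (f n1 x - h x))\<^sup>2)"
    by (rule square_integrable_diff(1)[OF mf _ i hi[OF n1]]) measurable
  hence h2: "integrable M (\<lambda>x. (h x)\<^sup>2)" by simp
  have "(\<lambda>n. \<integral>x. (f n x - h x)\<^sup>2 \<partial>M) \<longlonglongrightarrow> 0"
  proof (rule LIMSEQ_I)
    fix e :: real assume e: "e > 0"
    obtain N where N: "\<forall>n\<ge>N. (\<integral>\<^sup>+x. ennreal ((f n x - h x)\<^sup>2) \<partial>M) \<le> ennreal (e/2)" using bound[of "e/2"] e by auto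
    have "norm ((\<integral>x. (f n x - h x)\<^sup>2 \<partial>M) - 0) < e" if "n \<ge> N" for n
    proof -
      have "ennreal (\<integral>x. (f n x - h x)\<^sup>2 \<partial>M) \<le> ennreal (e/2)"
        using N that nn_integral_eq_integral[OF hi, of n "e/2"] by auto
      hence "(\<integral>x. (f n x - h x)\<^sup>2 \<partial>M) \<le> e/2" using e by (subst (asm) ennreal_le_iff) auto
      thus ?thesis using e by simp
    qed
    thus "\<exists>no. \<forall>n\<ge>no. norm ((\<integral>x. (f n x - h x)\<^sup>2 \<partial>M) - 0) < e" by blast
  qed
  with mh h2 show ?thesis by blast
qed

section \<open>Sobolev functions and their traces on spheres\<close>

text \<open>
A weakly differentiable function is only known to be integrable on compact sets, so its
measurability on \<open>S\<close> comes from an exhaustion of \<open>S\<close> by compact sets.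
\<close>

lemma weakly_differentiable_measurable:
  fixes v :: "real^'n::finite \<Rightarrow> real"
  assumes S: "open S" and g: "has_weak_gradient_on v g S"
  shows "(\<lambda>x. indicator S x * v x) \<in> borel_measurable lborel"
proof (cases "S = {}")
  case False
  obtain D where D: "countable D" "D \<subseteq> Pow S" "\<Union>D = S" "\<And>X. X \<in> D \<Longrightarrow> \<exists>a b. X = cbox a b"
    using open_countable_Union_open_cbox[OF S] by metis
  have ne: "D \<noteq> {}" using False D(3) by auto
  let ?K = "\<lambda>n. \<Union>i\<le>n. from_nat_into D i"
  have mem: "from_nat_into D i \<in> D" for i by (rule from_nat_into[OF ne])
  have K: "compact (?K n)" "?K n \<subseteq> S" for n
  proof -
    show "compact (?K n)" using D(4)[OF mem] by (intro compact_UN) (auto, metis compact_cbox)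
    show "?K n \<subseteq> S" using mem D(2) by blast
  qed
  show ?thesis
  proof (rule borel_measurable_LIMSEQ_real)
    show "(\<lambda>x. indicator (?K n) x * v x) \<in> borel_measurable lborel" for n
      using has_weak_gradientD(2)[OF g K] by (auto simp: set_integrable_def)
    fix x
    show "(\<lambda>n. indicator (?K n) x * v x) \<longlonglongrightarrow> indicator S x * v x"
    proof (cases "x \<in> S")
      case True
      then obtain X where X: "X \<in> D" "x \<in> X" using D(3) by blast
      then obtain j where j: "from_nat_into D j = X" using from_nat_into_surj[OF D(1)] by blast
      have "\<forall>n\<ge>j. indicator (?K n) x * v x = v x" using X j by (auto simp: indicator_def)
      hence "(\<lambda>n. indicator (?K n) x * v x) \<longlonglongrightarrow> v x"
        by (intro tendsto_eventually) (auto simp: eventually_sequentially)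
      thus ?thesis using True by simp
    next
      case False
      hence "x \<notin> ?K n" for n using K(2) by blast
      thus ?thesis using False by (simp add: indicator_def)
    qed
  qed
qed simp

lemma sq_indicator: "(indicator S x * (a::real))\<^sup>2 = indicator S x * a\<^sup>2"
  by (auto simp: indicator_def)

text \<open>
By uniqueness, the norms in \<open>H\<^sup>1\<close> can be computed with any weak gradient in place of the chosen one.
\<close>

lemma weak_gradient_norm_sq_cong:
  assumes S: "open S" and g: "has_weak_gradient_on v g S"
  shows "set_integrable lborel S (\<lambda>x. (norm (weak_gradient S v x))\<^sup>2) \<longleftrightarrow> set_integrable lborel S (\<lambda>x. (norm (g x))\<^sup>2)"
    "(LINT x:S|lborel. (norm (weak_gradient S v x))\<^sup>2) = (LINT x:S|lborel. (norm (g x))\<^sup>2)"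
proof -
  have [measurable]: "g \<in> borel_measurable borel" "weak_gradient S v \<in> borel_measurable borel"
    using has_weak_gradientD(1)[OF g] has_weak_gradientD(1)[OF weak_gradient_works[OF g]] by auto
  have [measurable]: "S \<in> sets borel" using S by simp
  have ae: "AE x\<in>S in lborel. (norm (weak_gradient S v x))\<^sup>2 = (norm (g x))\<^sup>2"
    using weak_gradient_AE[OF S g] by eventually_elim auto
  show "set_integrable lborel S (\<lambda>x. (norm (weak_gradient S v x))\<^sup>2) \<longleftrightarrow> set_integrable lborel S (\<lambda>x. (norm (g x))\<^sup>2)"
    by (rule set_integrable_cong_AE[OF _ _ ae]) auto
  show "(LINT x:S|lborel. (norm (weak_gradient S v x))\<^sup>2) = (LINT x:S|lborel. (norm (g x))\<^sup>2)"
    by (rule set_lebesgue_integral_cong_AE[OF _ _ _ ae]) auto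
qed

lemma H1_onI:
  assumes "open S" "has_weak_gradient_on v g S" "set_integrable lborel S (\<lambda>x. (v x)\<^sup>2)" "set_integrable lborel S (\<lambda>x. (norm (g x))\<^sup>2)"
  shows "v \<in> H1_on S" "H1_norm2 S v = (LINT x:S|lborel. (v x)\<^sup>2) + (LINT x:S|lborel. (norm (g x))\<^sup>2)"
  using assms weak_gradient_norm_sq_cong[OF assms(1,2)]
  by (auto simp: H1_on_def H1_norm2_def weakly_differentiable_on_def)

lemma H1_onD:
  assumes "v \<in> H1_on S"
  shows "has_weak_gradient_on v (weak_gradient S v) S" "set_integrable lborel S (\<lambda>x. (v x)\<^sup>2)"
    "set_integrable lborel S (\<lambda>x. (norm (weak_gradient S v x))\<^sup>2)"
  using assms weak_gradient_works by (auto simp: H1_on_def weakly_differentiable_on_def)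

lemma set_integral_nonneg_mono_set:
  fixes f :: "_ \<Rightarrow> real"
  assumes "set_integrable M B f" "A \<in> sets M" "B \<in> sets M" "A \<subseteq> B" "\<And>x. 0 \<le> f x"
  shows "(LINT x:A|M. f x) \<le> (LINT x:B|M. f x)"
  unfolding set_lebesgue_integral_def
proof (rule integral_mono)
  show "integrable M (\<lambda>x. indicator A x *\<^sub>R f x)" 
    using set_integrable_subset[OF assms(1,2,4)] by (simp add: set_integrable_def)
  show "integrable M (\<lambda>x. indicator B x *\<^sub>R f x)" using assms(1) by (simp add: set_integrable_def)
qed (use assms(4,5) in \<open>auto simp: indicator_def\<close>)

lemma H1_restrict:
  assumes v: "v \<in> H1_on S" and S: "open S" and T: "open T" "T \<subseteq> S"
  shows "v \<in> H1_on T" "H1_norm2 T v \<le> H1_norm2 S v"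
proof -
  note h = H1_onD[OF v]
  have Ts: "T \<in> sets lborel" "S \<in> sets lborel" using T S by auto
  note g = has_weak_gradient_restrict[OF h(1) T(2)]
  have i: "set_integrable lborel T (\<lambda>x. (v x)\<^sup>2)" "set_integrable lborel T (\<lambda>x. (norm (weak_gradient S v x))\<^sup>2)"
    using set_integrable_subset[OF h(2) Ts(1) T(2)] set_integrable_subset[OF h(3) Ts(1) T(2)] by auto
  note H = H1_onI[OF T(1) g i]
  show "v \<in> H1_on T" by (rule H(1))
  show "H1_norm2 T v \<le> H1_norm2 S v"
    unfolding H(2) unfolding H1_norm2_def
    by (intro add_mono set_integral_nonneg_mono_set h Ts T(2)) auto
qed

lemma norm_sq_diff_le: "(norm (a - b :: 'a::real_inner))\<^sup>2 \<le> 2 * (norm a)\<^sup>2 + 2 * (norm b)\<^sup>2"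
  using zero_le_power2[of "norm (a + b)"] unfolding power2_norm_eq_inner
  by (simp add: inner_add_left inner_add_right inner_diff_left inner_diff_right inner_commute algebra_simps)

lemma norm_sq_add_le: "(norm (a + b :: 'a::real_inner))\<^sup>2 \<le> 2 * (norm a)\<^sup>2 + 2 * (norm b)\<^sup>2"
  using norm_sq_diff_le[of a "- b"] by simp

lemma H1_diff:
  fixes v w :: "real^'n::finite \<Rightarrow> real"
  assumes S: "open S" and v: "v \<in> H1_on S" and w: "w \<in> H1_on S"
  shows "(\<lambda>x. v x - w x) \<in> H1_on S" "H1_norm2 S (\<lambda>x. v x - w x) \<le> 2 * H1_norm2 S v + 2 * H1_norm2 S w"
proof -
  note hv = H1_onD[OF v] and hw = H1_onD[OF w]
  note g = has_weak_gradient_diff[OF hv(1) hw(1)]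
  have [measurable]: "S \<in> sets borel" using S by simp
  have [measurable]: "weak_gradient S v \<in> borel_measurable borel" "weak_gradient S w \<in> borel_measurable borel"
    using has_weak_gradientD(1)[OF hv(1)] has_weak_gradientD(1)[OF hw(1)] by auto
  note m = weakly_differentiable_measurable[OF S hv(1)] weakly_differentiable_measurable[OF S hw(1)]
  have "integrable lborel (\<lambda>x. (indicator S x * v x)\<^sup>2)" "integrable lborel (\<lambda>x. (indicator S x * w x)\<^sup>2)"
    using hv(2) hw(2) by (simp_all add: set_integrable_def sq_indicator)
  note sd = square_integrable_diff[OF m this]
  have e: "(indicator S x * v x - indicator S x * w x)\<^sup>2 = indicator S x *\<^sub>R (v x - w x)\<^sup>2" for x by (auto simp: indicator_def)
  have i1: "set_integrable lborel S (\<lambda>x. (v x - w x)\<^sup>2)" using sd(1) unfolding e set_integrable_def .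
  have l1: "(LINT x:S|lborel. (v x - w x)\<^sup>2) \<le> 2 * (LINT x:S|lborel. (v x)\<^sup>2) + 2 * (LINT x:S|lborel. (w x)\<^sup>2)"
    using sd(2) unfolding e sq_indicator set_lebesgue_integral_def by simp
  let ?B = "\<lambda>x. 2 * (norm (weak_gradient S v x))\<^sup>2 + 2 * (norm (weak_gradient S w x))\<^sup>2"
  have iB: "set_integrable lborel S ?B" by (intro set_integral_add set_integrable_mult_right hv(3) hw(3))
  have i2: "set_integrable lborel S (\<lambda>x. (norm (weak_gradient S v x - weak_gradient S w x))\<^sup>2)"
  proof (rule set_integrable_bound[OF iB])
    show "set_borel_measurable lborel S (\<lambda>x. (norm (weak_gradient S v x - weak_gradient S w x))\<^sup>2)"
      unfolding set_borel_measurable_def by measurable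
    show "AE x in lborel. x \<in> S \<longrightarrow> norm ((norm (weak_gradient S v x - weak_gradient S w x))\<^sup>2) \<le> norm (?B x)"
      using norm_sq_diff_le[of "weak_gradient S v _" "weak_gradient S w _"] by (intro AE_I2) auto
  qed
  have l2: "(LINT x:S|lborel. (norm (weak_gradient S v x - weak_gradient S w x))\<^sup>2) \<le> 
      2 * (LINT x:S|lborel. (norm (weak_gradient S v x))\<^sup>2) + 2 * (LINT x:S|lborel. (norm (weak_gradient S w x))\<^sup>2)"
  proof -
    have "(LINT x:S|lborel. (norm (weak_gradient S v x - weak_gradient S w x))\<^sup>2) \<le> (LINT x:S|lborel. ?B x)"
      by (rule set_integral_mono[OF i2 iB]) (rule norm_sq_diff_le)
    also have "\<dots> = 2 * (LINT x:S|lborel. (norm (weak_gradient S v x))\<^sup>2) + 2 * (LINT x:S|lborel. (norm (weak_gradient S w x))\<^sup>2)"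
      by (subst set_integral_add(2)) (auto intro: set_integrable_mult_right hv(3) hw(3))
    finally show ?thesis .
  qed
  note H = H1_onI[OF S g i1 i2]
  show "(\<lambda>x. v x - w x) \<in> H1_on S" by (rule H(1))
  show "H1_norm2 S (\<lambda>x. v x - w x) \<le> 2 * H1_norm2 S v + 2 * H1_norm2 S w"
    unfolding H(2) using l1 l2 by (simp add: H1_norm2_def)
qed

lemma H1_norm2_nonneg: "0 \<le> H1_norm2 S v"
  unfolding H1_norm2_def set_lebesgue_integral_def by (intro add_nonneg_nonneg integral_nonneg_AE) auto

definition shell :: "real \<Rightarrow> real \<Rightarrow> (real^'n::finite) set" where
  "shell a b = {x. a < norm x \<and> norm x < b}"

lemma open_shell: "open (shell a b)"
  unfolding shell_def by (intro open_Collect_conj open_Collect_less continuous_intros)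

lemma grad_norm_sq: "grad (\<lambda>x::real^'n::finite. c - (norm x)\<^sup>2) x = (-2) *\<^sub>R x"
proof (rule grad_eqI)
  have "((\<lambda>x::real^'n. c - x \<bullet> x) has_derivative (\<lambda>h. 0 - (x \<bullet> h + h \<bullet> x))) (at x)"
    by (intro has_derivative_diff has_derivative_const has_derivative_inner has_derivative_ident)
  moreover have "(\<lambda>h. 0 - (x \<bullet> h + h \<bullet> x)) = (\<lambda>h. ((-2) *\<^sub>R x) \<bullet> h)" by (auto simp: inner_commute)
  ultimately show "((\<lambda>x. c - (norm x)\<^sup>2) has_derivative (\<lambda>h. ((-2) *\<^sub>R x) \<bullet> h)) (at x)"
    by (simp only: power2_norm_eq_inner)
qed

text \<open>
Apply \<open>radial_FTC\<close> between \<open>r\<close> and some \<open>c < b\<close> to \<open>(c\<^sup>2 - |x|\<^sup>2) f\<^sup>2\<close>. The cutoff vanishes on the outer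
sphere, so only the integral over the sphere of radius \<open>r\<close> is left at the boundary.
\<close>

lemma trace_inequality:
  assumes ar: "0 \<le> a" "a < r" "r < b"
  shows "\<exists>C\<ge>0. \<forall>f::real^'n::finite \<Rightarrow> real. Ck_on 1 (shell a b) f \<longrightarrow> f \<in> H1_on (shell a b) \<longrightarrow> 
     (LINT x|sphere_measure r. (f x)\<^sup>2) \<le> C * H1_norm2 (shell a b) f"
proof -
  \<comment> \<open>any radius strictly between \<open>r\<close> and \<open>b\<close> serves as the outer end of the cutoff\<close>
  define c where "c = (r + b) / 2"
  have c: "r < c" "c < b" "0 < r" using ar by (auto simp: c_def)
  have cr: "c\<^sup>2 - r\<^sup>2 > 0" using c by (simp add: power_strict_mono)
  define C where "C = (2 * c + c\<^sup>2) / (c\<^sup>2 - r\<^sup>2)"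
  have C0: "C \<ge> 0" using c cr by (simp add: C_def)
  have "(LINT x|sphere_measure r. (f x)\<^sup>2) \<le> C * H1_norm2 (shell a b) f"
    if f: "Ck_on 1 (shell a b) f" and H: "f \<in> H1_on (shell a b)" for f :: "real^'n \<Rightarrow> real"
  proof -
    let ?N = "CARD('n)" and ?A = "shell a b :: (real^'n) set"
    define Q where "Q = inverse (r ^ (?N - 1))"
    have Q: "Q > 0" using c by (simp add: Q_def)
    let ?\<chi> = "\<lambda>x::real^'n. c\<^sup>2 - (norm x)\<^sup>2"
    let ?G = "\<lambda>x. ?\<chi> x * (f x * f x)"
    have C\<chi>: "Ck_on 1 ?A ?\<chi>" by (intro Ck_on_diff[OF open_shell] Ck_on_const Ck_on_subset[OF Ck_on_norm_sq]) auto
    have CG: "Ck_on 1 ?A ?G" by (intro Ck_on_mult[OF open_shell] f C\<chi>)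
    have sub: "cshell r c \<subseteq> ?A" using c ar by (auto simp: cshell_def shell_def)
    note F = radial_FTC[OF c(3,1) open_shell sub CG]
    note wf = classical_gradient_weak[OF open_shell f]
    have df: "f differentiable (at x)" "?\<chi> differentiable (at x)" if "x \<in> ?A" for x
      using Ck1_D(1)[OF open_shell f that] Ck1_D(1)[OF open_shell C\<chi> that] by auto
    have gG: "grad ?G x = (f x * f x) *\<^sub>R ((-2) *\<^sub>R x) + ?\<chi> x *\<^sub>R (f x *\<^sub>R grad f x + f x *\<^sub>R grad f x)" if x: "x \<in> ?A" for x
      by (subst grad_mult[OF df(2)[OF x] differentiable_mult[OF df(1)[OF x] df(1)[OF x]]], 
          subst grad_mult[OF df(1)[OF x] df(1)[OF x]], subst grad_norm_sq) simp
    have Sc: "(LINT x|sphere_measure c. ?G x) = 0"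
    proof -
      have "(LINT x|sphere_measure c. ?G x) = (LINT x|(sphere_measure c :: (real^'n) measure). 0)"
        by (rule Bochner_Integration.integral_cong) auto
      thus ?thesis by simp
    qed
    have Sr: "(LINT x|sphere_measure r. ?G x) = (c\<^sup>2 - r\<^sup>2) * (LINT x|sphere_measure r. (f x)\<^sup>2)"
    proof -
      have "(LINT x|sphere_measure r. ?G x) = (LINT x|sphere_measure r. (c\<^sup>2 - r\<^sup>2) * (f x)\<^sup>2)"
        by (rule Bochner_Integration.integral_cong) (auto simp: power2_eq_square)
      thus ?thesis by simp
    qed
    let ?R = "\<lambda>x. Q * ((2 * c + c\<^sup>2) * ((f x)\<^sup>2 + (norm (grad f x))\<^sup>2))"
    have cf: "continuous_on (cshell r c) f" "continuous_on (cshell r c) (grad f)"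
      using Ck1_D[OF open_shell f] continuous_on_subset[OF _ sub] by blast+
    have Ri: "set_integrable lborel (cshell r c) ?R"
      by (intro set_integrable_continuous_compact compact_cshell continuous_intros cf)
    have bound: "- (inverse (norm x ^ (?N - 1)) * (grad ?G x \<bullet> sgn x)) \<le> ?R x" if x: "x \<in> cshell r c" for x
    proof -
      have xr: "r \<le> norm x" "norm x \<le> c" using x by (auto simp: cshell_def)
      have xA: "x \<in> ?A" using x sub by blast
      have s1: "norm (sgn x) \<le> 1" by (simp add: norm_sgn)
      have "\<bar>grad ?G x \<bullet> sgn x\<bar> \<le> norm (grad ?G x) * norm (sgn x)" by (rule Cauchy_Schwarz_ineq2)
      also have "\<dots> \<le> norm (grad ?G x)" using s1 by (simp add: mult_left_le)
      also have "\<dots> \<le> norm ((f x * f x) *\<^sub>R ((-2) *\<^sub>R x)) + norm (?\<chi> x *\<^sub>R (f x *\<^sub>R grad f x + f x *\<^sub>R grad f x))"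
        unfolding gG[OF xA] by (rule norm_triangle_ineq)
      also have "norm ((f x * f x) *\<^sub>R ((-2) *\<^sub>R x)) = 2 * norm x * (f x)\<^sup>2" by (simp add: power2_eq_square)
      also have "f x *\<^sub>R grad f x + f x *\<^sub>R grad f x = (2 * f x) *\<^sub>R grad f x" by (simp add: scaleR_2 flip: scaleR_scaleR)
      also have "norm (?\<chi> x *\<^sub>R ((2 * f x) *\<^sub>R grad f x)) = ?\<chi> x * (2 * \<bar>f x\<bar> * norm (grad f x))"
        using xr c by (simp add: abs_mult power_mono)
      also have "2 * norm x * (f x)\<^sup>2 + ?\<chi> x * (2 * \<bar>f x\<bar> * norm (grad f x)) \<le> 2 * c * (f x)\<^sup>2 + c\<^sup>2 * (\<bar>f x\<bar>\<^sup>2 + (norm (grad f x))\<^sup>2)"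
        using xr c by (intro add_mono mult_mono sum_squares_bound) auto
      also have "\<dots> \<le> (2 * c + c\<^sup>2) * ((f x)\<^sup>2 + (norm (grad f x))\<^sup>2)" using c by (simp add: algebra_simps)
      finally have g: "\<bar>grad ?G x \<bullet> sgn x\<bar> \<le> (2 * c + c\<^sup>2) * ((f x)\<^sup>2 + (norm (grad f x))\<^sup>2)" .
      have iq: "0 \<le> inverse (norm x ^ (?N - 1))" "inverse (norm x ^ (?N - 1)) \<le> Q"
        using xr c unfolding Q_def by (auto intro!: le_imp_inverse_le power_mono)
      have "- (inverse (norm x ^ (?N - 1)) * (grad ?G x \<bullet> sgn x)) \<le> inverse (norm x ^ (?N - 1)) * \<bar>grad ?G x \<bullet> sgn x\<bar>"
        using mult_left_mono[OF abs_ge_minus_self[of "grad ?G x \<bullet> sgn x"] iq(1)] by simp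
      also have "\<dots> \<le> ?R x" using g iq Q by (intro mult_mono) auto
      finally show ?thesis .
    qed
    have "Q * ((c\<^sup>2 - r\<^sup>2) * (LINT x|sphere_measure r. (f x)\<^sup>2)) = - (LINT x:cshell r c|lborel. inverse (norm x ^ (?N - 1)) * (grad ?G x \<bullet> sgn x))"
      unfolding F(2) Sc Sr by (simp add: Q_def)
    also have "\<dots> = (LINT x:cshell r c|lborel. - (inverse (norm x ^ (?N - 1)) * (grad ?G x \<bullet> sgn x)))"
      by (simp add: set_lebesgue_integral_def)
    also have "\<dots> \<le> (LINT x:cshell r c|lborel. ?R x)"
    proof (rule set_integral_mono[OF _ Ri bound])
      show "set_integrable lborel (cshell r c) (\<lambda>x. - (inverse (norm x ^ (?N - 1)) * (grad ?G x \<bullet> sgn x)))"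
        using F(1) unfolding set_integrable_def by simp
    qed
    also have "\<dots> = Q * ((2 * c + c\<^sup>2) * (LINT x:cshell r c|lborel. (f x)\<^sup>2 + (norm (grad f x))\<^sup>2))"
      by (simp only: set_integral_mult_right)
    also have "(LINT x:cshell r c|lborel. (f x)\<^sup>2 + (norm (grad f x))\<^sup>2) \<le> H1_norm2 ?A f"
    proof -
      have sq: "(norm (indicator ?A x *\<^sub>R grad f x))\<^sup>2 = (norm (grad f x))\<^sup>2" if "x \<in> ?A" for x using that by simp
      have iA: "set_integrable lborel ?A (\<lambda>x. (norm (indicator ?A x *\<^sub>R grad f x))\<^sup>2)"
        using H1_onD(3)[OF H] weak_gradient_norm_sq_cong(1)[OF open_shell wf] by simp
      have cm: "cshell r c \<in> sets lborel" by (simp add: borel_closed[OF compact_imp_closed[OF compact_cshell]])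
      have Am: "?A \<in> sets lborel" by (simp add: borel_open[OF open_shell])
      have "(LINT x:cshell r c|lborel. (f x)\<^sup>2 + (norm (grad f x))\<^sup>2) = (LINT x:cshell r c|lborel. (f x)\<^sup>2 + (norm (indicator ?A x *\<^sub>R grad f x))\<^sup>2)"
        by (rule set_lebesgue_integral_cong[OF cm]) (use sub in auto)
      also have "\<dots> \<le> (LINT x:?A|lborel. (f x)\<^sup>2 + (norm (indicator ?A x *\<^sub>R grad f x))\<^sup>2)"
        by (rule set_integral_nonneg_mono_set[OF set_integral_add(1)[OF H1_onD(2)[OF H] iA] cm Am sub]) auto
      also have "\<dots> = (LINT x:?A|lborel. (f x)\<^sup>2) + (LINT x:?A|lborel. (norm (indicator ?A x *\<^sub>R grad f x))\<^sup>2)"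
        by (rule set_integral_add(2)[OF H1_onD(2)[OF H] iA])
      also have "\<dots> = H1_norm2 ?A f" unfolding H1_norm2_def weak_gradient_norm_sq_cong(2)[OF open_shell wf] ..
      finally show ?thesis .
    qed
    finally have "Q * ((c\<^sup>2 - r\<^sup>2) * (LINT x|sphere_measure r. (f x)\<^sup>2)) \<le> Q * ((2 * c + c\<^sup>2) * H1_norm2 ?A f)"
      using Q c by (simp add: mult_left_mono)
    hence "(c\<^sup>2 - r\<^sup>2) * (LINT x|sphere_measure r. (f x)\<^sup>2) \<le> (2 * c + c\<^sup>2) * H1_norm2 ?A f"
      using Q by (simp only: mult_le_cancel_left_pos)
    thus ?thesis unfolding C_def using cr by (simp add: field_simps)
  qed
  thus ?thesis using C0 by blast
qed

lemma smooth_continuous_sphere: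
  assumes "smooth_on (shell a b) f" "a < r" "r < b"
  shows "continuous_on (sphere 0 r) f"
  by (rule continuous_on_subset[OF Ck1_D(3)[OF open_shell smooth_onD[OF assms(1)]]]) (use assms in \<open>auto simp: shell_def\<close>)

lemma has_sphere_trace_shell:
  "has_sphere_trace r u h \<longleftrightarrow>
     h \<in> borel_measurable (sphere_measure r) \<and>
     integrable (sphere_measure r) (\<lambda>x. (h x)\<^sup>2) \<and>
     (\<exists>a b. 0 \<le> a \<and> a < r \<and> r < b \<and> u \<in> H1_on (shell a b) \<and>
           (\<exists>w :: nat \<Rightarrow> real^'n::finite \<Rightarrow> real.
              (\<forall>k. smooth_on (shell a b) (w k) \<and> w k \<in> H1_on (shell a b)) \<and>
              (\<lambda>k. H1_norm2 (shell a b) (\<lambda>x. w k x - u x)) \<longlonglongrightarrow> 0 \<and>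
              (\<lambda>k. LINT x|sphere_measure r. (w k x - h x)\<^sup>2) \<longlonglongrightarrow> 0))"
  unfolding has_sphere_trace_def shell_def Let_def by simp

lemma sphere_square_integrable:
  assumes "r > 0" "smooth_on (shell a b) (f :: real^'n::finite \<Rightarrow> real)" "a < r" "r < b"
  shows "f \<in> borel_measurable (sphere_measure r)" "integrable (sphere_measure r) (\<lambda>x. (f x)\<^sup>2)"
  using smooth_continuous_sphere[OF assms(2-4)]
  by (auto intro!: continuous_on_sphere_measurable integrable_sphere_continuous continuous_intros assms(1))

text \<open>
By the trace inequality the restrictions to the sphere form an \<open>L\<^sup>2\<close>-Cauchy sequence.
\<close>

lemma sphere_trace_exists:
  fixes w :: "nat \<Rightarrow> real^'n::finite \<Rightarrow> real"
  assumes ar: "0 \<le> a" "a < r" "r < b" and u: "u \<in> H1_on (shell a b)"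
    and w: "\<And>k. smooth_on (shell a b) (w k)" "\<And>k. w k \<in> H1_on (shell a b)"
    and lim: "(\<lambda>k. H1_norm2 (shell a b) (\<lambda>x. w k x - u x)) \<longlonglongrightarrow> 0"
  shows "\<exists>h. has_sphere_trace r u h"
proof -
  let ?A = "shell a b :: (real^'n) set"
  have r: "r > 0" using ar by simp
  obtain C where C: "C \<ge> 0" "\<And>f::real^'n \<Rightarrow> real. Ck_on 1 ?A f \<Longrightarrow> f \<in> H1_on ?A \<Longrightarrow> (LINT x|sphere_measure r. (f x)\<^sup>2) \<le> C * H1_norm2 ?A f"
    using trace_inequality[OF ar] by blast
  have wu: "(\<lambda>x. w k x - u x) \<in> H1_on ?A" for k by (rule H1_diff(1)[OF open_shell w(2) u])
  have le: "(LINT x|sphere_measure r. (w m x - w n x)\<^sup>2) \<le> 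
      C * (2 * H1_norm2 ?A (\<lambda>x. w m x - u x) + 2 * H1_norm2 ?A (\<lambda>x. w n x - u x))" for m n
  proof -
    have "(LINT x|sphere_measure r. (w m x - w n x)\<^sup>2) \<le> C * H1_norm2 ?A (\<lambda>x. w m x - w n x)"
      by (intro C(2) smooth_onD[OF smooth_on_diff[OF open_shell w(1) w(1)]] H1_diff(1)[OF open_shell w(2) w(2)])
    also have "H1_norm2 ?A (\<lambda>x. w m x - w n x) \<le> 2 * H1_norm2 ?A (\<lambda>x. w m x - u x) + 2 * H1_norm2 ?A (\<lambda>x. w n x - u x)"
      using H1_diff(2)[OF open_shell wu[of m] wu[of n]] by simp
    finally show ?thesis using C(1) by (simp add: mult_left_mono)
  qed
  have "\<exists>h. h \<in> borel_measurable (sphere_measure r) \<and> integrable (sphere_measure r) (\<lambda>x. (h x)\<^sup>2) \<and> 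
      (\<lambda>n. \<integral>x. (w n x - h x)\<^sup>2 \<partial>sphere_measure r) \<longlonglongrightarrow> 0"
  proof (rule L2_complete[OF finite_sphere_measure[OF r]])
    show "w n \<in> borel_measurable (sphere_measure r)" "integrable (sphere_measure r) (\<lambda>x. (w n x)\<^sup>2)" for n
      using sphere_square_integrable[OF r w(1) ar(2,3)] by auto
    fix e :: real assume e: "e > 0"
    have "(\<lambda>k. C * (4 * H1_norm2 ?A (\<lambda>x. w k x - u x))) \<longlonglongrightarrow> C * (4 * 0)"
      by (intro tendsto_mult tendsto_const lim)
    hence "\<forall>\<^sub>F k in sequentially. C * (4 * H1_norm2 ?A (\<lambda>x. w k x - u x)) < e"
      using e by (intro order_tendstoD(2)[of _ "C * (4 * 0)"]) auto
    then obtain N where N: "\<And>k. k \<ge> N \<Longrightarrow> C * (4 * H1_norm2 ?A (\<lambda>x. w k x - u x)) < e" by (auto simp: eventually_sequentially)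
    show "\<exists>N. \<forall>m\<ge>N. \<forall>n\<ge>N. (\<integral>x. (w m x - w n x)\<^sup>2 \<partial>sphere_measure r) < e"
    proof (intro exI allI impI)
      fix m n assume "m \<ge> N" "n \<ge> N"
      with N[of m] N[of n] le[of m n] show "(\<integral>x. (w m x - w n x)\<^sup>2 \<partial>sphere_measure r) < e"
        by (simp add: algebra_simps)
    qed
  qed
  then show ?thesis unfolding has_sphere_trace_shell using ar u w lim by blast
qed

text \<open>
Two approximations of \<open>u\<close> in \<open>H\<^sup>1\<close> approach each other on the common shell, hence so do their
restrictions to the sphere. Thus a trace obtained from one approximation is the limit of every other one.
\<close>

lemma sphere_trace_limit:
  fixes w :: "nat \<Rightarrow> real^'n::finite \<Rightarrow> real"
  assumes ar: "0 \<le> a" "a < r" "r < b" and u: "u \<in> H1_on (shell a b)"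
    and w: "\<And>k. smooth_on (shell a b) (w k)" "\<And>k. w k \<in> H1_on (shell a b)"
    and lim: "(\<lambda>k. H1_norm2 (shell a b) (\<lambda>x. w k x - u x)) \<longlonglongrightarrow> 0"
    and h: "has_sphere_trace r u h"
  shows "(\<lambda>k. LINT x|sphere_measure r. (w k x - h x)\<^sup>2) \<longlonglongrightarrow> 0"
proof -
  have r: "r > 0" using ar by simp
  obtain a' b' w' where a': "0 \<le> a'" "a' < r" "r < b'" and u': "u \<in> H1_on (shell a' b')"
    and w': "\<And>k. smooth_on (shell a' b') (w' k)" "\<And>k. w' k \<in> H1_on (shell a' b')"
    and lim': "(\<lambda>k. H1_norm2 (shell a' b') (\<lambda>x. w' k x - u x)) \<longlonglongrightarrow> 0"
    and limh: "(\<lambda>k. LINT x|sphere_measure r. (w' k x - h x)\<^sup>2) \<longlonglongrightarrow> 0"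
    and mh: "h \<in> borel_measurable (sphere_measure r)" and ih: "integrable (sphere_measure r) (\<lambda>x. (h x)\<^sup>2)"
    using h unfolding has_sphere_trace_shell by blast
  define A where "A = (shell (max a a') (min b b') :: (real^'n) set)"
  have oA: "open A" unfolding A_def by (rule open_shell)
  have sub: "A \<subseteq> shell a b" "A \<subseteq> shell a' b'" by (auto simp: A_def shell_def)
  obtain C where C: "C \<ge> 0" "\<And>f::real^'n \<Rightarrow> real. Ck_on 1 A f \<Longrightarrow> f \<in> H1_on A \<Longrightarrow> (LINT x|sphere_measure r. (f x)\<^sup>2) \<le> C * H1_norm2 A f"
    using trace_inequality[of "max a a'" r "min b b'"] ar a' unfolding A_def by fastforce
  have wu: "(\<lambda>x. w k x - u x) \<in> H1_on (shell a b)" "(\<lambda>x. w' k x - u x) \<in> H1_on (shell a' b')" for k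
    by (rule H1_diff(1)[OF open_shell w(2) u], rule H1_diff(1)[OF open_shell w'(2) u'])
  note R = H1_restrict[OF wu(1) open_shell oA sub(1)] and R' = H1_restrict[OF wu(2) open_shell oA sub(2)]
  let ?b = "\<lambda>k. C * (2 * H1_norm2 (shell a b) (\<lambda>x. w k x - u x) + 2 * H1_norm2 (shell a' b') (\<lambda>x. w' k x - u x))"
  have le: "(LINT x|sphere_measure r. (w k x - w' k x)\<^sup>2) \<le> ?b k" for k
  proof -
    have "(LINT x|sphere_measure r. (w k x - w' k x)\<^sup>2) \<le> C * H1_norm2 A (\<lambda>x. w k x - w' k x)"
      by (intro C(2) smooth_onD[OF smooth_on_diff[OF oA]] smooth_on_subset[OF w(1) sub(1)] smooth_on_subset[OF w'(1) sub(2)]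
         H1_diff(1)[OF oA] H1_restrict(1)[OF w(2) open_shell oA sub(1)] H1_restrict(1)[OF w'(2) open_shell oA sub(2)])
    also have "H1_norm2 A (\<lambda>x. w k x - w' k x) \<le> 2 * H1_norm2 A (\<lambda>x. w k x - u x) + 2 * H1_norm2 A (\<lambda>x. w' k x - u x)"
      using H1_diff(2)[OF oA R(1) R'(1), of k k] by simp
    also have "\<dots> \<le> 2 * H1_norm2 (shell a b) (\<lambda>x. w k x - u x) + 2 * H1_norm2 (shell a' b') (\<lambda>x. w' k x - u x)"
      using R(2)[of k] R'(2)[of k] by simp
    finally show ?thesis using C(1) by (simp add: mult_left_mono)
  qed
  have "(\<lambda>k. 2 * ?b k + 2 * (LINT x|sphere_measure r. (w' k x - h x)\<^sup>2)) \<longlonglongrightarrow> 2 * (C * (2 * 0 + 2 * 0)) + 2 * 0"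
    by (intro tendsto_intros lim lim' limh)
  hence l0: "(\<lambda>k. 2 * ?b k + 2 * (LINT x|sphere_measure r. (w' k x - h x)\<^sup>2)) \<longlonglongrightarrow> 0" by simp
  show ?thesis
  proof (rule tendsto_0_sandwich[OF _ _ l0])
    fix k
    show "0 \<le> (LINT x|sphere_measure r. (w k x - h x)\<^sup>2)" by simp
    note m = sphere_square_integrable[OF r w(1) ar(2,3), of k] sphere_square_integrable[OF r w'(1) a'(2,3), of k]
    note d1 = square_integrable_diff[OF m(1,3,2,4)]
    note d2 = square_integrable_diff[OF mh m(3) ih m(4)]
    have "(LINT x|sphere_measure r. ((w k x - w' k x) - (h x - w' k x))\<^sup>2) \<le> 
       2 * (LINT x|sphere_measure r. (w k x - w' k x)\<^sup>2) + 2 * (LINT x|sphere_measure r. (h x - w' k x)\<^sup>2)"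
      by (rule square_integrable_diff(2)[OF _ _ d1(1) d2(1)]) (use m mh in auto)
    hence "(LINT x|sphere_measure r. (w k x - h x)\<^sup>2) \<le> 
       2 * (LINT x|sphere_measure r. (w k x - w' k x)\<^sup>2) + 2 * (LINT x|sphere_measure r. (w' k x - h x)\<^sup>2)"
      by (simp add: power2_commute[of "h _"])
    thus "(LINT x|sphere_measure r. (w k x - h x)\<^sup>2) \<le> 2 * ?b k + 2 * (LINT x|sphere_measure r. (w' k x - h x)\<^sup>2)"
      using le[of k] by linarith
  qed
qed

section \<open>The ground state\<close>

lemma open_regular_set: "open (regular_set :: (real^'n::finite) set)"
  unfolding regular_set_def by (intro open_Collect_conj open_Collect_neq continuous_intros)

lemma AE_regular_set: "AE x in lborel. x \<in> (regular_set :: (real^'n::finite) set)"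
proof -
  have "sphere (0::real^'n) r \<in> null_sets lborel" for r
  proof -
    have "sphere (0::real^'n) r \<in> null_sets (completion lborel)"
      using negligible_sphere[of "0::real^'n" r] by (simp only: negligible_iff_null_sets)
    thus ?thesis by (subst (asm) null_sets_completion_iff) simp_all
  qed
  hence "(\<Union>m. sphere (0::real^'n) (bessel_J0_zero m)) \<in> null_sets lborel" by (intro null_sets_UN) auto
  hence "AE x in lborel. x \<notin> (\<Union>m. sphere (0::real^'n) (bessel_J0_zero m))" by (rule AE_not_in)
  moreover have "AE x in lborel. x \<noteq> (0::real^'n)" by (rule AE_lborel_singleton)
  ultimately show ?thesis
  proof eventually_elim
    fix x :: "real^'n" assume x: "x \<notin> (\<Union>m. sphere 0 (bessel_J0_zero m))" "x \<noteq> 0"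
    have "bessel_J0 (norm x) \<noteq> 0"
    proof
      assume "bessel_J0 (norm x) = 0"
      then obtain m where "norm x = bessel_J0_zero m" using J0_zero_is_listed[of "norm x"] x by auto
      thus False using x by auto
    qed
    thus "x \<in> regular_set" using x by (simp add: regular_set_def)
  qed
qed

lemma ground_state_sq: "x \<noteq> 0 \<Longrightarrow> (ground_state x)\<^sup>2 = bessel_weight (x :: real^'n::finite)"
proof -
  assume "x \<noteq> 0"
  have "(norm x powr (- ((real CARD('n) - 2) / 2)))\<^sup>2 = norm x powr (- (real CARD('n) - 2))"
    unfolding power2_eq_square powr_add[symmetric] by (rule arg_cong[where f="\<lambda>a. norm x powr a"]) simp
  thus ?thesis by (simp add: ground_state_def bessel_weight_def power_mult_distrib)
qed

lemma bessel_weight_nonneg [simp]: "0 \<le> bessel_weight x"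
  by (simp add: bessel_weight_def)

lemma bessel_weight_measurable [measurable]: "(bessel_weight :: real^'n::finite \<Rightarrow> real) \<in> borel_measurable borel"
  unfolding bessel_weight_def[abs_def] by measurable

lemma ground_state_measurable [measurable]: "(ground_state :: real^'n::finite \<Rightarrow> real) \<in> borel_measurable borel"
  unfolding ground_state_def[abs_def] by measurable

lemma power_powr_cancel:
  assumes "r > 0" "N \<ge> 1" shows "r ^ (N - 1) * r powr (- (real N - 2)) = (r::real)"
proof -
  have "r ^ (N - 1) = r powr (real N - 1)" using assms by (simp add: powr_realpow[symmetric] of_nat_diff)
  thus ?thesis using assms by (simp add: powr_add[symmetric])
qed

text \<open>
In polar coordinates the Jacobian leaves a factor \<open>r\<close> of the singular weight. As a consequence test functions have
finite weighted energy. This matters because the norm is a sum of Lebesgue integrals, which are zero by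
convention for integrands that are not integrable.
\<close>

lemma bessel_weight_locally_integrable: "set_integrable lborel (cball 0 R) (bessel_weight :: real^'n::finite \<Rightarrow> real)"
proof (cases "R \<ge> 0")
  case False
  hence "cball (0::real^'n) R = {}" by simp
  thus ?thesis by (simp add: set_integrable_def)
next
  case R: True
  let ?N = "CARD('n)"
  have N1: "?N \<ge> 1" using zero_less_card_finite[where 'a='n] by linarith
  have [measurable]: "cball (0::real^'n) R \<in> sets borel" "ball (0::real^'n) 1 \<in> sets borel" by simp_all
  let ?F = "\<lambda>x::real^'n. ennreal (norm (indicator (cball 0 R) x *\<^sub>R bessel_weight x))"
  have "(\<integral>\<^sup>+x. ?F x \<partial>lborel) = (\<integral>\<^sup>+r. (\<integral>\<^sup>+y. ennreal (real ?N * r ^ (?N - 1)) * indicator {0<..} r * indicator (ball 0 1) y * ?F (r *\<^sub>R sgn y) \<partial>lborel) \<partial>lborel)"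
    by (rule polar_nn_integral[symmetric]) measurable
  also have "\<dots> \<le> (\<integral>\<^sup>+r. (\<integral>\<^sup>+y. ennreal (real ?N * R) * indicator {0..R} r * indicator (ball (0::real^'n) 1) y \<partial>lborel) \<partial>lborel)"
  proof (intro nn_integral_mono)
    fix r and y :: "real^'n"
    show "ennreal (real ?N * r ^ (?N - 1)) * indicator {0<..} r * indicator (ball 0 1) y * ?F (r *\<^sub>R sgn y) \<le> ennreal (real ?N * R) * indicator {0..R} r * indicator (ball 0 1) y"
    proof (cases "r > 0 \<and> y \<in> ball 0 1 \<and> y \<noteq> 0 \<and> r \<le> R")
      case True
      hence n: "norm (r *\<^sub>R sgn y) = r" by (simp add: norm_sgn)
      have J: "(bessel_J0 r)\<^sup>2 \<le> 1" using abs_J0_le_1[of r] True abs_square_le_1 by auto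
      have "real ?N * r ^ (?N - 1) * bessel_weight (r *\<^sub>R sgn y) = real ?N * (r ^ (?N - 1) * r powr (- (real ?N - 2))) * (bessel_J0 r)\<^sup>2"
        unfolding bessel_weight_def n by simp
      also have "\<dots> = real ?N * r * (bessel_J0 r)\<^sup>2" using True N1 by (simp only: power_powr_cancel)
      also have "\<dots> \<le> real ?N * R * 1" using True J R by (intro mult_mono) auto
      finally have "real ?N * r ^ (?N - 1) * bessel_weight (r *\<^sub>R sgn y) \<le> real ?N * R" by simp
      hence "ennreal (real ?N * r ^ (?N - 1)) * ennreal (bessel_weight (r *\<^sub>R sgn y)) \<le> ennreal (real ?N * R)"
        using True by (simp add: ennreal_mult[symmetric] ennreal_leI)
      thus ?thesis using True n by (simp add: indicator_def)
    next
      case False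
      have "bessel_weight (0::real^'n) = 0" by (simp add: bessel_weight_def)
      hence "ennreal (real ?N * r ^ (?N - 1)) * indicator {0<..} r * indicator (ball 0 1) y * ?F (r *\<^sub>R sgn y) = 0"
        using False by (auto simp: indicator_def norm_sgn)
      thus ?thesis by (simp only: zero_le)
    qed
  qed
  also have "\<dots> = (\<integral>\<^sup>+r. ennreal (real ?N * R) * indicator {0..R} r * emeasure lborel (ball (0::real^'n) 1) \<partial>lborel)"
    by (intro nn_integral_cong) (subst nn_integral_cmult, auto)
  also have "\<dots> = (\<integral>\<^sup>+r. (ennreal (real ?N * R) * emeasure lborel (ball (0::real^'n) 1)) * indicator {0..R} r \<partial>lborel)"
    by (intro nn_integral_cong) (simp add: mult_ac)
  also have "\<dots> = ennreal (real ?N * R) * emeasure lborel (ball (0::real^'n) 1) * emeasure lborel {0..R}"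
    by (rule nn_integral_cmult_indicator) simp
  also have "\<dots> < \<infinity>"
    using emeasure_bounded_finite[of "ball (0::real^'n) 1"] emeasure_bounded_finite[of "{0..R}"]
    by (auto simp: ennreal_mult_less_top)
  finally show ?thesis unfolding set_integrable_def
    by (intro integrableI_bounded) measurable
qed

lemma grad_ground_state_norm:
  fixes x :: "real^'n::finite"
  assumes "x \<in> regular_set"
  shows "norm (grad ground_state x) = \<bar>ground_state x\<bar> * \<bar>J0' (norm x) / bessel_J0 (norm x) - (real CARD('n) - 2) / 2 / norm x\<bar>"
proof -
  have x: "x \<noteq> 0" "bessel_J0 (norm x) \<noteq> 0" using assms by (auto simp: regular_set_def)
  have "norm (grad ground_state x) = \<bar>ground_state_deriv TYPE('n) (norm x)\<bar>"
    using x by (simp add: ground_state_grad)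
  also have "ground_state_deriv TYPE('n) (norm x) = ground_state x * (J0' (norm x) / bessel_J0 (norm x) - (real CARD('n) - 2) / 2 / norm x)"
    using x unfolding ground_state_deriv_def ground_state_def by (simp add: field_simps)
  finally show ?thesis by (simp only: abs_mult)
qed

lemma indicator_grad_ground_state_measurable:
  "(\<lambda>x::real^'n::finite. indicator regular_set x *\<^sub>R grad ground_state x) \<in> borel_measurable borel"
proof (rule borel_measurable_continuous_on_indicator)
  show "regular_set \<in> sets (borel :: (real^'n) measure)" by (rule borel_open[OF open_regular_set])
  show "continuous_on regular_set (grad ground_state :: real^'n \<Rightarrow> _)"
    by (rule Ck1_D(2)[OF open_regular_set smooth_onD[OF smooth_on_subset[OF ground_state_smooth]]]) (auto simp: regular_set_def)
qed

text \<open>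
The pair \<open>(f, \<gamma>)\<close> stands for a function and its gradient, and \<open>\<phi> \<gamma> + f \<nabla> \<phi>\<close> is the gradient of \<open>\<phi> f\<close>. Where
\<open>|\<nabla> \<phi>| / |\<phi>|\<close> is bounded, the weighted energy of \<open>f\<close> controls the \<open>H\<^sup>1\<close> norm of \<open>\<phi> f\<close>.
\<close>

lemma weighted_pair_bound:
  fixes f :: "real^'n::finite \<Rightarrow> real" and \<gamma> :: "real^'n \<Rightarrow> real^'n"
  assumes f [measurable]: "f \<in> borel_measurable borel" and \<gamma> [measurable]: "\<gamma> \<in> borel_measurable borel"
    and i: "integrable lborel (\<lambda>x. bessel_weight x * (f x)\<^sup>2)" "integrable lborel (\<lambda>x. bessel_weight x * (norm (\<gamma> x))\<^sup>2)"
    and X [measurable]: "X \<in> sets borel" and XR: "X \<subseteq> regular_set"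
    and C: "C \<ge> 0" "\<forall>x\<in>X. norm (grad ground_state x) \<le> C * \<bar>ground_state x\<bar>"
  shows "set_integrable lborel X (\<lambda>x. (ground_state x * f x)\<^sup>2)"
    "(LINT x:X|lborel. (ground_state x * f x)\<^sup>2) \<le> (\<integral>x. bessel_weight x * (f x)\<^sup>2 \<partial>lborel)"
    "set_integrable lborel X (\<lambda>x. (norm (indicator regular_set x *\<^sub>R (ground_state x *\<^sub>R \<gamma> x + f x *\<^sub>R grad ground_state x)))\<^sup>2)"
    "(LINT x:X|lborel. (norm (indicator regular_set x *\<^sub>R (ground_state x *\<^sub>R \<gamma> x + f x *\<^sub>R grad ground_state x)))\<^sup>2) \<le> 
       2 * (\<integral>x. bessel_weight x * (norm (\<gamma> x))\<^sup>2 \<partial>lborel) + 2 * C\<^sup>2 * (\<integral>x. bessel_weight x * (f x)\<^sup>2 \<partial>lborel)"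
proof -
  note [measurable] = indicator_grad_ground_state_measurable
  have w: "(ground_state x)\<^sup>2 = bessel_weight x" if "x \<in> X" for x 
    using that XR by (intro ground_state_sq) (auto simp: regular_set_def)
  have w0: "(indicator X x *\<^sub>R (ground_state x * f x)\<^sup>2) = indicator X x * (bessel_weight x * (f x)\<^sup>2)" for x
    using w[of x] by (auto simp: indicator_def power_mult_distrib)
  have ind: "integrable lborel (\<lambda>x. indicator X x * (bessel_weight x * (f x)\<^sup>2))"
    using integrable_mult_indicator[OF _ i(1), of X] by simp
  show "set_integrable lborel X (\<lambda>x. (ground_state x * f x)\<^sup>2)"
    unfolding set_integrable_def w0 by (rule ind)
  show "(LINT x:X|lborel. (ground_state x * f x)\<^sup>2) \<le> (\<integral>x. bessel_weight x * (f x)\<^sup>2 \<partial>lborel)"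
    unfolding set_lebesgue_integral_def w0 by (rule integral_mono[OF ind i(1)]) (auto simp: indicator_def)
  let ?G = "\<lambda>x. indicator regular_set x *\<^sub>R (ground_state x *\<^sub>R \<gamma> x + f x *\<^sub>R grad ground_state x)"
  let ?B = "\<lambda>x. 2 * (bessel_weight x * (norm (\<gamma> x))\<^sup>2) + 2 * C\<^sup>2 * (bessel_weight x * (f x)\<^sup>2)"
  have iB: "integrable lborel ?B" by (intro Bochner_Integration.integrable_add integrable_mult_right i)
  have bd: "indicator X x *\<^sub>R (norm (?G x))\<^sup>2 \<le> ?B x" for x
  proof (cases "x \<in> X")
    case True
    hence xr: "x \<in> regular_set" using XR by blast
    have "(norm (?G x))\<^sup>2 \<le> 2 * (norm (ground_state x *\<^sub>R \<gamma> x))\<^sup>2 + 2 * (norm (f x *\<^sub>R grad ground_state x))\<^sup>2"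
      using xr norm_sq_add_le[of "ground_state x *\<^sub>R \<gamma> x" "f x *\<^sub>R grad ground_state x"] by (simp del: norm_scaleR)
    also have "(norm (ground_state x *\<^sub>R \<gamma> x))\<^sup>2 = bessel_weight x * (norm (\<gamma> x))\<^sup>2"
      using w[OF True] by (simp add: power_mult_distrib)
    also have "(norm (f x *\<^sub>R grad ground_state x))\<^sup>2 \<le> C\<^sup>2 * (bessel_weight x * (f x)\<^sup>2)"
    proof -
      have "(norm (grad ground_state x))\<^sup>2 \<le> (C * \<bar>ground_state x\<bar>)\<^sup>2" by (intro power_mono bspec[OF C(2) True]) simp
      also have "\<dots> = C\<^sup>2 * bessel_weight x" using w[OF True] by (simp add: power_mult_distrib)
      finally have "(f x)\<^sup>2 * (norm (grad ground_state x))\<^sup>2 \<le> (f x)\<^sup>2 * (C\<^sup>2 * bessel_weight x)" by (intro mult_left_mono) auto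
      thus ?thesis by (simp add: power_mult_distrib mult_ac)
    qed
    finally show ?thesis using True by simp
  qed simp
  have eq: "?G = (\<lambda>x. (indicator regular_set x * ground_state x) *\<^sub>R \<gamma> x + f x *\<^sub>R (indicator regular_set x *\<^sub>R grad ground_state x))"
    by (auto simp: fun_eq_iff indicator_def)
  have [measurable]: "regular_set \<in> sets (borel :: (real^'n) measure)" by (rule borel_open[OF open_regular_set])
  have [measurable]: "?G \<in> borel_measurable borel" unfolding eq by measurable
  have iG: "integrable lborel (\<lambda>x. indicator X x *\<^sub>R (norm (?G x))\<^sup>2)"
  proof (rule Bochner_Integration.integrable_bound[OF iB])
    show "(\<lambda>x. indicator X x *\<^sub>R (norm (?G x))\<^sup>2) \<in> borel_measurable lborel" by measurable
    show "AE x in lborel. norm (indicator X x *\<^sub>R (norm (?G x))\<^sup>2) \<le> norm (?B x)"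
    proof (rule AE_I2)
      fix x
      have "0 \<le> ?B x" by simp
      moreover have "0 \<le> indicator X x *\<^sub>R (norm (?G x))\<^sup>2" by simp
      ultimately show "norm (indicator X x *\<^sub>R (norm (?G x))\<^sup>2) \<le> norm (?B x)" using bd[of x]
        by (simp only: real_norm_def abs_of_nonneg)
    qed
  qed
  thus "set_integrable lborel X (\<lambda>x. (norm (?G x))\<^sup>2)" unfolding set_integrable_def .
  have "(LINT x:X|lborel. (norm (?G x))\<^sup>2) \<le> (\<integral>x. ?B x \<partial>lborel)"
    unfolding set_lebesgue_integral_def by (rule integral_mono[OF iG iB bd])
  also have "\<dots> = 2 * (\<integral>x. bessel_weight x * (norm (\<gamma> x))\<^sup>2 \<partial>lborel) + 2 * C\<^sup>2 * (\<integral>x. bessel_weight x * (f x)\<^sup>2 \<partial>lborel)"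
    using i by simp
  finally show "(LINT x:X|lborel. (norm (?G x))\<^sup>2) \<le> 2 * (\<integral>x. bessel_weight x * (norm (\<gamma> x))\<^sup>2 \<partial>lborel) + 2 * C\<^sup>2 * (\<integral>x. bessel_weight x * (f x)\<^sup>2 \<partial>lborel)" .
qed

lemma weighted_square_diff:
  fixes \<gamma> \<delta> :: "real^'n::finite \<Rightarrow> 'b::euclidean_space"
  assumes [measurable]: "\<gamma> \<in> borel_measurable borel" "\<delta> \<in> borel_measurable borel"
    and i: "integrable lborel (\<lambda>x. bessel_weight x * (norm (\<gamma> x))\<^sup>2)" "integrable lborel (\<lambda>x. bessel_weight x * (norm (\<delta> x))\<^sup>2)"
  shows "integrable lborel (\<lambda>x. bessel_weight x * (norm (\<gamma> x - \<delta> x))\<^sup>2)"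
proof (rule Bochner_Integration.integrable_bound)
  let ?B = "\<lambda>x. 2 * (bessel_weight x * (norm (\<gamma> x))\<^sup>2) + 2 * (bessel_weight x * (norm (\<delta> x))\<^sup>2)"
  show "integrable lborel ?B" by (intro Bochner_Integration.integrable_add integrable_mult_right i)
  show "(\<lambda>x. bessel_weight x * (norm (\<gamma> x - \<delta> x))\<^sup>2) \<in> borel_measurable lborel" by measurable
  show "AE x in lborel. norm (bessel_weight x * (norm (\<gamma> x - \<delta> x))\<^sup>2) \<le> norm (?B x)"
  proof (rule AE_I2)
    fix x
    have "bessel_weight x * (norm (\<gamma> x - \<delta> x))\<^sup>2 \<le> bessel_weight x * (2 * (norm (\<gamma> x))\<^sup>2 + 2 * (norm (\<delta> x))\<^sup>2)"
      by (intro mult_left_mono norm_sq_diff_le) simp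
    also have "\<dots> = ?B x" by (simp add: algebra_simps)
    finally have "bessel_weight x * (norm (\<gamma> x - \<delta> x))\<^sup>2 \<le> ?B x" .
    moreover have "0 \<le> bessel_weight x * (norm (\<gamma> x - \<delta> x))\<^sup>2" by simp
    moreover have "0 \<le> ?B x" by simp
    ultimately show "norm (bessel_weight x * (norm (\<gamma> x - \<delta> x))\<^sup>2) \<le> norm (?B x)" by (simp only: real_norm_def abs_of_nonneg)
  qed
qed

lemma weighted_compact_support:
  fixes \<gamma> :: "real^'n::finite \<Rightarrow> 'b::euclidean_space"
  assumes c: "continuous_on UNIV \<gamma>" and K: "compact K" "\<And>x. x \<notin> K \<Longrightarrow> \<gamma> x = 0"
  shows "integrable lborel (\<lambda>x. bessel_weight x * (norm (\<gamma> x))\<^sup>2)"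
proof -
  obtain R where "\<forall>x\<in>K. norm x \<le> R" using compact_imp_bounded[OF K(1)] unfolding bounded_iff by blast
  hence R: "K \<subseteq> cball 0 R" by auto
  have [measurable]: "\<gamma> \<in> borel_measurable borel" by (rule borel_measurable_continuous_onI[OF c])
  have "set_integrable lborel (cball 0 R) (\<lambda>x. bessel_weight x * (norm (\<gamma> x))\<^sup>2)"
    by (rule set_integrable_mult_continuous_real[OF compact_cball bessel_weight_locally_integrable])
       (intro continuous_intros continuous_on_subset[OF c] subset_UNIV)
  moreover have "indicator (cball 0 R) x *\<^sub>R (bessel_weight x * (norm (\<gamma> x))\<^sup>2) = bessel_weight x * (norm (\<gamma> x))\<^sup>2" for x
    using K(2)[of x] R by (cases "x \<in> K") (auto simp: indicator_def)
  ultimately show ?thesis unfolding set_integrable_def by (simp only:)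
qed

lemma Ck1_radial:
  assumes F: "\<And>r. r > 0 \<Longrightarrow> (F has_real_derivative F' r) (at r)" and c: "continuous_on {0<..} F'"
  shows "Ck_on 1 (- {0}) (\<lambda>x::real^'n::finite. F (norm x))"
    "\<And>x::real^'n. x \<noteq> 0 \<Longrightarrow> grad (\<lambda>x. F (norm x)) x = (F' (norm x) / norm x) *\<^sub>R x"
proof -
  have D: "((\<lambda>x. F (norm x)) has_derivative (\<lambda>h. ((F' (norm x) / norm x) *\<^sub>R x) \<bullet> h)) (at x)" if "x \<noteq> 0" for x :: "real^'n"
    by (rule grad_radial[OF that F]) (use that in simp)
  show "grad (\<lambda>x. F (norm x)) x = (F' (norm x) / norm x) *\<^sub>R x" if "x \<noteq> 0" for x :: "real^'n"
    by (rule grad_eqI[OF D[OF that]])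
  have "continuous_on (- {0}) (partial_deriv i (\<lambda>x::real^'n. F (norm x)))" for i
  proof -
    have "continuous_on (- {0}) (\<lambda>x::real^'n. F' (norm x) / norm x * x $ i)"
      by (intro continuous_intros continuous_on_compose2[OF c]) auto
    moreover have "F' (norm x) / norm x * x $ i = partial_deriv i (\<lambda>x. F (norm x)) x" if "x \<in> - {0}" for x :: "real^'n"
      using partial_deriv_eqI[OF D, of x i] that by (simp add: inner_axis)
    ultimately show ?thesis using continuous_on_cong by (metis (no_types, lifting))
  qed
  moreover have "(\<lambda>x::real^'n. F (norm x)) differentiable_on - {0}"
    using D by (intro differentiable_at_imp_differentiable_on) (auto simp: differentiable_def)
  ultimately show "Ck_on 1 (- {0}) (\<lambda>x::real^'n. F (norm x))" by simp
qed

lemma bounded_multiplier: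
  fixes f P :: "_ \<Rightarrow> real"
  assumes [measurable]: "P \<in> borel_measurable M" "f \<in> borel_measurable M" and i: "integrable M (\<lambda>x. (f x)\<^sup>2)" and B: "\<And>x. \<bar>P x\<bar> \<le> B"
  shows "integrable M (\<lambda>x. (P x * f x)\<^sup>2)" "(\<integral>x. (P x * f x)\<^sup>2 \<partial>M) \<le> B\<^sup>2 * (\<integral>x. (f x)\<^sup>2 \<partial>M)"
proof -
  have le: "(P x * f x)\<^sup>2 \<le> B\<^sup>2 * (f x)\<^sup>2" for x
    unfolding power_mult_distrib using power_mono[OF B[of x], of 2] by (intro mult_right_mono) auto
  have iB: "integrable M (\<lambda>x. B\<^sup>2 * (f x)\<^sup>2)" by (rule integrable_mult_right[OF i])
  show iP: "integrable M (\<lambda>x. (P x * f x)\<^sup>2)"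
    by (rule Bochner_Integration.integrable_bound[OF iB]) (measurable, use le in \<open>auto simp: abs_mult\<close>)
  show "(\<integral>x. (P x * f x)\<^sup>2 \<partial>M) \<le> B\<^sup>2 * (\<integral>x. (f x)\<^sup>2 \<partial>M)"
    using integral_mono[OF iP iB le] by simp
qed

section \<open>The ground state transform\<close>

text \<open>
A function \<open>u = \<phi> v\<close> together with test functions \<open>w k\<close> that converge to \<open>v\<close> in the weighted norm. Every
element of \<open>J_space\<close> arises in this way (\<open>J_space_approx\<close>).
\<close>

locale bessel_approx =
  fixes u v :: "real^'n::finite \<Rightarrow> real" and w :: "nat \<Rightarrow> real^'n \<Rightarrow> real"
  assumes u_borel [measurable]: "u \<in> borel_measurable borel"
    and v_finite: "v \<in> finite_Jtilde_norm"
    and w_test: "\<And>k. w k \<in> test_functions UNIV"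
    and w_lim: "(\<lambda>k. Jtilde_norm2 (\<lambda>x. w k x - v x)) \<longlonglongrightarrow> 0"
    and uv: "AE x in lborel. u x = ground_state x * v x"
begin

definition v_grad where "v_grad = weak_gradient regular_set v"

lemma v_weak_gradient: "has_weak_gradient_on v v_grad regular_set"
proof -
  obtain g0 where "has_weak_gradient_on v g0 regular_set"
    using v_finite by (auto simp: finite_Jtilde_norm_def weakly_differentiable_on_def)
  thus ?thesis unfolding v_grad_def by (rule weak_gradient_works)
qed

lemma v_borel [measurable]: "v \<in> borel_measurable borel"
  using v_finite by (simp add: finite_Jtilde_norm_def)

lemma v_grad_borel [measurable]: "v_grad \<in> borel_measurable borel"
  by (rule has_weak_gradientD(1)[OF v_weak_gradient])

lemma v_integrable: "integrable lborel (\<lambda>x. bessel_weight x * (v x)\<^sup>2)"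
  and v_grad_integrable: "integrable lborel (\<lambda>x. bessel_weight x * (norm (v_grad x))\<^sup>2)"
  using v_finite by (auto simp: finite_Jtilde_norm_def v_grad_def)

lemma w_borel [measurable]: "w k \<in> borel_measurable borel" "grad (w k) \<in> borel_measurable borel"
  by (intro borel_measurable_continuous_onI test_function_continuous[OF w_test])+

lemma test_integrable: "integrable lborel (\<lambda>x. bessel_weight x * (w k x)\<^sup>2)"
  and grad_test_integrable: "integrable lborel (\<lambda>x. bessel_weight x * (norm (grad (w k) x))\<^sup>2)"
proof -
  obtain K where K: "compact K" "\<And>x. x \<notin> K \<Longrightarrow> w k x = 0" "\<And>x i. x \<notin> K \<Longrightarrow> partial_deriv i (w k) x = 0"
    by (rule test_function_support[OF w_test]) blast
  have g0: "grad (w k) x = 0" if "x \<notin> K" for x using K(3)[OF that] by (simp add: grad_def vec_eq_iff)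
  show "integrable lborel (\<lambda>x. bessel_weight x * (norm (grad (w k) x))\<^sup>2)"
    by (rule weighted_compact_support[OF test_function_continuous(2)[OF w_test] K(1) g0])
  show "integrable lborel (\<lambda>x. bessel_weight x * (w k x)\<^sup>2)"
    using weighted_compact_support[OF test_function_continuous(1)[OF w_test] K(1,2)] by simp
qed

lemma diff_integrable: "integrable lborel (\<lambda>x. bessel_weight x * (w k x - v x)\<^sup>2)"
  and grad_diff_integrable: "integrable lborel (\<lambda>x. bessel_weight x * (norm (grad (w k) x - v_grad x))\<^sup>2)"
proof -
  show "integrable lborel (\<lambda>x. bessel_weight x * (norm (grad (w k) x - v_grad x))\<^sup>2)"
    by (rule weighted_square_diff[OF w_borel(2) v_grad_borel grad_test_integrable v_grad_integrable])
  show "integrable lborel (\<lambda>x. bessel_weight x * (w k x - v x)\<^sup>2)"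
    using weighted_square_diff[OF w_borel(1) v_borel] test_integrable v_integrable by simp
qed

lemma test_Ck: "Ck_on n S (w k)"
  by (rule Ck_on_subset[OF smooth_onD[OF test_function_smooth[OF w_test]] subset_UNIV])

lemma diff_weak: "has_weak_gradient_on (\<lambda>x. w k x - v x) (\<lambda>x. indicator regular_set x *\<^sub>R grad (w k) x - v_grad x) regular_set"
  by (rule has_weak_gradient_diff[OF classical_gradient_weak[OF open_regular_set test_Ck] v_weak_gradient])

text \<open>
Splits the convergence in norm into its two parts, with the chosen weak gradient of \<open>w k - v\<close> replaced by the difference
of the classical gradient of \<open>w k\<close> and the weak gradient of \<open>v\<close>.
\<close>

lemma energy_lim:
  shows "(\<lambda>k. \<integral>x. bessel_weight x * (w k x - v x)\<^sup>2 \<partial>lborel) \<longlonglongrightarrow> 0"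
    "(\<lambda>k. \<integral>x. bessel_weight x * (norm (grad (w k) x - v_grad x))\<^sup>2 \<partial>lborel) \<longlonglongrightarrow> 0"
proof -
  have eq: "Jtilde_norm2 (\<lambda>x. w k x - v x) = (\<integral>x. bessel_weight x * (norm (grad (w k) x - v_grad x))\<^sup>2 \<partial>lborel) + (\<integral>x. bessel_weight x * (w k x - v x)\<^sup>2 \<partial>lborel)" for k
  proof -
    have [measurable]: "weak_gradient regular_set (\<lambda>x. w k x - v x) \<in> borel_measurable borel"
      by (rule has_weak_gradientD(1)[OF weak_gradient_works[OF diff_weak]])
    have "(\<integral>x. bessel_weight x * (norm (weak_gradient regular_set (\<lambda>x. w k x - v x) x))\<^sup>2 \<partial>lborel) = (\<integral>x. bessel_weight x * (norm (grad (w k) x - v_grad x))\<^sup>2 \<partial>lborel)"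
    proof (rule integral_cong_AE)
      show "AE x in lborel. bessel_weight x * (norm (weak_gradient regular_set (\<lambda>x. w k x - v x) x))\<^sup>2 = bessel_weight x * (norm (grad (w k) x - v_grad x))\<^sup>2"
        using weak_gradient_AE[OF open_regular_set diff_weak[of k]] AE_regular_set by eventually_elim simp
    qed measurable
    thus ?thesis unfolding Jtilde_norm2_def by simp
  qed
  have nn: "0 \<le> (\<integral>x. bessel_weight x * (norm (grad (w k) x - v_grad x))\<^sup>2 \<partial>lborel)" "0 \<le> (\<integral>x. bessel_weight x * (w k x - v x)\<^sup>2 \<partial>lborel)" for k
    by (intro integral_nonneg_AE AE_I2 mult_nonneg_nonneg; simp)+
  show "(\<lambda>k. \<integral>x. bessel_weight x * (w k x - v x)\<^sup>2 \<partial>lborel) \<longlonglongrightarrow> 0"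
    by (rule tendsto_0_sandwich[OF nn(2) _ w_lim]) (use eq nn in simp)
  show "(\<lambda>k. \<integral>x. bessel_weight x * (norm (grad (w k) x - v_grad x))\<^sup>2 \<partial>lborel) \<longlonglongrightarrow> 0"
    by (rule tendsto_0_sandwich[OF nn(1) _ w_lim]) (use eq nn in simp)
qed

lemma smooth_ground_state: "smooth_on regular_set (ground_state :: real^'n \<Rightarrow> real)"
  by (rule smooth_on_subset[OF ground_state_smooth]) (auto simp: regular_set_def)

definition u_grad where "u_grad x = indicator regular_set x *\<^sub>R (ground_state x *\<^sub>R v_grad x + v x *\<^sub>R grad ground_state x)"

lemma u_weak_gradient: "has_weak_gradient_on u u_grad regular_set"
proof (rule has_weak_gradient_cong_AE[OF open_regular_set _ u_borel])
  show "has_weak_gradient_on (\<lambda>x. ground_state x * v x) u_grad regular_set"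
    unfolding u_grad_def[abs_def] by (rule has_weak_gradient_mult_smooth[OF open_regular_set smooth_ground_state v_weak_gradient v_borel])
  show "AE x in lborel. x \<in> regular_set \<longrightarrow> ground_state x * v x = u x" using uv by eventually_elim simp
qed

definition regular_interval :: "real \<Rightarrow> real \<Rightarrow> bool" where
  "regular_interval a b \<longleftrightarrow> 0 < a \<and> a < b \<and> (\<forall>r\<in>{a..b}. bessel_J0 r \<noteq> 0)"

lemma regular_interval_subset:
  assumes "regular_interval a b"
  shows "cshell a b \<subseteq> (regular_set :: (real^'n) set)" "shell a b \<subseteq> (cshell a b :: (real^'n) set)"
  using assms by (auto simp: regular_interval_def cshell_def shell_def regular_set_def)

lemma regular_interval_grad_bound:
  assumes "regular_interval a b"
  obtains C where "C \<ge> 0" "\<And>x::real^'n. x \<in> cshell a b \<Longrightarrow> norm (grad ground_state x) \<le> C * \<bar>ground_state x\<bar>"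
proof -
  let ?f = "\<lambda>r. J0' r / bessel_J0 r - (real CARD('n) - 2) / 2 / r"
  have "bounded (?f ` {a..b})"
    using assms by (intro compact_imp_bounded compact_continuous_image continuous_intros) (auto simp: regular_interval_def)
  then obtain B where B: "\<And>r. r \<in> {a..b} \<Longrightarrow> norm (?f r) \<le> B" by (rule bounded_imageE) blast
  show thesis
  proof (rule that[of "max B 0"])
    fix x :: "real^'n" assume x: "x \<in> cshell a b"
    hence xr: "x \<in> regular_set" using regular_interval_subset[OF assms] by blast
    have "\<bar>?f (norm x)\<bar> \<le> max B 0" using B[of "norm x"] x by (auto simp: cshell_def le_max_iff_disj)
    thus "norm (grad ground_state x) \<le> max B 0 * \<bar>ground_state x\<bar>"
      unfolding grad_ground_state_norm[OF xr] by (subst mult.commute) (rule mult_right_mono, auto)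
  qed simp
qed

text \<open>
On a shell whose closure avoids the origin and the nodal spheres \<open>\<phi>\<close> is smooth, so the
products \<open>\<phi> w k\<close> are smooth approximations of \<open>u\<close> in \<open>H\<^sup>1\<close> and define its traces directly.
\<close>

lemma shell_approximation:
  assumes ab: "regular_interval a b"
  shows "u \<in> H1_on (shell a b)" "\<And>k. (\<lambda>x. ground_state x * w k x) \<in> H1_on (shell a b)"
    "\<And>k. smooth_on (shell a b) (\<lambda>x. ground_state x * w k x)"
    "(\<lambda>k. H1_norm2 (shell a b) (\<lambda>x. ground_state x * w k x - u x)) \<longlonglongrightarrow> 0"
proof -
  let ?A = "shell a b :: (real^'n) set"
  note sub = regular_interval_subset[OF ab]
  have AR: "?A \<subseteq> regular_set" using sub by blast
  have Am: "?A \<in> sets borel" by (rule borel_open[OF open_shell])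
  obtain C where C: "C \<ge> 0" "\<forall>x::real^'n\<in>?A. norm (grad ground_state x) \<le> C * \<bar>ground_state x\<bar>"
    by (rule regular_interval_grad_bound[OF ab]) (use sub(2) in blast)
  note B = weighted_pair_bound[OF _ _ _ _ Am AR C]
  note Bv = B[OF v_borel v_grad_borel v_integrable v_grad_integrable]
  have u2: "set_integrable lborel ?A (\<lambda>x. (u x)\<^sup>2)"
  proof -
    have [measurable]: "?A \<in> sets borel" by (rule Am)
    have "AE x\<in>?A in lborel. (u x)\<^sup>2 = (ground_state x * v x)\<^sup>2" using uv by eventually_elim simp
    from set_integrable_cong_AE[OF _ _ this] Bv(1) show ?thesis by auto
  qed
  show uH: "u \<in> H1_on ?A"
    by (rule H1_onI(1)[OF open_shell has_weak_gradient_restrict[OF u_weak_gradient AR] u2]) 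
       (use Bv(3) in \<open>simp only: u_grad_def\<close>)
  have gw_m: "(\<lambda>x. indicator regular_set x *\<^sub>R grad (w k) x) \<in> borel_measurable borel" for k
  proof -
    have [measurable]: "regular_set \<in> sets (borel :: (real^'n) measure)" by (rule borel_open[OF open_regular_set])
    show ?thesis by measurable
  qed
  have AEg: "AE x in lborel. bessel_weight x * (norm (indicator regular_set x *\<^sub>R grad (w k) x - c *\<^sub>R v_grad x))\<^sup>2 = bessel_weight x * (norm (grad (w k) x - c *\<^sub>R v_grad x))\<^sup>2" for k c
    using AE_regular_set by eventually_elim simp
  have gw_i: "integrable lborel (\<lambda>x. bessel_weight x * (norm (indicator regular_set x *\<^sub>R grad (w k) x))\<^sup>2)" for k
  proof -
    have m: "(\<lambda>x. bessel_weight x * (norm (indicator regular_set x *\<^sub>R grad (w k) x))\<^sup>2) \<in> borel_measurable lborel" 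
      "(\<lambda>x. bessel_weight x * (norm (grad (w k) x))\<^sup>2) \<in> borel_measurable lborel"
      using gw_m[of k] by measurable
    have ae: "AE x in lborel. bessel_weight x * (norm (indicator regular_set x *\<^sub>R grad (w k) x))\<^sup>2 = bessel_weight x * (norm (grad (w k) x))\<^sup>2"
      using AE_regular_set by eventually_elim simp
    show ?thesis using integrable_cong_AE[OF m ae] grad_test_integrable by blast
  qed
  have gd_m: "(\<lambda>x. indicator regular_set x *\<^sub>R grad (w k) x - v_grad x) \<in> borel_measurable borel" for k
    using gw_m[of k] by measurable
  have gd_eq: "integrable lborel (\<lambda>x. bessel_weight x * (norm (indicator regular_set x *\<^sub>R grad (w k) x - v_grad x))\<^sup>2)" 
    "(\<integral>x. bessel_weight x * (norm (indicator regular_set x *\<^sub>R grad (w k) x - v_grad x))\<^sup>2 \<partial>lborel) = (\<integral>x. bessel_weight x * (norm (grad (w k) x - v_grad x))\<^sup>2 \<partial>lborel)" for k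
  proof -
    have m: "(\<lambda>x. bessel_weight x * (norm (indicator regular_set x *\<^sub>R grad (w k) x - v_grad x))\<^sup>2) \<in> borel_measurable lborel" 
      "(\<lambda>x. bessel_weight x * (norm (grad (w k) x - v_grad x))\<^sup>2) \<in> borel_measurable lborel"
      using gd_m[of k] by measurable
    have ae: "AE x in lborel. bessel_weight x * (norm (indicator regular_set x *\<^sub>R grad (w k) x - v_grad x))\<^sup>2 = bessel_weight x * (norm (grad (w k) x - v_grad x))\<^sup>2"
      using AEg[of k 1] by simp
    show "integrable lborel (\<lambda>x. bessel_weight x * (norm (indicator regular_set x *\<^sub>R grad (w k) x - v_grad x))\<^sup>2)"
      using integrable_cong_AE[OF m ae] grad_diff_integrable by blast
    show "(\<integral>x. bessel_weight x * (norm (indicator regular_set x *\<^sub>R grad (w k) x - v_grad x))\<^sup>2 \<partial>lborel) = (\<integral>x. bessel_weight x * (norm (grad (w k) x - v_grad x))\<^sup>2 \<partial>lborel)"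
      by (rule integral_cong_AE[OF m ae])
  qed
  show "(\<lambda>x. ground_state x * w k x) \<in> H1_on ?A" for k
  proof -
    note Bw = B[OF w_borel(1)[of k] gw_m[of k] test_integrable[of k] gw_i[of k]]
    show ?thesis
      by (rule H1_onI(1)[OF open_shell has_weak_gradient_restrict[OF 
          has_weak_gradient_mult_smooth[OF open_regular_set smooth_ground_state 
            classical_gradient_weak[OF open_regular_set test_Ck] w_borel(1)] AR] Bw(1,3)])
  qed
  show "smooth_on ?A (\<lambda>x. ground_state x * w k x)" for k
    by (rule smooth_on_mult[OF open_shell smooth_on_subset[OF smooth_ground_state AR] smooth_on_subset[OF test_function_smooth[OF w_test] subset_UNIV]])
  let ?e = "\<lambda>k. (\<integral>x. bessel_weight x * (w k x - v x)\<^sup>2 \<partial>lborel) + 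
     (2 * (\<integral>x. bessel_weight x * (norm (grad (w k) x - v_grad x))\<^sup>2 \<partial>lborel) + 2 * C\<^sup>2 * (\<integral>x. bessel_weight x * (w k x - v x)\<^sup>2 \<partial>lborel))"
  have "?e \<longlonglongrightarrow> 0 + (2 * 0 + 2 * C\<^sup>2 * 0)" by (intro tendsto_intros energy_lim)
  hence e0: "?e \<longlonglongrightarrow> 0" by simp
  show "(\<lambda>k. H1_norm2 ?A (\<lambda>x. ground_state x * w k x - u x)) \<longlonglongrightarrow> 0"
  proof (rule tendsto_0_sandwich[OF H1_norm2_nonneg _ e0])
    fix k
    have dm: "(\<lambda>x. w k x - v x) \<in> borel_measurable borel" by measurable
    note Bd = B[OF dm gd_m[of k] diff_integrable[of k] gd_eq(1)[of k]]
    have "AE x in lborel. x \<in> ?A \<longrightarrow> ground_state x * (w k x - v x) = ground_state x * w k x - u x"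
      using uv by eventually_elim (simp add: algebra_simps)
    note wk = has_weak_gradient_cong_AE[OF open_shell has_weak_gradient_restrict[OF 
          has_weak_gradient_mult_smooth[OF open_regular_set smooth_ground_state diff_weak dm] AR] _ this]
    have ae: "AE x\<in>?A in lborel. (ground_state x * w k x - u x)\<^sup>2 = (ground_state x * (w k x - v x))\<^sup>2"
      using uv by eventually_elim (simp add: algebra_simps)
    have [measurable]: "?A \<in> sets borel" by (rule Am)
    have i: "set_integrable lborel ?A (\<lambda>x. (ground_state x * w k x - u x)\<^sup>2)"
      using set_integrable_cong_AE[OF _ _ ae] Bd(1) by auto
    have l: "(LINT x:?A|lborel. (ground_state x * w k x - u x)\<^sup>2) = (LINT x:?A|lborel. (ground_state x * (w k x - v x))\<^sup>2)"
      by (rule set_lebesgue_integral_cong_AE[OF _ _ _ ae]) auto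
    have wk': "has_weak_gradient_on (\<lambda>x. ground_state x * w k x - u x) (\<lambda>x. indicator regular_set x *\<^sub>R (ground_state x *\<^sub>R (indicator regular_set x *\<^sub>R grad (w k) x - v_grad x) + (w k x - v x) *\<^sub>R grad ground_state x)) ?A"
      by (rule wk) measurable
    show "H1_norm2 ?A (\<lambda>x. ground_state x * w k x - u x) \<le> ?e k"
      unfolding H1_onI(2)[OF open_shell wk' i Bd(3)] l
      using Bd(2,4) unfolding gd_eq(2) by linarith
  qed
qed

lemma regular_interval_around:
  assumes "0 < r" "bessel_J0 r \<noteq> 0" shows "\<exists>a b. regular_interval a b \<and> a < r \<and> r < b"
proof -
  have "isCont bessel_J0 r" using J0_has_deriv DERIV_isCont by blast
  hence "\<forall>\<^sub>F x in at r. bessel_J0 x \<noteq> 0" using assms(2) tendsto_imp_eventually_ne by (simp add: isCont_def)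
  then obtain d where d: "d > 0" "\<And>x. x \<noteq> r \<Longrightarrow> dist x r < d \<Longrightarrow> bessel_J0 x \<noteq> 0"
    unfolding eventually_at by auto
  \<comment> \<open>half of both bounds, so that the closed interval around \<open>r\<close> stays positive and free of zeros\<close>
  define e where "e = min (d/2) (r/2)"
  have e: "0 < e" "e < d" "e < r" using d assms by (auto simp: e_def)
  have "regular_interval (r - e) (r + e)"
    unfolding regular_interval_def
  proof (intro conjI ballI)
    fix x assume "x \<in> {r - e..r + e}"
    hence "dist x r < d" using e unfolding dist_real_def abs_less_iff by auto
    thus "bessel_J0 x \<noteq> 0" using d(2)[of x] assms(2) by (cases "x = r") auto
  qed (use e in auto)
  thus ?thesis using e by (intro exI[of _ "r - e"] exI[of _ "r + e"]) auto
qed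

lemma u_has_trace:
  assumes "0 < r" "bessel_J0 r \<noteq> 0" shows "has_sphere_trace r u (sphere_trace r u)"
proof -
  obtain a b where ab: "regular_interval a b" "a < r" "r < b" using regular_interval_around[OF assms] by blast
  have "\<exists>h. has_sphere_trace r u h"
    by (rule sphere_trace_exists[OF _ ab(2,3) shell_approximation(1)[OF ab(1)] shell_approximation(3)[OF ab(1)] shell_approximation(2)[OF ab(1)] shell_approximation(4)[OF ab(1)]])
       (use ab in \<open>simp add: regular_interval_def\<close>)
  thus ?thesis unfolding sphere_trace_def by (rule someI_ex)
qed

definition trace_mass where "trace_mass r = (LINT x|sphere_measure r. (sphere_trace r u x)\<^sup>2)"

text \<open>
The integral of \<open>v\<^sup>2\<close> over the sphere of radius \<open>r\<close>, divided by \<open>r ^ (N - 1)\<close> and expressed by the trace of \<open>u\<close>: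
the surface element and the weight \<open>\<phi>\<^sup>2\<close> combine to the denominator \<open>r J\<^sub>0\<^sup>2\<close>.
\<close>

definition sphere_mean where "sphere_mean r = trace_mass r / (r * (bessel_J0 r)\<^sup>2)"

lemma trace_mass_nonneg: "0 \<le> trace_mass r" unfolding trace_mass_def by simp

lemma sphere_mean_lim:
  assumes r: "0 < r" "bessel_J0 r \<noteq> 0"
  shows "(\<lambda>k. inverse (r ^ (CARD('n) - 1)) * (LINT x|sphere_measure r. (w k x)\<^sup>2)) \<longlonglongrightarrow> sphere_mean r"
proof -
  obtain a b where ab: "regular_interval a b" "a < r" "r < b" using regular_interval_around[OF r] by blast
  note A = shell_approximation[OF ab(1)]
  let ?h = "sphere_trace r u"
  have a0: "0 \<le> a" using ab by (simp add: regular_interval_def)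
  have lim: "(\<lambda>k. LINT x|sphere_measure r. (ground_state x * w k x - ?h x)\<^sup>2) \<longlonglongrightarrow> 0"
    by (rule sphere_trace_limit[OF a0 ab(2,3) A(1,3,2,4) u_has_trace[OF r]])
  have mh: "?h \<in> borel_measurable (sphere_measure r)" "integrable (sphere_measure r) (\<lambda>x. (?h x)\<^sup>2)"
    using u_has_trace[OF r] unfolding has_sphere_trace_shell by auto
  note sq = sphere_square_integrable[OF r(1) A(3) ab(2,3)]
  have l2: "(\<lambda>k. LINT x|sphere_measure r. (ground_state x * w k x) * (ground_state x * w k x)) \<longlonglongrightarrow> (LINT x|sphere_measure r. ?h x * ?h x)"
    by (rule L2_limit_product[OF sq(1) sq(1) mh(1) mh(1) sq(2) sq(2) mh(2) mh(2) lim lim])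
  \<comment> \<open>the constant value of \<open>\<phi>\<^sup>2\<close> on the sphere\<close>
  let ?c = "r powr (- (real CARD('n) - 2)) * (bessel_J0 r)\<^sup>2"
  have c: "?c \<noteq> 0" using r by simp
  have e: "(LINT x|sphere_measure r. (ground_state x * w k x) * (ground_state x * w k x)) = ?c * (LINT x|sphere_measure r. (w k x)\<^sup>2)" for k
  proof -
    have "(LINT x|sphere_measure r. (ground_state x * w k x) * (ground_state x * w k x)) = (LINT x|sphere_measure r. ?c * (w k x)\<^sup>2)"
    proof (rule Bochner_Integration.integral_cong[OF refl])
      fix x :: "real^'n" assume "x \<in> space (sphere_measure r)"
      hence x: "norm x = r" by simp
      hence "(ground_state x)\<^sup>2 = ?c" using r ground_state_sq[of x] by (auto simp: bessel_weight_def)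
      moreover have "(ground_state x * w k x) * (ground_state x * w k x) = (ground_state x)\<^sup>2 * (w k x)\<^sup>2"
        by (simp add: power2_eq_square)
      ultimately show "(ground_state x * w k x) * (ground_state x * w k x) = ?c * (w k x)\<^sup>2" by simp
    qed
    thus ?thesis by simp
  qed
  have "(\<lambda>k. inverse (r * (bessel_J0 r)\<^sup>2) * (?c * (LINT x|sphere_measure r. (w k x)\<^sup>2))) \<longlonglongrightarrow> inverse (r * (bessel_J0 r)\<^sup>2) * trace_mass r"
    using l2 unfolding e trace_mass_def power2_eq_square[of "?h _"] by (intro tendsto_mult tendsto_const)
  note lm = this
  have e2: "inverse (r * (bessel_J0 r)\<^sup>2) * (?c * y) = inverse (r ^ (CARD('n) - 1)) * y" for y
  proof -
    have N1: "CARD('n) \<ge> 1" using zero_less_card_finite[where 'a='n] by linarith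
    have "r ^ (CARD('n) - 1) * r powr (- (real CARD('n) - 2)) = r" by (rule power_powr_cancel[OF r(1) N1])
    hence "r powr (- (real CARD('n) - 2)) = r / r ^ (CARD('n) - 1)" using r by (simp add: field_simps)
    hence "inverse (r * (bessel_J0 r)\<^sup>2) * (?c * y) = inverse (r * (bessel_J0 r)\<^sup>2) * (r / r ^ (CARD('n) - 1) * (bessel_J0 r)\<^sup>2 * y)"
      by (simp only:)
    also have "\<dots> = inverse (r ^ (CARD('n) - 1)) * y" using r by (simp add: field_simps)
    finally show ?thesis .
  qed
  from lm show ?thesis by (simp only: e2 sphere_mean_def divide_inverse mult.commute[of "trace_mass r"])
qed

text \<open>
For a test function \<open>w k\<close> in place of \<open>v\<close> this is \<open>radial_FTC\<close> for \<open>F(|x|) (w k)\<^sup>2\<close>. The volume integrals converge because,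
on the shell, the integrand is a quadratic form in \<open>\<phi> w k\<close> and \<open>\<phi>\<close> times the radial derivative of \<open>w k\<close> with bounded
coefficients, and the boundary terms converge by \<open>sphere_mean_lim\<close>. The choice of \<open>F\<close> is free; different
choices give the energy identity and all boundary estimates.
\<close>

lemma radial_identity:
  assumes ab: "regular_interval a b"
    and F: "\<And>r. r > 0 \<Longrightarrow> (F has_real_derivative F' r) (at r)" and cF': "continuous_on {0<..} F'"
  shows "set_integrable lborel (cshell a b) (\<lambda>x. inverse (norm x ^ (CARD('n) - 1)) * (F' (norm x) * (v x)\<^sup>2 + 2 * F (norm x) * (v x * (v_grad x \<bullet> sgn x))))"
    "(LINT x:cshell a b|lborel. inverse (norm x ^ (CARD('n) - 1)) * (F' (norm x) * (v x)\<^sup>2 + 2 * F (norm x) * (v x * (v_grad x \<bullet> sgn x)))) = F b * sphere_mean b - F a * sphere_mean a"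
proof -
  let ?N = "CARD('n)" and ?c = "cshell a b :: (real^'n) set"
  have a0: "0 < a" "a < b" and J: "\<And>r. r \<in> {a..b} \<Longrightarrow> bessel_J0 r \<noteq> 0" using ab by (auto simp: regular_interval_def)
  note cR = regular_interval_subset(1)[OF ab]
  have cpos: "0 < norm x" "norm x \<in> {a..b}" if "x \<in> ?c" for x using that a0 by (auto simp: cshell_def)
  have csub: "?c \<subseteq> - {0}" using a0 by (auto simp: cshell_def)
  have cm [measurable]: "?c \<in> sets borel" by (rule borel_closed[OF compact_imp_closed[OF compact_cshell]])
  have cF: "continuous_on {0<..} F" using F by (intro DERIV_continuous_on) (auto intro: has_field_derivative_at_within)
  \<comment> \<open>the coefficients of the quadratic form in \<open>\<phi> w\<close> and \<open>\<phi> \<partial>\<^sub>r w\<close>: the factor \<open>\<phi>\<^sup>2\<close> is divided out, which is possible on the shell\<close>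
  define P where "P x = indicator ?c x * (inverse (norm x ^ (?N - 1)) * F' (norm x) / bessel_weight x)" for x
  define R where "R x = indicator ?c x * (inverse (norm x ^ (?N - 1)) * (2 * F (norm x)) / bessel_weight x)" for x
  have wnz: "bessel_weight x \<noteq> 0" if "x \<in> ?c" for x using J[of "norm x"] cpos[OF that] by (auto simp: bessel_weight_def)
  have cw: "continuous_on ?c bessel_weight"
    unfolding bessel_weight_def[abs_def] using csub by (intro continuous_intros) auto
  have cont: "continuous_on ?c (\<lambda>x. inverse (norm x ^ (?N - 1)) * F' (norm x) / bessel_weight x)"
    "continuous_on ?c (\<lambda>x. inverse (norm x ^ (?N - 1)) * (2 * F (norm x)) / bessel_weight x)"
    using cpos csub wnz by (intro continuous_intros cw continuous_on_compose2[OF cF'] continuous_on_compose2[OF cF]; force)+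
  have mP [measurable]: "P \<in> borel_measurable borel" "R \<in> borel_measurable borel"
    unfolding P_def[abs_def] R_def[abs_def]
    using borel_measurable_continuous_on_indicator[OF cm cont(1)] borel_measurable_continuous_on_indicator[OF cm cont(2)] by simp_all
  obtain B1 where B1: "\<And>x. x \<in> ?c \<Longrightarrow> norm (inverse (norm x ^ (?N - 1)) * F' (norm x) / bessel_weight x) \<le> B1"
    by (rule bounded_imageE[OF compact_imp_bounded[OF compact_continuous_image[OF cont(1) compact_cshell]]]) blast
  obtain B2 where B2: "\<And>x. x \<in> ?c \<Longrightarrow> norm (inverse (norm x ^ (?N - 1)) * (2 * F (norm x)) / bessel_weight x) \<le> B2"
    by (rule bounded_imageE[OF compact_imp_bounded[OF compact_continuous_image[OF cont(2) compact_cshell]]]) blast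
  have BP: "\<bar>P x\<bar> \<le> max B1 0" and BR: "\<bar>R x\<bar> \<le> max B2 0" for x
    using B1[of x] B2[of x] by (auto simp: P_def R_def indicator_def le_max_iff_disj)
  define f where "f k x = indicator ?c x * (ground_state x * w k x)" for k x
  define h where "h k x = indicator ?c x * (ground_state x * (grad (w k) x \<bullet> sgn x))" for k x
  define f0 where "f0 x = indicator ?c x * (ground_state x * v x)" for x
  define h0 where "h0 x = indicator ?c x * (ground_state x * (v_grad x \<bullet> sgn x))" for x
  have mf [measurable]: "f k \<in> borel_measurable borel" "h k \<in> borel_measurable borel" "f0 \<in> borel_measurable borel" "h0 \<in> borel_measurable borel" for k
    unfolding f_def[abs_def] h_def[abs_def] f0_def[abs_def] h0_def[abs_def] by measurable
  have w: "(ground_state x)\<^sup>2 = bessel_weight x" if "x \<in> ?c" for x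
    using that csub by (intro ground_state_sq) auto
  have sq1: "(indicator ?c x * (ground_state x * y))\<^sup>2 \<le> bessel_weight x * y\<^sup>2" for x y
    using w[of x] by (auto simp: indicator_def power_mult_distrib)
  have sq2: "(indicator ?c x * (ground_state x * (z \<bullet> sgn x)))\<^sup>2 \<le> bessel_weight x * (norm z)\<^sup>2" for x z
  proof -
    have "\<bar>z \<bullet> sgn x\<bar> \<le> norm z * norm (sgn x)" by (rule Cauchy_Schwarz_ineq2)
    also have "\<dots> \<le> norm z" by (simp add: norm_sgn)
    finally have "\<bar>z \<bullet> sgn x\<bar>\<^sup>2 \<le> (norm z)\<^sup>2" by (intro power_mono) auto
    hence "bessel_weight x * (z \<bullet> sgn x)\<^sup>2 \<le> bessel_weight x * (norm z)\<^sup>2" by (intro mult_left_mono) auto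
    thus ?thesis using sq1[of x "z \<bullet> sgn x"] by linarith
  qed
  have dom: "integrable lborel (\<lambda>x. (q x)\<^sup>2)" "(\<integral>x. (q x)\<^sup>2 \<partial>lborel) \<le> (\<integral>x. W x \<partial>lborel)"
    if q: "q \<in> borel_measurable borel" "integrable lborel W" "\<And>x. (q x)\<^sup>2 \<le> W x" for q W :: "real^'n \<Rightarrow> real"
  proof -
    show i: "integrable lborel (\<lambda>x. (q x)\<^sup>2)"
    proof (rule Bochner_Integration.integrable_bound[OF q(2)])
      show "AE x in lborel. norm ((q x)\<^sup>2) \<le> norm (W x)" using q(3) by (intro AE_I2) (smt (verit) real_norm_def zero_le_power2)
    qed (use q(1) in measurable)
    show "(\<integral>x. (q x)\<^sup>2 \<partial>lborel) \<le> (\<integral>x. W x \<partial>lborel)" by (rule integral_mono[OF i q(2,3)])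
  qed
  have fi: "integrable lborel (\<lambda>x. (f k x)\<^sup>2)" for k by (rule dom(1)[OF _ test_integrable[of k]]) (use sq1 in \<open>simp_all add: f_def\<close>)
  have hi: "integrable lborel (\<lambda>x. (h k x)\<^sup>2)" for k by (rule dom(1)[OF _ grad_test_integrable[of k]]) (use sq2 in \<open>simp_all add: h_def\<close>)
  have f0i: "integrable lborel (\<lambda>x. (f0 x)\<^sup>2)" by (rule dom(1)[OF _ v_integrable]) (use sq1 in \<open>simp_all add: f0_def\<close>)
  have h0i: "integrable lborel (\<lambda>x. (h0 x)\<^sup>2)" by (rule dom(1)[OF _ v_grad_integrable]) (use sq2 in \<open>simp_all add: h0_def\<close>)
  have df: "f k x - f0 x = indicator ?c x * (ground_state x * (w k x - v x))" for k x by (simp add: f_def f0_def algebra_simps)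
  have dh: "h k x - h0 x = indicator ?c x * (ground_state x * ((grad (w k) x - v_grad x) \<bullet> sgn x))" for k x
    by (simp add: h_def h0_def algebra_simps inner_diff_left)
  have fl: "(\<lambda>k. \<integral>x. (f k x - f0 x)\<^sup>2 \<partial>lborel) \<longlonglongrightarrow> 0"
  proof (rule tendsto_0_sandwich[OF _ _ energy_lim(1)])
    show "(\<integral>x. (f k x - f0 x)\<^sup>2 \<partial>lborel) \<le> (\<integral>x. bessel_weight x * (w k x - v x)\<^sup>2 \<partial>lborel)" for k
      by (rule dom(2)[OF _ diff_integrable]) (measurable, unfold df, rule sq1)
  qed simp
  have hl: "(\<lambda>k. \<integral>x. (h k x - h0 x)\<^sup>2 \<partial>lborel) \<longlonglongrightarrow> 0"
  proof (rule tendsto_0_sandwich[OF _ _ energy_lim(2)])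
    show "(\<integral>x. (h k x - h0 x)\<^sup>2 \<partial>lborel) \<le> (\<integral>x. bessel_weight x * (norm (grad (w k) x - v_grad x))\<^sup>2 \<partial>lborel)" for k
      by (rule dom(2)[OF _ grad_diff_integrable]) (measurable, unfold dh, rule sq2)
  qed simp
  have mult_lim: "(\<lambda>k. \<integral>x. (Q x * f k x - Q x * f0 x)\<^sup>2 \<partial>lborel) \<longlonglongrightarrow> 0"
    if Q: "Q \<in> borel_measurable borel" "\<And>x. \<bar>Q x\<bar> \<le> C" for Q :: "real^'n \<Rightarrow> real" and C
  proof -
    have fd: "integrable lborel (\<lambda>x. (f k x - f0 x)\<^sup>2)" for k by (rule square_integrable_diff(1)[OF _ _ fi f0i]) auto
    have "(\<lambda>k. C\<^sup>2 * (\<integral>x. (f k x - f0 x)\<^sup>2 \<partial>lborel)) \<longlonglongrightarrow> C\<^sup>2 * 0" by (intro tendsto_mult tendsto_const fl)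
    hence l: "(\<lambda>k. C\<^sup>2 * (\<integral>x. (f k x - f0 x)\<^sup>2 \<partial>lborel)) \<longlonglongrightarrow> 0" by simp
    have "(\<integral>x. (Q x * f k x - Q x * f0 x)\<^sup>2 \<partial>lborel) \<le> C\<^sup>2 * (\<integral>x. (f k x - f0 x)\<^sup>2 \<partial>lborel)" for k
      using bounded_multiplier(2)[OF _ _ fd[of k] Q(2)] Q(1) by (simp add: right_diff_distrib)
    thus ?thesis by (intro tendsto_0_sandwich[OF _ _ l]) auto
  qed
  have PI: "integrable lborel (\<lambda>x. (P x * f k x)\<^sup>2)" "integrable lborel (\<lambda>x. (R x * f k x)\<^sup>2)" 
    "integrable lborel (\<lambda>x. (P x * f0 x)\<^sup>2)" "integrable lborel (\<lambda>x. (R x * f0 x)\<^sup>2)" for k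
    by (rule bounded_multiplier(1)[OF _ _ fi BP] bounded_multiplier(1)[OF _ _ fi BR] bounded_multiplier(1)[OF _ _ f0i BP] bounded_multiplier(1)[OF _ _ f0i BR]; simp)+
  have mPf: "(\<lambda>x. P x * f k x) \<in> borel_measurable lborel" "(\<lambda>x. R x * f k x) \<in> borel_measurable lborel"
    "(\<lambda>x. P x * f0 x) \<in> borel_measurable lborel" "(\<lambda>x. R x * f0 x) \<in> borel_measurable lborel" for k by measurable
  have mfl: "f k \<in> borel_measurable lborel" "h k \<in> borel_measurable lborel" "f0 \<in> borel_measurable lborel" "h0 \<in> borel_measurable lborel" for k by auto
  have L1: "(\<lambda>k. \<integral>x. (P x * f k x) * f k x \<partial>lborel) \<longlonglongrightarrow> (\<integral>x. (P x * f0 x) * f0 x \<partial>lborel)"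
    by (rule L2_limit_product[OF mPf(1) mfl(1) mPf(3) mfl(3) PI(1) fi PI(3) f0i mult_lim[OF mP(1) BP] fl])
  have L2: "(\<lambda>k. \<integral>x. (R x * f k x) * h k x \<partial>lborel) \<longlonglongrightarrow> (\<integral>x. (R x * f0 x) * h0 x \<partial>lborel)"
    by (rule L2_limit_product[OF mPf(2) mfl(2) mPf(4) mfl(4) PI(2) hi PI(4) h0i mult_lim[OF mP(2) BR] hl])
  have I: "integrable lborel (\<lambda>x. (P x * f k x) * f k x)" "integrable lborel (\<lambda>x. (R x * f k x) * h k x)"
    "integrable lborel (\<lambda>x. (P x * f0 x) * f0 x)" "integrable lborel (\<lambda>x. (R x * f0 x) * h0 x)" for k
    by (rule square_integrable_mult[OF mPf(1) mfl(1) PI(1) fi], rule square_integrable_mult[OF mPf(2) mfl(2) PI(2) hi],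
        rule square_integrable_mult[OF mPf(3) mfl(3) PI(3) f0i], rule square_integrable_mult[OF mPf(4) mfl(4) PI(4) h0i])
  have alg: "(P x * (indicator ?c x * (ground_state x * y))) * (indicator ?c x * (ground_state x * y)) + (R x * (indicator ?c x * (ground_state x * y))) * (indicator ?c x * (ground_state x * z))
      = indicator ?c x *\<^sub>R (inverse (norm x ^ (?N - 1)) * (F' (norm x) * y\<^sup>2 + 2 * F (norm x) * (y * z)))" for x y z
  proof (cases "x \<in> ?c")
    case True
    let ?i = "inverse (norm x ^ (?N - 1))"
    have "(P x * (ground_state x * y)) * (ground_state x * y) + (R x * (ground_state x * y)) * (ground_state x * z)
       = (ground_state x)\<^sup>2 * (P x * y\<^sup>2 + R x * (y * z))" by (simp add: power2_eq_square algebra_simps)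
    also have "\<dots> = bessel_weight x * (?i * F' (norm x) / bessel_weight x * y\<^sup>2 + ?i * (2 * F (norm x)) / bessel_weight x * (y * z))"
      using True by (simp add: w P_def R_def)
    also have "\<dots> = ?i * (F' (norm x) * y\<^sup>2 + 2 * F (norm x) * (y * z))"
    proof -
      have "b * (i * A / b * Y + i * B / b * Z) = i * (A * Y + B * Z)" if "b \<noteq> 0" for b i A Y B Z :: real
        using that by (simp add: field_simps)
      thus ?thesis using wnz[OF True] by blast
    qed
    finally show ?thesis using True by simp
  qed simp
  have eq: "(P x * f k x) * f k x + (R x * f k x) * h k x = indicator ?c x *\<^sub>R (inverse (norm x ^ (?N - 1)) * (F' (norm x) * (w k x)\<^sup>2 + 2 * F (norm x) * (w k x * (grad (w k) x \<bullet> sgn x))))" for k x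
    unfolding f_def h_def by (rule alg)
  have eq0: "(P x * f0 x) * f0 x + (R x * f0 x) * h0 x = indicator ?c x *\<^sub>R (inverse (norm x ^ (?N - 1)) * (F' (norm x) * (v x)\<^sup>2 + 2 * F (norm x) * (v x * (v_grad x \<bullet> sgn x))))" for x
    unfolding f0_def h0_def by (rule alg)
  have val: "(\<integral>x. (P x * f k x) * f k x \<partial>lborel) + (\<integral>x. (R x * f k x) * h k x \<partial>lborel) = 
      F b * (inverse (b ^ (?N - 1)) * (LINT x|sphere_measure b. (w k x)\<^sup>2)) - F a * (inverse (a ^ (?N - 1)) * (LINT x|sphere_measure a. (w k x)\<^sup>2))" for k
  proof -
    let ?q = "\<lambda>x. F (norm x) * (w k x * w k x)"
    have o: "open (- {0::real^'n})" by auto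
    note CF = Ck1_radial(1)[OF F cF', where 'n='n] and gF = Ck1_radial(2)[OF F cF', where 'n='n]
    have Cq: "Ck_on 1 (- {0}) ?q" by (intro Ck_on_mult[OF o] CF test_Ck)
    note FT = radial_FTC[OF a0 o csub Cq]
    have gq: "grad ?q x \<bullet> sgn x = F' (norm x) * (w k x)\<^sup>2 + 2 * F (norm x) * (w k x * (grad (w k) x \<bullet> sgn x))" if x: "x \<in> ?c" for x
    proof -
      have x0: "x \<in> - {0}" using x csub by blast
      have dF: "(\<lambda>x. F (norm x)) differentiable (at x)" by (rule Ck1_D(1)[OF o CF x0])
      have dw: "w k differentiable (at x)" by (rule Ck1_D(1)[OF o test_Ck x0])
      have xs: "x \<bullet> sgn x = norm x" using x0 by (simp add: sgn_div_norm power2_norm_eq_inner[symmetric] power2_eq_square)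
      have "grad ?q x = (w k x * w k x) *\<^sub>R grad (\<lambda>x. F (norm x)) x + F (norm x) *\<^sub>R (w k x *\<^sub>R grad (w k) x + w k x *\<^sub>R grad (w k) x)"
        by (subst grad_mult[OF dF differentiable_mult[OF dw dw]], subst grad_mult[OF dw dw]) simp
      hence "grad ?q x \<bullet> sgn x = (w k x * w k x) * (F' (norm x) / norm x * (x \<bullet> sgn x)) + F (norm x) * (2 * (w k x * (grad (w k) x \<bullet> sgn x)))"
        using gF[of x] x0 by (simp only: inner_add_left inner_scaleR_left) (simp add: algebra_simps)
      thus ?thesis using x0 unfolding xs by (simp add: power2_eq_square)
    qed
    have sp: "(LINT x|sphere_measure r. ?q x) = F r * (LINT x|sphere_measure r. (w k x)\<^sup>2)" for r
    proof -
      have "(LINT x|sphere_measure r. ?q x) = (LINT x|sphere_measure r. F r * (w k x)\<^sup>2)"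
        by (rule Bochner_Integration.integral_cong) (auto simp: power2_eq_square)
      thus ?thesis by simp
    qed
    have "(\<integral>x. (P x * f k x) * f k x \<partial>lborel) + (\<integral>x. (R x * f k x) * h k x \<partial>lborel) = (\<integral>x. (P x * f k x) * f k x + (R x * f k x) * h k x \<partial>lborel)"
      by (rule Bochner_Integration.integral_add[symmetric, OF I(1,2)])
    also have "\<dots> = (LINT x:?c|lborel. inverse (norm x ^ (?N - 1)) * (grad ?q x \<bullet> sgn x))"
      unfolding eq set_lebesgue_integral_def by (rule Bochner_Integration.integral_cong) (use gq in \<open>auto simp: indicator_def\<close>)
    finally show ?thesis unfolding FT(2) sp by (simp add: mult_ac)
  qed
  have "(\<lambda>k. F b * (inverse (b ^ (?N - 1)) * (LINT x|sphere_measure b. (w k x)\<^sup>2)) - F a * (inverse (a ^ (?N - 1)) * (LINT x|sphere_measure a. (w k x)\<^sup>2)))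
     \<longlonglongrightarrow> F b * sphere_mean b - F a * sphere_mean a"
    by (intro tendsto_diff tendsto_mult tendsto_const sphere_mean_lim) (use a0 J in auto)
  moreover have "(\<lambda>k. F b * (inverse (b ^ (?N - 1)) * (LINT x|sphere_measure b. (w k x)\<^sup>2)) - F a * (inverse (a ^ (?N - 1)) * (LINT x|sphere_measure a. (w k x)\<^sup>2)))
     \<longlonglongrightarrow> (\<integral>x. (P x * f0 x) * f0 x \<partial>lborel) + (\<integral>x. (R x * f0 x) * h0 x \<partial>lborel)"
    using tendsto_add[OF L1 L2] unfolding val .
  ultimately have e: "F b * sphere_mean b - F a * sphere_mean a = (\<integral>x. (P x * f0 x) * f0 x \<partial>lborel) + (\<integral>x. (R x * f0 x) * h0 x \<partial>lborel)"
    by (rule LIMSEQ_unique)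
  show "set_integrable lborel ?c (\<lambda>x. inverse (norm x ^ (?N - 1)) * (F' (norm x) * (v x)\<^sup>2 + 2 * F (norm x) * (v x * (v_grad x \<bullet> sgn x))))"
    unfolding set_integrable_def eq0[symmetric] by (rule Bochner_Integration.integrable_add[OF I(3,4)])
  show "(LINT x:?c|lborel. inverse (norm x ^ (?N - 1)) * (F' (norm x) * (v x)\<^sup>2 + 2 * F (norm x) * (v x * (v_grad x \<bullet> sgn x)))) = F b * sphere_mean b - F a * sphere_mean a"
    unfolding set_lebesgue_integral_def eq0[symmetric] e by (rule Bochner_Integration.integral_add[OF I(3,4)])
qed

end

section \<open>Boundary estimates and the energy identity\<close>

lemma sum_set_integral_disjoint_le:
  fixes f :: "_ \<Rightarrow> real"
  assumes f: "integrable M f" "\<And>x. 0 \<le> f x" and A: "\<And>i::nat. A i \<in> sets M" "disjoint_family A"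
  shows "summable (\<lambda>i. LINT x:A i|M. f x)" "(\<Sum>i. LINT x:A i|M. f x) \<le> (\<integral>x. f x \<partial>M)"
proof -
  have si: "set_integrable M B f" if "B \<in> sets M" for B
    unfolding set_integrable_def by (rule integrable_mult_indicator[OF that f(1)])
  have nn: "0 \<le> (LINT x:A i|M. f x)" for i
    unfolding set_lebesgue_integral_def by (intro integral_nonneg_AE AE_I2) (simp add: f(2))
  have bd: "(\<Sum>i<n. LINT x:A i|M. f x) \<le> (\<integral>x. f x \<partial>M)" for n
  proof -
    have m: "(\<Union>i\<in>{..<n}. A i) \<in> sets M" using A(1) by (intro sets.finite_UN) auto
    have "(\<Sum>i<n. LINT x:A i|M. f x) = (LINT x:(\<Union>i\<in>{..<n}. A i)|M. f x)"
      by (rule set_integral_finite_Union[symmetric]) (use A si disjoint_family_on_mono[of "{..<n}" UNIV A] in auto)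
    also have "\<dots> \<le> (\<integral>x. f x \<partial>M)"
      unfolding set_lebesgue_integral_def
      by (rule integral_mono[OF si[OF m, unfolded set_integrable_def] f(1)]) (auto simp: indicator_def f(2))
    finally show ?thesis .
  qed
  show s: "summable (\<lambda>i. LINT x:A i|M. f x)" by (rule summableI_nonneg_bounded[OF nn bd])
  show "(\<Sum>i. LINT x:A i|M. f x) \<le> (\<integral>x. f x \<partial>M)" by (rule suminf_le_const[OF s bd])
qed

lemma set_integral_sums:
  fixes f :: "_ \<Rightarrow> real"
  assumes A: "\<And>i::nat. A i \<in> sets M" "disjoint_family A" and f: "set_integrable M (\<Union>i. A i) f"
  shows "(\<lambda>i. LINT x:A i|M. f x) sums (LINT x:(\<Union>i. A i)|M. f x)"
proof -
  let ?U = "\<Union>i. A i"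
  let ?F = "\<lambda>x. \<bar>indicator ?U x * f x\<bar>"
  have iF: "integrable M ?F" using f by (intro integrable_abs) (simp add: set_integrable_def)
  have eq: "indicator (A i) x *\<^sub>R f x = indicator (A i) x *\<^sub>R (indicator ?U x * f x)" for i x by (auto simp: indicator_def)
  have "\<bar>LINT x:A i|M. f x\<bar> \<le> (LINT x:A i|M. ?F x)" for i
  proof -
    have "\<bar>LINT x:A i|M. f x\<bar> \<le> (\<integral>x. \<bar>indicator (A i) x *\<^sub>R f x\<bar> \<partial>M)"
      unfolding set_lebesgue_integral_def by (rule integral_abs_bound)
    also have "\<dots> = (LINT x:A i|M. ?F x)"
      unfolding set_lebesgue_integral_def by (rule Bochner_Integration.integral_cong) (auto simp: indicator_def)
    finally show ?thesis .
  qed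
  note le = this
  have "summable (\<lambda>i. LINT x:A i|M. ?F x)" by (rule sum_set_integral_disjoint_le(1)[OF iF _ A]) simp
  hence "summable (\<lambda>i. LINT x:A i|M. f x)"
    by (rule summable_comparison_test'[where N=0]) (use le in simp)
  hence "(\<lambda>i. LINT x:A i|M. f x) sums (\<Sum>i. LINT x:A i|M. f x)" by (rule summable_sums)
  also have "(\<Sum>i. LINT x:A i|M. f x) = (LINT x:?U|M. f x)"
    by (rule lebesgue_integral_countable_add[symmetric]) (use A f in \<open>auto simp: disjoint_family_on_def\<close>)
  finally show ?thesis .
qed

lemma quadratic_arith:
  "0 \<le> A - B + 2 * C + D + 2 * P \<Longrightarrow> P \<le> 1 * z \<Longrightarrow> Q \<le> 1 * C \<Longrightarrow> 0 \<le> z \<Longrightarrow> B - A + Q - D \<le> 3 * (C + z :: real)"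
proof -
  assume "0 \<le> A - B + 2 * C + D + 2 * P" "P \<le> 1 * z" "Q \<le> 1 * C" "0 \<le> z"
  moreover have "1 * z = z" "1 * C = C" by simp_all
  moreover have "3 * (C + z) = 3 * C + 3 * z" by (rule distrib_left)
  ultimately show ?thesis by linarith
qed

text \<open>
Complete the squares \<open>(X - 2 Y)\<^sup>2\<close> and \<open>(X + 2 c Z)\<^sup>2\<close>. Below, \<open>c\<close> is the distance to the far end of the shell,
\<open>X = c J' y\<close>, \<open>Y = J y\<close> and \<open>Z = J z\<close>, where \<open>y\<close> and \<open>z\<close> are the values of \<open>v\<close> and of its radial derivative.
\<close>

lemma quadratic_form_bound:
  assumes "0 \<le> c" "c \<le> (1::real)"
  shows "2 * X * Y - X\<^sup>2 + c\<^sup>2 * Y\<^sup>2 - 2 * c * X * Z \<le> 3 * (Y\<^sup>2 + Z\<^sup>2)"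
proof -
  have c2: "c\<^sup>2 \<le> 1" using assms by (simp add: power_le_one)
  have "0 \<le> (X - 2 * Y)\<^sup>2 / 2 + (X + 2 * c * Z)\<^sup>2 / 2" by simp
  also have "\<dots> = X\<^sup>2 - 2 * X * Y + 2 * Y\<^sup>2 + 2 * c * X * Z + 2 * (c\<^sup>2 * Z\<^sup>2)"
    by (simp add: power2_eq_square field_simps)
  finally have "0 \<le> X\<^sup>2 - 2 * X * Y + 2 * Y\<^sup>2 + 2 * c * X * Z + 2 * (c\<^sup>2 * Z\<^sup>2)" .
  moreover have "c\<^sup>2 * Z\<^sup>2 \<le> 1 * Z\<^sup>2" "c\<^sup>2 * Y\<^sup>2 \<le> 1 * Y\<^sup>2" by (rule mult_right_mono[OF c2]; simp)+
  moreover have "0 \<le> Z\<^sup>2" by simp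
  ultimately show ?thesis by (rule quadratic_arith)
qed

lemma norm_sq_add_scaleR:
  "(norm (a + c *\<^sub>R b :: 'a::real_inner))\<^sup>2 = (norm a)\<^sup>2 + 2 * (c * (a \<bullet> b)) + c\<^sup>2 * (norm b)\<^sup>2"
  unfolding power2_norm_eq_inner
  by (simp add: inner_add_left inner_add_right inner_commute[of b a] power2_eq_square distrib_left)

text \<open>
The square root of the Hardy constant and, up to sign, the exponent in the ground state.
\<close>

definition hardy_exponent :: "'n::finite itself \<Rightarrow> real" where
  "hardy_exponent _ = (real CARD('n) - 2) / 2"

abbreviation bessel_log_deriv :: "real \<Rightarrow> real" where
  "bessel_log_deriv r \<equiv> J0' r / bessel_J0 r"

context bessel_approx
begin

definition energy_density where "energy_density x = bessel_weight x * ((norm (v_grad x))\<^sup>2 + (v x)\<^sup>2)"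

abbreviation energy_on where "energy_on X \<equiv> (LINT x:X|lborel. energy_density x)"

lemma energy_density_nonneg: "0 \<le> energy_density x" by (simp add: energy_density_def)

lemma energy_integrable: "integrable lborel energy_density"
  using Bochner_Integration.integrable_add[OF v_grad_integrable v_integrable] unfolding energy_density_def[abs_def] distrib_left .

lemma energy_density_measurable [measurable]: "energy_density \<in> borel_measurable borel"
  using borel_measurable_integrable[OF energy_integrable] by simp

lemma energy_set_integrable: "X \<in> sets borel \<Longrightarrow> set_integrable lborel X energy_density"
  unfolding set_integrable_def by (rule integrable_mult_indicator[OF _ energy_integrable]) simp

lemma energy_on_mono: "X \<in> sets borel \<Longrightarrow> Y \<in> sets borel \<Longrightarrow> X \<subseteq> Y \<Longrightarrow> energy_on X \<le> energy_on Y"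
  by (rule set_integral_nonneg_mono_set[OF energy_set_integrable]) (auto simp: energy_density_nonneg)

lemma energy_on_nonneg: "0 \<le> energy_on X"
  unfolding set_lebesgue_integral_def by (intro integral_nonneg_AE AE_I2) (simp add: energy_density_nonneg)

lemma cshell_borel: "(cshell a b :: (real^'n) set) \<in> sets borel"
  by (rule borel_closed[OF compact_imp_closed[OF compact_cshell]])

lemma weight_radial: 
  fixes x :: "real^'n" assumes "x \<noteq> 0"
  shows "inverse (norm x ^ (CARD('n) - 1)) * (norm x * (bessel_J0 (norm x))\<^sup>2) = bessel_weight x"
proof -
  let ?r = "norm x"
  have r: "?r > 0" using assms by simp
  have N1: "CARD('n) \<ge> 1" using zero_less_card_finite[where 'a='n] by linarith
  have "?r ^ (CARD('n) - 1) * ?r powr (- (real CARD('n) - 2)) = ?r" by (rule power_powr_cancel[OF r N1])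
  hence "?r powr (- (real CARD('n) - 2)) = inverse (?r ^ (CARD('n) - 1)) * ?r" using r by (simp add: field_simps)
  thus ?thesis by (simp add: bessel_weight_def)
qed

text \<open>
If the integrand of \<open>radial_identity\<close> is pointwise dominated by the energy density, then so is the difference of the boundary
terms by the energy. A function \<open>F\<close> that vanishes at one end isolates the boundary term at the other.
\<close>

lemma radial_estimate:
  assumes ab: "regular_interval a b"
    and F: "\<And>r. r > 0 \<Longrightarrow> (F has_real_derivative F' r) (at r)" and cF': "continuous_on {0<..} F'"
    and K: "0 \<le> K" "\<And>r y z. a \<le> r \<Longrightarrow> r \<le> b \<Longrightarrow> - (F' r * y\<^sup>2 + 2 * F r * (y * z)) \<le> K * (r * (bessel_J0 r)\<^sup>2 * (y\<^sup>2 + z\<^sup>2))"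
  shows "F a * sphere_mean a - F b * sphere_mean b \<le> K * energy_on (cshell a b)"
proof -
  let ?c = "cshell a b :: (real^'n) set"
  have a0: "0 < a" using ab by (simp add: regular_interval_def)
  let ?f = "\<lambda>x. inverse (norm x ^ (CARD('n) - 1)) * (F' (norm x) * (v x)\<^sup>2 + 2 * F (norm x) * (v x * (v_grad x \<bullet> sgn x)))"
  note R = radial_identity[OF ab F cF']
  have "F a * sphere_mean a - F b * sphere_mean b = - (LINT x:?c|lborel. ?f x)" using R(2) by simp
  also have "\<dots> = (LINT x:?c|lborel. - ?f x)" by (simp add: set_lebesgue_integral_def)
  also have "\<dots> \<le> (LINT x:?c|lborel. K * energy_density x)"
  proof (rule set_integral_mono)
    show "set_integrable lborel ?c (\<lambda>x. - ?f x)" using R(1) unfolding set_integrable_def by simp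
    show "set_integrable lborel ?c (\<lambda>x. K * energy_density x)" by (rule set_integrable_mult_right[OF energy_set_integrable[OF cshell_borel]])
    fix x assume x: "x \<in> ?c"
    let ?i = "inverse (norm x ^ (CARD('n) - 1))" and ?z = "v_grad x \<bullet> sgn x"
    have r: "a \<le> norm x" "norm x \<le> b" "x \<noteq> 0" using x a0 by (auto simp: cshell_def)
    have z: "?z\<^sup>2 \<le> (norm (v_grad x))\<^sup>2"
    proof -
      have "\<bar>?z\<bar> \<le> norm (v_grad x) * norm (sgn x)" by (rule Cauchy_Schwarz_ineq2)
      also have "\<dots> = norm (v_grad x)" using r by (simp add: norm_sgn)
      finally have "\<bar>?z\<bar>\<^sup>2 \<le> (norm (v_grad x))\<^sup>2" by (intro power_mono) auto
      thus ?thesis by simp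
    qed
    have "- ?f x = ?i * (- (F' (norm x) * (v x)\<^sup>2 + 2 * F (norm x) * (v x * ?z)))" by (simp only: mult_minus_right)
    also have "\<dots> \<le> ?i * (K * (norm x * (bessel_J0 (norm x))\<^sup>2 * ((v x)\<^sup>2 + ?z\<^sup>2)))"
      by (rule mult_left_mono[OF K(2)[OF r(1,2)]]) simp
    also have "\<dots> = K * ((?i * (norm x * (bessel_J0 (norm x))\<^sup>2)) * ((v x)\<^sup>2 + ?z\<^sup>2))" by simp
    also have "\<dots> = K * (bessel_weight x * ((v x)\<^sup>2 + ?z\<^sup>2))" by (simp only: weight_radial[OF r(3)])
    also have "\<dots> \<le> K * energy_density x" unfolding energy_density_def using z K(1) by (intro mult_left_mono) auto
    finally show "- ?f x \<le> K * energy_density x" .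
  qed
  also have "\<dots> = K * energy_on ?c" by (rule set_integral_mult_right)
  finally show ?thesis .
qed

lemma rJJ'_deriv: "r > 0 \<Longrightarrow> ((\<lambda>r. r * bessel_J0 r * J0' r) has_real_derivative (r * (J0' r)\<^sup>2 - r * (bessel_J0 r)\<^sup>2)) (at r)"
proof -
  have "((\<lambda>r. r * bessel_J0 r * J0' r) has_real_derivative 
      ((1 * bessel_J0 r + J0' r * 1 * r) * J0' r + J0'' r * 1 * (r * bessel_J0 r))) (at r)"
    by (intro DERIV_mult DERIV_ident J0_deriv J0'_deriv)
  moreover have "(1 * bessel_J0 r + J0' r * 1 * r) * J0' r + J0'' r * 1 * (r * bessel_J0 r)
     = bessel_J0 r * J0' r + r * (J0' r)\<^sup>2 + bessel_J0 r * (r * J0'' r)" by (simp add: power2_eq_square algebra_simps)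
  moreover have rJ: "r * J0'' r = - J0' r - r * bessel_J0 r" using J0_ode[of r] by simp
  moreover have "bessel_J0 r * J0' r + r * (J0' r)\<^sup>2 + bessel_J0 r * (- J0' r - r * bessel_J0 r) = r * (J0' r)\<^sup>2 - r * (bessel_J0 r)\<^sup>2"
    by (simp add: power2_eq_square algebra_simps)
  ultimately show ?thesis by (simp only:)
qed

text \<open>
Take \<open>F(r) = (b - r)\<^sup>2 r J J'\<close>. Because \<open>(r J J')' = r J'\<^sup>2 - r J\<^sup>2\<close>, the derivative contains the term
\<open>r J'\<^sup>2 v\<^sup>2\<close> with a favourable sign; it absorbs the mixed term and the derivative of the cutoff, even though
\<open>J'/J\<close> may be large near \<open>a\<close>. So the constant does not deteriorate as \<open>a\<close> approaches a zero.
\<close>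

lemma boundary_estimate_right:
  assumes ab: "regular_interval a b" "b - a \<le> 1"
  shows "(b - a)\<^sup>2 * (bessel_log_deriv a * trace_mass a) \<le> 3 * energy_on (cshell a b)"
proof -
  let ?F = "\<lambda>r. (b - r)\<^sup>2 * (r * bessel_J0 r * J0' r)"
  let ?F' = "\<lambda>r. - 2 * (b - r) * (r * bessel_J0 r * J0' r) + (b - r)\<^sup>2 * (r * (J0' r)\<^sup>2 - r * (bessel_J0 r)\<^sup>2)"
  have a0: "0 < a" "bessel_J0 a \<noteq> 0" using ab by (auto simp: regular_interval_def)
  have "?F a * sphere_mean a - ?F b * sphere_mean b \<le> 3 * energy_on (cshell a b)"
  proof (rule radial_estimate[OF ab(1), where F'="?F'"])
    fix r :: real assume r: "r > 0"
    have "((\<lambda>r. (b - r)\<^sup>2) has_real_derivative - 2 * (b - r)) (at r)" by (auto intro!: derivative_eq_intros)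
    from DERIV_mult[OF this rJJ'_deriv[OF r]] show "(?F has_real_derivative ?F' r) (at r)" by (simp add: mult.commute add.commute)
  next
    fix r y z assume r: "a \<le> r" "r \<le> b"
    let ?c = "b - r"
    have "2 * (?c * J0' r * y) * (bessel_J0 r * y) - (?c * J0' r * y)\<^sup>2 + ?c\<^sup>2 * (bessel_J0 r * y)\<^sup>2 - 2 * ?c * (?c * J0' r * y) * (bessel_J0 r * z)
      \<le> 3 * ((bessel_J0 r * y)\<^sup>2 + (bessel_J0 r * z)\<^sup>2)"
      by (rule quadratic_form_bound) (use r ab in auto)
    hence "r * (2 * (?c * J0' r * y) * (bessel_J0 r * y) - (?c * J0' r * y)\<^sup>2 + ?c\<^sup>2 * (bessel_J0 r * y)\<^sup>2 - 2 * ?c * (?c * J0' r * y) * (bessel_J0 r * z))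
      \<le> r * (3 * ((bessel_J0 r * y)\<^sup>2 + (bessel_J0 r * z)\<^sup>2))"
      using r a0 by (intro mult_left_mono) auto
    thus "- (?F' r * y\<^sup>2 + 2 * ?F r * (y * z)) \<le> 3 * (r * (bessel_J0 r)\<^sup>2 * (y\<^sup>2 + z\<^sup>2))"
      by (simp add: power2_eq_square algebra_simps)
  qed (intro continuous_intros | simp)+
  moreover have "?F a * sphere_mean a = (b - a)\<^sup>2 * (bessel_log_deriv a * trace_mass a)"
    using a0 by (simp add: sphere_mean_def power2_eq_square)
  ultimately show ?thesis by simp
qed

text \<open>
The mirror image, with \<open>F(r) = (r - a)\<^sup>2 r J J'\<close>.
\<close>

lemma boundary_estimate_left:
  assumes ab: "regular_interval a b" "b - a \<le> 1"
  shows "- ((b - a)\<^sup>2 * (bessel_log_deriv b * trace_mass b)) \<le> 3 * energy_on (cshell a b)"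
proof -
  let ?F = "\<lambda>r. (r - a)\<^sup>2 * (r * bessel_J0 r * J0' r)"
  let ?F' = "\<lambda>r. 2 * (r - a) * (r * bessel_J0 r * J0' r) + (r - a)\<^sup>2 * (r * (J0' r)\<^sup>2 - r * (bessel_J0 r)\<^sup>2)"
  have a0: "0 < a" "0 < b" "bessel_J0 b \<noteq> 0" using ab by (auto simp: regular_interval_def)
  have "?F a * sphere_mean a - ?F b * sphere_mean b \<le> 3 * energy_on (cshell a b)"
  proof (rule radial_estimate[OF ab(1), where F'="?F'"])
    fix r :: real assume r: "r > 0"
    have "((\<lambda>r. (r - a)\<^sup>2) has_real_derivative 2 * (r - a)) (at r)" by (auto intro!: derivative_eq_intros)
    from DERIV_mult[OF this rJJ'_deriv[OF r]] show "(?F has_real_derivative ?F' r) (at r)" by (simp add: mult.commute add.commute)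
  next
    fix r y z assume r: "a \<le> r" "r \<le> b"
    let ?c = "r - a"
    have "2 * (- (?c * J0' r * y)) * (bessel_J0 r * y) - (- (?c * J0' r * y))\<^sup>2 + ?c\<^sup>2 * (bessel_J0 r * y)\<^sup>2 - 2 * ?c * (- (?c * J0' r * y)) * (- (bessel_J0 r * z))
      \<le> 3 * ((bessel_J0 r * y)\<^sup>2 + (- (bessel_J0 r * z))\<^sup>2)"
      by (rule quadratic_form_bound) (use r ab in auto)
    hence "r * (2 * (- (?c * J0' r * y)) * (bessel_J0 r * y) - (- (?c * J0' r * y))\<^sup>2 + ?c\<^sup>2 * (bessel_J0 r * y)\<^sup>2 - 2 * ?c * (- (?c * J0' r * y)) * (- (bessel_J0 r * z)))
      \<le> r * (3 * ((bessel_J0 r * y)\<^sup>2 + (- (bessel_J0 r * z))\<^sup>2))"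
      using r a0 by (intro mult_left_mono) auto
    thus "- (?F' r * y\<^sup>2 + 2 * ?F r * (y * z)) \<le> 3 * (r * (bessel_J0 r)\<^sup>2 * (y\<^sup>2 + z\<^sup>2))"
      by (simp add: power2_eq_square algebra_simps)
  qed (intro continuous_intros | simp)+
  moreover have "?F b * sphere_mean b = (b - a)\<^sup>2 * (bessel_log_deriv b * trace_mass b)"
    using a0 by (simp add: sphere_mean_def power2_eq_square)
  ultimately show ?thesis by simp
qed

text \<open>
Take \<open>F(r) = (b - r)\<^sup>2 r J\<^sup>2\<close>. Near the origin \<open>r J\<^sup>2\<close> increases, so that its derivative has a favourable sign.
\<close>

lemma origin_estimate:
  assumes ab: "0 < a" "a < b" "b \<le> 1/2"
  shows "(b - a)\<^sup>2 * trace_mass a \<le> 3 * energy_on (cshell a b)"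
proof -
  let ?F = "\<lambda>r. (b - r)\<^sup>2 * (r * (bessel_J0 r)\<^sup>2)"
  let ?F' = "\<lambda>r. - 2 * (b - r) * (r * (bessel_J0 r)\<^sup>2) + (b - r)\<^sup>2 * ((bessel_J0 r)\<^sup>2 + 2 * r * (bessel_J0 r * J0' r))"
  have Jpos: "bessel_J0 r > 0" if "r \<in> {a..b}" for r using that ab by (intro J0_pos_lt_2) auto
  have reg: "regular_interval a b" using ab Jpos by (auto simp: regular_interval_def less_imp_neq[symmetric])
  have "?F a * sphere_mean a - ?F b * sphere_mean b \<le> 3 * energy_on (cshell a b)"
  proof (rule radial_estimate[OF reg, where F'="?F'"])
    fix r :: real assume r: "r > 0"
    show "(?F has_real_derivative ?F' r) (at r)"
      by (auto intro!: derivative_eq_intros simp: algebra_simps power2_eq_square)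
  next
    fix r y z assume r: "a \<le> r" "r \<le> b"
    let ?c = "b - r" and ?J = "bessel_J0 r" and ?J' = "J0' r"
    have c: "0 \<le> ?c" "?c \<le> 1" using r ab by auto
    have J: "?J > 0" using Jpos r by simp
    have "\<bar>?J' / ?J\<bar> \<le> r" by (rule log_deriv_J0_near_0) (use r ab in auto)
    hence "\<bar>?J'\<bar> \<le> r * ?J" using J by (simp add: abs_divide divide_le_eq)
    also have "\<dots> \<le> 1/2 * ?J" using r ab J by (intro mult_right_mono) auto
    finally have J'1: "- ?J' \<le> ?J / 2" by simp
    have "2 * r * (- ?J') \<le> 1 * (?J / 2)" 
    proof (cases "?J' \<le> 0")
      case True thus ?thesis using r ab J'1 by (intro mult_mono) auto
    next
      case False
      have "2 * r * (- ?J') \<le> 0" using False r ab by (simp add: mult_nonneg_nonpos)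
      thus ?thesis using J by simp
    qed
    hence "0 \<le> ?J + 2 * r * ?J'" using J by simp
    hence "0 \<le> ?J * (?J + 2 * r * ?J')" using J by simp
    hence "0 \<le> ?J\<^sup>2 + 2 * r * (?J * ?J')" by (simp add: power2_eq_square algebra_simps)
    hence pos: "0 \<le> ?c\<^sup>2 * (?J\<^sup>2 + 2 * r * (?J * ?J')) * y\<^sup>2"
      by (intro mult_nonneg_nonneg zero_le_power2)
    have c2: "?c\<^sup>2 \<le> 1" using c by (simp add: power_le_one)
    have yz: "- 2 * (y * z) \<le> y\<^sup>2 + z\<^sup>2" using zero_le_power2[of "y + z"] by (simp add: power2_eq_square algebra_simps)
    have "2 * ?c * y\<^sup>2 + ?c\<^sup>2 * (- 2 * (y * z)) \<le> 2 * 1 * y\<^sup>2 + ?c\<^sup>2 * (y\<^sup>2 + z\<^sup>2)"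
      using c yz by (intro add_mono mult_right_mono mult_left_mono) auto
    also have "\<dots> \<le> 2 * 1 * y\<^sup>2 + 1 * (y\<^sup>2 + z\<^sup>2)" using c2 by (intro add_left_mono mult_right_mono) auto
    also have "\<dots> \<le> 3 * (y\<^sup>2 + z\<^sup>2)" by simp
    finally have "(r * ?J\<^sup>2) * (2 * ?c * y\<^sup>2 + ?c\<^sup>2 * (- 2 * (y * z))) \<le> (r * ?J\<^sup>2) * (3 * (y\<^sup>2 + z\<^sup>2))"
      using r ab by (intro mult_left_mono) auto
    moreover have "- (?F' r * y\<^sup>2 + 2 * ?F r * (y * z)) = (r * ?J\<^sup>2) * (2 * ?c * y\<^sup>2 + ?c\<^sup>2 * (- 2 * (y * z))) - ?c\<^sup>2 * (?J\<^sup>2 + 2 * r * (?J * ?J')) * y\<^sup>2"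
      by (simp add: algebra_simps)
    moreover have "(r * ?J\<^sup>2) * (3 * (y\<^sup>2 + z\<^sup>2)) = 3 * (r * ?J\<^sup>2 * (y\<^sup>2 + z\<^sup>2))" by (rule mult.left_commute)
    moreover have "L \<le> T" if "P \<le> R" "L = P - Q" "R = T" "0 \<le> Q" for L P Q R T :: real using that by simp
    ultimately show "- (?F' r * y\<^sup>2 + 2 * ?F r * (y * z)) \<le> 3 * (r * ?J\<^sup>2 * (y\<^sup>2 + z\<^sup>2))"
      using pos by blast
  qed (intro continuous_intros | simp)+
  moreover have "?F a * sphere_mean a = (b - a)\<^sup>2 * trace_mass a"
    using ab Jpos[of a] by (simp add: sphere_mean_def)
  ultimately show ?thesis by simp
qed

text \<open>
The divergence of \<open>v\<^sup>2 \<phi> \<nabla> \<phi>\<close>: the integrand of \<open>radial_identity\<close> for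
\<open>F(r) = r ^ (N - 1) \<phi> \<phi>' = r J J' - s J\<^sup>2\<close> with \<open>s = (N - 2) / 2\<close>.
\<close>

definition flux_divergence where
  "flux_divergence x = inverse (norm x ^ (CARD('n) - 1)) * 
     ((norm x * (J0' (norm x))\<^sup>2 - norm x * (bessel_J0 (norm x))\<^sup>2 - 2 * hardy_exponent TYPE('n) * (bessel_J0 (norm x) * J0' (norm x))) * (v x)\<^sup>2
       + 2 * (norm x * bessel_J0 (norm x) * J0' (norm x) - hardy_exponent TYPE('n) * (bessel_J0 (norm x))\<^sup>2) * (v x * (v_grad x \<bullet> sgn x)))"

lemma flux_divergence_shell:
  assumes ab: "regular_interval a b"
  shows "set_integrable lborel (cshell a b) flux_divergence"
    "(LINT x:cshell a b|lborel. flux_divergence x) = (bessel_log_deriv b - hardy_exponent TYPE('n) / b) * trace_mass b - (bessel_log_deriv a - hardy_exponent TYPE('n) / a) * trace_mass a"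
proof -
  let ?F = "\<lambda>r. r * bessel_J0 r * J0' r - hardy_exponent TYPE('n) * (bessel_J0 r)\<^sup>2"
  let ?F' = "\<lambda>r. r * (J0' r)\<^sup>2 - r * (bessel_J0 r)\<^sup>2 - 2 * hardy_exponent TYPE('n) * (bessel_J0 r * J0' r)"
  have F: "(?F has_real_derivative ?F' r) (at r)" if r: "r > 0" for r
  proof -
    have "((\<lambda>r. hardy_exponent TYPE('n) * (bessel_J0 r)\<^sup>2) has_real_derivative 2 * hardy_exponent TYPE('n) * (bessel_J0 r * J0' r)) (at r)"
      by (auto intro!: derivative_eq_intros)
    from DERIV_diff[OF rJJ'_deriv[OF r] this] show ?thesis .
  qed
  have c: "continuous_on {0<..} ?F'" by (intro continuous_intros)
  note R = radial_identity[OF ab F c]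
  show "set_integrable lborel (cshell a b) flux_divergence" unfolding flux_divergence_def[abs_def] by (rule R(1))
  have Fm: "?F r * sphere_mean r = (bessel_log_deriv r - hardy_exponent TYPE('n) / r) * trace_mass r" if "0 < r" "bessel_J0 r \<noteq> 0" for r
    using that by (simp add: sphere_mean_def field_simps power2_eq_square)
  have "0 < a" "0 < b" "bessel_J0 a \<noteq> 0" "bessel_J0 b \<noteq> 0" using ab by (auto simp: regular_interval_def)
  thus "(LINT x:cshell a b|lborel. flux_divergence x) = (bessel_log_deriv b - hardy_exponent TYPE('n) / b) * trace_mass b - (bessel_log_deriv a - hardy_exponent TYPE('n) / a) * trace_mass a"
    unfolding flux_divergence_def using R(2) Fm by simp
qed

text \<open>
The ground state substitution: with \<open>q = J'/J - s/r\<close> one has \<open>\<nabla> \<phi> = \<phi> q sgn x\<close>, and expanding the square of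
\<open>\<phi> \<nabla> v + v \<nabla> \<phi>\<close> leaves the energy density plus the divergence.
\<close>

lemma hardy_density_decomposition:
  assumes x: "x \<in> regular_set"
  shows "(norm (u_grad x))\<^sup>2 - (hardy_exponent TYPE('n))\<^sup>2 * ((ground_state x * v x)\<^sup>2 / (norm x)\<^sup>2) = energy_density x + flux_divergence x"
proof -
  let ?r = "norm x" and ?J = "bessel_J0 (norm x)" and ?J' = "J0' (norm x)" and ?z = "v_grad x \<bullet> sgn x"
  let ?q = "bessel_log_deriv ?r - hardy_exponent TYPE('n) / ?r"
  have x0: "x \<noteq> 0" "?r > 0" "?J \<noteq> 0" using x by (auto simp: regular_set_def)
  have w: "(ground_state x)\<^sup>2 = bessel_weight x" by (rule ground_state_sq[OF x0(1)])
  have gr: "grad ground_state x = (ground_state x * ?q) *\<^sub>R sgn x"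
  proof -
    have "ground_state_deriv TYPE('n) ?r = ground_state x * ?q"
      unfolding ground_state_deriv_def ground_state_def hardy_exponent_def using x0 by (simp add: field_simps)
    thus ?thesis using ground_state_grad[OF x0(1)] by (simp add: sgn_div_norm divide_inverse)
  qed
  have ss: "(norm (sgn x))\<^sup>2 = 1" using x0 by (simp add: norm_sgn)
  have "u_grad x = ground_state x *\<^sub>R (v_grad x + (v x * ?q) *\<^sub>R sgn x)"
    using x by (simp add: u_grad_def gr scaleR_add_right mult_ac)
  hence "(norm (u_grad x))\<^sup>2 = bessel_weight x * (norm (v_grad x + (v x * ?q) *\<^sub>R sgn x))\<^sup>2"
    by (simp add: power_mult_distrib w)
  also have "(norm (v_grad x + (v x * ?q) *\<^sub>R sgn x))\<^sup>2 = (norm (v_grad x))\<^sup>2 + 2 * ?q * (v x * ?z) + ?q\<^sup>2 * (v x)\<^sup>2"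
    unfolding norm_sq_add_scaleR ss power_mult_distrib by (simp only: mult.assoc mult.left_commute[of "v x"] mult_1_right mult.commute[of "(v x)\<^sup>2"])
  finally have 1: "(norm (u_grad x))\<^sup>2 = bessel_weight x * ((norm (v_grad x))\<^sup>2 + 2 * ?q * (v x * ?z) + ?q\<^sup>2 * (v x)\<^sup>2)" .
  have 2: "(ground_state x * v x)\<^sup>2 / ?r\<^sup>2 = bessel_weight x * ((v x)\<^sup>2 / ?r\<^sup>2)"
    by (simp only: power_mult_distrib w times_divide_eq_right)
  let ?i = "inverse (?r ^ (CARD('n) - 1))"
  have rJ: "?r * ?J\<^sup>2 \<noteq> 0" using x0 by simp
  have 3: "flux_divergence x = bessel_weight x * ((?q\<^sup>2 - (hardy_exponent TYPE('n))\<^sup>2 / ?r\<^sup>2 - 1) * (v x)\<^sup>2 + 2 * ?q * (v x * ?z))"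
  proof -
    have a: "?r * ?J'\<^sup>2 - ?r * ?J\<^sup>2 - 2 * hardy_exponent TYPE('n) * (?J * ?J') = (?r * ?J\<^sup>2) * (?q\<^sup>2 - (hardy_exponent TYPE('n))\<^sup>2 / ?r\<^sup>2 - 1)"
    proof -
      have "r * p\<^sup>2 - r * j\<^sup>2 - 2 * s * (j * p) = (r * j\<^sup>2) * ((p / j - s / r)\<^sup>2 - s\<^sup>2 / r\<^sup>2 - 1)" if "r > 0" "j \<noteq> 0" for r j p s :: real
        using that by (simp add: power2_eq_square field_simps)
      thus ?thesis using x0 by blast
    qed
    have b: "?r * ?J * ?J' - hardy_exponent TYPE('n) * ?J\<^sup>2 = (?r * ?J\<^sup>2) * ?q"
    proof -
      have "r * j * p - s * j\<^sup>2 = (r * j\<^sup>2) * (p / j - s / r)" if "r > 0" "j \<noteq> 0" for r j p s :: real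
        using that by (simp add: power2_eq_square field_simps)
      thus ?thesis using x0 by blast
    qed
    have "flux_divergence x = (?i * (?r * ?J\<^sup>2)) * ((?q\<^sup>2 - (hardy_exponent TYPE('n))\<^sup>2 / ?r\<^sup>2 - 1) * (v x)\<^sup>2 + 2 * ?q * (v x * ?z))"
      unfolding flux_divergence_def a b by (simp only: distrib_left mult.assoc mult.left_commute mult.commute)
    thus ?thesis by (simp only: weight_radial[OF x0(1)])
  qed
  show ?thesis unfolding 1 2 3 energy_density_def by (simp add: algebra_simps)
qed

end

section \<open>The complement of the excised neighbourhoods\<close>

text \<open>
The shell between the zeros with numbers \<open>m\<close> and \<open>m + 1\<close>. For \<open>m = 0\<close> its inner radius is \<open>\<epsilon>\<close>, since the
zero with number \<open>0\<close> is \<open>0\<close>; so the excised ball at the origin is covered by the same formula.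
\<close>

definition shell_between :: "real \<Rightarrow> nat \<Rightarrow> (real^'n::finite) set" where
  "shell_between \<epsilon> m = {x. bessel_J0_zero m + \<epsilon> \<le> norm x \<and> norm x < bessel_J0_zero (Suc m) - \<epsilon>}"

lemma outside_B_eps_iff:
  assumes "\<epsilon> > 0"
  shows "x \<in> - B_eps \<epsilon> \<longleftrightarrow> (\<exists>m. x \<in> shell_between \<epsilon> m)"
proof
  assume x: "x \<in> - B_eps \<epsilon>"
  obtain m where m: "bessel_J0_zero m \<le> norm x" "norm x < bessel_J0_zero (Suc m)" using ex_zero_interval[of "norm x"] by auto
  have B: "\<not> norm x < \<epsilon>" "\<And>k. k \<ge> 1 \<Longrightarrow> norm x \<ge> bessel_J0_zero k + \<epsilon> \<or> norm x < bessel_J0_zero k - \<epsilon>"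
    using x by (auto simp: B_eps_def not_less not_le)
  have "bessel_J0_zero m + \<epsilon> \<le> norm x"
  proof (cases m)
    case (Suc k) thus ?thesis using B(2)[of m] m assms by auto
  qed (use B in auto)
  moreover have "norm x < bessel_J0_zero (Suc m) - \<epsilon>" using B(2)[of "Suc m"] m assms by auto
  ultimately show "\<exists>m. x \<in> shell_between \<epsilon> m" by (auto simp: shell_between_def)
next
  assume "\<exists>m. x \<in> shell_between \<epsilon> m"
  then obtain m where m: "bessel_J0_zero m + \<epsilon> \<le> norm x" "norm x < bessel_J0_zero (Suc m) - \<epsilon>" by (auto simp: shell_between_def)
  have near: "\<epsilon> \<le> norm x" using m bessel_J0_zero_props[of m] by linarith
  have "norm x \<ge> bessel_J0_zero k + \<epsilon> \<or> norm x < bessel_J0_zero k - \<epsilon>" for k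
  proof (cases "k \<le> m")
    case True thus ?thesis using bessel_J0_zero_mono[OF True] m by auto
  next
    case False
    hence "Suc m \<le> k" by simp
    from bessel_J0_zero_mono[OF this] show ?thesis using m by auto
  qed
  note far = this
  show "x \<in> - B_eps \<epsilon>"
  proof
    assume "x \<in> B_eps \<epsilon>"
    hence "norm x < \<epsilon> \<or> (\<exists>k. norm x < bessel_J0_zero k + \<epsilon> \<and> \<not> norm x < bessel_J0_zero k - \<epsilon>)"
      by (auto simp: B_eps_def)
    thus False
    proof
      assume "\<exists>k. norm x < bessel_J0_zero k + \<epsilon> \<and> \<not> norm x < bessel_J0_zero k - \<epsilon>"
      then obtain k where "norm x < bessel_J0_zero k + \<epsilon>" "\<not> norm x < bessel_J0_zero k - \<epsilon>" by blast
      thus False using far[of k] by linarith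
    qed (use near in simp)
  qed
qed

lemma outside_B_eps: "\<epsilon> > 0 \<Longrightarrow> - B_eps \<epsilon> = (\<Union>m. shell_between \<epsilon> m)"
  using outside_B_eps_iff by blast

lemma shell_between_borel [measurable]: "(shell_between \<epsilon> m :: (real^'n::finite) set) \<in> sets borel"
  unfolding shell_between_def by measurable

lemma disjoint_shell_between: "\<epsilon> > 0 \<Longrightarrow> disjoint_family (shell_between \<epsilon> :: nat \<Rightarrow> (real^'n::finite) set)"
  unfolding disjoint_family_on_def
proof (intro ballI impI)
  fix i j :: nat assume e: "\<epsilon> > 0" and ij: "i \<noteq> j"
  have "shell_between \<epsilon> i \<inter> shell_between \<epsilon> j = ({} :: (real^'n) set)" if "i < j" for i j
  proof -
    have "bessel_J0_zero (Suc i) \<le> bessel_J0_zero j" using that by (intro bessel_J0_zero_mono) simp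
    thus ?thesis using e by (auto simp: shell_between_def)
  qed
  thus "shell_between \<epsilon> i \<inter> shell_between \<epsilon> j = ({} :: (real^'n) set)" using ij by (metis Int_commute nat_neq_iff)
qed

lemma outside_B_eps_regular:
  assumes "\<epsilon> > 0" shows "- B_eps \<epsilon> \<subseteq> (regular_set :: (real^'n::finite) set)"
proof
  fix x :: "real^'n" assume "x \<in> - B_eps \<epsilon>"
  then obtain m where m: "x \<in> shell_between \<epsilon> m" using outside_B_eps_iff[OF assms] by blast
  have "bessel_J0_zero m < norm x" "norm x < bessel_J0_zero (Suc m)" using m assms by (auto simp: shell_between_def)
  moreover from this have "x \<noteq> 0" using bessel_J0_zero_props[of m] by auto
  ultimately show "x \<in> regular_set" using J0_nonzero_between by (auto simp: regular_set_def)
qed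

text \<open>
At distance at least \<open>\<epsilon>\<close> from the zeros and from the origin, both terms of \<open>J'/J - s/r\<close> are bounded.
\<close>

lemma outside_B_eps_grad_bound:
  assumes e: "0 < \<epsilon>" "\<epsilon> \<le> 1"
  shows "\<exists>C\<ge>0. \<forall>x::real^'n::finite\<in>- B_eps \<epsilon>. norm (grad ground_state x) \<le> C * \<bar>ground_state x\<bar>"
proof -
  obtain P where P: "\<forall>r\<ge>0. (\<forall>x. \<bar>x - r\<bar> \<le> \<epsilon>/2 \<longrightarrow> 0 < x \<longrightarrow> bessel_J0 x \<noteq> 0) \<longrightarrow> \<bar>J0' r / bessel_J0 r\<bar> \<le> P"
    using log_deriv_J0_bounded[of "\<epsilon>/2"] e by auto
  let ?C = "\<bar>P\<bar> + \<bar>(real CARD('n) - 2) / 2\<bar> / \<epsilon>"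
  have "norm (grad ground_state x) \<le> ?C * \<bar>ground_state x\<bar>" if x: "x \<in> - B_eps \<epsilon>" for x :: "real^'n"
  proof -
    obtain m where m: "bessel_J0_zero m + \<epsilon> \<le> norm x" "norm x < bessel_J0_zero (Suc m) - \<epsilon>"
      using x outside_B_eps_iff[OF e(1)] by (auto simp: shell_between_def)
    have "bessel_J0 y \<noteq> 0" if "\<bar>y - norm x\<bar> \<le> \<epsilon>/2" for y
    proof -
      have "norm x - \<epsilon>/2 \<le> y" "y \<le> norm x + \<epsilon>/2" using that unfolding abs_le_iff by linarith+
      thus ?thesis using m e by (intro J0_nonzero_between[of m]) linarith+
    qed
    hence p: "\<bar>J0' (norm x) / bessel_J0 (norm x)\<bar> \<le> P" using P by auto
    have ex: "\<epsilon> \<le> norm x" using m bessel_J0_zero_props[of m] by linarith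
    have "\<bar>(real CARD('n) - 2) / 2 / norm x\<bar> = \<bar>(real CARD('n) - 2) / 2\<bar> / norm x" by (simp add: abs_divide)
    also have "\<dots> \<le> \<bar>(real CARD('n) - 2) / 2\<bar> / \<epsilon>" using ex e by (intro divide_left_mono mult_pos_pos) auto
    finally have "\<bar>J0' (norm x) / bessel_J0 (norm x) - (real CARD('n) - 2) / 2 / norm x\<bar> \<le> ?C" using p by linarith
    hence "\<bar>ground_state x\<bar> * \<bar>J0' (norm x) / bessel_J0 (norm x) - (real CARD('n) - 2) / 2 / norm x\<bar> \<le> \<bar>ground_state x\<bar> * ?C"
      by (rule mult_left_mono) simp
    thus ?thesis using grad_ground_state_norm[of x] x outside_B_eps_regular[OF e(1)] by (auto simp: mult.commute)
  qed
  moreover have "?C \<ge> 0" using e by simp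
  ultimately show ?thesis by blast
qed

lemma B_eps_shrinks:
  assumes "x \<in> regular_set" shows "\<exists>\<delta>>0. \<forall>\<epsilon>. 0 < \<epsilon> \<longrightarrow> \<epsilon> < \<delta> \<longrightarrow> x \<in> - B_eps \<epsilon>"
proof -
  have x: "x \<noteq> 0" "bessel_J0 (norm x) \<noteq> 0" using assms by (auto simp: regular_set_def)
  obtain m where m: "bessel_J0_zero m \<le> norm x" "norm x < bessel_J0_zero (Suc m)" using ex_zero_interval[of "norm x"] by auto
  have "bessel_J0_zero m \<noteq> norm x" using x bessel_J0_zero_is_zero[of m] by (cases m) auto
  hence "bessel_J0_zero m < norm x" using m by simp
  hence "min (norm x - bessel_J0_zero m) (bessel_J0_zero (Suc m) - norm x) > 0" using m by simp
  moreover have "x \<in> - B_eps \<epsilon>" if "0 < \<epsilon>" "\<epsilon> < min (norm x - bessel_J0_zero m) (bessel_J0_zero (Suc m) - norm x)" for \<epsilon>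
    using that by (subst outside_B_eps_iff) (auto simp: shell_between_def intro!: exI[of _ m])
  ultimately show ?thesis by blast
qed

section \<open>Letting the neighbourhoods shrink\<close>

lemma log_deriv_near_zero:
  assumes m: "1 \<le> m" and e: "0 < \<epsilon>" "\<epsilon> \<le> 1/8"
  shows "bessel_J0 (bessel_J0_zero m + \<epsilon>) \<noteq> 0" "bessel_J0 (bessel_J0_zero m - \<epsilon>) \<noteq> 0"
    "0 < bessel_log_deriv (bessel_J0_zero m + \<epsilon>)" "1 \<le> 3 * \<epsilon> * bessel_log_deriv (bessel_J0_zero m + \<epsilon>)"
    "bessel_log_deriv (bessel_J0_zero m - \<epsilon>) < 0" "1 \<le> 3 * \<epsilon> * (- bessel_log_deriv (bessel_J0_zero m - \<epsilon>))"
proof -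
  let ?z = "bessel_J0_zero m"
  note Q = J0_quotient_near_zero[OF bessel_J0_zero_ge_2[OF m] bessel_J0_zero_is_zero[OF m]]
  have a1: "0 < \<bar>?z + \<epsilon> - ?z\<bar>" "\<bar>?z + \<epsilon> - ?z\<bar> \<le> 1/8" and a2: "0 < \<bar>?z - \<epsilon> - ?z\<bar>" "\<bar>?z - \<epsilon> - ?z\<bar> \<le> 1/8" using e by auto
  note P = Q[OF a1] and M = Q[OF a2]
  show "bessel_J0 (?z + \<epsilon>) \<noteq> 0" "bessel_J0 (?z - \<epsilon>) \<noteq> 0" using P M by auto
  define q where "q = bessel_J0 (?z + \<epsilon>) / J0' (?z + \<epsilon>)"
  have q: "0 < q" "q \<le> 3 * \<epsilon>" using P(1,2) e unfolding q_def[symmetric] by (simp_all add: zero_less_divide_iff divide_le_eq)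
  have pq: "bessel_log_deriv (?z + \<epsilon>) = 1 / q" by (simp add: q_def)
  show "0 < bessel_log_deriv (?z + \<epsilon>)" "1 \<le> 3 * \<epsilon> * bessel_log_deriv (?z + \<epsilon>)" unfolding pq using q by (simp_all add: divide_simps)
  define q' where "q' = - (bessel_J0 (?z - \<epsilon>) / J0' (?z - \<epsilon>))"
  have "bessel_J0 (?z - \<epsilon>) / J0' (?z - \<epsilon>) / (?z - \<epsilon> - ?z) = q' / \<epsilon>" by (simp add: q'_def)
  hence q': "0 < q'" "q' \<le> 3 * \<epsilon>" using M(1,2) e by (simp_all add: zero_less_divide_iff divide_le_eq)
  have pq': "bessel_log_deriv (?z - \<epsilon>) = - (1 / q')" by (simp add: q'_def)
  show "bessel_log_deriv (?z - \<epsilon>) < 0" "1 \<le> 3 * \<epsilon> * (- bessel_log_deriv (?z - \<epsilon>))" unfolding pq' using q' by (simp_all add: divide_simps)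
qed

context bessel_approx
begin

text \<open>
The energy near the nodal sphere with number \<open>m\<close>. As zeros are at least \<open>1/8\<close> apart, these neighbourhoods
are disjoint.
\<close>

definition node_energy where "node_energy m = energy_on (cshell (bessel_J0_zero m - 1/20) (bessel_J0_zero m + 1/20))"

lemma node_energy_summable:
  shows "summable (\<lambda>m. node_energy (Suc m))" "(\<Sum>m. node_energy (Suc m)) \<le> (\<integral>x. energy_density x \<partial>lborel)"
proof -
  let ?A = "\<lambda>m. cshell (bessel_J0_zero (Suc m) - 1/20) (bessel_J0_zero (Suc m) + 1/20) :: (real^'n) set"
  have d: "disjoint_family ?A"
    unfolding disjoint_family_on_def
  proof (intro ballI impI)
    fix i j :: nat assume ij: "i \<noteq> j"
    have "?A i \<inter> ?A j = {}" if "i < j" for i j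
    proof -
      have "bessel_J0_zero (Suc i) + 1/8 \<le> bessel_J0_zero (Suc (Suc i))" by (rule bessel_J0_zero_gap)
      also have "\<dots> \<le> bessel_J0_zero (Suc j)" using that by (intro bessel_J0_zero_mono) simp
      finally show ?thesis by (auto simp: cshell_def)
    qed
    thus "?A i \<inter> ?A j = {}" using ij by (metis Int_commute nat_neq_iff)
  qed
  have s: "?A i \<in> sets lborel" for i using cshell_borel by simp
  show "summable (\<lambda>m. node_energy (Suc m))" "(\<Sum>m. node_energy (Suc m)) \<le> (\<integral>x. energy_density x \<partial>lborel)"
    unfolding node_energy_def by (rule sum_set_integral_disjoint_le[OF energy_integrable energy_density_nonneg s d])+
qed

text \<open>
The boundary estimates on the shells between \<open>z\<^sub>m \<plusminus> \<epsilon>\<close> and \<open>z\<^sub>m \<plusminus> 1/20\<close>. They have width at least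
\<open>1/40\<close>, whence the constant \<open>4800 = 3 * 40\<^sup>2\<close>; and \<open>|J/J'| \<le> 3 \<epsilon>\<close> at \<open>z\<^sub>m \<plusminus> \<epsilon>\<close> yields the last two
bounds.
\<close>

lemma node_bounds:
  assumes m: "1 \<le> m" and e: "0 < \<epsilon>" "\<epsilon> \<le> 1/40"
  shows "0 \<le> bessel_log_deriv (bessel_J0_zero m + \<epsilon>) * trace_mass (bessel_J0_zero m + \<epsilon>)"
    "bessel_log_deriv (bessel_J0_zero m + \<epsilon>) * trace_mass (bessel_J0_zero m + \<epsilon>) \<le> 4800 * node_energy m"
    "0 \<le> - (bessel_log_deriv (bessel_J0_zero m - \<epsilon>) * trace_mass (bessel_J0_zero m - \<epsilon>))"
    "- (bessel_log_deriv (bessel_J0_zero m - \<epsilon>) * trace_mass (bessel_J0_zero m - \<epsilon>)) \<le> 4800 * node_energy m"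
    "trace_mass (bessel_J0_zero m + \<epsilon>) \<le> \<epsilon> * (14400 * node_energy m)"
    "trace_mass (bessel_J0_zero m - \<epsilon>) \<le> \<epsilon> * (14400 * node_energy m)"
proof -
  let ?z = "bessel_J0_zero m"
  have e8: "\<epsilon> \<le> 1/8" using e by simp
  have z2: "?z \<ge> 2" by (rule bessel_J0_zero_ge_2[OF m])
  note L = log_deriv_near_zero[OF m e(1) e8]
  let ?p = "bessel_log_deriv (?z + \<epsilon>)" and ?q = "- bessel_log_deriv (?z - \<epsilon>)"
  have nz: "bessel_J0 r \<noteq> 0" if "r \<noteq> ?z" "\<bar>r - ?z\<bar> \<le> 1/8" for r
    by (rule J0_quotient_near_zero(3)[OF z2 bessel_J0_zero_is_zero[OF m]]) (use that in auto)
  have rp: "regular_interval (?z + \<epsilon>) (?z + 1/20)"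
    unfolding regular_interval_def
  proof (intro conjI ballI)
    fix r assume "r \<in> {?z + \<epsilon>..?z + 1/20}"
    thus "bessel_J0 r \<noteq> 0" using e by (intro nz) auto
  qed (use e z2 in auto)
  have rm: "regular_interval (?z - 1/20) (?z - \<epsilon>)"
    unfolding regular_interval_def
  proof (intro conjI ballI)
    fix r assume "r \<in> {?z - 1/20..?z - \<epsilon>}"
    thus "bessel_J0 r \<noteq> 0" using e by (intro nz) auto
  qed (use e z2 in auto)
  show 1: "0 \<le> ?p * trace_mass (?z + \<epsilon>)" using L(3) trace_mass_nonneg by (intro mult_nonneg_nonneg) auto
  have 3: "0 \<le> ?q * trace_mass (?z - \<epsilon>)" using L(5) trace_mass_nonneg by (intro mult_nonneg_nonneg) auto
  thus "0 \<le> - (bessel_log_deriv (?z - \<epsilon>) * trace_mass (?z - \<epsilon>))" by simp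
  have sq: "1/1600 \<le> (1/20 - \<epsilon>)\<^sup>2"
  proof -
    have "(1/40)\<^sup>2 \<le> (1/20 - \<epsilon>)\<^sup>2" using e by (intro power_mono) auto
    thus ?thesis by (simp add: power2_eq_square)
  qed
  have "(?z + 1/20 - (?z + \<epsilon>))\<^sup>2 * (?p * trace_mass (?z + \<epsilon>)) \<le> 3 * energy_on (cshell (?z + \<epsilon>) (?z + 1/20))"
    by (rule boundary_estimate_right[OF rp]) (use e in simp)
  also have "\<dots> \<le> 3 * node_energy m" unfolding node_energy_def
    using e by (intro mult_left_mono energy_on_mono cshell_borel) (auto simp: cshell_def)
  finally have "(1/20 - \<epsilon>)\<^sup>2 * (?p * trace_mass (?z + \<epsilon>)) \<le> 3 * node_energy m" by simp
  moreover have "1/1600 * (?p * trace_mass (?z + \<epsilon>)) \<le> (1/20 - \<epsilon>)\<^sup>2 * (?p * trace_mass (?z + \<epsilon>))" by (rule mult_right_mono[OF sq 1])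
  ultimately show 2: "?p * trace_mass (?z + \<epsilon>) \<le> 4800 * node_energy m" by linarith
  have "- ((?z - \<epsilon> - (?z - 1/20))\<^sup>2 * (bessel_log_deriv (?z - \<epsilon>) * trace_mass (?z - \<epsilon>))) \<le> 3 * energy_on (cshell (?z - 1/20) (?z - \<epsilon>))"
    by (rule boundary_estimate_left[OF rm]) (use e in simp)
  also have "\<dots> \<le> 3 * node_energy m" unfolding node_energy_def
    using e by (intro mult_left_mono energy_on_mono cshell_borel) (auto simp: cshell_def)
  finally have "(1/20 - \<epsilon>)\<^sup>2 * (?q * trace_mass (?z - \<epsilon>)) \<le> 3 * node_energy m" by simp
  moreover have "1/1600 * (?q * trace_mass (?z - \<epsilon>)) \<le> (1/20 - \<epsilon>)\<^sup>2 * (?q * trace_mass (?z - \<epsilon>))" by (rule mult_right_mono[OF sq 3])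
  ultimately have 4: "?q * trace_mass (?z - \<epsilon>) \<le> 4800 * node_energy m" by linarith
  thus "- (bessel_log_deriv (?z - \<epsilon>) * trace_mass (?z - \<epsilon>)) \<le> 4800 * node_energy m" by simp
  have "trace_mass (?z + \<epsilon>) * 1 \<le> trace_mass (?z + \<epsilon>) * (3 * \<epsilon> * ?p)" by (rule mult_left_mono[OF L(4) trace_mass_nonneg])
  also have "\<dots> = 3 * \<epsilon> * (?p * trace_mass (?z + \<epsilon>))" by (simp only: mult.assoc mult.left_commute mult.commute)
  also have "\<dots> \<le> 3 * \<epsilon> * (4800 * node_energy m)" using e by (intro mult_left_mono 2) auto
  finally show "trace_mass (?z + \<epsilon>) \<le> \<epsilon> * (14400 * node_energy m)" by simp
  have "trace_mass (?z - \<epsilon>) * 1 \<le> trace_mass (?z - \<epsilon>) * (3 * \<epsilon> * ?q)" by (rule mult_left_mono[OF L(6) trace_mass_nonneg])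
  also have "\<dots> = 3 * \<epsilon> * (?q * trace_mass (?z - \<epsilon>))" by (simp only: mult.assoc mult.left_commute mult.commute)
  also have "\<dots> \<le> 3 * \<epsilon> * (4800 * node_energy m)" using e by (intro mult_left_mono 4) auto
  finally show "trace_mass (?z - \<epsilon>) \<le> \<epsilon> * (14400 * node_energy m)" by simp
qed

lemma boundary_term_eq: "bessel_boundary_term r u = bessel_log_deriv r * trace_mass r"
proof -
  have "bessel_boundary_term r u = (LINT x|sphere_measure r. bessel_log_deriv r * (sphere_trace r u x)\<^sup>2)"
    unfolding bessel_boundary_term_def J0'_def[symmetric]
    by (rule Bochner_Integration.integral_cong) (auto simp: divide_inverse mult.commute)
  thus ?thesis by (simp add: trace_mass_def)
qed

lemma hardy_energy_eq: "hardy_energy \<epsilon> u = hardy_exponent TYPE('n) / \<epsilon> * trace_mass \<epsilon>"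
  unfolding hardy_energy_def trace_mass_def hardy_exponent_def by (simp only: divide_inverse)

text \<open>
Dividing \<open>u\<close> by the ground state recovers \<open>v\<close> almost everywhere on the regular set. The two functions thus have the same weak gradients,
and so the chosen gradients are equal.
\<close>

lemma J_norm2_eq: "J_norm2 u = (\<integral>x. energy_density x \<partial>lborel)"
proof -
  let ?v = "\<lambda>x. norm x powr ((real CARD('n) - 2) / 2) * inverse (bessel_J0 (norm x)) * u x"
  have ae: "AE x in lborel. x \<in> regular_set \<longrightarrow> ?v x = v x"
    using uv
  proof eventually_elim
    fix x assume ux: "u x = ground_state x * v x"
    show "x \<in> regular_set \<longrightarrow> ?v x = v x"
    proof
      assume "x \<in> regular_set"
      hence x: "norm x > 0" "bessel_J0 (norm x) \<noteq> 0" by (auto simp: regular_set_def)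
      have "norm x powr ((real CARD('n) - 2) / 2) * norm x powr (- ((real CARD('n) - 2) / 2)) = 1"
        using x by (simp add: powr_add[symmetric])
      moreover have "?v x = (norm x powr ((real CARD('n) - 2) / 2) * norm x powr (- ((real CARD('n) - 2) / 2))) * (inverse (bessel_J0 (norm x)) * bessel_J0 (norm x)) * v x"
        unfolding ux ground_state_def by (simp only: mult.assoc mult.left_commute mult.commute)
      ultimately show "?v x = v x" using x by simp
    qed
  qed
  have mv: "?v \<in> borel_measurable borel" by measurable
  have ae': "AE x in lborel. x \<in> regular_set \<longrightarrow> v x = ?v x" using ae by eventually_elim auto
  have "has_weak_gradient_on ?v h regular_set \<longleftrightarrow> has_weak_gradient_on v h regular_set" for h
    by (rule iffI; erule has_weak_gradient_cong_AE[OF open_regular_set _ mv ae'] has_weak_gradient_cong_AE[OF open_regular_set _ v_borel ae])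
  hence wg: "weak_gradient regular_set ?v = v_grad" unfolding weak_gradient_def v_grad_def by simp
  have "(LINT x|lborel. bessel_weight x * \<bar>?v x\<bar>\<^sup>2) = (LINT x|lborel. bessel_weight x * (v x)\<^sup>2)"
  proof (rule integral_cong_AE)
    show "AE x in lborel. bessel_weight x * \<bar>?v x\<bar>\<^sup>2 = bessel_weight x * (v x)\<^sup>2"
      using ae AE_regular_set by eventually_elim simp
    show "(\<lambda>x. bessel_weight x * \<bar>?v x\<bar>\<^sup>2) \<in> borel_measurable lborel" using mv by measurable
  qed measurable
  hence "J_norm2 u = (LINT x|lborel. bessel_weight x * (norm (v_grad x))\<^sup>2) + (LINT x|lborel. bessel_weight x * (v x)\<^sup>2)"
    unfolding J_norm2_def Let_def wg bessel_weight_def[symmetric] by simp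
  also have "\<dots> = (\<integral>x. energy_density x \<partial>lborel)"
    unfolding energy_density_def distrib_left by (rule Bochner_Integration.integral_add[OF v_grad_integrable v_integrable, symmetric])
  finally show ?thesis .
qed

lemma B_eps_borel:
  assumes "0 < \<epsilon>" shows "(- B_eps \<epsilon> :: (real^'n) set) \<in> sets borel"
  unfolding outside_B_eps[OF assms] by (rule sets.countable_UN) (intro image_subsetI shell_between_borel)

text \<open>
On the complement of the excised set both terms of the Hardy functional are integrable, so the
pointwise decomposition can be integrated.
\<close>

lemma hardy_integrals:
  assumes e: "0 < \<epsilon>" "\<epsilon> \<le> 1"
  shows "hardy_integrals_converge (- B_eps \<epsilon>) u"
    "set_integrable lborel (- B_eps \<epsilon>) flux_divergence"
    "hardy_functional (- B_eps \<epsilon>) u = energy_on (- B_eps \<epsilon>) + (LINT x:- B_eps \<epsilon>|lborel. flux_divergence x)"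
proof -
  let ?D = "- B_eps \<epsilon> :: (real^'n) set" and ?s = "(hardy_exponent TYPE('n))\<^sup>2"
  have Dm [measurable]: "?D \<in> sets borel" by (rule B_eps_borel[OF e(1)])
  note DR = outside_B_eps_regular[OF e(1), where 'n='n]
  obtain C where C: "C \<ge> 0" "\<forall>x::real^'n\<in>?D. norm (grad ground_state x) \<le> C * \<bar>ground_state x\<bar>"
    using outside_B_eps_grad_bound[OF e] by blast
  note B = weighted_pair_bound[OF v_borel v_grad_borel v_integrable v_grad_integrable Dm DR C]
  have iG: "set_integrable lborel ?D (\<lambda>x. (norm (u_grad x))\<^sup>2)" using B(3) by (simp only: u_grad_def)
  let ?h = "\<lambda>x. (ground_state x * v x)\<^sup>2 / (norm x)\<^sup>2"
  have nx: "\<epsilon> \<le> norm x" if "x \<in> ?D" for x using that by (auto simp: B_eps_def)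
  have ih: "set_integrable lborel ?D ?h"
  proof (rule set_integrable_bound)
    show "set_integrable lborel ?D (\<lambda>x. 1 / \<epsilon>\<^sup>2 * (ground_state x * v x)\<^sup>2)" by (rule set_integrable_mult_right[OF B(1)])
    show "set_borel_measurable lborel ?D ?h" unfolding set_borel_measurable_def by measurable
    show "AE x in lborel. x \<in> ?D \<longrightarrow> norm (?h x) \<le> norm (1 / \<epsilon>\<^sup>2 * (ground_state x * v x)\<^sup>2)"
    proof (intro AE_I2 impI)
      fix x assume x: "x \<in> ?D"
      have "\<epsilon>\<^sup>2 \<le> (norm x)\<^sup>2" using nx[OF x] e by (intro power_mono) auto
      hence "(ground_state x * v x)\<^sup>2 / (norm x)\<^sup>2 \<le> (ground_state x * v x)\<^sup>2 / \<epsilon>\<^sup>2" using e nx[OF x] by (intro divide_left_mono mult_pos_pos) auto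
      thus "norm (?h x) \<le> norm (1 / \<epsilon>\<^sup>2 * (ground_state x * v x)\<^sup>2)" by simp
    qed
  qed
  have wgm [measurable]: "weak_gradient regular_set u \<in> borel_measurable borel"
    by (rule has_weak_gradientD(1)[OF weak_gradient_works[OF u_weak_gradient]])
  have Gm [measurable]: "u_grad \<in> borel_measurable borel" by (rule has_weak_gradientD(1)[OF u_weak_gradient])
  have ae1: "AE x\<in>?D in lborel. (norm (weak_gradient regular_set u x))\<^sup>2 = (norm (u_grad x))\<^sup>2"
    using weak_gradient_AE[OF open_regular_set u_weak_gradient] by eventually_elim (use DR in auto)
  have ae2: "AE x\<in>?D in lborel. (u x)\<^sup>2 / (norm x)\<^sup>2 = ?h x"
    using uv by eventually_elim simp
  have D': "?D \<in> sets lborel" using Dm by simp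
  have M: "(\<lambda>x. (norm (weak_gradient regular_set u x))\<^sup>2) \<in> borel_measurable lborel" "(\<lambda>x. (norm (u_grad x))\<^sup>2) \<in> borel_measurable lborel"
     "(\<lambda>x. (u x)\<^sup>2 / (norm x)\<^sup>2) \<in> borel_measurable lborel" "?h \<in> borel_measurable lborel" by measurable
  have "set_integrable lborel ?D (\<lambda>x. (norm (weak_gradient regular_set u x))\<^sup>2)"
    using set_integrable_cong_AE[OF M(1,2) ae1 D'] iG by blast
  moreover have "set_integrable lborel ?D (\<lambda>x. (u x)\<^sup>2 / (norm x)\<^sup>2)"
    using set_integrable_cong_AE[OF M(3,4) ae2 D'] ih by blast
  ultimately show "hardy_integrals_converge ?D u"
    unfolding hardy_integrals_converge_def weakly_differentiable_on_def using u_weak_gradient by blast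
  have eq: "indicator ?D x *\<^sub>R flux_divergence x = indicator ?D x *\<^sub>R ((norm (u_grad x))\<^sup>2 - ?s * ?h x - energy_density x)" for x
    using hardy_density_decomposition[of x] DR by (auto simp: indicator_def)
  have i3: "set_integrable lborel ?D (\<lambda>x. (norm (u_grad x))\<^sup>2 - ?s * ?h x)"
    by (rule set_integral_diff(1)[OF iG set_integrable_mult_right[OF ih]])
  have ie: "set_integrable lborel ?D energy_density" by (rule energy_set_integrable[OF Dm])
  show "set_integrable lborel ?D flux_divergence"
    using set_integral_diff(1)[OF i3 ie] unfolding set_integrable_def eq .
  have "(LINT x:?D|lborel. flux_divergence x) = (LINT x:?D|lborel. (norm (u_grad x))\<^sup>2 - ?s * ?h x - energy_density x)"
    unfolding set_lebesgue_integral_def eq ..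
  also have "\<dots> = (LINT x:?D|lborel. (norm (u_grad x))\<^sup>2) - ?s * (LINT x:?D|lborel. ?h x) - energy_on ?D"
    unfolding set_integral_diff(2)[OF i3 ie] set_integral_diff(2)[OF iG set_integrable_mult_right[OF ih]] by (simp only: set_integral_mult_right)
  also have "(LINT x:?D|lborel. (norm (u_grad x))\<^sup>2) - ?s * (LINT x:?D|lborel. ?h x) = hardy_functional ?D u"
    unfolding hardy_functional_def set_lebesgue_integral_cong_AE[OF D' M(1,2) ae1] set_lebesgue_integral_cong_AE[OF D' M(3,4) ae2] hardy_exponent_def ..
  finally show "hardy_functional ?D u = energy_on ?D + (LINT x:?D|lborel. flux_divergence x)" by simp
qed

text \<open>
The flux of \<open>v\<^sup>2 \<phi> \<nabla> \<phi>\<close> through the sphere of radius \<open>r\<close>.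
\<close>

definition hardy_flux where "hardy_flux r = (bessel_log_deriv r - hardy_exponent TYPE('n) / r) * trace_mass r"

lemma flux_divergence_between:
  assumes e: "0 < \<epsilon>" "\<epsilon> \<le> 1/40"
  shows "(LINT x:shell_between \<epsilon> m|lborel. flux_divergence x) = hardy_flux (bessel_J0_zero (Suc m) - \<epsilon>) - hardy_flux (bessel_J0_zero m + \<epsilon>)"
proof -
  let ?a = "bessel_J0_zero m + \<epsilon>" and ?b = "bessel_J0_zero (Suc m) - \<epsilon>"
  have z: "0 \<le> bessel_J0_zero m" using bessel_J0_zero_props[of m] by simp
  have ab: "regular_interval ?a ?b"
    unfolding regular_interval_def
  proof (intro conjI ballI)
    show "0 < ?a" using z e by simp
    show "?a < ?b" using bessel_J0_zero_gap[of m] e by simp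
    show "bessel_J0 r \<noteq> 0" if "r \<in> {?a..?b}" for r using that e by (intro J0_nonzero_between[of m]) auto
  qed
  note R = flux_divergence_shell[OF ab]
  have "AE x in lborel. x \<notin> sphere (0::real^'n) ?b"
  proof (rule AE_not_in)
    have "sphere (0::real^'n) ?b \<in> null_sets (completion lborel)"
      using negligible_sphere[of "0::real^'n" ?b] by (simp only: negligible_iff_null_sets)
    thus "sphere (0::real^'n) ?b \<in> null_sets lborel" by (subst (asm) null_sets_completion_iff) simp_all
  qed
  hence ae: "AE x in lborel. x \<in> cshell ?a ?b \<longleftrightarrow> x \<in> (shell_between \<epsilon> m :: (real^'n) set)"
    by eventually_elim (auto simp: cshell_def shell_between_def)
  have sub: "shell_between \<epsilon> m \<subseteq> (cshell ?a ?b :: (real^'n) set)" by (auto simp: cshell_def shell_between_def)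
  have "set_integrable lborel (shell_between \<epsilon> m) flux_divergence"
    by (rule set_integrable_subset[OF R(1) _ sub]) simp
  hence "(LINT x:shell_between \<epsilon> m|lborel. flux_divergence x) = (LINT x:cshell ?a ?b|lborel. flux_divergence x)"
    using R(1) ae by (intro set_integral_cong_set) (auto simp: set_borel_measurable_def set_integrable_def)
  thus ?thesis using R(2) by (simp add: hardy_flux_def)
qed

text \<open>
The fluxes through the two sides of each shell are rearranged into a telescoping series, which leaves the flux at \<open>\<epsilon>\<close>,
and differences across the nodal spheres. There the parts with \<open>J'/J\<close> cancel against \<open>\<Lambda>\<^sub>\<plusminus>\<close>, and the parts
with \<open>s/r\<close> are of order \<open>\<epsilon>\<close> by \<open>node_bounds\<close>. At the origin \<open>|J'/J| \<le> \<epsilon>\<close> while the trace integral stays bounded.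
\<close>

lemma boundary_sums:
  assumes e: "0 < \<epsilon>" "\<epsilon> \<le> 1/40"
  shows "summable (\<lambda>m. Lambda_plus \<epsilon> (Suc m) u - Lambda_minus \<epsilon> (Suc m) u)"
    "\<bar>(hardy_functional (- B_eps \<epsilon>) u - hardy_energy \<epsilon> u + (\<Sum>m. Lambda_plus \<epsilon> (Suc m) u - Lambda_minus \<epsilon> (Suc m) u)) - energy_on (- B_eps \<epsilon>)\<bar>
       \<le> \<epsilon> * ((48 + 28800 * \<bar>hardy_exponent TYPE('n)\<bar>) * (\<integral>x. energy_density x \<partial>lborel))"
proof -
  let ?s = "hardy_exponent TYPE('n)"
  define zp zm where "zp m = bessel_J0_zero m + \<epsilon>" and "zm m = bessel_J0_zero m - \<epsilon>" for m
  have z2: "bessel_J0_zero (Suc m) \<ge> 2" for m by (rule bessel_J0_zero_ge_2) simp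
  have one_le: "1 \<le> Suc k" for k by simp
  note nb = node_bounds[OF one_le e, folded zp_def zm_def]
  have SN: "summable (\<lambda>m. c * node_energy (Suc m))" for c by (rule summable_mult[OF node_energy_summable(1)])
  have sp: "summable (\<lambda>m. bessel_log_deriv (zp (Suc m)) * trace_mass (zp (Suc m)))"
  proof (rule summable_comparison_test'[OF SN[of 4800], where N=0])
    fix m
    show "norm (bessel_log_deriv (zp (Suc m)) * trace_mass (zp (Suc m))) \<le> 4800 * node_energy (Suc m)"
      using nb(1,2)[of m] unfolding real_norm_def abs_le_iff by linarith
  qed
  have sm: "summable (\<lambda>m. bessel_log_deriv (zm (Suc m)) * trace_mass (zm (Suc m)))"
  proof (rule summable_comparison_test'[OF SN[of 4800], where N=0])
    fix m
    show "norm (bessel_log_deriv (zm (Suc m)) * trace_mass (zm (Suc m))) \<le> 4800 * node_energy (Suc m)"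
      using nb(3,4)[of m] unfolding real_norm_def abs_le_iff by linarith
  qed
  have hp: "\<bar>?s / zp (Suc m) * trace_mass (zp (Suc m))\<bar> \<le> \<epsilon> * (\<bar>?s\<bar> * (14400 * node_energy (Suc m)))"
    and hm: "\<bar>?s / zm (Suc m) * trace_mass (zm (Suc m))\<bar> \<le> \<epsilon> * (\<bar>?s\<bar> * (14400 * node_energy (Suc m)))" for m
  proof -
    have gen: "\<bar>?s / r * trace_mass r\<bar> \<le> \<epsilon> * (\<bar>?s\<bar> * (14400 * node_energy (Suc m)))" if r: "r \<ge> 1" "trace_mass r \<le> \<epsilon> * (14400 * node_energy (Suc m))" for r
    proof -
      have "\<bar>?s / r * trace_mass r\<bar> = \<bar>?s\<bar> / r * trace_mass r" using r trace_mass_nonneg[of r] by (simp add: abs_mult)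
      also have "\<dots> \<le> \<bar>?s\<bar> * trace_mass r" using r by (intro mult_right_mono trace_mass_nonneg) (auto simp: divide_le_eq mult_le_cancel_left1)
      also have "\<dots> \<le> \<bar>?s\<bar> * (\<epsilon> * (14400 * node_energy (Suc m)))" by (rule mult_left_mono[OF r(2)]) simp
      finally show ?thesis by (simp only: mult.left_commute)
    qed
    show "\<bar>?s / zp (Suc m) * trace_mass (zp (Suc m))\<bar> \<le> \<epsilon> * (\<bar>?s\<bar> * (14400 * node_energy (Suc m)))"
      by (rule gen[OF _ nb(5)]) (use z2[of m] e in \<open>simp add: zp_def\<close>)
    show "\<bar>?s / zm (Suc m) * trace_mass (zm (Suc m))\<bar> \<le> \<epsilon> * (\<bar>?s\<bar> * (14400 * node_energy (Suc m)))"
      by (rule gen[OF _ nb(6)]) (use z2[of m] e in \<open>simp add: zm_def\<close>)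
  qed
  have SB: "summable (\<lambda>m. \<epsilon> * (\<bar>?s\<bar> * (14400 * node_energy (Suc m))))" 
    by (intro summable_mult node_energy_summable(1))
  have shp: "summable (\<lambda>m. ?s / zp (Suc m) * trace_mass (zp (Suc m)))" 
    by (rule summable_comparison_test'[OF SB, where N=0]) (use hp in simp)
  have shm: "summable (\<lambda>m. ?s / zm (Suc m) * trace_mass (zm (Suc m)))" 
    by (rule summable_comparison_test'[OF SB, where N=0]) (use hm in simp)
  define L where "L m = Lambda_plus \<epsilon> (Suc m) u - Lambda_minus \<epsilon> (Suc m) u" for m
  have L: "L m = bessel_log_deriv (zp (Suc m)) * trace_mass (zp (Suc m)) - bessel_log_deriv (zm (Suc m)) * trace_mass (zm (Suc m))" for m
    by (simp add: L_def Lambda_plus_def Lambda_minus_def boundary_term_eq zp_def zm_def)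
  have sL: "summable L" unfolding L by (rule summable_diff[OF sp sm])
  thus "summable (\<lambda>m. Lambda_plus \<epsilon> (Suc m) u - Lambda_minus \<epsilon> (Suc m) u)" by (simp add: L_def[abs_def])
  have Hp: "hardy_flux (zp (Suc m)) = bessel_log_deriv (zp (Suc m)) * trace_mass (zp (Suc m)) - ?s / zp (Suc m) * trace_mass (zp (Suc m))" 
   and Hm: "hardy_flux (zm (Suc m)) = bessel_log_deriv (zm (Suc m)) * trace_mass (zm (Suc m)) - ?s / zm (Suc m) * trace_mass (zm (Suc m))" for m
    by (simp_all only: hardy_flux_def left_diff_distrib)
  have sHp: "summable (\<lambda>m. hardy_flux (zp (Suc m)))" unfolding Hp by (rule summable_diff[OF sp shp])
  \<comment> \<open>the fluxes \<open>hardy_flux (zp m)\<close> are summable, so the series of their increments telescopes to minus the first of them\<close>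
  have "(\<lambda>m. hardy_flux (zp m)) \<longlonglongrightarrow> 0" using summable_LIMSEQ_zero[OF sHp] by (rule LIMSEQ_imp_Suc)
  hence tel: "(\<lambda>m. hardy_flux (zp (Suc m)) - hardy_flux (zp m)) sums (0 - hardy_flux (zp 0))" by (rule telescope_sums)
  define T where "T m = ?s / zp (Suc m) * trace_mass (zp (Suc m)) - ?s / zm (Suc m) * trace_mass (zm (Suc m))" for m
  have sT: "summable T" unfolding T_def by (rule summable_diff[OF shp shm])
  have "(\<lambda>m. LINT x:shell_between \<epsilon> m|lborel. flux_divergence x) sums (LINT x:(\<Union>m. shell_between \<epsilon> m)|lborel. flux_divergence x)"
  proof (rule set_integral_sums[OF _ disjoint_shell_between[OF e(1)]])
    have "\<epsilon> \<le> 1" using e(2) by simp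
    thus "set_integrable lborel (\<Union>m. shell_between \<epsilon> m) flux_divergence"
      using hardy_integrals(2)[OF e(1)] unfolding outside_B_eps[OF e(1)] by blast
  qed simp
  hence rs: "(\<lambda>m. hardy_flux (zm (Suc m)) - hardy_flux (zp m)) sums (LINT x:- B_eps \<epsilon>|lborel. flux_divergence x)"
    unfolding flux_divergence_between[OF e] outside_B_eps[OF e(1)] zp_def zm_def .
  have "(\<lambda>m. (hardy_flux (zm (Suc m)) - hardy_flux (zp m)) + L m) sums ((LINT x:- B_eps \<epsilon>|lborel. flux_divergence x) + (\<Sum>m. L m))"
    by (rule sums_add[OF rs summable_sums[OF sL]])
  moreover have "(hardy_flux (zm (Suc m)) - hardy_flux (zp m)) + L m = (hardy_flux (zp (Suc m)) - hardy_flux (zp m)) + T m" for m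
    unfolding L Hp Hm T_def by simp
  ultimately have "(\<lambda>m. (hardy_flux (zp (Suc m)) - hardy_flux (zp m)) + T m) sums ((LINT x:- B_eps \<epsilon>|lborel. flux_divergence x) + (\<Sum>m. L m))" by (simp only:)
  moreover have "(\<lambda>m. (hardy_flux (zp (Suc m)) - hardy_flux (zp m)) + T m) sums (0 - hardy_flux (zp 0) + (\<Sum>m. T m))"
    by (rule sums_add[OF tel summable_sums[OF sT]])
  ultimately have main: "(LINT x:- B_eps \<epsilon>|lborel. flux_divergence x) + (\<Sum>m. L m) = (\<Sum>m. T m) - hardy_flux \<epsilon>"
    using sums_unique2 by (fastforce simp: zp_def)
  let ?TT = "\<integral>x. energy_density x \<partial>lborel"
  have TT: "0 \<le> ?TT" by (intro integral_nonneg_AE AE_I2 energy_density_nonneg)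
  have Tb: "\<bar>\<Sum>m. T m\<bar> \<le> \<epsilon> * (28800 * \<bar>?s\<bar> * ?TT)"
  proof -
    have b: "norm (T m) \<le> \<epsilon> * (28800 * \<bar>?s\<bar>) * node_energy (Suc m)" for m
    proof -
      have "norm (T m) \<le> \<epsilon> * (\<bar>?s\<bar> * (14400 * node_energy (Suc m))) + \<epsilon> * (\<bar>?s\<bar> * (14400 * node_energy (Suc m)))"
        unfolding T_def real_norm_def by (rule order_trans[OF abs_triangle_ineq4 add_mono[OF hp hm]])
      thus ?thesis by (simp add: algebra_simps)
    qed
    have sb: "summable (\<lambda>m. \<epsilon> * (28800 * \<bar>?s\<bar>) * node_energy (Suc m))" by (rule SN)
    have sa: "summable (\<lambda>m. \<bar>T m\<bar>)"
      by (rule summable_comparison_test'[OF sb, where N=0]) (use b in simp)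
    have "norm (\<Sum>m. T m) \<le> (\<Sum>m. \<bar>T m\<bar>)" unfolding real_norm_def by (rule summable_rabs[OF sa])
    also have "\<dots> \<le> (\<Sum>m. \<epsilon> * (28800 * \<bar>?s\<bar>) * node_energy (Suc m))"
      by (rule suminf_le[OF _ sa sb]) (use b in simp)
    also have "\<dots> = \<epsilon> * (28800 * \<bar>?s\<bar>) * (\<Sum>m. node_energy (Suc m))" by (rule suminf_mult[OF node_energy_summable(1)])
    also have "\<dots> \<le> \<epsilon> * (28800 * \<bar>?s\<bar>) * ?TT" using e by (intro mult_left_mono node_energy_summable(2)) auto
    finally show ?thesis by (simp add: mult.assoc)
  qed
  have Sb: "\<bar>bessel_log_deriv \<epsilon> * trace_mass \<epsilon>\<bar> \<le> \<epsilon> * (48 * ?TT)"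
  proof -
    have "(1/2 - \<epsilon>)\<^sup>2 * trace_mass \<epsilon> \<le> 3 * energy_on (cshell \<epsilon> (1/2))" by (rule origin_estimate) (use e in auto)
    also have "energy_on (cshell \<epsilon> (1/2)) \<le> energy_on UNIV" by (rule energy_on_mono[OF cshell_borel]) auto
    also have "energy_on UNIV = ?TT" by (simp add: set_lebesgue_integral_def)
    finally have 1: "(1/2 - \<epsilon>)\<^sup>2 * trace_mass \<epsilon> \<le> 3 * ?TT" by simp
    have "(1/4)\<^sup>2 \<le> (1/2 - \<epsilon>)\<^sup>2" using e by (intro power_mono) auto
    from mult_right_mono[OF this trace_mass_nonneg[of \<epsilon>]] 1 have S: "trace_mass \<epsilon> \<le> 48 * ?TT" by (simp add: power2_eq_square)
    have "\<bar>bessel_log_deriv \<epsilon> * trace_mass \<epsilon>\<bar> = \<bar>bessel_log_deriv \<epsilon>\<bar> * trace_mass \<epsilon>" using trace_mass_nonneg[of \<epsilon>] by (simp only: abs_mult abs_of_nonneg)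
    also have "\<dots> \<le> \<epsilon> * (48 * ?TT)" using e S by (intro mult_mono log_deriv_J0_near_0 trace_mass_nonneg) auto
    finally show ?thesis .
  qed
  have "(hardy_functional (- B_eps \<epsilon>) u - hardy_energy \<epsilon> u + (\<Sum>m. L m)) - energy_on (- B_eps \<epsilon>) = (\<Sum>m. T m) - hardy_flux \<epsilon> - ?s / \<epsilon> * trace_mass \<epsilon>"
    using main hardy_integrals(3)[of \<epsilon>] e hardy_energy_eq[of \<epsilon>] by simp
  also have "\<dots> = (\<Sum>m. T m) - bessel_log_deriv \<epsilon> * trace_mass \<epsilon>" by (simp add: hardy_flux_def left_diff_distrib)
  finally have "\<bar>(hardy_functional (- B_eps \<epsilon>) u - hardy_energy \<epsilon> u + (\<Sum>m. L m)) - energy_on (- B_eps \<epsilon>)\<bar> \<le> \<epsilon> * (28800 * \<bar>?s\<bar> * ?TT) + \<epsilon> * (48 * ?TT)"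
    using Tb Sb by linarith
  also have "\<dots> = \<epsilon> * ((48 + 28800 * \<bar>?s\<bar>) * ?TT)" by (simp add: algebra_simps)
  finally show "\<bar>(hardy_functional (- B_eps \<epsilon>) u - hardy_energy \<epsilon> u + (\<Sum>m. Lambda_plus \<epsilon> (Suc m) u - Lambda_minus \<epsilon> (Suc m) u)) - energy_on (- B_eps \<epsilon>)\<bar>
       \<le> \<epsilon> * ((48 + 28800 * \<bar>?s\<bar>) * ?TT)" by (simp only: L_def)
qed

text \<open>
Every regular point eventually leaves the excised set, and the nodal spheres are null sets.
\<close>

lemma energy_outside_tendsto: "((\<lambda>\<epsilon>. energy_on (- B_eps \<epsilon>)) \<longlongrightarrow> (\<integral>x. energy_density x \<partial>lborel)) (at_right 0)"
  unfolding tendsto_at_iff_sequentially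
proof (intro allI impI)
  fix X :: "nat \<Rightarrow> real" assume X: "\<forall>i. X i \<in> {0<..} - {0}" "X \<longlonglongrightarrow> 0"
  have pos: "X i > 0" for i using X(1) by auto
  have "(\<lambda>i. \<integral>x. indicator (- B_eps (X i)) x *\<^sub>R energy_density x \<partial>lborel) \<longlonglongrightarrow> (\<integral>x. energy_density x \<partial>lborel)"
  proof (rule integral_dominated_convergence[where w=energy_density])
    show "(\<lambda>x. indicator (- B_eps (X i)) x *\<^sub>R energy_density x) \<in> borel_measurable lborel" for i
      using energy_set_integrable[OF B_eps_borel[OF pos]] unfolding set_integrable_def by (rule borel_measurable_integrable)
    show "AE x in lborel. (\<lambda>i. indicator (- B_eps (X i)) x *\<^sub>R energy_density x) \<longlonglongrightarrow> energy_density x"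
      using AE_regular_set
    proof eventually_elim
      fix x :: "real^'n" assume "x \<in> regular_set"
      then obtain \<delta> where \<delta>: "\<delta> > 0" "\<And>\<epsilon>. 0 < \<epsilon> \<Longrightarrow> \<epsilon> < \<delta> \<Longrightarrow> x \<in> - B_eps \<epsilon>" using B_eps_shrinks by blast
      have "\<forall>\<^sub>F i in sequentially. X i < \<delta>" using order_tendstoD(2)[OF X(2) \<delta>(1)] .
      hence "\<forall>\<^sub>F i in sequentially. indicator (- B_eps (X i)) x *\<^sub>R energy_density x = energy_density x"
      proof eventually_elim
        fix i assume "X i < \<delta>"
        hence "x \<in> - B_eps (X i)" using \<delta>(2) pos by blast
        thus "indicator (- B_eps (X i)) x *\<^sub>R energy_density x = energy_density x" by (simp only: indicator_simps scaleR_one)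
      qed
      thus "(\<lambda>i. indicator (- B_eps (X i)) x *\<^sub>R energy_density x) \<longlonglongrightarrow> energy_density x" by (rule tendsto_eventually)
    qed
    show "AE x in lborel. norm (indicator (- B_eps (X i)) x *\<^sub>R energy_density x) \<le> energy_density x" for i
      using energy_density_nonneg by (intro AE_I2) (auto simp: indicator_def)
  qed (use energy_integrable in auto)
  thus "((\<lambda>\<epsilon>. energy_on (- B_eps \<epsilon>)) \<circ> X) \<longlonglongrightarrow> (\<integral>x. energy_density x \<partial>lborel)" by (simp add: set_lebesgue_integral_def comp_def)
qed

lemma hardy_limit:
  "((\<lambda>\<epsilon>. hardy_functional (- B_eps \<epsilon>) u - hardy_energy \<epsilon> u + (\<Sum>m. Lambda_plus \<epsilon> (Suc m) u - Lambda_minus \<epsilon> (Suc m) u)) \<longlongrightarrow> J_norm2 u) (at_right 0)"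
proof -
  let ?T = "\<lambda>\<epsilon>. hardy_functional (- B_eps \<epsilon>) u - hardy_energy \<epsilon> u + (\<Sum>m. Lambda_plus \<epsilon> (Suc m) u - Lambda_minus \<epsilon> (Suc m) u)"
  let ?K = "(48 + 28800 * \<bar>hardy_exponent TYPE('n)\<bar>) * (\<integral>x. energy_density x \<partial>lborel)"
  have small: "\<forall>\<^sub>F \<epsilon> in at_right 0. 0 < \<epsilon> \<and> \<epsilon> < (1/40::real)"
    using eventually_at_right_real[of 0 "1/40::real"] by (auto elim: eventually_mono)
  have "((\<lambda>\<epsilon>. ?T \<epsilon> - energy_on (- B_eps \<epsilon>)) \<longlongrightarrow> 0) (at_right 0)"
  proof (rule Lim_null_comparison)
    show "\<forall>\<^sub>F \<epsilon> in at_right 0. norm (?T \<epsilon> - energy_on (- B_eps \<epsilon>)) \<le> \<epsilon> * ?K"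
      using small by eventually_elim (use boundary_sums(2) in auto)
    have "((\<lambda>\<epsilon>. \<epsilon> * ?K) \<longlongrightarrow> 0 * ?K) (at_right 0)" by (intro tendsto_mult tendsto_const tendsto_ident_at)
    thus "((\<lambda>\<epsilon>. \<epsilon> * ?K) \<longlongrightarrow> 0) (at_right 0)" by simp
  qed
  from tendsto_add[OF this energy_outside_tendsto] show ?thesis by (simp add: J_norm2_eq)
qed

lemma zero_boundary_trace:
  assumes r: "0 < r" "bessel_J0 r \<noteq> 0" and S: "trace_mass r = 0"
  shows "AE x in sphere_measure r. sphere_trace r u x = 0"
proof -
  have "integrable (sphere_measure r) (\<lambda>x. (sphere_trace r u x)\<^sup>2)"
    using u_has_trace[OF r] unfolding has_sphere_trace_shell by blast
  from integral_nonneg_eq_0_iff_AE[OF this] S show ?thesis unfolding trace_mass_def by simp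
qed

end

lemma J_space_approx:
  fixes u :: "real^'n::finite \<Rightarrow> real"
  assumes "u \<in> J_space" obtains v w where "bessel_approx u v w"
proof -
  obtain v where v: "u \<in> borel_measurable borel" "v \<in> Jtilde" "AE x in lborel. u x = ground_state x * v x"
    using assms unfolding J_space_def by blast
  then obtain w where w: "\<forall>k. w k \<in> test_functions UNIV" "(\<lambda>k. Jtilde_norm2 (\<lambda>x. w k x - v x)) \<longlonglongrightarrow> 0"
    unfolding Jtilde_def by blast
  have "v \<in> finite_Jtilde_norm" using v(2) unfolding Jtilde_def by blast
  hence "bessel_approx u v w" using v w by unfold_locales auto
  thus thesis by (rule that)
qed

theorem lemma6p2:
  assumes "CARD('n::finite) \<ge> 3"
  shows "(\<forall>u \<in> (J_space :: (real^'n \<Rightarrow> real) set).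
            (\<forall>\<^sub>F \<epsilon> in at_right 0.
               hardy_integrals_converge (- B_eps \<epsilon>) u \<and>
               (\<exists>h. has_sphere_trace \<epsilon> u h) \<and>
               (\<forall>m\<ge>1. (\<exists>h. has_sphere_trace (bessel_J0_zero m + \<epsilon>) u h) \<and>
                       (\<exists>h. has_sphere_trace (bessel_J0_zero m - \<epsilon>) u h)) \<and>
               summable (\<lambda>m. Lambda_plus \<epsilon> (Suc m) u - Lambda_minus \<epsilon> (Suc m) u)) \<and>
            ((\<lambda>\<epsilon>. hardy_functional (- B_eps \<epsilon>) u - hardy_energy \<epsilon> u +
                    (\<Sum>m. Lambda_plus \<epsilon> (Suc m) u - Lambda_minus \<epsilon> (Suc m) u))
               \<longlongrightarrow> J_norm2 u) (at_right 0)) \<and>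
         (\<forall>\<^sub>F \<epsilon> in at_right 0. \<forall>u \<in> (J_space :: (real^'n \<Rightarrow> real) set). \<forall>m\<ge>1.
            0 \<le> Lambda_plus \<epsilon> m u \<and>
            0 \<le> - Lambda_minus \<epsilon> m u \<and>
            (Lambda_plus \<epsilon> m u = 0 \<longrightarrow>
               (AE x in sphere_measure (bessel_J0_zero m + \<epsilon>).
                  sphere_trace (bessel_J0_zero m + \<epsilon>) u x = 0)) \<and>
            (Lambda_minus \<epsilon> m u = 0 \<longrightarrow>
               (AE x in sphere_measure (bessel_J0_zero m - \<epsilon>).
                  sphere_trace (bessel_J0_zero m - \<epsilon>) u x = 0)))"
proof (intro conjI ballI)
  have small: "\<forall>\<^sub>F \<epsilon> in at_right 0. 0 < \<epsilon> \<and> \<epsilon> < (1/40::real)"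
    using eventually_at_right_real[of 0 "1/40::real"] by (auto elim: eventually_mono)
  {
    fix u :: "real^'n \<Rightarrow> real" assume "u \<in> J_space"
    then obtain v w where "bessel_approx u v w" by (rule J_space_approx)
    then interpret bessel_approx u v w .
    show "\<forall>\<^sub>F \<epsilon> in at_right 0.
               hardy_integrals_converge (- B_eps \<epsilon>) u \<and>
               (\<exists>h. has_sphere_trace \<epsilon> u h) \<and>
               (\<forall>m\<ge>1. (\<exists>h. has_sphere_trace (bessel_J0_zero m + \<epsilon>) u h) \<and>
                       (\<exists>h. has_sphere_trace (bessel_J0_zero m - \<epsilon>) u h)) \<and>
               summable (\<lambda>m. Lambda_plus \<epsilon> (Suc m) u - Lambda_minus \<epsilon> (Suc m) u)"
      using small
    proof eventually_elim
      fix \<epsilon> :: real assume "0 < \<epsilon> \<and> \<epsilon> < 1/40"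
      hence e: "0 < \<epsilon>" "\<epsilon> \<le> 1/40" "\<epsilon> \<le> 1" "\<epsilon> \<le> 1/8" "\<epsilon> < 2" by auto
      have J: "bessel_J0 \<epsilon> \<noteq> 0" using J0_pos_lt_2[of \<epsilon>] e by auto
      have "has_sphere_trace (bessel_J0_zero m + \<epsilon>) u (sphere_trace (bessel_J0_zero m + \<epsilon>) u)"
        "has_sphere_trace (bessel_J0_zero m - \<epsilon>) u (sphere_trace (bessel_J0_zero m - \<epsilon>) u)" if m: "m \<ge> 1" for m
        by (rule u_has_trace[OF _ log_deriv_near_zero(1)[OF m e(1,4)]] u_has_trace[OF _ log_deriv_near_zero(2)[OF m e(1,4)]];
            use bessel_J0_zero_ge_2[OF m] e in linarith)+
      thus "hardy_integrals_converge (- B_eps \<epsilon>) u \<and>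
               (\<exists>h. has_sphere_trace \<epsilon> u h) \<and>
               (\<forall>m\<ge>1. (\<exists>h. has_sphere_trace (bessel_J0_zero m + \<epsilon>) u h) \<and>
                       (\<exists>h. has_sphere_trace (bessel_J0_zero m - \<epsilon>) u h)) \<and>
               summable (\<lambda>m. Lambda_plus \<epsilon> (Suc m) u - Lambda_minus \<epsilon> (Suc m) u)"
        using hardy_integrals(1)[OF e(1,3)] u_has_trace[OF e(1) J] boundary_sums(1)[OF e(1,2)] by blast
    qed
    show "((\<lambda>\<epsilon>. hardy_functional (- B_eps \<epsilon>) u - hardy_energy \<epsilon> u +
                    (\<Sum>m. Lambda_plus \<epsilon> (Suc m) u - Lambda_minus \<epsilon> (Suc m) u))
               \<longlongrightarrow> J_norm2 u) (at_right 0)"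
      by (rule hardy_limit)
  }
  show "\<forall>\<^sub>F \<epsilon> in at_right 0. \<forall>u \<in> (J_space :: (real^'n \<Rightarrow> real) set). \<forall>m\<ge>1.
            0 \<le> Lambda_plus \<epsilon> m u \<and>
            0 \<le> - Lambda_minus \<epsilon> m u \<and>
            (Lambda_plus \<epsilon> m u = 0 \<longrightarrow>
               (AE x in sphere_measure (bessel_J0_zero m + \<epsilon>).
                  sphere_trace (bessel_J0_zero m + \<epsilon>) u x = 0)) \<and>
            (Lambda_minus \<epsilon> m u = 0 \<longrightarrow>
               (AE x in sphere_measure (bessel_J0_zero m - \<epsilon>).
                  sphere_trace (bessel_J0_zero m - \<epsilon>) u x = 0))"
    using small
  proof eventually_elim
    fix \<epsilon> :: real assume "0 < \<epsilon> \<and> \<epsilon> < 1/40"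
    hence e: "0 < \<epsilon>" "\<epsilon> \<le> 1/40" "\<epsilon> \<le> 1/8" by auto
    show "\<forall>u \<in> (J_space :: (real^'n \<Rightarrow> real) set). \<forall>m\<ge>1.
            0 \<le> Lambda_plus \<epsilon> m u \<and>
            0 \<le> - Lambda_minus \<epsilon> m u \<and>
            (Lambda_plus \<epsilon> m u = 0 \<longrightarrow>
               (AE x in sphere_measure (bessel_J0_zero m + \<epsilon>).
                  sphere_trace (bessel_J0_zero m + \<epsilon>) u x = 0)) \<and>
            (Lambda_minus \<epsilon> m u = 0 \<longrightarrow>
               (AE x in sphere_measure (bessel_J0_zero m - \<epsilon>).
                  sphere_trace (bessel_J0_zero m - \<epsilon>) u x = 0))"
    proof (intro ballI allI impI)
      fix u :: "real^'n \<Rightarrow> real" and m :: nat assume "u \<in> J_space" and m: "1 \<le> m"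
      from \<open>u \<in> J_space\<close> obtain v w where "bessel_approx u v w" by (rule J_space_approx)
      then interpret bessel_approx u v w .
      note L = log_deriv_near_zero[OF m e(1,3)] and N = node_bounds[OF m e(1,2)]
      have z: "0 < bessel_J0_zero m + \<epsilon>" "0 < bessel_J0_zero m - \<epsilon>" using bessel_J0_zero_ge_2[OF m] e by linarith+
      have "trace_mass (bessel_J0_zero m + \<epsilon>) = 0" if "Lambda_plus \<epsilon> m u = 0"
        using that L(3) unfolding Lambda_plus_def boundary_term_eq by (metis less_irrefl mult_eq_0_iff)
      moreover have "trace_mass (bessel_J0_zero m - \<epsilon>) = 0" if "Lambda_minus \<epsilon> m u = 0"
        using that L(5) unfolding Lambda_minus_def boundary_term_eq by (metis less_irrefl mult_eq_0_iff)
      moreover have "0 \<le> Lambda_plus \<epsilon> m u" "0 \<le> - Lambda_minus \<epsilon> m u"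
        using N(1,3) unfolding Lambda_plus_def Lambda_minus_def boundary_term_eq by auto
      ultimately show "0 \<le> Lambda_plus \<epsilon> m u \<and> 0 \<le> - Lambda_minus \<epsilon> m u \<and>
            (Lambda_plus \<epsilon> m u = 0 \<longrightarrow>
               (AE x in sphere_measure (bessel_J0_zero m + \<epsilon>). sphere_trace (bessel_J0_zero m + \<epsilon>) u x = 0)) \<and>
            (Lambda_minus \<epsilon> m u = 0 \<longrightarrow>
               (AE x in sphere_measure (bessel_J0_zero m - \<epsilon>). sphere_trace (bessel_J0_zero m - \<epsilon>) u x = 0))"
        using zero_boundary_trace[OF z(1) L(1)] zero_boundary_trace[OF z(2) L(2)] by blast
    qed
  qed
qed

end
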